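(* In the preemptive market entry game with symmetric payoff processes $L^1=L^2=L$, $F^1=F^2=F$, $M^1=M^2=M$ driven by the geometric Brownian motion $X$ as described in the context, there exists a subgame-perfect equilibrium with extended mixed strategies $(G_1,\alpha_1)$ and $(G_2,\alpha_2)$ given as follows. For any $i=1,2$ and $\vartheta\in\mathcal T$ set $$\alpha^\vartheta_i(t)=\begin{cases}\dfrac{L_t-F_t}{L_t-M_t} & \text{if } L_t>F_t\Leftrightarrow X_t\in\mathcal P=(x^P,x^F),\\[6pt] 1 & \text{if } F_t=M_t\Leftrightarrow X_t\in\mathcal M=[x^F,\infty),\\ 0 & \text{else,}\end{cases}\qquad G^\vartheta_i(t)=\mathbf 1_{\{t\ge\tau^{\mathcal P}(\vartheta)\wedge\tau^{\mathcal M}(\vartheta)\}}$$ for any $t\in[\vartheta,\infty]$ (with $\alpha_i^\vartheta(\infty)=G_i^\vartheta(\infty)=1$, and both processes equal to $0$ on $[0,\vartheta)$). The resulting payoffs are $$V_i^\vartheta(G_i^\vartheta,\alpha^\vartheta_i,G_j^\vartheta,\alpha^\vartheta_j)=E\bigl[F_{\tau^{\mathcal P}(\vartheta)\wedge\tau^{\mathcal M}(\vartheta)}\bigm|\mathcal F_\vartheta\bigr].$$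
   Context: **The market entry model.** $(\Omega,\mathcal F,(\mathcal F_t)_{t\ge0},P)$ is a filtered probability space satisfying the usual conditions, $B$ an $(\mathcal F_t)$-Brownian motion, $\mathcal T$ the set of all stopping times (values in $[0,\infty]$). $X$ solves $dX=\mu X\,dt+\sigma X\,dB$ with $X_0=x\in\mathbb R_+$; $\mu,\sigma$ are constants, $\sigma\ne0$. Further constants: $m>1$ (monopoly markup), $I>0$ (sunk cost), $r>\max(\mu,0)$ (discount rate). Let $\beta_1>1$ be the positive root of $0=\frac12\sigma^2\beta(\beta-1)+\mu\beta-r$, $x^F=\frac{\beta_1}{\beta_1-1}(r-\mu)I$, and $\tau^F(\vartheta)=\inf\{s\ge\vartheta:X_s\ge x^F\}$. Define $$F_t=\operatorname*{ess\,sup}_{\tau\ge t}E\Bigl[\int_\tau^\infty e^{-rs}(X_s-rI)\,ds\Bigm|\mathcal F_t\Bigr]=\begin{cases}e^{-rt}\bigl(\frac{X_t}{x^F}\bigr)^{\beta_1}\bigl(\frac{x^F}{r-\mu}-I\bigr), & X_t<x^F,\\ e^{-rt}\bigl(\frac{X_t}{r-\mu}-I\bigr), & \text{else,}\end{cases}$$ $$L_t=E\Bigl[\int_t^{\tau^F(t)}e^{-rs}(mX_s-rI)\,ds+\int_{\tau^F(t)}^\infty e^{-rs}(X_s-rI)\,ds\Bigm|\mathcal F_t\Bigr]=\begin{cases}e^{-rt}\Bigl(\frac{mX_t}{r-\mu}-I+\bigl(\frac{X_t}{x^F}\bigr)^{\beta_1}\frac{x^F(1-m)}{r-\mu}\Bigr),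 & X_t<x^F,\\ F_t, & \text{else,}\end{cases}$$ $$M_t=E\Bigl[\int_t^\infty e^{-rs}(X_s-rI)\,ds\Bigm|\mathcal F_t\Bigr]=e^{-rt}\Bigl(\frac{X_t}{r-\mu}-I\Bigr),$$ with $L_\infty=F_\infty=M_\infty=0$ (the a.s. limits). There is a unique $x^P\in(0,x^F)$ such that $L_t<F_t$ iff $X_t\in[0,x^P)$ and $L_t>F_t$ iff $X_t\in(x^P,x^F)$. Put $\mathcal P=(x^P,x^F)$, $\mathcal M=[x^F,\infty)$, $\tau^{\mathcal P}(\vartheta)=\inf\{s\ge\vartheta:X_s\in\mathcal P\}$, $\tau^{\mathcal M}(\vartheta)=\inf\{s\ge\vartheta:X_s\in\mathcal M\}$. Both players $i=1,2$ have leader payoff $L^i=L$, follower payoff $F^i=F$ and simultaneous stopping payoff $M^i=M$. **Extended mixed strategies in a subgame.** Let $\vartheta\in\mathcal T$. An extended mixed strategy for player $i$ in the subgame starting at $\vartheta$ ($\vartheta$-strategy) is a pair of $[0,1]$-valued processes $(G^\vartheta_i,\alpha^\vartheta_i)$ such that: (i) $G^\vartheta_i$ is adapted, and a.s. right-continuous and non-decreasing with $G^\vartheta_i(s)=0$ for all $s<\vartheta$; (ii) $\alpha^\vartheta_i$ is progressively measurable and a.s. right-continuous at every time at which its value is in $(0,1)$; (iii) a.s., for all $t\ge0$, $\alpha^\vartheta_i(t)>0\Rightarrow G^\vartheta_i(t)=1$. Always set $G^\vartheta_i(0-)=0$, $G^\vartheta_i(\infty)=1$, $\alpha^\vartheta_i(\infty)=1$.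 $\Delta G(t)=G(t)-G(t-)$. **Strategies for the whole game.** An extended mixed strategy $(G_i,\alpha_i)$ is a family $(G^\vartheta_i,\alpha^\vartheta_i)_{\vartheta\in\mathcal T}$ of $\vartheta$-strategies such that for all $\vartheta,\vartheta'\in\mathcal T$, $G^\vartheta_i=G^{\vartheta'}_i$ and $\alpha^\vartheta_i=\alpha^{\vartheta'}_i$ a.s. on $\{\vartheta=\vartheta'\}$. It is time-consistent if for all $\vartheta\le\vartheta'$ in $\mathcal T$: $\vartheta'\le t\in\mathbb R_+$ implies $G_i^\vartheta(t)=G_i^\vartheta(\vartheta'-)+(1-G_i^\vartheta(\vartheta'-))G_i^{\vartheta'}(t)$ a.s., and $\vartheta'\le\tau\in\mathcal T$ implies $\alpha^\vartheta_i(\tau)=\alpha^{\vartheta'}_i(\tau)$ a.s. **Outcome probabilities.** On $[0,1]^2\setminus\{(0,0)\}$ let $\mu_L(x,y)=\frac{x(1-y)}{x+y-xy}$, $\mu_M(x,y)=\frac{xy}{x+y-xy}$. Given $\vartheta$-strategies of both players, let $\hat\tau^\vartheta_k=\inf\{t\ge\vartheta:\alpha^\vartheta_k(t)>0\}$ ($k=1,2$) and $\hat\tau=\hat\tau^\vartheta=\inf\{t\ge\vartheta:\alpha^\vartheta_1(t)+\alpha^\vartheta_2(t)>0\}$. With superscript $\vartheta$ suppressed on the right-hand sides and $i\ne j$ in $\{1,2\}$, define $\lambda^\vartheta_{L,1},\lambda^\vartheta_{L,2},\lambda^\vartheta_M$ by: - If $\hat\tau<\hat\tau_j$: $\lambda^\vartheta_{L,i}=(1-G_i(\hat\tau-))(1-G_j(\hat\tau))$,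 $\lambda^\vartheta_M=(1-G_i(\hat\tau-))\alpha_i(\hat\tau)\Delta G_j(\hat\tau)$. - If $\hat\tau<\hat\tau_i$: $\lambda^\vartheta_{L,i}=(1-G_j(\hat\tau-))(1-\alpha_j(\hat\tau))\Delta G_i(\hat\tau)$, $\lambda^\vartheta_M=(1-G_j(\hat\tau-))\alpha_j(\hat\tau)\Delta G_i(\hat\tau)$. - If $\hat\tau=\hat\tau_1=\hat\tau_2$ and ($\alpha_1(\hat\tau)\vee\alpha_2(\hat\tau)=1$ or $\alpha_1(\hat\tau)\wedge\alpha_2(\hat\tau)>0$): $\lambda^\vartheta_{L,i}=(1-G_i(\hat\tau-))(1-G_j(\hat\tau-))\mu_L(\alpha_i(\hat\tau),\alpha_j(\hat\tau))$, $\lambda^\vartheta_M=(1-G_i(\hat\tau-))(1-G_j(\hat\tau-))\mu_M(\alpha_1(\hat\tau),\alpha_2(\hat\tau))$. - If $\hat\tau=\hat\tau_1=\hat\tau_2$, $\alpha_1(\hat\tau)\vee\alpha_2(\hat\tau)<1$ and $\alpha_1(\hat\tau)\wedge\alpha_2(\hat\tau)=0$: $\lambda^\vartheta_{L,i}=(1-G_i(\hat\tau-))(1-G_j(\hat\tau-))(1-\alpha_j(\hat\tau))\bigl(\alpha_i(\hat\tau)+(1-\alpha_i(\hat\tau))\tfrac12\{\liminf\mu_L(\alpha_i(t),\alpha_j(t))+\limsup\mu_L(\alpha_i(t),\alpha_j(t))\}\bigr)$, where $\liminf$ and $\limsup$ are taken as $t\searrow\hat\tau$ along $t$ with $\alpha_i(t)+\alpha_j(t)>0$;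 and $\lambda^\vartheta_M=(1-G_i(\hat\tau-))(1-G_j(\hat\tau-))-\lambda^\vartheta_{L,i}-\lambda^\vartheta_{L,j}$. **Payoffs.** The payoff of player $i$ in the subgame at $\vartheta$ is $$V^\vartheta_i(G^\vartheta_i,\alpha^\vartheta_i,G^\vartheta_j,\alpha^\vartheta_j)=E\Bigl[\int_{[0,\hat\tau)}(1-G^\vartheta_j(s))L^i_s\,dG^\vartheta_i(s)+\int_{[0,\hat\tau)}(1-G^\vartheta_i(s))F^i_s\,dG^\vartheta_j(s)+\sum_{s\in[0,\hat\tau)}\Delta G^\vartheta_i(s)\Delta G^\vartheta_j(s)M^i_s+\lambda^\vartheta_{L,i}L^i_{\hat\tau}+\lambda^\vartheta_{L,j}F^i_{\hat\tau}+\lambda^\vartheta_MM^i_{\hat\tau}\Bigm|\mathcal F_\vartheta\Bigr]$$ (integrals include a possible jump of the integrator at $0$). **Subgame-perfect equilibrium.** A pair $(G_1,\alpha_1),(G_2,\alpha_2)$ of time-consistent extended mixed strategies such that for all $\vartheta\in\mathcal T$, $i\ne j$ in $\{1,2\}$ and every $\vartheta$-strategy $(G^\vartheta_a,\alpha^\vartheta_a)$: $V_i^\vartheta(G_i^\vartheta,\alpha^\vartheta_i,G_j^\vartheta,\alpha^\vartheta_j)\ge V_i^\vartheta(G_a^\vartheta,\alpha^\vartheta_a,G_j^\vartheta,\alpha^\vartheta_j)$ a.s. *)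

theory Defs
  imports "HOL-Probability.Probability"
begin

section \<open>Filtered probability spaces\<close>

text \<open>
  Time is \<^typ>\<open>ennreal\<close>, i.e. \<open>[0,\<infinity>]\<close>, so that the library notions of stopping time and
  of the \<open>\<sigma>\<close>-algebra \<open>pre_sigma\<close> of a stopping time apply to stopping times with values in
  \<open>[0,\<infinity>]\<close>.  The \<open>\<sigma>\<close>-algebra at time \<open>\<infinity>\<close> may be any one between the join of the
  \<open>\<F>\<^sub>t\<close>, \<open>t < \<infinity>\<close>, and the full \<open>\<sigma>\<close>-algebra; both common conventions are covered.
  The filtration enters only through the carriers and the \<open>\<sigma>\<close>-algebras of the measures \<open>\<F> t\<close>.
\<close>

locale usual_filtration = prob_space P + filtration "space P" \<F>
  for P :: "'a measure" and \<F> :: "ennreal \<Rightarrow> 'a measure" +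
  assumes sets_filtration: "sets (\<F> t) \<subseteq> sets P"
    and complete_filtration: "N \<in> null_sets P \<Longrightarrow> A \<subseteq> N \<Longrightarrow> A \<in> sets (\<F> 0)"
    and right_continuous_filtration: "t < \<infinity> \<Longrightarrow> sets (\<F> t) = (\<Inter>s\<in>{t<..}. sets (\<F> s))"

abbreviation sigma_at :: "'a measure \<Rightarrow> (ennreal \<Rightarrow> 'a measure) \<Rightarrow> ('a \<Rightarrow> ennreal) \<Rightarrow> 'a measure"
  where "sigma_at P \<F> \<theta> \<equiv> filtration.pre_sigma (space P) \<F> \<theta>"

definition adapted :: "(ennreal \<Rightarrow> 'a measure) \<Rightarrow> (ennreal \<Rightarrow> 'a \<Rightarrow> real) \<Rightarrow> bool"
  where "adapted \<F> Y \<longleftrightarrow> (\<forall>t<\<infinity>. Y t \<in> borel_measurable (\<F> t))"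

definition progressive :: "(ennreal \<Rightarrow> 'a measure) \<Rightarrow> (ennreal \<Rightarrow> 'a \<Rightarrow> real) \<Rightarrow> bool"
  where "progressive \<F> Y \<longleftrightarrow>
    (\<forall>t<\<infinity>. (\<lambda>(s, \<omega>). Y s \<omega>) \<in> borel_measurable (restrict_space borel {0..t} \<Otimes>\<^sub>M \<F> t))"


section \<open>Geometric Brownian motion\<close>

text \<open>
  \<open>B\<close> and \<open>X\<close> are indexed by \<^typ>\<open>real\<close>; only times \<open>t \<ge> 0\<close> are relevant.
\<close>

definition brownian_motion ::
    "'a measure \<Rightarrow> (ennreal \<Rightarrow> 'a measure) \<Rightarrow> (real \<Rightarrow> 'a \<Rightarrow> real) \<Rightarrow> bool"
  where "brownian_motion P \<F> B \<longleftrightarrow>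
    (\<forall>t\<ge>0. B t \<in> borel_measurable (\<F> (ennreal t))) \<and>
    (AE \<omega> in P. B 0 \<omega> = 0) \<and>
    (AE \<omega> in P. continuous_on {0..} (\<lambda>t. B t \<omega>)) \<and>
    (\<forall>s t. 0 \<le> s \<and> s < t \<longrightarrow>
      distributed P lborel (\<lambda>\<omega>. B t \<omega> - B s \<omega>) (normal_density 0 (sqrt (t - s))) \<and>
      prob_space.indep_set P (sets (\<F> (ennreal s)))
        {(\<lambda>\<omega>. B t \<omega> - B s \<omega>) -` A \<inter> space P | A. A \<in> sets borel})"

definition tends_in_prob ::
    "'a measure \<Rightarrow> (nat \<Rightarrow> 'a \<Rightarrow> real) \<Rightarrow> ('a \<Rightarrow> real) \<Rightarrow> bool"
  where "tends_in_prob P Y Z \<longleftrightarrow>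
    (\<forall>\<epsilon>>0. (\<lambda>n. measure P {\<omega> \<in> space P. \<epsilon> < \<bar>Y n \<omega> - Z \<omega>\<bar>}) \<longlonglongrightarrow> 0)"

definition partitions_mesh_to_0 :: "real \<Rightarrow> (nat \<Rightarrow> nat) \<Rightarrow> (nat \<Rightarrow> nat \<Rightarrow> real) \<Rightarrow> bool"
  where "partitions_mesh_to_0 t N p \<longleftrightarrow>
    (\<forall>n. p n 0 = 0 \<and> p n (N n) = t \<and> (\<forall>k<N n. p n k \<le> p n (Suc k))) \<and>
    (\<forall>\<delta>>0. \<forall>\<^sub>F n in sequentially. \<forall>k<N n. p n (Suc k) - p n k < \<delta>)"

text \<open>
  \<open>J\<close> is the Ito integral process of the integrand \<open>H\<close> with respect to \<open>B\<close>.  For adapted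
  integrands with continuous paths, the only ones needed here, the Ito integral over \<open>[0,t]\<close> is the
  limit in probability of the left-point Riemann sums along deterministic partitions of \<open>[0,t]\<close>
  whose mesh tends to 0.
\<close>

definition ito_integral_process ::
    "'a measure \<Rightarrow> (ennreal \<Rightarrow> 'a measure) \<Rightarrow> (real \<Rightarrow> 'a \<Rightarrow> real) \<Rightarrow> (real \<Rightarrow> 'a \<Rightarrow> real)
      \<Rightarrow> (real \<Rightarrow> 'a \<Rightarrow> real) \<Rightarrow> bool"
  where "ito_integral_process P \<F> B H J \<longleftrightarrow>
    (\<forall>t\<ge>0. J t \<in> borel_measurable (\<F> (ennreal t))) \<and>
    (AE \<omega> in P. continuous_on {0..} (\<lambda>t. J t \<omega>)) \<and>
    (\<forall>t\<ge>0. \<forall>N p. partitions_mesh_to_0 t N p \<longrightarrow>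
      tends_in_prob P
        (\<lambda>n \<omega>. \<Sum>k<N n. H (p n k) \<omega> * (B (p n (Suc k)) \<omega> - B (p n k) \<omega>)) (J t))"

text \<open>
  \<open>X\<close> solves \<open>dX = \<mu> X dt + \<sigma> X dB\<close>, \<open>X\<^sub>0 = x\<close>.  Paths are continuous for every \<open>\<omega>\<close>, not just
  almost every one: processes built from \<open>X\<close> have to be progressively measurable, which is not
  preserved under changes on a null set of paths.
\<close>

definition solves_gbm_sde ::
    "'a measure \<Rightarrow> (ennreal \<Rightarrow> 'a measure) \<Rightarrow> (real \<Rightarrow> 'a \<Rightarrow> real) \<Rightarrow> real \<Rightarrow> real \<Rightarrow> real
      \<Rightarrow> (real \<Rightarrow> 'a \<Rightarrow> real) \<Rightarrow> bool"
  where "solves_gbm_sde P \<F> B \<mu> \<sigma> x X \<longleftrightarrow>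
    (\<forall>t\<ge>0. X t \<in> borel_measurable (\<F> (ennreal t))) \<and>
    (\<forall>\<omega>\<in>space P. continuous_on {0..} (\<lambda>t. X t \<omega>)) \<and>
    (AE \<omega> in P. X 0 \<omega> = x) \<and>
    (\<exists>J. ito_integral_process P \<F> B (\<lambda>t \<omega>. \<sigma> * X t \<omega>) J \<and>
      (\<forall>t\<ge>0. AE \<omega> in P. X t \<omega> = x + integral {0..t} (\<lambda>s. \<mu> * X s \<omega>) + J t \<omega>))"


section \<open>Extended mixed strategies\<close>

text \<open>The left limit, with the convention \<open>g(0-) = 0\<close>.\<close>

definition left_lim :: "(ennreal \<Rightarrow> real) \<Rightarrow> ennreal \<Rightarrow> real"
  where "left_lim g t = (if t = 0 then 0 else Lim (at_left t) g)"

definition jump :: "(ennreal \<Rightarrow> real) \<Rightarrow> ennreal \<Rightarrow> real"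
  where "jump g t = g t - left_lim g t"

definition subgame_strategy ::
    "'a measure \<Rightarrow> (ennreal \<Rightarrow> 'a measure) \<Rightarrow> ('a \<Rightarrow> ennreal)
      \<Rightarrow> (ennreal \<Rightarrow> 'a \<Rightarrow> real) \<Rightarrow> (ennreal \<Rightarrow> 'a \<Rightarrow> real) \<Rightarrow> bool"
  where "subgame_strategy P \<F> \<theta> G \<alpha> \<longleftrightarrow>
    (\<forall>t. \<forall>\<omega>\<in>space P. G t \<omega> \<in> {0..1} \<and> \<alpha> t \<omega> \<in> {0..1}) \<and>
    (\<forall>\<omega>\<in>space P. G \<infinity> \<omega> = 1 \<and> \<alpha> \<infinity> \<omega> = 1) \<and>
    adapted \<F> G \<and>
    (AE \<omega> in P. (\<forall>t. ((\<lambda>s. G s \<omega>) \<longlongrightarrow> G t \<omega>) (at_right t)) \<and>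
      mono (\<lambda>t. G t \<omega>) \<and> (\<forall>s<\<theta> \<omega>. G s \<omega> = 0)) \<and>
    progressive \<F> \<alpha> \<and>
    (AE \<omega> in P. \<forall>t. 0 < \<alpha> t \<omega> \<and> \<alpha> t \<omega> < 1 \<longrightarrow> ((\<lambda>s. \<alpha> s \<omega>) \<longlongrightarrow> \<alpha> t \<omega>) (at_right t)) \<and>
    (AE \<omega> in P. \<forall>t. \<alpha> t \<omega> > 0 \<longrightarrow> G t \<omega> = 1)"

definition extended_mixed_strategy ::
    "'a measure \<Rightarrow> (ennreal \<Rightarrow> 'a measure) \<Rightarrow> (('a \<Rightarrow> ennreal) \<Rightarrow> ennreal \<Rightarrow> 'a \<Rightarrow> real)
      \<Rightarrow> (('a \<Rightarrow> ennreal) \<Rightarrow> ennreal \<Rightarrow> 'a \<Rightarrow> real) \<Rightarrow> bool"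
  where "extended_mixed_strategy P \<F> G \<alpha> \<longleftrightarrow>
    (\<forall>\<theta>. stopping_time \<F> \<theta> \<longrightarrow> subgame_strategy P \<F> \<theta> (G \<theta>) (\<alpha> \<theta>)) \<and>
    (\<forall>\<theta> \<theta>'. stopping_time \<F> \<theta> \<and> stopping_time \<F> \<theta>' \<longrightarrow>
      (AE \<omega> in P. \<theta> \<omega> = \<theta>' \<omega> \<longrightarrow> (\<forall>t. G \<theta> t \<omega> = G \<theta>' t \<omega> \<and> \<alpha> \<theta> t \<omega> = \<alpha> \<theta>' t \<omega>)))"

definition time_consistent ::
    "'a measure \<Rightarrow> (ennreal \<Rightarrow> 'a measure) \<Rightarrow> (('a \<Rightarrow> ennreal) \<Rightarrow> ennreal \<Rightarrow> 'a \<Rightarrow> real)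
      \<Rightarrow> (('a \<Rightarrow> ennreal) \<Rightarrow> ennreal \<Rightarrow> 'a \<Rightarrow> real) \<Rightarrow> bool"
  where "time_consistent P \<F> G \<alpha> \<longleftrightarrow>
    (\<forall>\<theta> \<theta>'. stopping_time \<F> \<theta> \<and> stopping_time \<F> \<theta>' \<and> (AE \<omega> in P. \<theta> \<omega> \<le> \<theta>' \<omega>) \<longrightarrow>
      (AE \<omega> in P. \<forall>t<\<infinity>. \<theta>' \<omega> \<le> t \<longrightarrow>
        G \<theta> t \<omega> = left_lim (\<lambda>s. G \<theta> s \<omega>) (\<theta>' \<omega>)
          + (1 - left_lim (\<lambda>s. G \<theta> s \<omega>) (\<theta>' \<omega>)) * G \<theta>' t \<omega>) \<and>
      (\<forall>\<tau>. stopping_time \<F> \<tau> \<and> (AE \<omega> in P. \<theta>' \<omega> \<le> \<tau> \<omega>) \<longrightarrow>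
        (AE \<omega> in P. \<alpha> \<theta> (\<tau> \<omega>) \<omega> = \<alpha> \<theta>' (\<tau> \<omega>) \<omega>)))"


section \<open>Outcome probabilities\<close>

text \<open>
  The definitions of this section are pathwise: \<open>\<theta>\<close> is a time and \<open>G\<^sub>i, \<alpha>\<^sub>i\<close> are real functions
  of time.  The indices \<open>i, j\<close> denote a player and the opponent.
\<close>

definition mu_L :: "real \<Rightarrow> real \<Rightarrow> real"
  where "mu_L x y = x * (1 - y) / (x + y - x * y)"

definition mu_M :: "real \<Rightarrow> real \<Rightarrow> real"
  where "mu_M x y = x * y / (x + y - x * y)"

definition tau_hat1 :: "ennreal \<Rightarrow> (ennreal \<Rightarrow> real) \<Rightarrow> ennreal"
  where "tau_hat1 \<theta> \<alpha> = Inf {t. \<theta> \<le> t \<and> \<alpha> t > 0}"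

definition tau_hat :: "ennreal \<Rightarrow> (ennreal \<Rightarrow> real) \<Rightarrow> (ennreal \<Rightarrow> real) \<Rightarrow> ennreal"
  where "tau_hat \<theta> \<alpha>i \<alpha>j = Inf {t. \<theta> \<le> t \<and> \<alpha>i t + \<alpha>j t > 0}"

text \<open>
  The average of limes inferior and limes superior of \<open>mu_L\<close> on the right of \<open>\<tau>\<close>.  The values of
  \<open>mu_L\<close> lie in \<open>[0,1]\<close>; the passage through \<^typ>\<open>ereal\<close> only serves to have a complete lattice.
\<close>

definition mean_lim_mu_L :: "ennreal \<Rightarrow> (ennreal \<Rightarrow> real) \<Rightarrow> (ennreal \<Rightarrow> real) \<Rightarrow> real"
  where "mean_lim_mu_L \<tau> \<alpha>i \<alpha>j =
    (let \<A> = at \<tau> within {t. \<tau> < t \<and> \<alpha>i t + \<alpha>j t > 0};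
         q = (\<lambda>t. ereal (mu_L (\<alpha>i t) (\<alpha>j t)))
     in (real_of_ereal (Liminf \<A> q) + real_of_ereal (Limsup \<A> q)) / 2)"

definition lambda_L ::
    "ennreal \<Rightarrow> (ennreal \<Rightarrow> real) \<Rightarrow> (ennreal \<Rightarrow> real) \<Rightarrow> (ennreal \<Rightarrow> real) \<Rightarrow> (ennreal \<Rightarrow> real) \<Rightarrow> real"
  where "lambda_L \<theta> Gi \<alpha>i Gj \<alpha>j =
    (let \<tau> = tau_hat \<theta> \<alpha>i \<alpha>j in
     if \<tau> < tau_hat1 \<theta> \<alpha>j then (1 - left_lim Gi \<tau>) * (1 - Gj \<tau>)
     else if \<tau> < tau_hat1 \<theta> \<alpha>i then (1 - left_lim Gj \<tau>) * (1 - \<alpha>j \<tau>) * jump Gi \<tau>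
     else if max (\<alpha>i \<tau>) (\<alpha>j \<tau>) = 1 \<or> min (\<alpha>i \<tau>) (\<alpha>j \<tau>) > 0 then
       (1 - left_lim Gi \<tau>) * (1 - left_lim Gj \<tau>) * mu_L (\<alpha>i \<tau>) (\<alpha>j \<tau>)
     else
       (1 - left_lim Gi \<tau>) * (1 - left_lim Gj \<tau>) * (1 - \<alpha>j \<tau>) *
         (\<alpha>i \<tau> + (1 - \<alpha>i \<tau>) * mean_lim_mu_L \<tau> \<alpha>i \<alpha>j))"

definition lambda_M ::
    "ennreal \<Rightarrow> (ennreal \<Rightarrow> real) \<Rightarrow> (ennreal \<Rightarrow> real) \<Rightarrow> (ennreal \<Rightarrow> real) \<Rightarrow> (ennreal \<Rightarrow> real) \<Rightarrow> real"
  where "lambda_M \<theta> Gi \<alpha>i Gj \<alpha>j =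
    (let \<tau> = tau_hat \<theta> \<alpha>i \<alpha>j in
     if \<tau> < tau_hat1 \<theta> \<alpha>j then (1 - left_lim Gi \<tau>) * \<alpha>i \<tau> * jump Gj \<tau>
     else if \<tau> < tau_hat1 \<theta> \<alpha>i then (1 - left_lim Gj \<tau>) * \<alpha>j \<tau> * jump Gi \<tau>
     else if max (\<alpha>i \<tau>) (\<alpha>j \<tau>) = 1 \<or> min (\<alpha>i \<tau>) (\<alpha>j \<tau>) > 0 then
       (1 - left_lim Gi \<tau>) * (1 - left_lim Gj \<tau>) * mu_M (\<alpha>i \<tau>) (\<alpha>j \<tau>)
     else
       (1 - left_lim Gi \<tau>) * (1 - left_lim Gj \<tau>)
         - lambda_L \<theta> Gi \<alpha>i Gj \<alpha>j - lambda_L \<theta> Gj \<alpha>j Gi \<alpha>i)"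


section \<open>Payoffs and subgame-perfect equilibrium\<close>

text \<open>
  The Lebesgue-Stieltjes integral of \<open>f\<close> over \<open>[0,\<tau>)\<close>.  Extending \<open>g\<close> by 0 to negative times
  gives the point 0 the mass \<open>g 0\<close>.
\<close>

definition stieltjes_integral :: "ennreal \<Rightarrow> (ennreal \<Rightarrow> real) \<Rightarrow> (ennreal \<Rightarrow> real) \<Rightarrow> real"
  where "stieltjes_integral \<tau> g f =
    set_lebesgue_integral (interval_measure (\<lambda>s. if s < 0 then 0 else g (ennreal s)))
      {s. 0 \<le> s \<and> ennreal s < \<tau>} (\<lambda>s. f (ennreal s))"

text \<open>\<open>L, F, M\<close> are the payoff processes of player \<open>i\<close>.\<close>

definition path_payoff ::
    "ennreal \<Rightarrow> (ennreal \<Rightarrow> real) \<Rightarrow> (ennreal \<Rightarrow> real) \<Rightarrow> (ennreal \<Rightarrow> real)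
      \<Rightarrow> (ennreal \<Rightarrow> real) \<Rightarrow> (ennreal \<Rightarrow> real) \<Rightarrow> (ennreal \<Rightarrow> real) \<Rightarrow> (ennreal \<Rightarrow> real) \<Rightarrow> real"
  where "path_payoff \<theta> L F M Gi \<alpha>i Gj \<alpha>j =
    (let \<tau> = tau_hat \<theta> \<alpha>i \<alpha>j in
       stieltjes_integral \<tau> Gi (\<lambda>s. (1 - Gj s) * L s)
     + stieltjes_integral \<tau> Gj (\<lambda>s. (1 - Gi s) * F s)
     + (\<Sum>\<^sub>\<infinity>s\<in>{..<\<tau>}. jump Gi s * jump Gj s * M s)
     + lambda_L \<theta> Gi \<alpha>i Gj \<alpha>j * L \<tau>
     + lambda_L \<theta> Gj \<alpha>j Gi \<alpha>i * F \<tau>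
     + lambda_M \<theta> Gi \<alpha>i Gj \<alpha>j * M \<tau>)"

definition payoff ::
    "'a measure \<Rightarrow> (ennreal \<Rightarrow> 'a measure)
      \<Rightarrow> (ennreal \<Rightarrow> 'a \<Rightarrow> real) \<Rightarrow> (ennreal \<Rightarrow> 'a \<Rightarrow> real) \<Rightarrow> (ennreal \<Rightarrow> 'a \<Rightarrow> real)
      \<Rightarrow> ('a \<Rightarrow> ennreal)
      \<Rightarrow> (ennreal \<Rightarrow> 'a \<Rightarrow> real) \<Rightarrow> (ennreal \<Rightarrow> 'a \<Rightarrow> real)
      \<Rightarrow> (ennreal \<Rightarrow> 'a \<Rightarrow> real) \<Rightarrow> (ennreal \<Rightarrow> 'a \<Rightarrow> real) \<Rightarrow> 'a \<Rightarrow> real"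
  where "payoff P \<F> L F M \<theta> Gi \<alpha>i Gj \<alpha>j =
    real_cond_exp P (sigma_at P \<F> \<theta>)
      (\<lambda>\<omega>. path_payoff (\<theta> \<omega>) (\<lambda>t. L t \<omega>) (\<lambda>t. F t \<omega>) (\<lambda>t. M t \<omega>)
        (\<lambda>t. Gi t \<omega>) (\<lambda>t. \<alpha>i t \<omega>) (\<lambda>t. Gj t \<omega>) (\<lambda>t. \<alpha>j t \<omega>))"

text \<open>Payoff processes and strategies are indexed by the players \<open>1, 2\<close>.\<close>

definition subgame_perfect_equilibrium ::
    "'a measure \<Rightarrow> (ennreal \<Rightarrow> 'a measure)
      \<Rightarrow> (nat \<Rightarrow> ennreal \<Rightarrow> 'a \<Rightarrow> real) \<Rightarrow> (nat \<Rightarrow> ennreal \<Rightarrow> 'a \<Rightarrow> real) \<Rightarrow> (nat \<Rightarrow> ennreal \<Rightarrow> 'a \<Rightarrow> real)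
      \<Rightarrow> (nat \<Rightarrow> ('a \<Rightarrow> ennreal) \<Rightarrow> ennreal \<Rightarrow> 'a \<Rightarrow> real)
      \<Rightarrow> (nat \<Rightarrow> ('a \<Rightarrow> ennreal) \<Rightarrow> ennreal \<Rightarrow> 'a \<Rightarrow> real) \<Rightarrow> bool"
  where "subgame_perfect_equilibrium P \<F> L F M G \<alpha> \<longleftrightarrow>
    (\<forall>i\<in>{1,2}. extended_mixed_strategy P \<F> (G i) (\<alpha> i) \<and> time_consistent P \<F> (G i) (\<alpha> i)) \<and>
    (\<forall>\<theta>. stopping_time \<F> \<theta> \<longrightarrow>
      (\<forall>i\<in>{1,2}. \<forall>j\<in>{1,2}. i \<noteq> j \<longrightarrow>
        (\<forall>Ga \<alpha>a. subgame_strategy P \<F> \<theta> Ga \<alpha>a \<longrightarrow>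
          (AE \<omega> in P.
            payoff P \<F> (L i) (F i) (M i) \<theta> (G i \<theta>) (\<alpha> i \<theta>) (G j \<theta>) (\<alpha> j \<theta>) \<omega>
            \<ge> payoff P \<F> (L i) (F i) (M i) \<theta> Ga \<alpha>a (G j \<theta>) (\<alpha> j \<theta>) \<omega>))))"


section \<open>The market entry game\<close>

definition beta1 :: "real \<Rightarrow> real \<Rightarrow> real \<Rightarrow> real"
  where "beta1 \<mu> \<sigma> r = (THE \<beta>. \<beta> > 0 \<and> 0 = 1/2 * \<sigma>\<^sup>2 * \<beta> * (\<beta> - 1) + \<mu> * \<beta> - r)"

definition x_F :: "real \<Rightarrow> real \<Rightarrow> real \<Rightarrow> real \<Rightarrow> real"
  where "x_F \<mu> \<sigma> r I = beta1 \<mu> \<sigma> r / (beta1 \<mu> \<sigma> r - 1) * (r - \<mu>) * I"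

text \<open>
  The payoff processes are \<open>e\<^sup>-\<^sup>r\<^sup>t v(X\<^sub>t)\<close>, where \<open>v\<close> is one of the following functions of the
  state.  These closed forms are the continuous versions of the optimal stopping value and of the
  conditional expectations by which follower, leader and simultaneous payoffs are defined.
\<close>

definition follower_value :: "real \<Rightarrow> real \<Rightarrow> real \<Rightarrow> real \<Rightarrow> real \<Rightarrow> real"
  where "follower_value \<mu> \<sigma> r I x =
    (if x < x_F \<mu> \<sigma> r I
     then (x / x_F \<mu> \<sigma> r I) powr beta1 \<mu> \<sigma> r * (x_F \<mu> \<sigma> r I / (r - \<mu>) - I)
     else x / (r - \<mu>) - I)"

definition leader_value :: "real \<Rightarrow> real \<Rightarrow> real \<Rightarrow> real \<Rightarrow> real \<Rightarrow> real \<Rightarrow> real"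
  where "leader_value \<mu> \<sigma> r I m x =
    (if x < x_F \<mu> \<sigma> r I
     then m * x / (r - \<mu>) - I
       + (x / x_F \<mu> \<sigma> r I) powr beta1 \<mu> \<sigma> r * (x_F \<mu> \<sigma> r I * (1 - m) / (r - \<mu>))
     else follower_value \<mu> \<sigma> r I x)"

definition simultaneous_value :: "real \<Rightarrow> real \<Rightarrow> real \<Rightarrow> real \<Rightarrow> real"
  where "simultaneous_value \<mu> r I x = x / (r - \<mu>) - I"

definition discounted_process ::
    "real \<Rightarrow> (real \<Rightarrow> real) \<Rightarrow> (real \<Rightarrow> 'a \<Rightarrow> real) \<Rightarrow> ennreal \<Rightarrow> 'a \<Rightarrow> real"
  where "discounted_process r v X t \<omega> =
    (if t = \<infinity> then 0 else exp (- r * enn2real t) * v (X (enn2real t) \<omega>))"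

text \<open>
  Characterised through the functions of the state rather than through the processes, so that it is
  uniquely determined also when \<open>X\<close> starts in 0 and stays there.
\<close>

definition x_P :: "real \<Rightarrow> real \<Rightarrow> real \<Rightarrow> real \<Rightarrow> real \<Rightarrow> real"
  where "x_P \<mu> \<sigma> r I m = (THE y. 0 < y \<and> y < x_F \<mu> \<sigma> r I \<and>
    (\<forall>x\<ge>0. (leader_value \<mu> \<sigma> r I m x < follower_value \<mu> \<sigma> r I x \<longleftrightarrow> x < y) \<and>
           (leader_value \<mu> \<sigma> r I m x > follower_value \<mu> \<sigma> r I x \<longleftrightarrow> y < x \<and> x < x_F \<mu> \<sigma> r I)))"

definition hitting_time :: "(real \<Rightarrow> 'a \<Rightarrow> real) \<Rightarrow> real set \<Rightarrow> ('a \<Rightarrow> ennreal) \<Rightarrow> 'a \<Rightarrow> ennreal"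
  where "hitting_time X A \<theta> \<omega> = Inf {ennreal s | s. 0 \<le> s \<and> \<theta> \<omega> \<le> ennreal s \<and> X s \<omega> \<in> A}"

definition entry_alpha ::
    "(ennreal \<Rightarrow> 'a \<Rightarrow> real) \<Rightarrow> (ennreal \<Rightarrow> 'a \<Rightarrow> real) \<Rightarrow> (ennreal \<Rightarrow> 'a \<Rightarrow> real)
      \<Rightarrow> ('a \<Rightarrow> ennreal) \<Rightarrow> ennreal \<Rightarrow> 'a \<Rightarrow> real"
  where "entry_alpha L F M \<theta> t \<omega> =
    (if t = \<infinity> then 1
     else if t < \<theta> \<omega> then 0
     else if L t \<omega> > F t \<omega> then (L t \<omega> - F t \<omega>) / (L t \<omega> - M t \<omega>)
     else if F t \<omega> = M t \<omega> then 1
     else 0)"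

definition entry_G :: "(('a \<Rightarrow> ennreal) \<Rightarrow> 'a \<Rightarrow> ennreal) \<Rightarrow> ('a \<Rightarrow> ennreal) \<Rightarrow> ennreal \<Rightarrow> 'a \<Rightarrow> real"
  where "entry_G \<tau> \<theta> t \<omega> = (if \<tau> \<theta> \<omega> \<le> t then 1 else 0)"

end

theory Submission
  imports Defs
begin

text \<open>
  Both players stop when the state first enters \<open>(xP, \<infinity>)\<close>.  Until then leading is worth at most as much
  as following, and at that moment the intensity of the opponent makes an attempt to become leader worth
  exactly as much as following.  A deviating player can thus never do better than with the follower
  payoff \<open>F\<close>, received at the time at which the deviation, or else the opponent, stops.  If the
  subgame starts below the threshold, \<open>F\<close> is a martingale until entry, so that this is worth
  the expectation of \<open>F\<close> at entry.  If it starts above, entry is immediate and every strategy yields \<open>F\<close>.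
  The equilibrium strategy attains the bound; at the threshold itself, where the intensity vanishes, this
  is due to the tie-breaking rule, which makes each player leader with probability one half.

  The martingale property holds because \<open>\<beta>\<close> solves its quadratic equation: with
  \<open>X\<^sub>t = x exp (\<sigma> B\<^sub>t + (\<mu> - \<sigma>\<^sup>2 / 2) t)\<close> the process \<open>exp (- r t) X\<^sub>t\<^sup>\<beta>\<close> is a multiple of the
  exponential martingale of \<open>\<beta> \<sigma> B\<close> (\<open>follower_exp_mart\<close>).  The explicit form of \<open>X\<close> has to be extracted from
  the equation, in which the stochastic integral is a limit of Riemann sums.  The theorem
  \<open>explicit_solution\<close> does so by telescoping the product of \<open>X\<close> with the reciprocal of the
  candidate along refining grids, with the isometry \<open>orthogonal_increments\<close> as the only tool from
  stochastic integration.  Optional sampling at the entry time is obtained from discrete sampling on a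
  grid in \<open>optional_sampling_truncated\<close>.

  The comparison of payoffs is done path by path.  On a fixed path, \<open>payoff_at_entry\<close> evaluates all
  cases of the outcome probabilities at the entry time by means of the indifference, and \<open>payoff_le_\<Phi>\<close>
  bounds the payoff of a deviation by the integral \<open>\<Phi>\<close> of the stopped follower payoff against the
  distribution function of the deviation.  This integral is the limit of right-endpoint Riemann sums
  (\<open>right_sum_tendsto\<close>), for which \<open>right_sum_le_follower\<close> needs the martingale property at deterministic
  times only.  The inequality between expectations holds on every event of the \<open>\<sigma>\<close>-algebra at \<open>\<theta>\<close> that
  lies in \<open>calm_at \<theta>\<close>, where the subgame starts outside the stopping region and \<open>F\<close> is bounded until entry;
  \<open>real_cond_exp_le_local\<close> turns it into the inequality between conditional expectations.
\<close>

section \<open>The follower threshold and the preemption threshold\<close>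

locale entry_parameters =
  fixes \<mu> \<sigma> m I r :: real
  assumes volatility: "\<sigma> \<noteq> 0" and markup: "m > 1" and cost: "I > 0" and discount: "r > max \<mu> 0"
begin

abbreviation "\<beta> \<equiv> beta1 \<mu> \<sigma> r"
abbreviation "xF \<equiv> x_F \<mu> \<sigma> r I"
abbreviation "xP \<equiv> x_P \<mu> \<sigma> r I m"
abbreviation "fv \<equiv> follower_value \<mu> \<sigma> r I"
abbreviation "lv \<equiv> leader_value \<mu> \<sigma> r I m"
abbreviation "sv \<equiv> simultaneous_value \<mu> r I"

lemma r_pos: "r > 0" and r_gt: "r > \<mu>"
  using discount by auto

text \<open>
  The quadratic is negative at 1 because \<open>r > \<mu>\<close>, so it has a root beyond 1.  After division by the
  unknown it reads \<open>\<sigma>\<^sup>2 / 2 * (b - 1) + \<mu> = r / b\<close> with an increasing left and a decreasing right hand side, which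
  leaves one positive root.
\<close>

lemma beta1_root: "\<beta> > 1" "r = 1/2 * \<sigma>\<^sup>2 * \<beta> * (\<beta> - 1) + \<mu> * \<beta>"
proof -
  define q where "q b = 1/2 * \<sigma>\<^sup>2 * b * (b - 1) + \<mu> * b - r" for b
  define b0 where "b0 = 1 + 2 * (r + \<bar>\<mu>\<bar>) / \<sigma>\<^sup>2"
  have b0: "b0 > 1" using r_pos volatility by (simp add: b0_def add_pos_nonneg)
  (* b0 is chosen so that the leading term dominates both other terms. *)
  have "1/2 * \<sigma>\<^sup>2 * (b0 - 1) = r + \<bar>\<mu>\<bar>"
    using volatility by (simp add: b0_def)
  then have "q b0 = b0 * (r + \<bar>\<mu>\<bar>) + \<mu> * b0 - r"
    unfolding q_def by (metis mult.assoc mult.commute)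
  also have "\<dots> = (b0 - 1) * r + b0 * (\<bar>\<mu>\<bar> + \<mu>)" by (simp add: algebra_simps)
  finally have q0: "q b0 > 0"
    using b0 r_pos by (simp add: add_pos_nonneg)
  have q1: "q 1 < 0" using r_gt by (simp add: q_def)
  have "\<exists>b. 1 \<le> b \<and> b \<le> b0 \<and> q b = 0"
    using b0 q0 q1 by (intro IVT') (auto simp: q_def intro!: continuous_intros)
  then obtain b where b: "1 \<le> b" "q b = 0" by auto
  have uniq: "a = b" if "a > 0" "q a = 0" for a
  proof -
    have *: "1/2 * \<sigma>\<^sup>2 * (c - 1) + \<mu> = r / c" if "q c = 0" "c > 0" for c
      using that by (simp add: q_def field_simps)
    have eq: "1/2 * \<sigma>\<^sup>2 * (a - b) = r / a - r / b"
      using *[of a] *[of b] that b by (simp add: right_diff_distrib)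
    have "r / a - r / b = - (r / (a * b) * (a - b))" using that b by (simp add: field_simps)
    then have "(1/2 * \<sigma>\<^sup>2 + r / (a * b)) * (a - b) = 0" using eq unfolding distrib_right by linarith
    moreover have "1/2 * \<sigma>\<^sup>2 + r / (a * b) > 0"
      using that b r_pos volatility by (intro add_pos_pos) auto
    ultimately show ?thesis by simp
  qed
  have "\<beta> = b"
    unfolding beta1_def using b uniq by (intro the_equality) (auto simp: q_def)
  moreover have "b \<noteq> 1" using q1 b by auto
  ultimately show "\<beta> > 1" "r = 1/2 * \<sigma>\<^sup>2 * \<beta> * (\<beta> - 1) + \<mu> * \<beta>"
    using b by (auto simp: q_def)
qed

lemma x_F_pos: "xF > 0"
  using beta1_root(1) r_gt cost unfolding x_F_def by (simp add: zero_less_mult_iff)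

lemma x_F_worth: "xF / (r - \<mu>) = \<beta> * I / (\<beta> - 1)"
  using r_gt by (simp add: x_F_def)

lemma powr_gt_tangent:
  assumes "0 \<le> u" "u < 1" "b > (1::real)"
  shows "1 + b * (u - 1) < u powr b"
proof -
  have cont: "continuous_on {u..1} (\<lambda>u. u powr b)"
    using assms by (intro continuous_on_powr' continuous_intros) auto
  have diff: "(\<lambda>u. u powr b) differentiable (at z)" if "u < z" for z
    using that assms has_real_derivative_powr[of z b] unfolding real_differentiable_def
    by (meson le_less_trans)
  obtain l z where z: "u < z" "z < 1" "((\<lambda>u. u powr b) has_real_derivative l) (at z)"
      "1 powr b - u powr b = (1 - u) * l"
    using MVT[OF assms(2) cont diff] by blast
  have "l = b * z powr (b - 1)"
    using z assms by (intro DERIV_unique[OF z(3)] has_real_derivative_powr) auto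
  moreover have "z powr (b - 1) < 1 powr (b - 1)"
    using z assms by (intro powr_less_mono2) auto
  ultimately have "l < b" using assms by simp
  then have "(1 - u) * l < (1 - u) * b" using assms by simp
  with z show ?thesis by (simp add: algebra_simps)
qed

lemma fv_eq_sv: "x \<ge> xF \<Longrightarrow> fv x = sv x" and lv_eq_fv: "x \<ge> xF \<Longrightarrow> lv x = fv x"
  by (auto simp: follower_value_def simultaneous_value_def leader_value_def)

lemma fv_lt_threshold:
  "x < xF \<Longrightarrow> fv x = (x / xF) powr \<beta> * (I / (\<beta> - 1))"
  using beta1_root(1) unfolding follower_value_def x_F_worth
  by (simp add: field_simps)

lemma fv_nonneg: "fv x \<ge> 0"
proof (cases "x < xF")
  case True
  then show ?thesis using beta1_root(1) cost by (simp add: fv_lt_threshold)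
next
  case False
  have "I \<le> \<beta> * I / (\<beta> - 1)" using beta1_root(1) cost by (simp add: field_simps)
  also have "\<dots> \<le> x / (r - \<mu>)" using False r_gt unfolding x_F_worth[symmetric]
    by (intro divide_right_mono) auto
  finally show ?thesis using False by (simp add: follower_value_def)
qed

text \<open>
  Smooth pasting: in units of the threshold, \<open>fv\<close> is a multiple of \<open>u \<mapsto> u\<^sup>\<beta>\<close> and \<open>sv\<close> is the same
  multiple of the tangent of this strictly convex function at \<open>u = 1\<close>.
\<close>

lemma sv_less_fv:
  assumes "x < xF" shows "sv x < fv x"
proof (cases "x < 0")
  case True
  then have "x / (r - \<mu>) < 0" using r_gt by (simp add: divide_neg_pos)
  then show ?thesis using fv_nonneg[of x] cost by (simp add: simultaneous_value_def)
next
  case False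
  define u where "u = x / xF"
  have u: "0 \<le> u" "u < 1" "x = u * xF" using False assms x_F_pos by (auto simp: u_def)
  have "x / (r - \<mu>) = u * (\<beta> * I / (\<beta> - 1))" by (simp add: u(3) flip: x_F_worth)
  then have "sv x = (I / (\<beta> - 1)) * (1 + \<beta> * (u - 1))"
    using beta1_root(1) by (simp add: simultaneous_value_def field_simps)
  also have "\<dots> < (I / (\<beta> - 1)) * u powr \<beta>"
    using powr_gt_tangent[OF u(1,2) beta1_root(1)] beta1_root(1) cost by (intro mult_strict_left_mono) auto
  also have "\<dots> = fv x" using assms by (simp add: fv_lt_threshold u_def)
  finally show ?thesis .
qed

text \<open>
  Paths are nonnegative only almost surely, whereas the strategies have to be measurable as functions
  of all paths.  Including negative states makes \<open>lv > fv\<close> equivalent to \<open>xP < x < xF\<close> on the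
  whole line.
\<close>

lemma lv_less_fv_neg:
  assumes "x < 0" shows "lv x < fv x"
proof -
  have "m * x / (r - \<mu>) < 0" using assms r_gt markup by (simp add: divide_neg_pos mult_pos_neg)
  moreover have "(x / xF) powr \<beta> * (xF * (1 - m) / (r - \<mu>)) \<le> 0"
    using markup x_F_pos r_gt by (intro mult_nonneg_nonpos divide_nonpos_pos) (auto simp: mult_le_0_iff)
  ultimately show ?thesis
    using fv_nonneg[of x] assms x_F_pos cost by (simp add: leader_value_def)
qed

text \<open>
  In the variable \<open>u = x / xF\<close> the leader's advantage is a constant minus a strictly convex power
  plus a linear function.  It is negative at \<open>0\<close> and vanishes at \<open>1\<close> with negative slope, which is where
  \<open>m > 1\<close> enters; strict concavity leaves exactly one sign change.
\<close>

lemma x_P_exists: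
  "\<exists>y. 0 < y \<and> y < xF \<and> (\<forall>x\<ge>0. (lv x < fv x \<longleftrightarrow> x < y) \<and> (lv x > fv x \<longleftrightarrow> y < x \<and> x < xF))"
proof -
  define A where "A = m * \<beta> * I / (\<beta> - 1)"
  define D where "D u = A * u - I - (A - I) * u powr \<beta>" for u
  define D' where "D' u = A - (A - I) * (\<beta> * u powr (\<beta> - 1))" for u
  note b = beta1_root(1)
  have "m * (\<beta> * I) > 1 * (\<beta> * I)" using markup b cost by (intro mult_strict_right_mono) auto
  moreover have "\<beta> * I > (\<beta> - 1) * I" using cost by simp
  ultimately have "m * \<beta> * I > (\<beta> - 1) * I" by (simp add: mult.assoc)
  then have A: "A > I" using b unfolding A_def by (simp add: pos_less_divide_eq mult.commute)
  have dec: "D' t < D' s" if "0 < s" "s < t" for s t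
    using A b that unfolding D'_def by (simp add: powr_less_mono2)
  have D1: "D 1 = 0" "D 0 < 0" using cost b by (auto simp: D_def)
  have der: "(D has_real_derivative D' u) (at u)" if "u > 0" for u
    unfolding D_def D'_def using that
    by (auto intro!: derivative_eq_intros has_real_derivative_powr)
  have cont: "continuous_on {s..t} D" if "0 \<le> s" for s t
    unfolding D_def using that b by (intro continuous_intros continuous_on_powr') auto
  have mvt: "\<exists>z>s. z < t \<and> D t - D s = (t - s) * D' z" if st: "0 \<le> s" "s < t" for s t
  proof -
    have diff: "D differentiable (at z)" if "s < z" for z
      using der[of z] that st unfolding real_differentiable_def by (meson le_less_trans)
    obtain l z where z: "s < z" "z < t" "(D has_real_derivative l) (at z)" "D t - D s = (t - s) * l"
      using MVT[OF st(2) cont[OF st(1)] diff] by blast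
    have "l = D' z" using z st by (intro DERIV_unique[OF z(3)] der) auto
    then show ?thesis using z by blast
  qed
  have "D' 1 = \<beta> * I * (1 - m)" proof -
    have "A * (\<beta> - 1) = m * \<beta> * I" using b by (simp add: A_def)
    then show ?thesis by (simp add: D'_def algebra_simps)
  qed
  then have "D' 1 < 0" using b cost markup by (simp add: mult_pos_neg)
  from DERIV_neg_dec_left[OF der this] obtain d where d: "d > 0" "\<And>h. 0 < h \<Longrightarrow> h < d \<Longrightarrow> D 1 < D (1 - h)"
    by auto
  define h where "h = min (d/2) (1/2)"
  have h: "0 < h" "h < d" "h < 1" using d(1) by (auto simp: h_def)
  have "\<exists>u\<ge>0. u \<le> 1 - h \<and> D u = 0"
    using d(2)[OF h(1,2)] D1 h by (intro IVT' cont) auto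
  then obtain u0 where u0: "0 \<le> u0" "u0 \<le> 1 - h" "D u0 = 0" by auto
  have u0': "0 < u0" "u0 < 1" using u0 D1 h by (auto simp: order_less_le)
  have neg: "D u < 0" if u: "0 \<le> u" "u < u0" for u
  proof (rule ccontr)
    assume "\<not> ?thesis"
    obtain z where z: "u < z" "z < u0" "D u0 - D u = (u0 - u) * D' z" using mvt[OF u] by auto
    obtain w where w: "u0 < w" "w < 1" "D 1 - D u0 = (1 - u0) * D' w" using mvt[of u0 1] u0' by auto
    have "(u0 - u) * D' z \<le> 0" using z u0 \<open>\<not> D u < 0\<close> by simp
    then have "D' z \<le> 0" using that by (simp add: mult_le_0_iff)
    moreover have "D' w = 0" using w u0 D1 by simp
    ultimately show False using dec[of z w] z w that by simp
  qed
  have pos: "D u > 0" if u: "u0 < u" "u < 1" for u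
  proof (rule ccontr)
    assume "\<not> ?thesis"
    obtain z where z: "u0 < z" "z < u" "D u - D u0 = (u - u0) * D' z" using mvt[of u0 u] u u0 by auto
    obtain w where w: "u < w" "w < 1" "D 1 - D u = (1 - u) * D' w" using mvt[of u 1] u0' u by auto
    have "(u - u0) * D' z \<le> 0" using z u0 \<open>\<not> D u > 0\<close> by simp
    then have "D' z \<le> 0" using that by (simp add: mult_le_0_iff)
    moreover have "(1 - u) * D' w \<ge> 0" using w D1 \<open>\<not> D u > 0\<close> by simp
    then have "D' w \<ge> 0" using that by (simp add: zero_le_mult_iff)
    ultimately show False using dec[of z w] z w u0' by simp
  qed
  define w where "w = xF / (r - \<mu>)"
  have A_w: "A = m * w" by (simp add: A_def w_def x_F_worth)
  have D: "lv x - fv x = D (x / xF)" if "x < xF" for x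
  proof -
    have "lv x - fv x = m * x / (r - \<mu>) - I + (x / xF) powr \<beta> * (xF * (1 - m) / (r - \<mu>) - (xF / (r - \<mu>) - I))"
      using that by (simp add: leader_value_def follower_value_def algebra_simps)
    also have "m * x / (r - \<mu>) = m * (x / xF) * (xF / (r - \<mu>))" using x_F_pos by simp
    also have "xF * (1 - m) / (r - \<mu>) = (1 - m) * (xF / (r - \<mu>))" by simp
    finally have "lv x - fv x = m * (x / xF) * w - I + (x / xF) powr \<beta> * ((1 - m) * w - (w - I))"
      unfolding w_def .
    also have "m * (x / xF) * w - I + (x / xF) powr \<beta> * ((1 - m) * w - (w - I)) = D (x / xF)"
      using A_w by (simp add: D_def algebra_simps)
    finally show ?thesis .
  qed
  show ?thesis
  proof (intro exI[of _ "u0 * xF"] conjI allI impI)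
    show "0 < u0 * xF" "u0 * xF < xF" using u0' x_F_pos by auto
    fix x :: real assume "x \<ge> 0"
    have i: "x / xF < u0 \<longleftrightarrow> x < u0 * xF" "u0 < x / xF \<longleftrightarrow> u0 * xF < x" "x / xF < 1 \<longleftrightarrow> x < xF"
      "x / xF \<ge> 0" "x / xF = u0 \<longleftrightarrow> x = u0 * xF"
      using x_F_pos \<open>x \<ge> 0\<close> by (auto simp: field_simps)
    have "x < xF" if "x < u0 * xF" using that \<open>u0 * xF < xF\<close> by simp
    then show "lv x < fv x \<longleftrightarrow> x < u0 * xF" "lv x > fv x \<longleftrightarrow> u0 * xF < x \<and> x < xF"
      using neg[of "x / xF"] pos[of "x / xF"] u0(3) i D[of x] lv_eq_fv[of x]
      by (smt (verit))+
  qed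
qed

lemma
  shows x_P_pos: "0 < xP" and x_P_less: "xP < xF"
    and lv_less_fv_iff: "x \<ge> 0 \<Longrightarrow> lv x < fv x \<longleftrightarrow> x < xP"
    and fv_less_lv_iff': "x \<ge> 0 \<Longrightarrow> lv x > fv x \<longleftrightarrow> xP < x \<and> x < xF"
proof -
  let ?Q = "\<lambda>y. 0 < y \<and> y < xF \<and> (\<forall>x\<ge>0. (lv x < fv x \<longleftrightarrow> x < y) \<and> (lv x > fv x \<longleftrightarrow> y < x \<and> x < xF))"
  have "\<exists>!y. ?Q y"
  proof (rule ex_ex1I[OF x_P_exists])
    fix y z assume "?Q y" "?Q z"
    then have "\<forall>x\<ge>0. x < y \<longleftrightarrow> x < z" "0 < y" "0 < z" by blast+
    then show "y = z" by (metis less_eq_real_def linorder_neqE_linordered_idom less_irrefl)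
  qed
  from theI'[OF this] have "?Q xP" unfolding x_P_def .
  then show "0 < xP" "xP < xF" "x \<ge> 0 \<Longrightarrow> lv x < fv x \<longleftrightarrow> x < xP"
    "x \<ge> 0 \<Longrightarrow> lv x > fv x \<longleftrightarrow> xP < x \<and> x < xF" by blast+
qed

lemma fv_less_lv_iff: "lv x > fv x \<longleftrightarrow> xP < x \<and> x < xF"
  using fv_less_lv_iff'[of x] lv_less_fv_neg[of x] x_P_pos by (cases "x < 0") auto

lemma lv_le_fv: "x \<le> xP \<Longrightarrow> lv x \<le> fv x"
  using fv_less_lv_iff[of x] by auto

lemma lv_eq_fv_threshold: "lv xP = fv xP"
  using fv_less_lv_iff[of xP] lv_less_fv_iff[of xP] x_P_pos by auto

lemma fv_eq_sv_iff: "fv x = sv x \<longleftrightarrow> xF \<le> x"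
  using sv_less_fv[of x] fv_eq_sv[of x] by force

lemma sv_le_fv: "sv x \<le> fv x"
  using sv_less_fv[of x] fv_eq_sv[of x] by force

lemma lv_ge:
  assumes "0 \<le> x" "x < xF" shows "- I - xF * (m - 1) / (r - \<mu>) \<le> lv x"
proof -
  have "(x / xF) powr \<beta> \<le> 1" using assms x_F_pos beta1_root(1) by (intro powr_le1) auto
  then have "(x / xF) powr \<beta> * (xF * (m - 1) / (r - \<mu>)) \<le> 1 * (xF * (m - 1) / (r - \<mu>))"
    using markup x_F_pos r_gt by (intro mult_right_mono) auto
  moreover have "m * x / (r - \<mu>) \<ge> 0" using assms markup r_gt by simp
  moreover have "xF * (1 - m) / (r - \<mu>) = - (xF * (m - 1) / (r - \<mu>))"
    by (metis minus_diff_eq minus_divide_left mult_minus_right)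
  ultimately show ?thesis using assms by (simp add: leader_value_def)
qed

lemma fv_le:
  assumes "0 \<le> x" "x \<le> xP" shows "fv x \<le> I / (\<beta> - 1)"
proof -
  have "(x / xF) powr \<beta> \<le> 1" using assms x_F_pos beta1_root(1) x_P_less by (intro powr_le1) auto
  then have "(x / xF) powr \<beta> * (I / (\<beta> - 1)) \<le> 1 * (I / (\<beta> - 1))"
    using beta1_root(1) cost by (intro mult_right_mono) auto
  then show ?thesis using assms x_P_less by (simp add: fv_lt_threshold)
qed

lemma continuous_fv: "continuous_on {0..} fv"
proof -
  have "continuous_on ({x\<in>{0..}. x \<le> xF} \<union> {x\<in>{0..}. xF \<le> x})
      (\<lambda>x. if x \<le> xF then (x / xF) powr \<beta> * (xF / (r - \<mu>) - I) else x / (r - \<mu>) - I)"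
    using x_F_pos beta1_root(1) r_gt
    by (intro continuous_on_cases_le continuous_intros continuous_on_powr')
       (auto intro!: continuous_intros)
  also have "{x\<in>{0..}. x \<le> xF} \<union> {x\<in>{0..}. xF \<le> x} = {0..}" by auto
  finally show ?thesis
    by (rule continuous_on_eq) (use x_F_pos in \<open>auto simp: follower_value_def\<close>)
qed

lemma continuous_lv: "continuous_on {0<..<xF} lv"
proof -
  have "continuous_on {0<..<xF} (\<lambda>x. m * x / (r - \<mu>) - I + (x / xF) powr \<beta> * (xF * (1 - m) / (r - \<mu>)))"
    using x_F_pos r_gt by (auto intro!: continuous_intros)
  then show ?thesis by (rule continuous_on_eq) (auto simp: leader_value_def)
qed

lemma continuous_sv: "continuous_on A sv"
  using r_gt unfolding simultaneous_value_def by (auto intro!: continuous_intros)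

lemma measurable_values [measurable]:
  "fv \<in> borel_measurable borel" "lv \<in> borel_measurable borel" "sv \<in> borel_measurable borel"
proof -
  show *: "fv \<in> borel_measurable borel"
    unfolding follower_value_def[abs_def] by measurable
  then show "lv \<in> borel_measurable borel"
    unfolding leader_value_def[abs_def] by measurable
  show "sv \<in> borel_measurable borel"
    unfolding simultaneous_value_def[abs_def] by measurable
qed

end

section \<open>Increments of Brownian motion\<close>

text \<open>
  Exponential tilting: the centred Gaussian density times \<open>exp (a y)\<close> is, up to the constant \<open>K\<close>, the
  Gaussian density with mean \<open>b = a s\<^sup>2\<close>, so that only moments of order at most 2 remain.
\<close>

lemma (in prob_space) gaussian_exponential_moments:
  fixes Y :: "'a \<Rightarrow> real"
  assumes Y: "distributed M lborel Y (normal_density 0 s)" and s: "s > 0"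
  shows "integrable M (\<lambda>\<omega>. (c0 + c1 * Y \<omega> + c2 * (Y \<omega>)\<^sup>2) * exp (a * Y \<omega>))" (is ?int)
    and "expectation (\<lambda>\<omega>. (c0 + c1 * Y \<omega> + c2 * (Y \<omega>)\<^sup>2) * exp (a * Y \<omega>)) =
      (c0 + c1 * a * s\<^sup>2 + c2 * (s\<^sup>2 + a\<^sup>2 * s ^ 4)) * exp (a\<^sup>2 * s\<^sup>2 / 2)" (is ?eq)
proof -
  define b where "b = a * s\<^sup>2"
  define K where "K = exp (a\<^sup>2 * s\<^sup>2 / 2)"
  have tilt: "normal_density 0 s y * ((c0 + c1 * y + c2 * y\<^sup>2) * exp (a * y))
      = K * ((c0 - c2 * b\<^sup>2) * normal_density b s y + (c1 + 2 * c2 * b) * (normal_density b s y * y)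
         + c2 * (normal_density b s y * (y - b) ^ (2 * 1)))" for y
  proof -
    have e: "- y\<^sup>2 / (2 * s\<^sup>2) + a * y = a\<^sup>2 * s\<^sup>2 / 2 + - (y - b)\<^sup>2 / (2 * s\<^sup>2)"
    proof -
      have "(y - b)\<^sup>2 = y\<^sup>2 - 2 * s\<^sup>2 * (a * y) + a\<^sup>2 * s\<^sup>2 * s\<^sup>2"
        by (simp add: b_def power2_eq_square algebra_simps)
      then show ?thesis using s by (simp add: diff_divide_distrib add_divide_distrib)
    qed
    have "normal_density 0 s y * exp (a * y) = K * normal_density b s y"
      unfolding normal_density_def K_def
      using arg_cong[OF e, of exp] unfolding exp_add by simp
    moreover have "c0 + c1 * y + c2 * y\<^sup>2 = c0 - c2 * b\<^sup>2 + (c1 + 2 * c2 * b) * y + c2 * (y - b) ^ (2 * 1)"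
      by (simp add: power2_eq_square algebra_simps)
    ultimately have "normal_density 0 s y * ((c0 + c1 * y + c2 * y\<^sup>2) * exp (a * y))
        = K * normal_density b s y * (c0 - c2 * b\<^sup>2 + (c1 + 2 * c2 * b) * y + c2 * (y - b) ^ (2 * 1))"
      by (metis mult.assoc mult.commute)
    then show ?thesis by (simp only: distrib_left mult.assoc mult.left_commute[of "normal_density b s y"] mult.commute[of "normal_density b s y"])
  qed
  have moments: "has_bochner_integral lborel (normal_density b s) 1"
    "has_bochner_integral lborel (\<lambda>y. normal_density b s y * y) b"
    "has_bochner_integral lborel (\<lambda>y. normal_density b s y * (y - b) ^ (2 * 1)) (s\<^sup>2)"
    using s normal_moment_nz_1[OF s, of b] normal_moment_even[OF s, of b 1]
    by (auto simp: has_bochner_integral_iff)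
  have bi: "has_bochner_integral lborel
     (\<lambda>y. normal_density 0 s y * ((c0 + c1 * y + c2 * y\<^sup>2) * exp (a * y)))
     (K * ((c0 - c2 * b\<^sup>2) * 1 + (c1 + 2 * c2 * b) * b + c2 * s\<^sup>2))"
    unfolding tilt
    using moments
    by (intro has_bochner_integral_mult_right[where c=K]
        has_bochner_integral_mult_right[where c="c0 - c2 * b\<^sup>2"]
        has_bochner_integral_mult_right[where c="c1 + 2 * c2 * b"]
        has_bochner_integral_mult_right[where c=c2] has_bochner_integral_add)
  have ev: "K * ((c0 - c2 * b\<^sup>2) * 1 + (c1 + 2 * c2 * b) * b + c2 * s\<^sup>2)
     = (c0 + c1 * a * s\<^sup>2 + c2 * (s\<^sup>2 + a\<^sup>2 * s ^ 4)) * exp (a\<^sup>2 * s\<^sup>2 / 2)"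
    unfolding b_def K_def by (simp add: power2_eq_square power4_eq_xxxx algebra_simps)
  have m: "(\<lambda>y. (c0 + c1 * y + c2 * y\<^sup>2) * exp (a * y)) \<in> borel_measurable lborel" by measurable
  show ?int
    using distributed_integrable[OF Y m] bi by (auto simp: has_bochner_integral_iff)
  show ?eq
    using distributed_integral[OF Y m] bi ev by (auto simp: has_bochner_integral_iff)
qed

text \<open>
  Brownian motion comes with independence of \<open>\<sigma>\<close>-algebras, whereas expectations of products factorise
  for independent random variables.
\<close>

lemma (in prob_space) indep_var_of_indep_set:
  assumes indep: "indep_set (sets N) {D -` A \<inter> space M | A. A \<in> sets borel}"
    and N: "space N = space M" "sets N \<subseteq> sets M"
    and D: "D \<in> borel_measurable M" and U: "U \<in> borel_measurable N"
    and g: "(g :: real \<Rightarrow> real) \<in> borel_measurable borel"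
  shows "indep_var borel (U :: 'a \<Rightarrow> real) borel (\<lambda>\<omega>. g (D \<omega>))"
  unfolding indep_var_eq
proof (intro conjI)
  show U': "random_variable borel U"
    using U N unfolding measurable_def by auto
  show "random_variable borel (\<lambda>\<omega>. g (D \<omega>))" by (rule measurable_compose[OF D g])
  let ?V = "vimage_algebra (space M) D borel"
  have V: "sets ?V = {D -` A \<inter> space M | A. A \<in> sets borel}"
    by (rule sets_vimage_algebra2) auto
  have g_V: "(\<lambda>\<omega>. g (D \<omega>)) -` A \<inter> space M \<in> sets ?V" if "A \<in> sets borel" for A
  proof -
    have "(\<lambda>\<omega>. g (D \<omega>)) -` A \<inter> space M = D -` (g -` A) \<inter> space M" by auto
    moreover have "g -` A \<in> sets borel" using measurable_sets[OF g that] by simp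
    ultimately show ?thesis unfolding V by blast
  qed
  have 1: "sigma_sets (space N) {U -` A \<inter> space M |A. A \<in> sets borel} \<subseteq> sets N"
  proof (rule sets.sigma_sets_subset)
    show "{U -` A \<inter> space M |A. A \<in> sets borel} \<subseteq> sets N"
      using measurable_sets[OF U] unfolding N(1) by blast
  qed
  have 2: "sigma_sets (space ?V) {(\<lambda>\<omega>. g (D \<omega>)) -` A \<inter> space M |A. A \<in> sets borel} \<subseteq> sets ?V"
  proof (rule sets.sigma_sets_subset)
    show "{(\<lambda>\<omega>. g (D \<omega>)) -` A \<inter> space M |A. A \<in> sets borel} \<subseteq> sets ?V"
      using g_V by blast
  qed
  have i: "sets N \<subseteq> events" "sets ?V \<subseteq> events"
      "\<And>a b. a \<in> sets N \<Longrightarrow> b \<in> sets ?V \<Longrightarrow> prob (a \<inter> b) = prob a * prob b"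
    using indep unfolding indep_sets2_eq V by blast+
  show "indep_set (sigma_sets (space M) {U -` A \<inter> space M |A. A \<in> sets borel})
     (sigma_sets (space M) {(\<lambda>\<omega>. g (D \<omega>)) -` A \<inter> space M |A. A \<in> sets borel})"
    unfolding indep_sets2_eq
  proof (intro conjI ballI)
    note one = 1[unfolded N(1)] and two = 2[unfolded space_vimage_algebra]
    show "sigma_sets (space M) {U -` A \<inter> space M |A. A \<in> sets borel} \<subseteq> events"
      by (rule subset_trans[OF one i(1)])
    show "sigma_sets (space M) {(\<lambda>\<omega>. g (D \<omega>)) -` A \<inter> space M |A. A \<in> sets borel} \<subseteq> events"
      by (rule subset_trans[OF two i(2)])
    show "prob (a \<inter> b) = prob a * prob b"
      if "a \<in> sigma_sets (space M) {U -` A \<inter> space M |A. A \<in> sets borel}"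
        "b \<in> sigma_sets (space M) {(\<lambda>\<omega>. g (D \<omega>)) -` A \<inter> space M |A. A \<in> sets borel}" for a b
      by (rule i(3)[OF subsetD[OF one that(1)] subsetD[OF two that(2)]])
  qed
qed

locale brownian_filtration = usual_filtration P \<F>
  for P :: "'a measure" and \<F> :: "ennreal \<Rightarrow> 'a measure" +
  fixes B :: "real \<Rightarrow> 'a \<Rightarrow> real"
  assumes brownian: "brownian_motion P \<F> B"
begin

abbreviation \<F>r :: "real \<Rightarrow> 'a measure" where "\<F>r t \<equiv> \<F> (ennreal t)"

lemma measurable_from_filtration: "f \<in> measurable (\<F> t) N \<Longrightarrow> f \<in> measurable P N"
  using sets_filtration[of t] space_F[of t] unfolding measurable_def by auto

lemma measurable_filtration_mono: "f \<in> measurable (\<F> s) N \<Longrightarrow> s \<le> t \<Longrightarrow> f \<in> measurable (\<F> t) N"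
  using sets_F_mono[of s t] space_F unfolding measurable_def by auto

lemma measurable_filtrationr_mono: "f \<in> measurable (\<F>r s) N \<Longrightarrow> s \<le> t \<Longrightarrow> f \<in> measurable (\<F>r t) N"
  by (erule measurable_filtration_mono) (rule ennreal_leI)

lemma measurable_B: "0 \<le> s \<Longrightarrow> s \<le> t \<Longrightarrow> B s \<in> borel_measurable (\<F>r t)"
  using brownian measurable_filtrationr_mono unfolding brownian_motion_def by blast

lemma measurable_B_P [measurable (raw)]: "0 \<le> t \<Longrightarrow> B t \<in> borel_measurable P"
  using measurable_B[of t t] measurable_from_filtration by auto

lemma increment_distributed:
  "0 \<le> s \<Longrightarrow> s < t \<Longrightarrow> distributed P lborel (\<lambda>\<omega>. B t \<omega> - B s \<omega>) (normal_density 0 (sqrt (t - s)))"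
  using brownian unfolding brownian_motion_def by blast

lemma increment_indep:
  assumes "0 \<le> s" "s < t" "U \<in> borel_measurable (\<F>r s)" "(g::real\<Rightarrow>real) \<in> borel_measurable borel"
  shows "indep_var borel U borel (\<lambda>\<omega>. g (B t \<omega> - B s \<omega>))"
  using brownian assms space_F sets_filtration unfolding brownian_motion_def
  by (intro indep_var_of_indep_set[where N="\<F>r s" and D="\<lambda>\<omega>. B t \<omega> - B s \<omega>"])
     (auto intro!: borel_measurable_diff measurable_B_P)

lemma increment_product:
  fixes U :: "'a \<Rightarrow> real"
  assumes "0 \<le> s" "s < t" "U \<in> borel_measurable (\<F>r s)" "g \<in> borel_measurable borel"
    and "integrable P U" "integrable P (\<lambda>\<omega>. g (B t \<omega> - B s \<omega>))"
  shows "integrable P (\<lambda>\<omega>. U \<omega> * g (B t \<omega> - B s \<omega>))"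
    and "expectation (\<lambda>\<omega>. U \<omega> * g (B t \<omega> - B s \<omega>)) = expectation U * expectation (\<lambda>\<omega>. g (B t \<omega> - B s \<omega>))"
  using indep_var_integrable[OF increment_indep[OF assms(1-4)] assms(5,6)]
    indep_var_lebesgue_integral[OF increment_indep[OF assms(1-4)] assms(5,6)] by auto

lemma increment_exponential_moments:
  assumes "0 \<le> s" "s < t"
  shows "integrable P (\<lambda>\<omega>. (c0 + c1 * (B t \<omega> - B s \<omega>) + c2 * (B t \<omega> - B s \<omega>)\<^sup>2) * exp (a * (B t \<omega> - B s \<omega>)))"
    and "expectation (\<lambda>\<omega>. (c0 + c1 * (B t \<omega> - B s \<omega>) + c2 * (B t \<omega> - B s \<omega>)\<^sup>2) * exp (a * (B t \<omega> - B s \<omega>))) =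
      (c0 + c1 * a * (t - s) + c2 * ((t - s) + a\<^sup>2 * (t - s)\<^sup>2)) * exp (a\<^sup>2 * (t - s) / 2)"
proof -
  have s: "sqrt (t - s) > 0" using assms by simp
  note g = gaussian_exponential_moments[OF increment_distributed[OF assms] s, of c0 c1 c2 a]
  have "sqrt (t - s) ^ 4 = ((sqrt (t - s))\<^sup>2)\<^sup>2" by (simp flip: power_mult)
  then have "sqrt (t - s) ^ 4 = (t - s)\<^sup>2" using assms by simp
  then show "integrable P (\<lambda>\<omega>. (c0 + c1 * (B t \<omega> - B s \<omega>) + c2 * (B t \<omega> - B s \<omega>)\<^sup>2) * exp (a * (B t \<omega> - B s \<omega>)))"
   "expectation (\<lambda>\<omega>. (c0 + c1 * (B t \<omega> - B s \<omega>) + c2 * (B t \<omega> - B s \<omega>)\<^sup>2) * exp (a * (B t \<omega> - B s \<omega>))) =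
      (c0 + c1 * a * (t - s) + c2 * ((t - s) + a\<^sup>2 * (t - s)\<^sup>2)) * exp (a\<^sup>2 * (t - s) / 2)"
    using g assms by auto
qed

text \<open>
  The isometry for elementary integrands.  The mixed terms of the square vanish, as \<open>g k\<close> of the
  increment is centred and independent of everything known at time \<open>t k\<close>.
\<close>

lemma orthogonal_increments:
  fixes U :: "nat \<Rightarrow> 'a \<Rightarrow> real" and g :: "nat \<Rightarrow> real \<Rightarrow> real" and t :: "nat \<Rightarrow> real"
  assumes t: "0 \<le> t 0" "\<And>k. t k < t (Suc k)"
    and U: "\<And>k. k < n \<Longrightarrow> U k \<in> borel_measurable (\<F>r (t k))"
      "\<And>k \<omega>. k < n \<Longrightarrow> \<omega> \<in> space P \<Longrightarrow> \<bar>U k \<omega>\<bar> \<le> C"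
    and g: "\<And>k. g k \<in> borel_measurable borel"
      "\<And>k. expectation (\<lambda>\<omega>. g k (B (t (Suc k)) \<omega> - B (t k) \<omega>)) = 0"
      "\<And>k. integrable P (\<lambda>\<omega>. (g k (B (t (Suc k)) \<omega> - B (t k) \<omega>))\<^sup>2)"
  defines "S \<equiv> \<lambda>n \<omega>. \<Sum>k<n. U k \<omega> * g k (B (t (Suc k)) \<omega> - B (t k) \<omega>)"
  shows "S n \<in> borel_measurable P" "integrable P (\<lambda>\<omega>. (S n \<omega>)\<^sup>2)"
    "expectation (\<lambda>\<omega>. (S n \<omega>)\<^sup>2) =
      (\<Sum>k<n. expectation (\<lambda>\<omega>. (U k \<omega>)\<^sup>2) * expectation (\<lambda>\<omega>. (g k (B (t (Suc k)) \<omega> - B (t k) \<omega>))\<^sup>2))"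
proof -
  have t0: "0 \<le> t k" for k
  proof (induction k)
    case (Suc k)
    then show ?case using t(2)[of k] by linarith
  qed (fact t(1))
  have inc: "t i \<le> t j" if "i \<le> j" for i j
    by (rule lift_Suc_mono_le[of t, OF less_imp_le[OF t(2)] that])
  have C: "C \<ge> 0" if "n > 0"
  proof -
    obtain \<omega> where "\<omega> \<in> space P" using not_empty by blast
    from order_trans[OF abs_ge_zero U(2)[OF that this]] show ?thesis .
  qed
  let ?d = "\<lambda>k \<omega>. B (t (Suc k)) \<omega> - B (t k) \<omega>"
  have "S j \<in> borel_measurable (\<F>r (t j)) \<and> integrable P (\<lambda>\<omega>. (S j \<omega>)\<^sup>2) \<and>
    expectation (\<lambda>\<omega>. (S j \<omega>)\<^sup>2) =
      (\<Sum>k<j. expectation (\<lambda>\<omega>. (U k \<omega>)\<^sup>2) * expectation (\<lambda>\<omega>. (g k (?d k \<omega>))\<^sup>2))"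
    if "j \<le> n" for j
    using that
  proof (induction j)
    case 0
    then show ?case by (simp add: S_def)
  next
    case (Suc j)
    then have j: "j < n" and IHm: "S j \<in> borel_measurable (\<F>r (t j))"
      and IHi: "integrable P (\<lambda>\<omega>. (S j \<omega>)\<^sup>2)" by auto
    note Uj = U(1)[OF j] U(2)[OF j]
    have gi: "integrable P (\<lambda>\<omega>. g j (?d j \<omega>))"
      by (rule square_integrable_imp_integrable[OF _ g(3)])
         (intro measurable_compose[OF _ g(1)] borel_measurable_diff measurable_B_P t0)
    have Si: "integrable P (S j)"
      using measurable_from_filtration[OF IHm] IHi by (rule square_integrable_imp_integrable)
    have SUi: "integrable P (\<lambda>\<omega>. S j \<omega> * U j \<omega>)"
      using measurable_from_filtration[OF IHm] measurable_from_filtration[OF Uj(1)]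
    proof (intro Bochner_Integration.integrable_bound[OF integrable_mult_right[OF Si, of C]] AE_I2)
      fix \<omega> assume "\<omega> \<in> space P"
      then show "norm (S j \<omega> * U j \<omega>) \<le> norm (C * S j \<omega>)"
        using mult_left_mono[OF Uj(2), of \<omega> "\<bar>S j \<omega>\<bar>"] C j by (simp add: abs_mult mult.commute)
    qed simp
    have UUi: "integrable P (\<lambda>\<omega>. (U j \<omega>)\<^sup>2)"
      using measurable_from_filtration[OF Uj(1)]
      by (intro integrable_const_bound[of _ "C\<^sup>2"]) (use Uj(2) power_mono[OF Uj(2) abs_ge_zero, of _ 2] in \<open>auto intro!: AE_I2\<close>)
    have cross: "integrable P (\<lambda>\<omega>. (S j \<omega> * U j \<omega>) * g j (?d j \<omega>))"
       "expectation (\<lambda>\<omega>. (S j \<omega> * U j \<omega>) * g j (?d j \<omega>)) = 0"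
      using increment_product[OF t0 t(2) _ g(1) SUi gi] IHm Uj(1) g(2) by auto
    have diag: "integrable P (\<lambda>\<omega>. (U j \<omega>)\<^sup>2 * (g j (?d j \<omega>))\<^sup>2)"
       "expectation (\<lambda>\<omega>. (U j \<omega>)\<^sup>2 * (g j (?d j \<omega>))\<^sup>2) = expectation (\<lambda>\<omega>. (U j \<omega>)\<^sup>2) * expectation (\<lambda>\<omega>. (g j (?d j \<omega>))\<^sup>2)"
      using increment_product[OF t0 t(2) borel_measurable_power[OF Uj(1)] borel_measurable_power[OF g(1)] UUi g(3)]
      by auto
    have expand: "(S (Suc j) \<omega>)\<^sup>2 = (S j \<omega>)\<^sup>2 + 2 * ((S j \<omega> * U j \<omega>) * g j (?d j \<omega>)) + (U j \<omega>)\<^sup>2 * (g j (?d j \<omega>))\<^sup>2" for \<omega>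
      by (simp add: S_def power2_eq_square algebra_simps)
    have "S (Suc j) \<in> borel_measurable (\<F>r (t (Suc j)))"
    proof -
      have "S j \<in> borel_measurable (\<F>r (t (Suc j)))" "U j \<in> borel_measurable (\<F>r (t (Suc j)))"
        using IHm Uj(1) inc[of j "Suc j"] by (auto intro: measurable_filtrationr_mono)
      moreover have "(\<lambda>\<omega>. g j (?d j \<omega>)) \<in> borel_measurable (\<F>r (t (Suc j)))"
        using t0 inc by (intro measurable_compose[OF _ g(1)] borel_measurable_diff measurable_B) auto
      ultimately show ?thesis by (simp add: S_def)
    qed
    then show ?case
      unfolding expand using cross diag Suc by simp
  qed
  from this[of n] show "S n \<in> borel_measurable P" "integrable P (\<lambda>\<omega>. (S n \<omega>)\<^sup>2)"
    "expectation (\<lambda>\<omega>. (S n \<omega>)\<^sup>2) =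
      (\<Sum>k<n. expectation (\<lambda>\<omega>. (U k \<omega>)\<^sup>2) * expectation (\<lambda>\<omega>. (g k (B (t (Suc k)) \<omega> - B (t k) \<omega>))\<^sup>2))"
    by (auto intro: measurable_from_filtration)
qed

end

section \<open>The explicit solution\<close>

text \<open>
  The stochastic integral in the equation is given by limits of its Riemann sums, so that Ito's
  formula has to be replaced by a discrete computation.  Let \<open>Z\<close> be the reciprocal of the candidate
  solution.  Along a grid of \<open>n\<close> blocks, each subdivided into \<open>q\<close> steps, the increment of \<open>X Z\<close> over a
  block splits into the error of an Euler step, the gain from adjusting the position \<open>\<sigma> X\<close> within
  the block, the covariation of this gain with \<open>Z\<close>, an error in the drift and the
  distance of the stochastic integral from its Riemann sums.  The last one vanishes as \<open>q \<rightarrow> \<infinity>\<close>, the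
  others as \<open>n \<rightarrow> \<infinity>\<close>; hence \<open>X Z\<close> is constant.
\<close>

lemma scaled_increment_tendsto:
  assumes "(h has_real_derivative d) (at 0)" "h 0 = 0" "T > 0"
  shows "(\<lambda>n. real n * h (T / real n)) \<longlonglongrightarrow> T * d"
proof -
  have lim: "((\<lambda>y. h y / y) \<longlongrightarrow> d) (at 0)"
    using assms(1,2) unfolding DERIV_def by simp
  have T: "filterlim (\<lambda>n. T / real n) (at 0) sequentially"
    unfolding filterlim_at
  proof
    show "(\<lambda>n. T / real n) \<longlonglongrightarrow> 0" by (rule lim_const_over_n)
    show "\<forall>\<^sub>F n in sequentially. T / real n \<in> UNIV \<and> T / real n \<noteq> 0"
      using eventually_gt_at_top[of 0] by eventually_elim (use assms(3) in auto)
  qed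
  have "(\<lambda>n. T * (h (T / real n) / (T / real n))) \<longlonglongrightarrow> T * d"
    by (intro tendsto_intros filterlim_compose[OF lim T])
  then show ?thesis
  proof (rule Lim_transform_eventually)
    show "\<forall>\<^sub>F n in sequentially. T * (h (T / real n) / (T / real n)) = real n * h (T / real n)"
      using eventually_gt_at_top[of 0] by eventually_elim (use assms(3) in auto)
  qed
qed

lemma riemann_block_error_tendsto:
  fixes f :: "real \<Rightarrow> real"
  assumes f: "continuous_on {0..T} f" and T: "T > 0"
  defines "u \<equiv> \<lambda>n k. T * real k / real n"
  shows "(\<lambda>n. \<Sum>k<n. \<bar>integral {u n k..u n (Suc k)} f - f (u n k) * (T / real n)\<bar>) \<longlonglongrightarrow> 0"
proof (rule LIMSEQ_I)
  fix e :: real assume e: "e > 0"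
  have "uniformly_continuous_on {0..T} f"
    using f by (intro compact_uniformly_continuous) auto
  then obtain d where d: "d > 0" "\<And>s t. s \<in> {0..T} \<Longrightarrow> t \<in> {0..T} \<Longrightarrow> dist s t < d \<Longrightarrow> dist (f s) (f t) < e / (2 * T)"
    using e T unfolding uniformly_continuous_on_def by (metis divide_pos_pos mult_pos_pos zero_less_numeral)
  obtain n0 :: nat where n0: "T / d < real n0" using reals_Archimedean2 by blast
  show "\<exists>no. \<forall>n\<ge>no. norm ((\<Sum>k<n. \<bar>integral {u n k..u n (Suc k)} f - f (u n k) * (T / real n)\<bar>) - 0) < e"
  proof (intro exI[of _ "Suc n0"] allI impI)
    fix n assume n: "Suc n0 \<le> n"
    then have npos: "n > 0" and "T / d < real n" using n0 by auto
    then have mesh: "T / real n < d" using d T by (simp add: field_simps)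
    have "\<bar>integral {u n k..u n (Suc k)} f - f (u n k) * (T / real n)\<bar> \<le> e / (2 * T) * (T / real n)"
      if k: "k < n" for k
    proof -
      have len: "u n (Suc k) - u n k = T / real n"
        using npos by (simp add: u_def field_simps)
      have le: "u n k \<le> u n (Suc k)" using len T npos by (metis diff_ge_0_iff_ge divide_nonneg_nonneg less_imp_le of_nat_0_le_iff)
      have "T * real (Suc k) \<le> T * real n" using k T by (intro mult_left_mono) auto
      then have "u n (Suc k) \<le> T" using npos by (simp add: u_def field_simps)
      moreover have "0 \<le> u n k" using T by (simp add: u_def)
      ultimately have sub: "{u n k..u n (Suc k)} \<subseteq> {0..T}" by auto
      have int: "f integrable_on {u n k..u n (Suc k)}"
        using continuous_on_subset[OF f sub] by (rule integrable_continuous_interval)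
      have "integral {u n k..u n (Suc k)} f - f (u n k) * (T / real n) = integral {u n k..u n (Suc k)} (\<lambda>s. f s - f (u n k))"
        using int le len by (subst integral_diff) (auto simp: mult.commute)
      also have "norm \<dots> \<le> e / (2 * T) * (u n (Suc k) - u n k)"
      proof (rule integral_bound[OF le])
        show "continuous_on {u n k..u n (Suc k)} (\<lambda>s. f s - f (u n k))"
          using continuous_on_subset[OF f sub] by (intro continuous_intros)
        fix s assume s: "s \<in> {u n k..u n (Suc k)}"
        have "dist (f s) (f (u n k)) < e / (2 * T)"
          using s sub le len mesh by (intro d(2)) (auto simp: dist_real_def)
        then show "norm (f s - f (u n k)) \<le> e / (2 * T)" by (simp add: dist_real_def)
      qed
      finally show ?thesis using len by simp
    qed
    then have "(\<Sum>k<n. \<bar>integral {u n k..u n (Suc k)} f - f (u n k) * (T / real n)\<bar>) \<le> (\<Sum>k<n. e / (2 * T) * (T / real n))"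
      by (intro sum_mono) auto
    also have "\<dots> = e / 2" using npos T by simp
    also have "\<dots> < e" using e by simp
    finally show "norm ((\<Sum>k<n. \<bar>integral {u n k..u n (Suc k)} f - f (u n k) * (T / real n)\<bar>) - 0) < e"
      by (simp add: sum_nonneg)
  qed
qed

text \<open>
  Errors that are small in truncated mean can be added up over the blocks: truncation at 1 is
  subadditive, while a level that is exceeded would have to be split among the summands.
\<close>

lemma (in prob_space) tends_in_prob_truncated:
  assumes "tends_in_prob M Y Z" and [measurable]: "\<And>n. Y n \<in> borel_measurable M" "Z \<in> borel_measurable M"
  shows "(\<lambda>n. expectation (\<lambda>\<omega>. min 1 \<bar>Y n \<omega> - Z \<omega>\<bar>)) \<longlonglongrightarrow> 0"
proof (rule LIMSEQ_I)
  fix e :: real assume e: "e > 0"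
  have "(\<lambda>n. prob {\<omega> \<in> space M. e / 2 < \<bar>Y n \<omega> - Z \<omega>\<bar>}) \<longlonglongrightarrow> 0"
    using assms(1) half_gt_zero[OF e] unfolding tends_in_prob_def by blast
  from LIMSEQ_D[OF this, of "e/2"] e obtain n0 where
    n0: "\<And>n. n \<ge> n0 \<Longrightarrow> prob {\<omega> \<in> space M. e / 2 < \<bar>Y n \<omega> - Z \<omega>\<bar>} < e / 2" by auto
  show "\<exists>no. \<forall>n\<ge>no. norm (expectation (\<lambda>\<omega>. min 1 \<bar>Y n \<omega> - Z \<omega>\<bar>) - 0) < e"
  proof (intro exI[of _ n0] allI impI)
    fix n assume n: "n0 \<le> n"
    define A where "A = {\<omega> \<in> space M. e / 2 < \<bar>Y n \<omega> - Z \<omega>\<bar>}"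
    have A: "A \<in> events" unfolding A_def by measurable
    have "expectation (\<lambda>\<omega>. min 1 \<bar>Y n \<omega> - Z \<omega>\<bar>) \<le> expectation (\<lambda>\<omega>. e / 2 + indicator A \<omega>)"
    proof (rule integral_mono)
      show "integrable M (\<lambda>\<omega>. min 1 \<bar>Y n \<omega> - Z \<omega>\<bar>)" by (rule integrable_const_bound[of _ 1]) auto
      show "integrable M (\<lambda>\<omega>. e / 2 + indicator A \<omega>)"
        by (intro Bochner_Integration.integrable_add integrable_const integrable_real_indicator A)
          (simp add: emeasure_eq_measure)
    qed (use e in \<open>auto simp: indicator_def min_def A_def\<close>)
    also have "\<dots> = e / 2 + prob A" using A by (subst Bochner_Integration.integral_add) (auto simp: prob_space emeasure_eq_measure)
    also have "\<dots> < e" using n0[OF n] by (simp add: A_def)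
    finally show "norm (expectation (\<lambda>\<omega>. min 1 \<bar>Y n \<omega> - Z \<omega>\<bar>) - 0) < e"
      by (simp add: integral_nonneg_AE)
  qed
qed

lemma min_one_sum_le: "finite A \<Longrightarrow> (\<And>a. a \<in> A \<Longrightarrow> 0 \<le> f a) \<Longrightarrow> min 1 (sum f A) \<le> (\<Sum>a\<in>A. min 1 (f a :: real))"
proof (induction A rule: finite_induct)
  case (insert a A)
  then have "min 1 (sum f A) \<le> (\<Sum>a\<in>A. min 1 (f a))" "0 \<le> f a" "0 \<le> sum f A" by (auto intro: sum_nonneg)
  then show ?case using insert(1,2) by simp
qed simp

lemma (in prob_space) expectation_abs_le_sqrt:
  assumes "f \<in> borel_measurable M" "integrable M (\<lambda>\<omega>. (f \<omega> :: real)\<^sup>2)"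
  shows "integrable M f" "expectation (\<lambda>\<omega>. \<bar>f \<omega>\<bar>) \<le> sqrt (expectation (\<lambda>\<omega>. (f \<omega>)\<^sup>2))"
proof -
  show f: "integrable M f" using assms by (rule square_integrable_imp_integrable)
  have "0 \<le> variance (\<lambda>\<omega>. \<bar>f \<omega>\<bar>)" by (rule variance_positive)
  also have "\<dots> = expectation (\<lambda>\<omega>. (f \<omega>)\<^sup>2) - (expectation (\<lambda>\<omega>. \<bar>f \<omega>\<bar>))\<^sup>2"
    using f assms(2) by (subst variance_eq) auto
  finally show "expectation (\<lambda>\<omega>. \<bar>f \<omega>\<bar>) \<le> sqrt (expectation (\<lambda>\<omega>. (f \<omega>)\<^sup>2))"
    by (intro real_le_rsqrt) simp
qed

context brownian_filtration begin

text \<open>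
  For one time step of length \<open>\<delta>\<close> with increment \<open>b\<close> of the driving motion, \<open>inverse_step\<close> is the
  growth factor of \<open>exp (- \<sigma> B - (\<mu> - \<sigma>\<^sup>2/2) t)\<close>, the reciprocal of the candidate solution, and
  \<open>step_error\<close> is the error of the Euler step relative to the candidate.
\<close>

definition inverse_step :: "real \<Rightarrow> real \<Rightarrow> real \<Rightarrow> real \<Rightarrow> real"
  where "inverse_step \<mu> \<sigma> \<delta> b = exp (- (\<mu> - \<sigma>\<^sup>2 / 2) * \<delta>) * exp (- \<sigma> * b)"

definition step_error :: "real \<Rightarrow> real \<Rightarrow> real \<Rightarrow> real \<Rightarrow> real"
  where "step_error \<mu> \<sigma> \<delta> b = (1 + \<mu> * \<delta> + \<sigma> * b) * inverse_step \<mu> \<sigma> \<delta> b - 1"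

lemma measurable_step [measurable]:
  "inverse_step \<mu> \<sigma> \<delta> \<in> borel_measurable borel" "step_error \<mu> \<sigma> \<delta> \<in> borel_measurable borel"
  unfolding step_error_def[abs_def] inverse_step_def[abs_def] by measurable

text \<open>
  The moments of one step are explicit; what counts is their order in the step length.  The mean
  and the mean square of the error are \<open>o(\<delta>)\<close>, so that \<open>n\<close> errors on a grid of mesh \<open>T / n\<close> add up to
  something small, and \<open>mean_square_step\<close> is of order \<open>\<sigma>\<^sup>2 \<delta>\<close>.
\<close>

definition mean_step_error :: "real \<Rightarrow> real \<Rightarrow> real \<Rightarrow> real"
  where "mean_step_error \<mu> \<sigma> \<delta> =
    exp (- (\<mu> - \<sigma>\<^sup>2 / 2) * \<delta>) * ((1 + \<mu> * \<delta> - \<sigma>\<^sup>2 * \<delta>) * exp (\<sigma>\<^sup>2 * \<delta> / 2)) - 1"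

definition mean_square_step_error :: "real \<Rightarrow> real \<Rightarrow> real \<Rightarrow> real"
  where "mean_square_step_error \<mu> \<sigma> \<delta> =
    exp (- 2 * (\<mu> - \<sigma>\<^sup>2 / 2) * \<delta>) * (((1 + \<mu> * \<delta>)\<^sup>2 - 4 * (1 + \<mu> * \<delta>) * \<sigma>\<^sup>2 * \<delta> + \<sigma>\<^sup>2 * (\<delta> + 4 * \<sigma>\<^sup>2 * \<delta>\<^sup>2)) * exp (2 * \<sigma>\<^sup>2 * \<delta>))
    - 2 * mean_step_error \<mu> \<sigma> \<delta> - 1"

definition mean_square_step :: "real \<Rightarrow> real \<Rightarrow> real \<Rightarrow> real"
  where "mean_square_step \<mu> \<sigma> \<delta> =
    exp (- 2 * (\<mu> - \<sigma>\<^sup>2 / 2) * \<delta>) * exp (2 * \<sigma>\<^sup>2 * \<delta>) - 2 * (exp (- (\<mu> - \<sigma>\<^sup>2 / 2) * \<delta>) * exp (\<sigma>\<^sup>2 * \<delta> / 2)) + 1"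

lemma step_moments:
  assumes "0 \<le> s" "s < t"
  defines "b \<equiv> \<lambda>\<omega>. B t \<omega> - B s \<omega>"
  shows "integrable P (\<lambda>\<omega>. step_error \<mu> \<sigma> (t - s) (b \<omega>))"
    "expectation (\<lambda>\<omega>. step_error \<mu> \<sigma> (t - s) (b \<omega>)) = mean_step_error \<mu> \<sigma> (t - s)"
    "integrable P (\<lambda>\<omega>. (step_error \<mu> \<sigma> (t - s) (b \<omega>))\<^sup>2)"
    "expectation (\<lambda>\<omega>. (step_error \<mu> \<sigma> (t - s) (b \<omega>))\<^sup>2) = mean_square_step_error \<mu> \<sigma> (t - s)"
    "integrable P (\<lambda>\<omega>. (inverse_step \<mu> \<sigma> (t - s) (b \<omega>) - 1)\<^sup>2)"
    "expectation (\<lambda>\<omega>. (inverse_step \<mu> \<sigma> (t - s) (b \<omega>) - 1)\<^sup>2) = mean_square_step \<mu> \<sigma> (t - s)"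
proof -
  define \<delta> where "\<delta> = t - s"
  define k where "k = exp (- (\<mu> - \<sigma>\<^sup>2 / 2) * \<delta>)"
  have k2: "exp (- 2 * (\<mu> - \<sigma>\<^sup>2 / 2) * \<delta>) = k * k"
    unfolding k_def exp_add[symmetric] by (simp add: algebra_simps)
  have e2: "exp (- \<sigma> * y) * exp (- \<sigma> * y) = exp (- 2 * \<sigma> * y)" for y
    by (simp flip: exp_add)
  have m: "integrable P (\<lambda>\<omega>. (c0 + c1 * b \<omega> + c2 * (b \<omega>)\<^sup>2) * exp (a * b \<omega>))"
     "expectation (\<lambda>\<omega>. (c0 + c1 * b \<omega> + c2 * (b \<omega>)\<^sup>2) * exp (a * b \<omega>)) =
      (c0 + c1 * a * \<delta> + c2 * (\<delta> + a\<^sup>2 * \<delta>\<^sup>2)) * exp (a\<^sup>2 * \<delta> / 2)" for a c0 c1 c2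
    unfolding b_def \<delta>_def by (rule increment_exponential_moments[OF assms(1,2)])+
  note m1 = m[of "1 + \<mu> * \<delta>" \<sigma> 0 "- \<sigma>"]
  note m2 = m[of "(1 + \<mu> * \<delta>)\<^sup>2" "2 * (1 + \<mu> * \<delta>) * \<sigma>" "\<sigma>\<^sup>2" "- 2 * \<sigma>"]
  note m3 = m[of 1 0 0 "- 2 * \<sigma>"] m[of 1 0 0 "- \<sigma>"]
  have x1: "step_error \<mu> \<sigma> \<delta> y = k * ((1 + \<mu> * \<delta> + \<sigma> * y + 0 * y\<^sup>2) * exp (- \<sigma> * y)) - 1" for y
    by (simp add: step_error_def inverse_step_def k_def)
  have x2: "(step_error \<mu> \<sigma> \<delta> y)\<^sup>2 =
     k * k * (((1 + \<mu> * \<delta>)\<^sup>2 + 2 * (1 + \<mu> * \<delta>) * \<sigma> * y + \<sigma>\<^sup>2 * y\<^sup>2) * exp (- 2 * \<sigma> * y))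
     - 2 * step_error \<mu> \<sigma> \<delta> y - 1" for y
    unfolding e2[symmetric] x1 by (simp add: power2_eq_square algebra_simps)
  have x3: "(inverse_step \<mu> \<sigma> \<delta> y - 1)\<^sup>2 =
     k * k * ((1 + 0 * y + 0 * y\<^sup>2) * exp (- 2 * \<sigma> * y)) - 2 * (k * ((1 + 0 * y + 0 * y\<^sup>2) * exp (- \<sigma> * y))) + 1" for y
    unfolding e2[symmetric] inverse_step_def k_def by (simp add: power2_eq_square algebra_simps)
  show i1: "integrable P (\<lambda>\<omega>. step_error \<mu> \<sigma> (t - s) (b \<omega>))"
    unfolding \<delta>_def[symmetric] x1 using m1(1) by simp
  show e1: "expectation (\<lambda>\<omega>. step_error \<mu> \<sigma> (t - s) (b \<omega>)) = mean_step_error \<mu> \<sigma> (t - s)"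
  proof -
    let ?f = "\<lambda>\<omega>. (1 + \<mu> * \<delta> + \<sigma> * b \<omega> + 0 * (b \<omega>)\<^sup>2) * exp (- \<sigma> * b \<omega>)"
    have "expectation (\<lambda>\<omega>. step_error \<mu> \<sigma> \<delta> (b \<omega>)) = k * expectation ?f - 1"
      unfolding x1 using m1(1) by (subst Bochner_Integration.integral_diff) (auto simp: prob_space)
    also have "expectation ?f = (1 + \<mu> * \<delta> - \<sigma>\<^sup>2 * \<delta>) * exp (\<sigma>\<^sup>2 * \<delta> / 2)"
      unfolding m1(2) by (simp add: power2_eq_square)
    finally show ?thesis unfolding \<delta>_def[symmetric] mean_step_error_def k_def .
  qed
  show "integrable P (\<lambda>\<omega>. (step_error \<mu> \<sigma> (t - s) (b \<omega>))\<^sup>2)"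
    using i1 m2(1) unfolding \<delta>_def[symmetric] x2 by simp
  have "expectation (\<lambda>\<omega>. (step_error \<mu> \<sigma> \<delta> (b \<omega>))\<^sup>2) =
     k * k * ((((1 + \<mu> * \<delta>)\<^sup>2 + 2 * (1 + \<mu> * \<delta>) * \<sigma> * (- 2 * \<sigma>) * \<delta> + \<sigma>\<^sup>2 * (\<delta> + (- 2 * \<sigma>)\<^sup>2 * \<delta>\<^sup>2))) * exp ((- 2 * \<sigma>)\<^sup>2 * \<delta> / 2))
     - 2 * mean_step_error \<mu> \<sigma> \<delta> - 1"
    unfolding x2 using i1 e1 m2 unfolding \<delta>_def[symmetric] by (simp add: prob_space)
  also have "(- 2 * \<sigma>)\<^sup>2 * \<delta> / 2 = 2 * \<sigma>\<^sup>2 * \<delta>" by (simp add: power2_eq_square)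
  also have "(1 + \<mu> * \<delta>)\<^sup>2 + 2 * (1 + \<mu> * \<delta>) * \<sigma> * (- 2 * \<sigma>) * \<delta> + \<sigma>\<^sup>2 * (\<delta> + (- 2 * \<sigma>)\<^sup>2 * \<delta>\<^sup>2)
      = (1 + \<mu> * \<delta>)\<^sup>2 - 4 * (1 + \<mu> * \<delta>) * \<sigma>\<^sup>2 * \<delta> + \<sigma>\<^sup>2 * (\<delta> + 4 * \<sigma>\<^sup>2 * \<delta>\<^sup>2)"
    by (simp add: power2_eq_square)
  finally show "expectation (\<lambda>\<omega>. (step_error \<mu> \<sigma> (t - s) (b \<omega>))\<^sup>2) = mean_square_step_error \<mu> \<sigma> (t - s)"
    unfolding \<delta>_def[symmetric] mean_square_step_error_def k2 .
  show "integrable P (\<lambda>\<omega>. (inverse_step \<mu> \<sigma> (t - s) (b \<omega>) - 1)\<^sup>2)"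
    unfolding \<delta>_def[symmetric] x3 using m3(1,3) by simp
  have "expectation (\<lambda>\<omega>. (inverse_step \<mu> \<sigma> \<delta> (b \<omega>) - 1)\<^sup>2) =
      k * k * exp ((- 2 * \<sigma>)\<^sup>2 * \<delta> / 2) - 2 * (k * exp ((- \<sigma>)\<^sup>2 * \<delta> / 2)) + 1"
    unfolding x3 using m3 by (simp add: prob_space)
  also have "(- 2 * \<sigma>)\<^sup>2 * \<delta> / 2 = 2 * \<sigma>\<^sup>2 * \<delta>" by (simp add: power2_eq_square)
  finally show "expectation (\<lambda>\<omega>. (inverse_step \<mu> \<sigma> (t - s) (b \<omega>) - 1)\<^sup>2) = mean_square_step \<mu> \<sigma> (t - s)"
    unfolding \<delta>_def[symmetric] mean_square_step_def k2 k_def by simp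
qed

lemma scaled_mean_step_errors_tendsto:
  assumes "T > 0"
  shows "(\<lambda>n. real n * mean_step_error \<mu> \<sigma> (T / real n)) \<longlonglongrightarrow> 0"
    "(\<lambda>n. real n * mean_square_step_error \<mu> \<sigma> (T / real n)) \<longlonglongrightarrow> 0"
    "(\<lambda>n. real n * mean_square_step \<mu> \<sigma> (T / real n)) \<longlonglongrightarrow> T * \<sigma>\<^sup>2"
proof -
  have 1: "(mean_step_error \<mu> \<sigma> has_real_derivative 0) (at 0)"
    unfolding mean_step_error_def[abs_def]
    by (auto intro!: derivative_eq_intros simp: field_simps)
  then have 2: "(mean_square_step_error \<mu> \<sigma> has_real_derivative 0) (at 0)"
    unfolding mean_square_step_error_def[abs_def]
    by (auto intro!: derivative_eq_intros simp: field_simps)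
  have 3: "(mean_square_step \<mu> \<sigma> has_real_derivative \<sigma>\<^sup>2) (at 0)"
    unfolding mean_square_step_def[abs_def]
    by (auto intro!: derivative_eq_intros simp: field_simps)
  show "(\<lambda>n. real n * mean_step_error \<mu> \<sigma> (T / real n)) \<longlonglongrightarrow> 0"
    using scaled_increment_tendsto[OF 1 _ assms] by (simp add: mean_step_error_def)
  show "(\<lambda>n. real n * mean_square_step_error \<mu> \<sigma> (T / real n)) \<longlonglongrightarrow> 0"
    using scaled_increment_tendsto[OF 2 _ assms] by (simp add: mean_square_step_error_def mean_step_error_def)
  show "(\<lambda>n. real n * mean_square_step \<mu> \<sigma> (T / real n)) \<longlonglongrightarrow> T * \<sigma>\<^sup>2"
    using scaled_increment_tendsto[OF 3 _ assms] by (simp add: mean_square_step_def)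
qed

lemma martingale_sum_second_moment:
  fixes U :: "nat \<Rightarrow> 'a \<Rightarrow> real"
  assumes "0 \<le> s" "0 < \<delta>"
    and U: "\<And>k. k < n \<Longrightarrow> U k \<in> borel_measurable (\<F>r (s + \<delta> * real k))"
      "\<And>k \<omega>. k < n \<Longrightarrow> \<omega> \<in> space P \<Longrightarrow> \<bar>U k \<omega>\<bar> \<le> C"
      "\<And>k. k < n \<Longrightarrow> expectation (\<lambda>\<omega>. (U k \<omega>)\<^sup>2) \<le> c"
  defines "S \<equiv> \<lambda>\<omega>. \<Sum>k<n. U k \<omega> * (B (s + \<delta> * real (Suc k)) \<omega> - B (s + \<delta> * real k) \<omega>)"
  shows "S \<in> borel_measurable P" "integrable P (\<lambda>\<omega>. (S \<omega>)\<^sup>2)"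
    "expectation (\<lambda>\<omega>. (S \<omega>)\<^sup>2) \<le> real n * \<delta> * c"
proof -
  let ?t = "\<lambda>k. s + \<delta> * real k"
  have t: "0 \<le> ?t 0" "\<And>k. ?t k < ?t (Suc k)" "\<And>k. 0 \<le> ?t k" using assms(1,2) by auto
  have d: "?t (Suc k) - ?t k = \<delta>" for k by (simp add: algebra_simps)
  note m = increment_exponential_moments[OF t(3,2), where ?c0.0=0 and ?c1.0=1 and ?c2.0=0 and a=0]
    increment_exponential_moments[OF t(3,2), where ?c0.0=0 and ?c1.0=0 and ?c2.0=1 and a=0]
  have g1: "expectation (\<lambda>\<omega>. B (?t (Suc k)) \<omega> - B (?t k) \<omega>) = 0" for k
    using m(2)[of k] by simp
  have g2: "integrable P (\<lambda>\<omega>. (B (?t (Suc k)) \<omega> - B (?t k) \<omega>)\<^sup>2)"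
      "expectation (\<lambda>\<omega>. (B (?t (Suc k)) \<omega> - B (?t k) \<omega>)\<^sup>2) = \<delta>" for k
    using m(3,4)[of k] by (simp_all add: algebra_simps)
  have id: "(\<lambda>x::real. x) \<in> borel_measurable borel" by simp
  note o = orthogonal_increments[where t="?t" and g="\<lambda>_ x. x" and n=n and U=U and C=C, OF t(1,2) U(1,2) id g1 g2(1)]
  show "S \<in> borel_measurable P" "integrable P (\<lambda>\<omega>. (S \<omega>)\<^sup>2)"
    using o(1,2) unfolding S_def by auto
  have "expectation (\<lambda>\<omega>. (S \<omega>)\<^sup>2) = (\<Sum>k<n. expectation (\<lambda>\<omega>. (U k \<omega>)\<^sup>2) * \<delta>)"
    using o(3) unfolding S_def g2(2) by simp
  also have "\<dots> \<le> (\<Sum>k<n. c * \<delta>)"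
    using U(3) assms(2) by (intro sum_mono mult_right_mono) auto
  finally show "expectation (\<lambda>\<omega>. (S \<omega>)\<^sup>2) \<le> real n * \<delta> * c" by (simp add: mult.commute mult.left_commute)
qed

end

locale gbm_sde = brownian_filtration P \<F> B
  for P :: "'a measure" and \<F> :: "ennreal \<Rightarrow> 'a measure" and B :: "real \<Rightarrow> 'a \<Rightarrow> real" +
  fixes \<mu> \<sigma> x :: real and X :: "real \<Rightarrow> 'a \<Rightarrow> real"
  assumes sde: "solves_gbm_sde P \<F> B \<mu> \<sigma> x X"
begin

lemma measurable_X: "0 \<le> s \<Longrightarrow> s \<le> t \<Longrightarrow> X s \<in> borel_measurable (\<F>r t)"
  using sde measurable_filtrationr_mono unfolding solves_gbm_sde_def by blast

lemma measurable_X_P [measurable (raw)]: "0 \<le> t \<Longrightarrow> X t \<in> borel_measurable P"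
  using measurable_X[of t t] measurable_from_filtration by auto

lemma continuous_X: "\<omega> \<in> space P \<Longrightarrow> continuous_on {0..} (\<lambda>t. X t \<omega>)"
  using sde unfolding solves_gbm_sde_def by blast

definition Z :: "real \<Rightarrow> 'a \<Rightarrow> real"
  where "Z t \<omega> = exp (- \<sigma> * B t \<omega> - (\<mu> - \<sigma>\<^sup>2 / 2) * t)"

lemma Z_pos: "Z t \<omega> > 0" by (simp add: Z_def)

lemma Z_step: "Z t \<omega> = Z s \<omega> * inverse_step \<mu> \<sigma> (t - s) (B t \<omega> - B s \<omega>)"
  unfolding Z_def inverse_step_def exp_add[symmetric] by (simp add: algebra_simps diff_divide_distrib)

lemma measurable_Z: "0 \<le> s \<Longrightarrow> s \<le> t \<Longrightarrow> Z s \<in> borel_measurable (\<F>r t)"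
  unfolding Z_def using measurable_B[of s t] by simp

text \<open>
  Clipping at \<open>K\<close> makes all weights bounded and hence square integrable.  It has no effect on the
  event \<open>bounded_paths\<close> below, and almost every path belongs to this event for large \<open>K\<close>.
\<close>

definition clipX :: "real \<Rightarrow> real \<Rightarrow> 'a \<Rightarrow> real"
  where "clipX K t \<omega> = max (- K) (min K (X t \<omega>))"

definition clipZ :: "real \<Rightarrow> real \<Rightarrow> 'a \<Rightarrow> real"
  where "clipZ K t \<omega> = min K (Z t \<omega>)"

lemma measurable_clip:
  assumes "0 \<le> s" "s \<le> t"
  shows "clipX K s \<in> borel_measurable (\<F>r t)" "clipZ K s \<in> borel_measurable (\<F>r t)"
  unfolding clipX_def clipZ_def using measurable_X[OF assms] measurable_Z[OF assms] by auto

lemma clip_bounds: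
  "K \<ge> 0 \<Longrightarrow> \<bar>clipX K t \<omega>\<bar> \<le> K" "K \<ge> 0 \<Longrightarrow> 0 \<le> clipZ K t \<omega>" "clipZ K t \<omega> \<le> K"
  using Z_pos[of t \<omega>] by (auto simp: clipX_def clipZ_def)

lemma clipX_diff_le: "K \<ge> 0 \<Longrightarrow> \<bar>clipX K s \<omega> - clipX K t \<omega>\<bar> \<le> 2 * K"
  using clip_bounds(1)[of K s \<omega>] clip_bounds(1)[of K t \<omega>] by linarith

text \<open>
  The modulus of continuity \<open>osc\<close> of the clipped path on \<open>[0,T]\<close> is taken over countably many pairs,
  for measurability.
\<close>

definition rat_pairs :: "nat \<Rightarrow> (real \<times> real) set"
  where "rat_pairs n = {(a, b). a \<in> \<rat> \<inter> {0..1} \<and> b \<in> \<rat> \<inter> {0..1} \<and> \<bar>a - b\<bar> \<le> 1 / real n}"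

definition osc :: "real \<Rightarrow> real \<Rightarrow> nat \<Rightarrow> 'a \<Rightarrow> real"
  where "osc K T n \<omega> = (SUP p\<in>rat_pairs n. \<bar>clipX K (T * fst p) \<omega> - clipX K (T * snd p) \<omega>\<bar>)"

lemma rat_pairs: "countable (rat_pairs n)" "(0, 0) \<in> rat_pairs n"
proof -
  show "countable (rat_pairs n)"
    by (rule countable_subset[of _ "\<rat> \<times> \<rat>"]) (auto simp: rat_pairs_def countable_rat)
qed (simp add: rat_pairs_def)

lemma osc_bdd: "K \<ge> 0 \<Longrightarrow> bdd_above ((\<lambda>p. \<bar>clipX K (T * fst p) \<omega> - clipX K (T * snd p) \<omega>\<bar>) ` rat_pairs n)"
  by (rule bdd_aboveI2[of _ _ "2 * K"]) (rule clipX_diff_le)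

lemma osc_upper: "K \<ge> 0 \<Longrightarrow> (a, b) \<in> rat_pairs n \<Longrightarrow> \<bar>clipX K (T * a) \<omega> - clipX K (T * b) \<omega>\<bar> \<le> osc K T n \<omega>"
  unfolding osc_def by (rule cSUP_upper2[OF osc_bdd, of K "(a, b)"]) auto

lemma osc_least: "(\<And>a b. (a, b) \<in> rat_pairs n \<Longrightarrow> \<bar>clipX K (T * a) \<omega> - clipX K (T * b) \<omega>\<bar> \<le> c) \<Longrightarrow> osc K T n \<omega> \<le> c"
  unfolding osc_def using rat_pairs(2)[of n] by (intro cSUP_least) auto

lemma osc_nonneg: "K \<ge> 0 \<Longrightarrow> 0 \<le> osc K T n \<omega>"
  using osc_upper[OF _ rat_pairs(2)] by fastforce

lemma osc_le: "K \<ge> 0 \<Longrightarrow> osc K T n \<omega> \<le> 2 * K"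
  by (rule osc_least) (rule clipX_diff_le)

lemma measurable_osc: "K \<ge> 0 \<Longrightarrow> T \<ge> 0 \<Longrightarrow> osc K T n \<in> borel_measurable P"
  unfolding osc_def
proof (rule borel_measurable_cSUP[OF rat_pairs(1)])
  show "K \<ge> 0 \<Longrightarrow> bdd_above ((\<lambda>p. \<bar>clipX K (T * fst p) \<omega> - clipX K (T * snd p) \<omega>\<bar>) ` rat_pairs n)" for \<omega>
    by (rule osc_bdd)
  fix p assume "T \<ge> 0" "p \<in> rat_pairs n"
  then have "0 \<le> T * fst p" "0 \<le> T * snd p" by (auto simp: rat_pairs_def)
  then have "clipX K (T * fst p) \<in> borel_measurable P" "clipX K (T * snd p) \<in> borel_measurable P"
    using measurable_clip(1) measurable_from_filtration by blast+
  then show "(\<lambda>\<omega>. \<bar>clipX K (T * fst p) \<omega> - clipX K (T * snd p) \<omega>\<bar>) \<in> borel_measurable P"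
    by measurable
qed

lemma osc_tendsto:
  assumes K: "K \<ge> 0" and T: "T > 0" and \<omega>: "\<omega> \<in> space P"
  shows "(\<lambda>n. osc K T n \<omega>) \<longlonglongrightarrow> 0"
proof (rule LIMSEQ_I)
  fix e :: real assume e: "e > 0"
  have "continuous_on {0..T} (\<lambda>t. clipX K t \<omega>)"
    unfolding clipX_def using continuous_on_subset[OF continuous_X[OF \<omega>]]
    by (intro continuous_intros) auto
  then have "uniformly_continuous_on {0..T} (\<lambda>t. clipX K t \<omega>)"
    by (intro compact_uniformly_continuous) auto
  from this[unfolded uniformly_continuous_on_def, rule_format, OF half_gt_zero[OF e]]
  obtain d where d: "d > 0"
    "\<And>s t. s \<in> {0..T} \<Longrightarrow> t \<in> {0..T} \<Longrightarrow> dist t s < d \<Longrightarrow> dist (clipX K t \<omega>) (clipX K s \<omega>) < e / 2"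
    by blast
  obtain n0 :: nat where n0: "T / d < real n0" using reals_Archimedean2 by blast
  show "\<exists>no. \<forall>n\<ge>no. norm (osc K T n \<omega> - 0) < e"
  proof (intro exI[of _ "Suc n0"] allI impI)
    fix n assume n: "Suc n0 \<le> n"
    then have npos: "n > 0" and "T / d < real n" using n0 by auto
    then have mesh: "T / real n < d" using d T by (simp add: field_simps)
    have "osc K T n \<omega> \<le> e / 2"
    proof (rule osc_least)
      fix a b assume ab: "(a, b) \<in> rat_pairs n"
      then have "T * \<bar>a - b\<bar> \<le> T * (1 / real n)" using T by (intro mult_left_mono) (auto simp: rat_pairs_def)
      moreover have "dist (T * a) (T * b) = T * \<bar>a - b\<bar>"
        using T by (simp add: dist_real_def abs_mult flip: right_diff_distrib)
      ultimately have "dist (T * a) (T * b) < d" using mesh by simp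
      moreover have "T * a \<in> {0..T}" "T * b \<in> {0..T}"
        using ab T by (auto simp: rat_pairs_def mult_le_cancel_left1)
      ultimately show "\<bar>clipX K (T * a) \<omega> - clipX K (T * b) \<omega>\<bar> \<le> e / 2"
        using d(2) by (force simp: dist_real_def)
    qed
    then show "norm (osc K T n \<omega> - 0) < e" using e osc_nonneg[OF K, of T n \<omega>] by simp
  qed
qed

lemma osc_square:
  assumes K: "K \<ge> 0" and T: "T > 0"
  shows "integrable P (\<lambda>\<omega>. (osc K T n \<omega>)\<^sup>2)" "(\<lambda>n. expectation (\<lambda>\<omega>. (osc K T n \<omega>)\<^sup>2)) \<longlonglongrightarrow> 0"
proof -
  have m: "osc K T n \<in> borel_measurable P" for n using K T by (intro measurable_osc) auto
  have b: "norm ((osc K T n \<omega>)\<^sup>2) \<le> (2 * K)\<^sup>2" for n \<omega>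
    using power_mono[OF osc_le[OF K] osc_nonneg[OF K], of T n \<omega> 2] by simp
  show "integrable P (\<lambda>\<omega>. (osc K T n \<omega>)\<^sup>2)"
    using m b by (intro integrable_const_bound[of _ "(2 * K)\<^sup>2"]) auto
  have "(\<lambda>n. expectation (\<lambda>\<omega>. (osc K T n \<omega>)\<^sup>2)) \<longlonglongrightarrow> expectation (\<lambda>\<omega>. 0)"
  proof (rule integral_dominated_convergence[where w="\<lambda>_. (2 * K)\<^sup>2"])
    show "AE \<omega> in P. (\<lambda>n. (osc K T n \<omega>)\<^sup>2) \<longlonglongrightarrow> 0"
      using tendsto_power[OF osc_tendsto[OF K T], of _ 2] by (intro AE_I2) auto
  qed (use m b in auto)
  then show "(\<lambda>n. expectation (\<lambda>\<omega>. (osc K T n \<omega>)\<^sup>2)) \<longlonglongrightarrow> 0" by simp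
qed

definition grid :: "real \<Rightarrow> nat \<Rightarrow> nat \<Rightarrow> real"
  where "grid T n k = T * real k / real n"

lemma grid_refine: "q > 0 \<Longrightarrow> grid T (n * q) (k * q) = grid T n k"
  by (simp add: grid_def)

lemma grid_Suc: "n > 0 \<Longrightarrow> grid T n (Suc k) - grid T n k = T / real n"
  by (simp add: grid_def field_simps)

lemma grid_nonneg: "T \<ge> 0 \<Longrightarrow> 0 \<le> grid T n k"
  by (simp add: grid_def)

lemma grid_mono: "T \<ge> 0 \<Longrightarrow> i \<le> j \<Longrightarrow> grid T n i \<le> grid T n j"
  by (simp add: grid_def divide_right_mono mult_left_mono)

lemma clip_osc:
  assumes "n > 0" "q > 0" "T > 0" "K \<ge> 0" "k < n" "j < q"
  shows "\<bar>clipX K (grid T (n * q) (k * q + j)) \<omega> - clipX K (grid T n k) \<omega>\<bar> \<le> osc K T n \<omega>"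
proof -
  let ?a = "real (k * q + j) / real (n * q)" and ?b = "real k / real n"
  have "k * q + j \<le> k * q + q" using assms by simp
  also have "\<dots> = Suc k * q" by simp
  also have "\<dots> \<le> n * q" using assms by (intro mult_right_mono) auto
  finally have "k * q + j \<le> n * q" .
  then have "real (k * q + j) \<le> real (n * q)" by (rule of_nat_mono)
  then have a: "?a \<in> {0..1}" using assms by (simp add: divide_le_eq_1)
  have "?a - ?b = real j / real (n * q)" using assms by (simp add: field_simps)
  also have "\<dots> \<le> real q / real (n * q)" using assms by (intro divide_right_mono) auto
  also have "\<dots> = 1 / real n" using assms by simp
  finally have ab: "?a - ?b \<le> 1 / real n" .
  have "?a - ?b \<ge> 0" using \<open>?a - ?b = real j / real (n * q)\<close> by simp
  with a ab have "(?a, ?b) \<in> rat_pairs n"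
    using assms unfolding rat_pairs_def by auto
  from osc_upper[OF assms(4) this, of T \<omega>] show ?thesis by (simp add: grid_def)
qed

text \<open>
  On the block \<open>k\<close> of the coarse grid, the gain of the fine Euler scheme over holding the position fixed at
  the start of the block.
\<close>

definition block_gain :: "real \<Rightarrow> real \<Rightarrow> nat \<Rightarrow> nat \<Rightarrow> nat \<Rightarrow> 'a \<Rightarrow> real"
  where "block_gain K T n q k \<omega> = (\<Sum>j<q. \<sigma> * (clipX K (grid T (n * q) (k * q + j)) \<omega> - clipX K (grid T n k) \<omega>)
    * (B (grid T (n * q) (Suc (k * q + j))) \<omega> - B (grid T (n * q) (k * q + j)) \<omega>))"

lemma weighted_clip_difference:
  assumes "n > 0" "q > 0" "T > 0" "K \<ge> 0" "k < n" "j < q"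
    and w: "w \<in> borel_measurable (\<F>r (grid T n k))" "\<And>\<omega>. \<omega> \<in> space P \<Longrightarrow> \<bar>w \<omega>\<bar> \<le> W"
  defines "U \<equiv> \<lambda>\<omega>. w \<omega> * (\<sigma> * (clipX K (grid T (n * q) (k * q + j)) \<omega> - clipX K (grid T n k) \<omega>))"
  shows "U \<in> borel_measurable (\<F>r (grid T (n * q) (k * q + j)))"
    "\<omega> \<in> space P \<Longrightarrow> \<bar>U \<omega>\<bar> \<le> W * (\<bar>\<sigma>\<bar> * (2 * K))"
    "expectation (\<lambda>\<omega>. (U \<omega>)\<^sup>2) \<le> W\<^sup>2 * \<sigma>\<^sup>2 * expectation (\<lambda>\<omega>. (osc K T n \<omega>)\<^sup>2)"
proof -
  let ?s = "grid T n k" and ?t = "grid T (n * q) (k * q + j)"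
  have s: "0 \<le> ?s" using assms by (intro grid_nonneg) auto
  have st: "?s \<le> ?t" using grid_mono[of T "k * q" "k * q + j" "n * q"] assms by (simp add: grid_refine)
  show m: "U \<in> borel_measurable (\<F>r ?t)"
    unfolding U_def using measurable_filtrationr_mono[OF w(1) st] measurable_clip(1)[OF s st]
      measurable_clip(1)[of ?t ?t] s st
    by (intro borel_measurable_times borel_measurable_diff borel_measurable_const) auto
  show "\<bar>U \<omega>\<bar> \<le> W * (\<bar>\<sigma>\<bar> * (2 * K))" if "\<omega> \<in> space P" for \<omega>
    unfolding U_def abs_mult
    using w(2)[OF that] clipX_diff_le[OF assms(4)] abs_ge_zero[of "w \<omega>"] assms(4)
    by (intro mult_mono mult_left_mono) auto
  have sq: "(U \<omega>)\<^sup>2 \<le> W\<^sup>2 * \<sigma>\<^sup>2 * (osc K T n \<omega>)\<^sup>2" if "\<omega> \<in> space P" for \<omega>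
  proof -
    have "\<bar>U \<omega>\<bar> \<le> W * (\<bar>\<sigma>\<bar> * osc K T n \<omega>)"
      unfolding U_def abs_mult
      using w(2)[OF that] clip_osc[OF assms(1-6)] abs_ge_zero[of "w \<omega>"]
      by (intro mult_mono mult_left_mono) (auto intro!: mult_nonneg_nonneg osc_nonneg[OF assms(4)])
    from power_mono[OF this, of 2] show ?thesis by (simp add: power_mult_distrib mult.assoc)
  qed
  have "expectation (\<lambda>\<omega>. (U \<omega>)\<^sup>2) \<le> expectation (\<lambda>\<omega>. W\<^sup>2 * \<sigma>\<^sup>2 * (osc K T n \<omega>)\<^sup>2)"
    using osc_square(1)[OF assms(4,3)] sq by (intro integral_mono') auto
  then show "expectation (\<lambda>\<omega>. (U \<omega>)\<^sup>2) \<le> W\<^sup>2 * \<sigma>\<^sup>2 * expectation (\<lambda>\<omega>. (osc K T n \<omega>)\<^sup>2)" by simp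
qed

text \<open>
  The bound does not involve \<open>q\<close>: the coefficients are dominated by the oscillation on the coarse
  scale, and the mean squares of the increments add up to the length of the block.
\<close>

lemma block_gain_square:
  assumes "n > 0" "q > 0" "T > 0" "K \<ge> 0" "k < n"
  shows "block_gain K T n q k \<in> borel_measurable P" "integrable P (\<lambda>\<omega>. (block_gain K T n q k \<omega>)\<^sup>2)"
    "expectation (\<lambda>\<omega>. (block_gain K T n q k \<omega>)\<^sup>2) \<le> T / real n * \<sigma>\<^sup>2 * expectation (\<lambda>\<omega>. (osc K T n \<omega>)\<^sup>2)"
proof -
  let ?d = "T / real (n * q)"
  let ?U = "\<lambda>j \<omega>. 1 * (\<sigma> * (clipX K (grid T (n * q) (k * q + j)) \<omega> - clipX K (grid T n k) \<omega>))"
  have d: "0 \<le> grid T n k" "?d > 0" using assms by (auto simp: grid_def)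
  have g: "grid T (n * q) (k * q + j) = grid T n k + ?d * real j" for j
    using assms by (simp add: grid_def field_simps)
  have g': "grid T (n * q) (Suc (k * q + j)) = grid T n k + ?d * real (Suc j)" for j
    using g[of "Suc j"] by simp
  note w = weighted_clip_difference[OF assms, where w="\<lambda>_. 1" and W=1]
  note m = martingale_sum_second_moment[OF d, of q ?U "1 * (\<bar>\<sigma>\<bar> * (2 * K))" "1\<^sup>2 * \<sigma>\<^sup>2 * expectation (\<lambda>\<omega>. (osc K T n \<omega>)\<^sup>2)"]
  have e: "block_gain K T n q k = (\<lambda>\<omega>. \<Sum>j<q. ?U j \<omega> * (B (grid T n k + ?d * real (Suc j)) \<omega> - B (grid T n k + ?d * real j) \<omega>))"
    unfolding block_gain_def g' unfolding g by simp
  have "real q * ?d = T / real n" using assms by simp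
  then show "block_gain K T n q k \<in> borel_measurable P" "integrable P (\<lambda>\<omega>. (block_gain K T n q k \<omega>)\<^sup>2)"
    "expectation (\<lambda>\<omega>. (block_gain K T n q k \<omega>)\<^sup>2) \<le> T / real n * \<sigma>\<^sup>2 * expectation (\<lambda>\<omega>. (osc K T n \<omega>)\<^sup>2)"
    unfolding e using m w unfolding g by auto
qed

text \<open>
  The weights are known at the start of their block, so that the whole sum is again orthogonal on the
  fine grid.  Estimating the \<open>n\<close> blocks one by one would lose a factor \<open>sqrt n\<close>.
\<close>

lemma weighted_block_gains:
  assumes "n > 0" "q > 0" "T > 0" "K \<ge> 0"
  defines "S \<equiv> \<lambda>\<omega>. \<Sum>k<n. clipZ K (grid T n k) \<omega> * block_gain K T n q k \<omega>"
  shows "integrable P S"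
    "expectation (\<lambda>\<omega>. \<bar>S \<omega>\<bar>) \<le> sqrt (T * (K\<^sup>2 * \<sigma>\<^sup>2 * expectation (\<lambda>\<omega>. (osc K T n \<omega>)\<^sup>2)))"
proof -
  let ?d = "T / real (n * q)"
  define U where "U l \<omega> = clipZ K (grid T n (l div q)) \<omega> *
    (\<sigma> * (clipX K (grid T (n * q) l) \<omega> - clipX K (grid T n (l div q)) \<omega>))" for l \<omega>
  have d: "0 \<le> (0::real)" "?d > 0" using assms by (auto simp: grid_def)
  have g: "grid T (n * q) l = 0 + ?d * real l" for l
    by (simp add: grid_def)
  have w: "U l \<in> borel_measurable (\<F>r (0 + ?d * real l))"
      "\<And>\<omega>. \<omega> \<in> space P \<Longrightarrow> \<bar>U l \<omega>\<bar> \<le> K * (\<bar>\<sigma>\<bar> * (2 * K))"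
      "expectation (\<lambda>\<omega>. (U l \<omega>)\<^sup>2) \<le> K\<^sup>2 * \<sigma>\<^sup>2 * expectation (\<lambda>\<omega>. (osc K T n \<omega>)\<^sup>2)" if "l < n * q" for l
  proof -
    have k: "l div q < n" "l mod q < q" using that assms by (auto simp: less_mult_imp_div_less)
    have "clipZ K (grid T n (l div q)) \<in> borel_measurable (\<F>r (grid T n (l div q)))"
      using assms by (intro measurable_clip(2) grid_nonneg) auto
    moreover have "\<bar>clipZ K (grid T n (l div q)) \<omega>\<bar> \<le> K" for \<omega>
      using clip_bounds(2,3)[of K] assms by simp
    ultimately show "U l \<in> borel_measurable (\<F>r (0 + ?d * real l))"
      "\<And>\<omega>. \<omega> \<in> space P \<Longrightarrow> \<bar>U l \<omega>\<bar> \<le> K * (\<bar>\<sigma>\<bar> * (2 * K))"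
      "expectation (\<lambda>\<omega>. (U l \<omega>)\<^sup>2) \<le> K\<^sup>2 * \<sigma>\<^sup>2 * expectation (\<lambda>\<omega>. (osc K T n \<omega>)\<^sup>2)"
      using weighted_clip_difference[OF assms(1-4) k, where w="clipZ K (grid T n (l div q))" and W=K]
      unfolding g[symmetric] U_def by auto
  qed
  have S: "S = (\<lambda>\<omega>. \<Sum>l<n * q. U l \<omega> * (B (0 + ?d * real (Suc l)) \<omega> - B (0 + ?d * real l) \<omega>))"
  proof
    fix \<omega>
    have "S \<omega> = (\<Sum>k<n. \<Sum>l=k * q..<k * q + q. U l \<omega> * (B (grid T (n * q) (Suc l)) \<omega> - B (grid T (n * q) l) \<omega>))"
      unfolding S_def
    proof (rule sum.cong[OF refl])
      fix k assume "k \<in> {..<n}"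
      have "(k * q + j) div q = k" if "j < q" for j using that by simp
      then have "clipZ K (grid T n k) \<omega> * block_gain K T n q k \<omega> =
        (\<Sum>j<q. U (k * q + j) \<omega> * (B (grid T (n * q) (Suc (k * q + j))) \<omega> - B (grid T (n * q) (k * q + j)) \<omega>))"
        unfolding block_gain_def U_def sum_distrib_left by (intro sum.cong) (auto simp: mult.assoc)
      also have "\<dots> = (\<Sum>l=k * q..<k * q + q. U l \<omega> * (B (grid T (n * q) (Suc l)) \<omega> - B (grid T (n * q) l) \<omega>))"
        using sum.shift_bounds_nat_ivl[of "\<lambda>l. U l \<omega> * (B (grid T (n * q) (Suc l)) \<omega> - B (grid T (n * q) l) \<omega>)" 0 "k * q" q]
        by (simp add: atLeast0LessThan add.commute)
      finally show "clipZ K (grid T n k) \<omega> * block_gain K T n q k \<omega> =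
        (\<Sum>l=k * q..<k * q + q. U l \<omega> * (B (grid T (n * q) (Suc l)) \<omega> - B (grid T (n * q) l) \<omega>))" .
    qed
    also have "\<dots> = (\<Sum>l<n * q. U l \<omega> * (B (grid T (n * q) (Suc l)) \<omega> - B (grid T (n * q) l) \<omega>))"
      by (rule sum.nat_group)
    finally show "S \<omega> = (\<Sum>l<n * q. U l \<omega> * (B (0 + ?d * real (Suc l)) \<omega> - B (0 + ?d * real l) \<omega>))"
      unfolding g .
  qed
  have m: "S \<in> borel_measurable P" "integrable P (\<lambda>\<omega>. (S \<omega>)\<^sup>2)"
    "expectation (\<lambda>\<omega>. (S \<omega>)\<^sup>2) \<le> real (n * q) * ?d * (K\<^sup>2 * \<sigma>\<^sup>2 * expectation (\<lambda>\<omega>. (osc K T n \<omega>)\<^sup>2))"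
    unfolding S
    using martingale_sum_second_moment[OF d, of "n * q" U "K * (\<bar>\<sigma>\<bar> * (2 * K))" "K\<^sup>2 * \<sigma>\<^sup>2 * expectation (\<lambda>\<omega>. (osc K T n \<omega>)\<^sup>2)"] w
    by auto
  show "integrable P S"
    using expectation_abs_le_sqrt(1)[OF m(1,2)] .
  have "real (n * q) * ?d = T" using assms by simp
  then show "expectation (\<lambda>\<omega>. \<bar>S \<omega>\<bar>) \<le> sqrt (T * (K\<^sup>2 * \<sigma>\<^sup>2 * expectation (\<lambda>\<omega>. (osc K T n \<omega>)\<^sup>2)))"
    using order_trans[OF expectation_abs_le_sqrt(2)[OF m(1,2)] real_sqrt_le_mono[OF m(3)]] by simp
qed

text \<open>
  Both factors have second moments of order \<open>1 / n\<close>, that of the block gain with the mean square of the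
  oscillation as a small factor.  Young's inequality with the weight \<open>c\<close> passes this smallness on to
  the product.
\<close>

lemma block_covariation:
  assumes "n > 0" "q > 0" "T > 0" "K \<ge> 0" "c > 0"
  defines "\<rho> \<equiv> \<lambda>k \<omega>. inverse_step \<mu> \<sigma> (T / real n) (B (grid T n (Suc k)) \<omega> - B (grid T n k) \<omega>)"
  defines "S \<equiv> \<lambda>\<omega>. \<Sum>k<n. clipZ K (grid T n k) \<omega> * ((\<rho> k \<omega> - 1) * block_gain K T n q k \<omega>)"
  shows "integrable P S"
    "expectation (\<lambda>\<omega>. \<bar>S \<omega>\<bar>) \<le> K * (c * (real n * mean_square_step \<mu> \<sigma> (T / real n)) + T * \<sigma>\<^sup>2 * expectation (\<lambda>\<omega>. (osc K T n \<omega>)\<^sup>2) / c)"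
proof -
  let ?e = "expectation (\<lambda>\<omega>. (osc K T n \<omega>)\<^sup>2)"
  define R where "R k \<omega> = K * (c * (\<rho> k \<omega> - 1)\<^sup>2 + (block_gain K T n q k \<omega>)\<^sup>2 / c)" for k \<omega>
  have rho: "integrable P (\<lambda>\<omega>. (\<rho> k \<omega> - 1)\<^sup>2)"
      "expectation (\<lambda>\<omega>. (\<rho> k \<omega> - 1)\<^sup>2) = mean_square_step \<mu> \<sigma> (T / real n)" for k
  proof -
    have "grid T n k < grid T n (Suc k)" using grid_Suc[of n T k] assms
      by (metis diff_gt_0_iff_gt divide_pos_pos of_nat_0_less_iff)
    from step_moments(5,6)[OF grid_nonneg this, where \<mu>=\<mu> and \<sigma>=\<sigma>, unfolded grid_Suc[OF assms(1)]] assms(3)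
    show "integrable P (\<lambda>\<omega>. (\<rho> k \<omega> - 1)\<^sup>2)"
      "expectation (\<lambda>\<omega>. (\<rho> k \<omega> - 1)\<^sup>2) = mean_square_step \<mu> \<sigma> (T / real n)"
      unfolding \<rho>_def by auto
  qed
  have m: "\<rho> k \<in> borel_measurable P" for k
    unfolding \<rho>_def using assms grid_nonneg
    by (intro measurable_compose[OF _ measurable_step(1)] borel_measurable_diff measurable_B_P) auto
  have mZ: "clipZ K (grid T n k) \<in> borel_measurable P" for k
    using assms grid_nonneg measurable_from_filtration[OF measurable_clip(2)] by (meson less_imp_le order_refl)
  have Ri: "integrable P (R k)" if "k < n" for k
    unfolding R_def using rho(1) block_gain_square(2)[OF assms(1-4) that] by simp
  have young: "\<bar>clipZ K (grid T n k) \<omega> * ((\<rho> k \<omega> - 1) * block_gain K T n q k \<omega>)\<bar> \<le> R k \<omega>" for k \<omega>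
  proof -
    define a d where "a = \<bar>\<rho> k \<omega> - 1\<bar>" and "d = \<bar>block_gain K T n q k \<omega>\<bar>"
    have "0 \<le> (c * a - d)\<^sup>2" by simp
    then have "2 * (c * (a * d)) \<le> c * (c * a\<^sup>2 + d\<^sup>2 / c)" using assms(5) by (simp add: power2_eq_square algebra_simps)
    moreover have "0 \<le> c * (a * d)" using assms(5) by (simp add: a_def d_def)
    ultimately have "c * (a * d) \<le> c * (c * a\<^sup>2 + d\<^sup>2 / c)" by linarith
    then have "a * d \<le> c * a\<^sup>2 + d\<^sup>2 / c" using assms(5) by simp
    moreover have "\<bar>clipZ K (grid T n k) \<omega>\<bar> \<le> K" using clip_bounds(2,3)[of K] assms(4) by simp
    ultimately show ?thesis
      unfolding R_def abs_mult a_def d_def power2_abs using assms(4)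
      by (intro mult_mono) auto
  qed
  have Ti: "integrable P (\<lambda>\<omega>. clipZ K (grid T n k) \<omega> * ((\<rho> k \<omega> - 1) * block_gain K T n q k \<omega>))" if "k < n" for k
    using young m mZ block_gain_square(1)[OF assms(1-4) that]
    by (intro Bochner_Integration.integrable_bound[OF Ri[OF that]])
       (auto intro!: AE_I2 order_trans[OF young abs_ge_self])
  show "integrable P S" unfolding S_def using Ti by auto
  then have "expectation (\<lambda>\<omega>. \<bar>S \<omega>\<bar>) \<le> expectation (\<lambda>\<omega>. \<Sum>k<n. R k \<omega>)"
    unfolding S_def using Ri Ti young
    by (intro integral_mono integrable_abs Bochner_Integration.integrable_sum order_trans[OF sum_abs] sum_mono) auto
  also have "\<dots> = (\<Sum>k<n. expectation (R k))" using Ri by (subst Bochner_Integration.integral_sum) auto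
  also have "\<dots> \<le> (\<Sum>k<n. K * (c * mean_square_step \<mu> \<sigma> (T / real n) + (T / real n * \<sigma>\<^sup>2 * ?e) / c))"
  proof (rule sum_mono)
    fix k assume "k \<in> {..<n}"
    then have k: "k < n" by simp
    have "expectation (R k) = K * (c * mean_square_step \<mu> \<sigma> (T / real n) + expectation (\<lambda>\<omega>. (block_gain K T n q k \<omega>)\<^sup>2) / c)"
      unfolding R_def using rho block_gain_square(2)[OF assms(1-4) k] by simp
    also have "\<dots> \<le> K * (c * mean_square_step \<mu> \<sigma> (T / real n) + (T / real n * \<sigma>\<^sup>2 * ?e) / c)"
      using block_gain_square(3)[OF assms(1-4) k] assms(4,5)
      by (intro mult_left_mono add_left_mono divide_right_mono) auto
    finally show "expectation (R k) \<le> K * (c * mean_square_step \<mu> \<sigma> (T / real n) + (T / real n * \<sigma>\<^sup>2 * ?e) / c)" .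
  qed
  also have "\<dots> = K * (c * (real n * mean_square_step \<mu> \<sigma> (T / real n)) + T * \<sigma>\<^sup>2 * ?e / c)"
    using assms(1) by (simp add: field_simps)
  finally show "expectation (\<lambda>\<omega>. \<bar>S \<omega>\<bar>) \<le> K * (c * (real n * mean_square_step \<mu> \<sigma> (T / real n)) + T * \<sigma>\<^sup>2 * ?e / c)" .
qed

text \<open>
  The centred errors of different steps are orthogonal, and the sum of their means is small.
\<close>

lemma euler_error:
  assumes "n > 0" "T > 0" "K \<ge> 0"
  defines "S \<equiv> \<lambda>\<omega>. \<Sum>k<n. clipZ K (grid T n k) \<omega> * clipX K (grid T n k) \<omega>
    * step_error \<mu> \<sigma> (T / real n) (B (grid T n (Suc k)) \<omega> - B (grid T n k) \<omega>)"
  shows "integrable P S"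
    "expectation (\<lambda>\<omega>. \<bar>S \<omega>\<bar>) \<le> sqrt ((K * K)\<^sup>2 * (real n * mean_square_step_error \<mu> \<sigma> (T / real n)))
      + K * K * \<bar>real n * mean_step_error \<mu> \<sigma> (T / real n)\<bar>"
proof -
  let ?\<delta> = "T / real n"
  define e where "e = mean_step_error \<mu> \<sigma> ?\<delta>"
  define g where "g b = step_error \<mu> \<sigma> ?\<delta> b - e" for b
  define U where "U k \<omega> = clipZ K (grid T n k) \<omega> * clipX K (grid T n k) \<omega>" for k \<omega>
  define S' where "S' \<omega> = (\<Sum>k<n. U k \<omega> * g (B (grid T n (Suc k)) \<omega> - B (grid T n k) \<omega>))" for \<omega>
  have t: "0 \<le> grid T n k" "grid T n k < grid T n (Suc k)" for k
    using grid_nonneg[of T n k] grid_Suc[of n T k] assms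
    by (auto simp: less_imp_le) (metis diff_gt_0_iff_gt divide_pos_pos of_nat_0_less_iff)
  note st = step_moments[OF t, where \<mu>=\<mu> and \<sigma>=\<sigma>, unfolded grid_Suc[OF assms(1)], folded e_def]
  have g1: "expectation (\<lambda>\<omega>. g (B (grid T n (Suc k)) \<omega> - B (grid T n k) \<omega>)) = 0" for k
    unfolding g_def using st(1,2) by (simp add: prob_space)
  have gsq: "(g b)\<^sup>2 = (step_error \<mu> \<sigma> ?\<delta> b)\<^sup>2 - 2 * e * step_error \<mu> \<sigma> ?\<delta> b + e\<^sup>2" for b
    by (simp add: g_def power2_eq_square algebra_simps)
  have g2: "integrable P (\<lambda>\<omega>. (g (B (grid T n (Suc k)) \<omega> - B (grid T n k) \<omega>))\<^sup>2)"
    "expectation (\<lambda>\<omega>. (g (B (grid T n (Suc k)) \<omega> - B (grid T n k) \<omega>))\<^sup>2) \<le> mean_square_step_error \<mu> \<sigma> ?\<delta>" for k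
  proof -
    show "integrable P (\<lambda>\<omega>. (g (B (grid T n (Suc k)) \<omega> - B (grid T n k) \<omega>))\<^sup>2)"
      unfolding gsq using st(1,3) by simp
    have "expectation (\<lambda>\<omega>. (g (B (grid T n (Suc k)) \<omega> - B (grid T n k) \<omega>))\<^sup>2) = mean_square_step_error \<mu> \<sigma> ?\<delta> - e\<^sup>2"
      unfolding gsq using st by (simp add: prob_space power2_eq_square)
    then show "expectation (\<lambda>\<omega>. (g (B (grid T n (Suc k)) \<omega> - B (grid T n k) \<omega>))\<^sup>2) \<le> mean_square_step_error \<mu> \<sigma> ?\<delta>"
      by simp
  qed
  have gm: "g \<in> borel_measurable borel" unfolding g_def by measurable
  have Um: "U k \<in> borel_measurable (\<F>r (grid T n k))" for k
    unfolding U_def using t by (intro borel_measurable_times measurable_clip) auto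
  have Ub: "\<bar>U k \<omega>\<bar> \<le> K * K" for k \<omega>
    unfolding U_def abs_mult using clip_bounds[of K] assms(3) by (intro mult_mono) auto
  have S': "S' \<in> borel_measurable P" "integrable P (\<lambda>\<omega>. (S' \<omega>)\<^sup>2)"
    "expectation (\<lambda>\<omega>. (S' \<omega>)\<^sup>2) = (\<Sum>k<n. expectation (\<lambda>\<omega>. (U k \<omega>)\<^sup>2) *
      expectation (\<lambda>\<omega>. (g (B (grid T n (Suc k)) \<omega> - B (grid T n k) \<omega>))\<^sup>2))"
    using orthogonal_increments[where t="grid T n" and U=U and g="\<lambda>_. g" and n=n and C="K * K", OF t(1,2) Um Ub gm g1 g2(1)]
    unfolding S'_def by auto
  have U2: "expectation (\<lambda>\<omega>. (U k \<omega>)\<^sup>2) \<le> (K * K)\<^sup>2" for k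
  proof -
    have b: "(U k \<omega>)\<^sup>2 \<le> (K * K)\<^sup>2" for \<omega>
      using power_mono[OF Ub abs_ge_zero, of k \<omega> 2] by simp
    have "expectation (\<lambda>\<omega>. (U k \<omega>)\<^sup>2) \<le> expectation (\<lambda>\<omega>. (K * K)\<^sup>2)"
      using b by (intro integral_mono') auto
    then show ?thesis by (simp add: prob_space)
  qed
  have "expectation (\<lambda>\<omega>. (S' \<omega>)\<^sup>2) \<le> (\<Sum>k<n. (K * K)\<^sup>2 * mean_square_step_error \<mu> \<sigma> ?\<delta>)"
    unfolding S'(3) using U2 g2(2) by (intro sum_mono mult_mono) auto
  also have "\<dots> = (K * K)\<^sup>2 * (real n * mean_square_step_error \<mu> \<sigma> ?\<delta>)" by simp
  finally have b1: "expectation (\<lambda>\<omega>. \<bar>S' \<omega>\<bar>) \<le> sqrt ((K * K)\<^sup>2 * (real n * mean_square_step_error \<mu> \<sigma> ?\<delta>))"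
    using expectation_abs_le_sqrt(2)[OF S'(1,2)] by (meson order_trans real_sqrt_le_mono)
  have S: "S \<omega> = S' \<omega> + e * (\<Sum>k<n. U k \<omega>)" for \<omega>
    unfolding S_def S'_def g_def U_def by (simp add: sum_distrib_left sum.distrib[symmetric] algebra_simps)
  have UP: "U k \<in> borel_measurable P" for k using Um measurable_from_filtration by blast
  have Ui: "integrable P (U k)" for k
    using UP Ub by (intro integrable_const_bound[of _ "K * K"]) auto
  have S'i: "integrable P S'" using expectation_abs_le_sqrt(1)[OF S'(1,2)] .
  show "integrable P S" unfolding S[abs_def] using S'i Ui by simp
  have "\<bar>S \<omega>\<bar> \<le> \<bar>S' \<omega>\<bar> + K * K * \<bar>real n * e\<bar>" for \<omega>
  proof -
    have "\<bar>\<Sum>k<n. U k \<omega>\<bar> \<le> (\<Sum>k<n. K * K)" using Ub by (intro order_trans[OF sum_abs] sum_mono)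
    then have "\<bar>e\<bar> * \<bar>\<Sum>k<n. U k \<omega>\<bar> \<le> \<bar>e\<bar> * (real n * (K * K))" by (intro mult_left_mono) auto
    moreover have "\<bar>S \<omega>\<bar> \<le> \<bar>S' \<omega>\<bar> + \<bar>e\<bar> * \<bar>\<Sum>k<n. U k \<omega>\<bar>"
      unfolding S by (metis abs_mult abs_triangle_ineq)
    ultimately show ?thesis by (simp add: abs_mult algebra_simps)
  qed
  then have "expectation (\<lambda>\<omega>. \<bar>S \<omega>\<bar>) \<le> expectation (\<lambda>\<omega>. \<bar>S' \<omega>\<bar> + K * K * \<bar>real n * e\<bar>)"
    using S'i \<open>integrable P S\<close> by (intro integral_mono) auto
  also have "\<dots> = expectation (\<lambda>\<omega>. \<bar>S' \<omega>\<bar>) + K * K * \<bar>real n * e\<bar>"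
    using S'i by (simp add: prob_space)
  finally show "expectation (\<lambda>\<omega>. \<bar>S \<omega>\<bar>) \<le> sqrt ((K * K)\<^sup>2 * (real n * mean_square_step_error \<mu> \<sigma> ?\<delta>))
      + K * K * \<bar>real n * mean_step_error \<mu> \<sigma> ?\<delta>\<bar>"
    using b1 unfolding e_def by simp
qed

text \<open>
  By continuity rational times are enough.  They are taken as fractions of \<open>T\<close>, so that they contain
  every grid point.
\<close>

definition bounded_paths :: "real \<Rightarrow> real \<Rightarrow> 'a set"
  where "bounded_paths K T = {\<omega> \<in> space P. \<forall>a\<in>\<rat> \<inter> {0..1}. \<bar>X (T * a) \<omega>\<bar> \<le> K \<and> Z (T * a) \<omega> \<le> K}"

lemma bounded_paths_events:
  assumes "T \<ge> 0" shows "bounded_paths K T \<in> events"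
proof -
  have "{\<omega> \<in> space P. \<bar>X (T * a) \<omega>\<bar> \<le> K \<and> Z (T * a) \<omega> \<le> K} \<in> events" if "a \<in> \<rat> \<inter> {0..1}" for a
  proof -
    have "0 \<le> T * a" using that assms by simp
    then have [measurable]: "X (T * a) \<in> borel_measurable P" "Z (T * a) \<in> borel_measurable P"
      using measurable_X measurable_Z measurable_from_filtration by blast+
    show ?thesis by measurable
  qed
  then have "{\<omega> \<in> space P. \<forall>a\<in>\<rat> \<inter> {0..1}. \<bar>X (T * a) \<omega>\<bar> \<le> K \<and> Z (T * a) \<omega> \<le> K} \<in> events"
    by (rule sets.sets_Collect_countable_All') (auto intro: countable_Int1 countable_rat)
  then show ?thesis unfolding bounded_paths_def .
qed

lemma bounded_paths_grid:
  assumes "\<omega> \<in> bounded_paths K T" "k \<le> n" "n > 0"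
  shows "clipX K (grid T n k) \<omega> = X (grid T n k) \<omega>" "clipZ K (grid T n k) \<omega> = Z (grid T n k) \<omega>"
    "Z (grid T n k) \<omega> \<le> K"
proof -
  have "real k / real n \<in> \<rat> \<inter> {0..1}" using assms by (simp add: divide_le_eq_1)
  then have "\<bar>X (T * (real k / real n)) \<omega>\<bar> \<le> K \<and> Z (T * (real k / real n)) \<omega> \<le> K"
    using assms(1) unfolding bounded_paths_def by blast
  then have "\<bar>X (grid T n k) \<omega>\<bar> \<le> K" "Z (grid T n k) \<omega> \<le> K"
    by (simp_all add: grid_def)
  then show "clipX K (grid T n k) \<omega> = X (grid T n k) \<omega>" "clipZ K (grid T n k) \<omega> = Z (grid T n k) \<omega>"
    "Z (grid T n k) \<omega> \<le> K"
    by (auto simp: clipX_def clipZ_def)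
qed

definition euler_sum :: "real \<Rightarrow> nat \<Rightarrow> nat \<Rightarrow> 'a \<Rightarrow> real"
  where "euler_sum T n j \<omega> = (\<Sum>l<j. \<sigma> * X (grid T n l) \<omega> * (B (grid T n (Suc l)) \<omega> - B (grid T n l) \<omega>))"

text \<open>
  Over one block, \<open>X\<close> is multiplied by the Euler factor and increases by the block gain, the drift
  error and the increment of the gap between the integral process and its Riemann sums.  Multiplied
  by the value of \<open>Z\<close> at the end of the block, the Euler part gives the first sum and the block gain the
  second and third, according to \<open>Z = Z\<^sub>k + Z\<^sub>k (\<rho> - 1)\<close> with \<open>\<rho>\<close> the growth factor of \<open>Z\<close>.
\<close>

lemma telescoped_product:
  fixes J :: "real \<Rightarrow> 'a \<Rightarrow> real"
  assumes \<omega>: "\<omega> \<in> bounded_paths K T" and nq: "n > 0" "q > 0" and T: "T > 0" and K: "K \<ge> 0"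
  defines "drift \<equiv> \<lambda>k. X (grid T n (Suc k)) \<omega> - X (grid T n k) \<omega> - (J (grid T n (Suc k)) \<omega> - J (grid T n k) \<omega>)
      - \<mu> * X (grid T n k) \<omega> * (T / real n)"
    and "gap \<equiv> \<lambda>k. J (grid T n k) \<omega> - euler_sum T (n * q) (k * q) \<omega>"
    and "\<Delta> \<equiv> \<lambda>k. B (grid T n (Suc k)) \<omega> - B (grid T n k) \<omega>"
  shows "\<bar>X T \<omega> * Z T \<omega> - X 0 \<omega> * Z 0 \<omega>\<bar> \<le>
    \<bar>\<Sum>k<n. clipZ K (grid T n k) \<omega> * clipX K (grid T n k) \<omega> * step_error \<mu> \<sigma> (T / real n) (\<Delta> k)\<bar>
    + \<bar>\<Sum>k<n. clipZ K (grid T n k) \<omega> * block_gain K T n q k \<omega>\<bar>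
    + \<bar>\<Sum>k<n. clipZ K (grid T n k) \<omega> * ((inverse_step \<mu> \<sigma> (T / real n) (\<Delta> k) - 1) * block_gain K T n q k \<omega>)\<bar>
    + K * (\<Sum>k<n. \<bar>drift k\<bar>) + K * (\<Sum>k<n. \<bar>gap (Suc k)\<bar> + \<bar>gap k\<bar>)"
proof -
  let ?t = "grid T n" and ?u = "grid T (n * q)"
  define s1 s2 s3 where "s1 k = clipZ K (?t k) \<omega> * clipX K (?t k) \<omega> * step_error \<mu> \<sigma> (T / real n) (\<Delta> k)"
    and "s2 k = clipZ K (?t k) \<omega> * block_gain K T n q k \<omega>"
    and "s3 k = clipZ K (?t k) \<omega> * ((inverse_step \<mu> \<sigma> (T / real n) (\<Delta> k) - 1) * block_gain K T n q k \<omega>)" for k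
  have step: "X (?t (Suc k)) \<omega> * Z (?t (Suc k)) \<omega> - X (?t k) \<omega> * Z (?t k) \<omega>
      = s1 k + s2 k + s3 k + (Z (?t (Suc k)) \<omega> * drift k + Z (?t (Suc k)) \<omega> * (gap (Suc k) - gap k))"
    if k: "k < n" for k
  proof -
    let ?\<rho> = "inverse_step \<mu> \<sigma> (T / real n) (\<Delta> k)"
    note b = bounded_paths_grid[OF \<omega> less_imp_le[OF k] nq(1)]
    have Z: "Z (?t (Suc k)) \<omega> = Z (?t k) \<omega> * ?\<rho>"
      using Z_step[of "?t (Suc k)" \<omega> "?t k"] unfolding grid_Suc[OF nq(1)] \<Delta>_def .
    have fine: "clipX K (?u (k * q + j)) \<omega> = X (?u (k * q + j)) \<omega>" if "j < q" for j
    proof -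
      have "k * q + j \<le> Suc k * q" using that by simp
      also have "\<dots> \<le> n * q" using k by (intro mult_right_mono) auto
      finally show ?thesis by (rule bounded_paths_grid(1)[OF \<omega>]) (use nq in auto)
    qed
    have tel: "(\<Sum>j<q. B (?u (Suc (k * q + j))) \<omega> - B (?u (k * q + j)) \<omega>) = \<Delta> k"
    proof -
      have "(\<Sum>j<q. B (?u (Suc (k * q + j))) \<omega> - B (?u (k * q + j)) \<omega>) = B (?u (k * q + q)) \<omega> - B (?u (k * q)) \<omega>"
        using sum_lessThan_telescope[of "\<lambda>j. B (?u (k * q + j)) \<omega>" q] by simp
      moreover have "?u (k * q + q) = ?t (Suc k)" using grid_refine[OF nq(2), of T n "Suc k"] by (simp add: add.commute)
      ultimately show ?thesis using grid_refine[OF nq(2), of T n k] by (simp add: \<Delta>_def)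
    qed
    have blk: "(\<Sum>j<q. \<sigma> * X (?u (k * q + j)) \<omega> * (B (?u (Suc (k * q + j))) \<omega> - B (?u (k * q + j)) \<omega>))
        = euler_sum T (n * q) (Suc k * q) \<omega> - euler_sum T (n * q) (k * q) \<omega>"
    proof -
      have "euler_sum T (n * q) (k * q + j) \<omega> = euler_sum T (n * q) (k * q) \<omega> +
          (\<Sum>i<j. \<sigma> * X (?u (k * q + i)) \<omega> * (B (?u (Suc (k * q + i))) \<omega> - B (?u (k * q + i)) \<omega>))" for j
        by (induction j) (auto simp: euler_sum_def)
      from this[of q] show ?thesis by (simp add: add.commute)
    qed
    have "block_gain K T n q k \<omega> = (\<Sum>j<q. \<sigma> * X (?u (k * q + j)) \<omega> * (B (?u (Suc (k * q + j))) \<omega> - B (?u (k * q + j)) \<omega>)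
        - \<sigma> * X (?t k) \<omega> * (B (?u (Suc (k * q + j))) \<omega> - B (?u (k * q + j)) \<omega>))"
      unfolding block_gain_def using fine b(1) by (intro sum.cong) (auto simp: algebra_simps)
    also have "\<dots> = euler_sum T (n * q) (Suc k * q) \<omega> - euler_sum T (n * q) (k * q) \<omega> - \<sigma> * X (?t k) \<omega> * \<Delta> k"
      unfolding sum_subtractf blk sum_distrib_left[symmetric] tel[unfolded sum_subtractf] ..
    finally have gain: "block_gain K T n q k \<omega> = euler_sum T (n * q) (Suc k * q) \<omega> - euler_sum T (n * q) (k * q) \<omega> - \<sigma> * X (?t k) \<omega> * \<Delta> k" .
    have X: "X (?t (Suc k)) \<omega> = X (?t k) \<omega> * (1 + \<mu> * (T / real n) + \<sigma> * \<Delta> k) + drift k + (gap (Suc k) - gap k) + block_gain K T n q k \<omega>"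
      unfolding gain drift_def gap_def by (simp add: algebra_simps)
    have "s2 k + s3 k = Z (?t (Suc k)) \<omega> * block_gain K T n q k \<omega>"
      unfolding s2_def s3_def Z b(2) by (simp add: algebra_simps)
    moreover have "s1 k = Z (?t (Suc k)) \<omega> * (X (?t k) \<omega> * (1 + \<mu> * (T / real n) + \<sigma> * \<Delta> k)) - X (?t k) \<omega> * Z (?t k) \<omega>"
      unfolding s1_def b(1,2) step_error_def Z by (simp add: algebra_simps)
    ultimately show ?thesis unfolding X by (simp add: algebra_simps)
  qed
  have "?t n = T" "?t 0 = 0" using nq by (auto simp: grid_def)
  then have "X T \<omega> * Z T \<omega> - X 0 \<omega> * Z 0 \<omega> = (\<Sum>k<n. X (?t (Suc k)) \<omega> * Z (?t (Suc k)) \<omega> - X (?t k) \<omega> * Z (?t k) \<omega>)"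
    using sum_lessThan_telescope[of "\<lambda>k. X (?t k) \<omega> * Z (?t k) \<omega>" n] by simp
  also have "\<dots> = sum s1 {..<n} + sum s2 {..<n} + sum s3 {..<n} + ((\<Sum>k<n. Z (?t (Suc k)) \<omega> * drift k) + (\<Sum>k<n. Z (?t (Suc k)) \<omega> * (gap (Suc k) - gap k)))"
    using step by (simp add: sum.distrib)
  finally have eq: "X T \<omega> * Z T \<omega> - X 0 \<omega> * Z 0 \<omega> = \<dots>" .
  have Zb: "\<bar>Z (?t (Suc k)) \<omega> * c\<bar> \<le> K * \<bar>c\<bar>" if "k < n" for k c
    unfolding abs_mult using Z_pos[of "?t (Suc k)" \<omega>] bounded_paths_grid(3)[OF \<omega> _ nq(1), of "Suc k"] that
    by (intro mult_right_mono) auto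
  have d: "\<bar>\<Sum>k<n. Z (?t (Suc k)) \<omega> * drift k\<bar> \<le> K * (\<Sum>k<n. \<bar>drift k\<bar>)"
    unfolding sum_distrib_left using Zb by (intro order_trans[OF sum_abs] sum_mono) auto
  have "\<bar>\<Sum>k<n. Z (?t (Suc k)) \<omega> * (gap (Suc k) - gap k)\<bar> \<le> (\<Sum>k<n. K * \<bar>gap (Suc k) - gap k\<bar>)"
    using Zb by (intro order_trans[OF sum_abs] sum_mono) auto
  also have "\<dots> \<le> K * (\<Sum>k<n. \<bar>gap (Suc k)\<bar> + \<bar>gap k\<bar>)"
    unfolding sum_distrib_left using K by (intro sum_mono mult_left_mono abs_triangle_ineq4)
  finally show ?thesis
    using d unfolding eq s1_def[symmetric] s2_def[symmetric] s3_def[symmetric] by linarith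
qed

lemma partitions_grid: "T > 0 \<Longrightarrow> n > 0 \<Longrightarrow>
  partitions_mesh_to_0 (grid T n k) (\<lambda>q. k * Suc q) (\<lambda>q. grid T (n * Suc q))"
  unfolding partitions_mesh_to_0_def
proof (intro conjI allI impI)
  fix q assume T: "T > 0" and n: "n > 0"
  show "grid T (n * Suc q) 0 = 0" by (simp add: grid_def)
  show "grid T (n * Suc q) (k * Suc q) = grid T n k" by (rule grid_refine) simp
  show "grid T (n * Suc q) j \<le> grid T (n * Suc q) (Suc j)" for j using T by (intro grid_mono) auto
next
  fix d :: real assume T: "T > 0" and n: "n > 0" and d: "d > 0"
  obtain q0 :: nat where q0: "T / d < real q0" using reals_Archimedean2 by blast
  show "\<forall>\<^sub>F q in sequentially. \<forall>l<k * Suc q. grid T (n * Suc q) (Suc l) - grid T (n * Suc q) l < d"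
    using eventually_ge_at_top[of q0]
  proof eventually_elim
    fix q assume "q0 \<le> q"
    moreover have "1 * Suc q \<le> n * Suc q" using n by (intro mult_le_mono) auto
    ultimately have "q0 \<le> n * Suc q" unfolding mult_1 by (meson le_SucI order_trans)
    then have "real q0 \<le> real (n * Suc q)" by (rule of_nat_mono)
    then have "T / d < real (n * Suc q)" using q0 by linarith
    then have "T / real (n * Suc q) < d" using n d by (simp add: divide_less_eq mult.commute del: of_nat_mult of_nat_Suc)
    then show "\<forall>l<k * Suc q. grid T (n * Suc q) (Suc l) - grid T (n * Suc q) l < d"
      using grid_Suc[of "n * Suc q" T] n by simp
  qed
qed

text \<open>
  For fixed \<open>n\<close> the refinement \<open>q \<rightarrow> \<infinity>\<close> removes the gap to the stochastic integral and leaves the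
  bound \<open>a n\<close> of the other four sums, which tends to 0.  The order of the two limits
  matters, as the gap is controlled only at each fixed point of the coarse grid.
\<close>

lemma product_constant_on_bounded_paths:
  assumes T: "T > 0" and K: "K \<ge> 1"
  shows "AE \<omega> in P. \<omega> \<in> bounded_paths K T \<longrightarrow> X T \<omega> * Z T \<omega> = X 0 \<omega> * Z 0 \<omega>"
proof -
  obtain J where J: "ito_integral_process P \<F> B (\<lambda>t \<omega>. \<sigma> * X t \<omega>) J"
    and JX: "\<And>t. t \<ge> 0 \<Longrightarrow> AE \<omega> in P. X t \<omega> = x + integral {0..t} (\<lambda>s. \<mu> * X s \<omega>) + J t \<omega>"
    using sde unfolding solves_gbm_sde_def by blast
  have Jm: "J t \<in> borel_measurable P" if "t \<ge> 0" for t
    using J that measurable_from_filtration unfolding ito_integral_process_def by blast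
  have Jr: "\<And>t N p. t \<ge> 0 \<Longrightarrow> partitions_mesh_to_0 t N p \<Longrightarrow>
      tends_in_prob P (\<lambda>n \<omega>. \<Sum>k<N n. \<sigma> * X (p n k) \<omega> * (B (p n (Suc k)) \<omega> - B (p n k) \<omega>)) (J t)"
    using J unfolding ito_integral_process_def by blast
  have K0: "K \<ge> 0" using K by simp
  have [measurable]: "euler_sum T n j \<in> borel_measurable P" for n j
    unfolding euler_sum_def using grid_nonneg T
    by (intro borel_measurable_sum borel_measurable_times borel_measurable_diff measurable_X_P measurable_B_P borel_measurable_const) auto
  have [measurable]: "J (grid T n k) \<in> borel_measurable P" "X (grid T n k) \<in> borel_measurable P" for n k
    using grid_nonneg T Jm by (auto intro!: measurable_X_P)
  have A: "bounded_paths K T \<in> events" using T by (intro bounded_paths_events) auto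
  have Zm: "Z t \<in> borel_measurable P" if "t \<ge> 0" for t
    using measurable_Z[OF that order_refl] measurable_from_filtration by blast
  define drift where "drift n k \<omega> = X (grid T n (Suc k)) \<omega> - X (grid T n k) \<omega> - (J (grid T n (Suc k)) \<omega> - J (grid T n k) \<omega>)
      - \<mu> * X (grid T n k) \<omega> * (T / real n)" for n k \<omega>
  have [measurable]: "drift n k \<in> borel_measurable P" for n k unfolding drift_def[abs_def] by measurable
  define e where "e n = expectation (\<lambda>\<omega>. (osc K T n \<omega>)\<^sup>2)" for n
  have e0: "e n \<ge> 0" for n unfolding e_def by simp
  (* The weight in Young's inequality: both c n and e n / c n <= sqrt (e n) tend to 0, and the summand
     1 / n keeps c n positive. *)
  define c where "c n = sqrt (e n) + 1 / real n" for n
  define a where "a n = sqrt ((K * K)\<^sup>2 * (real n * mean_square_step_error \<mu> \<sigma> (T / real n)))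
      + K * K * \<bar>real n * mean_step_error \<mu> \<sigma> (T / real n)\<bar>
      + sqrt (T * (K\<^sup>2 * \<sigma>\<^sup>2 * e n))
      + K * (c n * (real n * mean_square_step \<mu> \<sigma> (T / real n)) + T * \<sigma>\<^sup>2 * sqrt (e n))
      + K * expectation (\<lambda>\<omega>. min 1 (\<Sum>k<n. \<bar>drift n k \<omega>\<bar>))" for n
  define W where "W \<omega> = X T \<omega> * Z T \<omega> - X 0 \<omega> * Z 0 \<omega>" for \<omega>
  define E where "E = expectation (\<lambda>\<omega>. indicator (bounded_paths K T) \<omega> * min 1 \<bar>W \<omega>\<bar>)"
  have Wm: "W \<in> borel_measurable P" unfolding W_def
    using T Zm[of T] Zm[of 0] by (intro borel_measurable_diff borel_measurable_times) (auto intro!: measurable_X_P)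
  have Wi: "integrable P (\<lambda>\<omega>. indicator (bounded_paths K T) \<omega> * min 1 \<bar>W \<omega>\<bar>)"
    using A Wm by (intro integrable_const_bound[of _ 1]) (auto simp: indicator_def)
  have bound: "E \<le> a n" if n: "n > 0" for n
  proof -
    define gap where "gap q k \<omega> = J (grid T n k) \<omega> - euler_sum T (n * Suc q) (k * Suc q) \<omega>" for q k \<omega>
    have [measurable]: "gap q k \<in> borel_measurable P" for q k unfolding gap_def[abs_def] by measurable
    have gap0: "(\<lambda>q. expectation (\<lambda>\<omega>. min 1 \<bar>gap q k \<omega>\<bar>)) \<longlonglongrightarrow> 0" for k
    proof -
      have "tends_in_prob P (\<lambda>q. euler_sum T (n * Suc q) (k * Suc q)) (J (grid T n k))"
        using Jr[OF _ partitions_grid[OF T n]] grid_nonneg T unfolding euler_sum_def[abs_def] by simp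
      from tends_in_prob_truncated[OF this] show ?thesis
        unfolding gap_def by (simp add: abs_minus_commute)
    qed
    have c0: "c n > 0" unfolding c_def using n e0 by (intro add_nonneg_pos) auto
    have main: "E \<le> a n + K * (\<Sum>k<n. expectation (\<lambda>\<omega>. min 1 \<bar>gap q (Suc k) \<omega>\<bar>) + expectation (\<lambda>\<omega>. min 1 \<bar>gap q k \<omega>\<bar>))" for q
    proof -
      let ?\<Delta> = "\<lambda>k \<omega>. B (grid T n (Suc k)) \<omega> - B (grid T n k) \<omega>"
      define S1 where "S1 \<omega> = (\<Sum>k<n. clipZ K (grid T n k) \<omega> * clipX K (grid T n k) \<omega> * step_error \<mu> \<sigma> (T / real n) (?\<Delta> k \<omega>))" for \<omega>
      define S2 where "S2 \<omega> = (\<Sum>k<n. clipZ K (grid T n k) \<omega> * block_gain K T n (Suc q) k \<omega>)" for \<omega>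
      define S3 where "S3 \<omega> = (\<Sum>k<n. clipZ K (grid T n k) \<omega> * ((inverse_step \<mu> \<sigma> (T / real n) (?\<Delta> k \<omega>) - 1) * block_gain K T n (Suc q) k \<omega>))" for \<omega>
      note b1 = euler_error[OF n T K0, folded S1_def]
      note b2 = weighted_block_gains[OF n zero_less_Suc T K0, of q, folded S2_def]
      note b3 = block_covariation[OF n zero_less_Suc T K0 c0, of q, folded S3_def]
      define D where "D \<omega> = (\<Sum>k<n. \<bar>drift n k \<omega>\<bar>)" for \<omega>
      have [measurable]: "D \<in> borel_measurable P" unfolding D_def[abs_def] by measurable
      let ?g = "\<lambda>\<omega>. \<Sum>k<n. min 1 \<bar>gap q (Suc k) \<omega>\<bar> + min 1 \<bar>gap q k \<omega>\<bar>"
      have mi: "integrable P (\<lambda>\<omega>. min 1 \<bar>f \<omega>\<bar>)" if "f \<in> borel_measurable P" for f :: "'a \<Rightarrow> real"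
        using that by (intro integrable_const_bound[of _ 1]) auto
      have D0: "0 \<le> D \<omega>" for \<omega> unfolding D_def by (intro sum_nonneg) auto
      then have Di: "integrable P (\<lambda>\<omega>. min 1 (D \<omega>))" using mi[of D] by simp
      have gi: "integrable P ?g" using mi by simp
      have "E \<le> expectation (\<lambda>\<omega>. \<bar>S1 \<omega>\<bar> + \<bar>S2 \<omega>\<bar> + \<bar>S3 \<omega>\<bar> + K * min 1 (D \<omega>) + K * ?g \<omega>)"
        unfolding E_def
      proof (rule integral_mono[OF Wi])
        show "integrable P (\<lambda>\<omega>. \<bar>S1 \<omega>\<bar> + \<bar>S2 \<omega>\<bar> + \<bar>S3 \<omega>\<bar> + K * min 1 (D \<omega>) + K * ?g \<omega>)"
          using b1(1) b2(1) b3(1) Di gi by simp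
        fix \<omega> assume "\<omega> \<in> space P"
        have g0: "?g \<omega> \<ge> 0" by (intro sum_nonneg) auto
        show "indicator (bounded_paths K T) \<omega> * min 1 \<bar>W \<omega>\<bar> \<le> \<bar>S1 \<omega>\<bar> + \<bar>S2 \<omega>\<bar> + \<bar>S3 \<omega>\<bar> + K * min 1 (D \<omega>) + K * ?g \<omega>"
        proof (cases "\<omega> \<in> bounded_paths K T")
          case True
          define H where "H = (\<Sum>k<n. \<bar>gap q (Suc k) \<omega>\<bar> + \<bar>gap q k \<omega>\<bar>)"
          have "\<bar>W \<omega>\<bar> \<le> \<bar>S1 \<omega>\<bar> + \<bar>S2 \<omega>\<bar> + \<bar>S3 \<omega>\<bar> + K * D \<omega> + K * H"
            using telescoped_product[OF True n zero_less_Suc T K0, of q J]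
            unfolding W_def S1_def S2_def S3_def D_def H_def drift_def gap_def .
          moreover have "min 1 H \<le> ?g \<omega>"
          proof -
            have "min 1 H \<le> (\<Sum>k<n. min 1 (\<bar>gap q (Suc k) \<omega>\<bar> + \<bar>gap q k \<omega>\<bar>))"
              unfolding H_def by (rule min_one_sum_le) auto
            also have "\<dots> \<le> ?g \<omega>" by (intro sum_mono) auto
            finally show ?thesis .
          qed
          moreover have "H \<ge> 0" unfolding H_def by (intro sum_nonneg) auto
          (* As K >= 1, the factor K can be pulled out of the truncation. *)
          moreover have le: "min 1 (K * y) \<le> K * min 1 y" if "y \<ge> 0" for y
          proof (cases "y \<ge> 1")
            case True
            then show ?thesis using K by simp
          qed (use K in auto)
          have "min 1 (K * D \<omega>) \<le> K * min 1 (D \<omega>)" using le D0 by blast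
          moreover have "min 1 (K * H) \<le> K * min 1 H" using le \<open>H \<ge> 0\<close> by blast
          moreover have "K * min 1 H \<le> K * ?g \<omega>" using K0 \<open>min 1 H \<le> ?g \<omega>\<close> by (rule mult_left_mono[rotated])
          ultimately have "min 1 \<bar>W \<omega>\<bar> \<le> \<bar>S1 \<omega>\<bar> + \<bar>S2 \<omega>\<bar> + \<bar>S3 \<omega>\<bar> + K * min 1 (D \<omega>) + K * ?g \<omega>"
            using D0[of \<omega>] K0 by (smt (verit) abs_ge_zero mult_nonneg_nonneg)
          then show ?thesis using True by simp
        next
          case False
          then show ?thesis using g0 D0 K0 by simp
        qed
      qed
      also have "\<dots> = expectation (\<lambda>\<omega>. \<bar>S1 \<omega>\<bar>) + expectation (\<lambda>\<omega>. \<bar>S2 \<omega>\<bar>) + expectation (\<lambda>\<omega>. \<bar>S3 \<omega>\<bar>)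
          + K * expectation (\<lambda>\<omega>. min 1 (D \<omega>)) + K * expectation ?g"
        using b1(1) b2(1) b3(1) Di gi by simp
      also have "expectation ?g = (\<Sum>k<n. expectation (\<lambda>\<omega>. min 1 \<bar>gap q (Suc k) \<omega>\<bar>) + expectation (\<lambda>\<omega>. min 1 \<bar>gap q k \<omega>\<bar>))"
        using mi by simp
      finally have split: "E \<le> expectation (\<lambda>\<omega>. \<bar>S1 \<omega>\<bar>) + expectation (\<lambda>\<omega>. \<bar>S2 \<omega>\<bar>) + expectation (\<lambda>\<omega>. \<bar>S3 \<omega>\<bar>)
          + K * expectation (\<lambda>\<omega>. min 1 (D \<omega>))
          + K * (\<Sum>k<n. expectation (\<lambda>\<omega>. min 1 \<bar>gap q (Suc k) \<omega>\<bar>) + expectation (\<lambda>\<omega>. min 1 \<bar>gap q k \<omega>\<bar>))" .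
      have "T * \<sigma>\<^sup>2 * e n / c n \<le> T * \<sigma>\<^sup>2 * sqrt (e n)"
      proof -
        have "e n = sqrt (e n) * sqrt (e n)" using e0 by simp
        also have "\<dots> \<le> sqrt (e n) * c n" unfolding c_def using e0 by (intro mult_left_mono) auto
        finally have "e n / c n \<le> sqrt (e n)" using c0 by (simp add: divide_le_eq)
        from mult_left_mono[OF this, of "T * \<sigma>\<^sup>2"] T show ?thesis by simp
      qed
      then have "K * (c n * (real n * mean_square_step \<mu> \<sigma> (T / real n)) + T * \<sigma>\<^sup>2 * e n / c n)
         \<le> K * (c n * (real n * mean_square_step \<mu> \<sigma> (T / real n)) + T * \<sigma>\<^sup>2 * sqrt (e n))"
        using K0 by (intro mult_left_mono add_left_mono)
      then show ?thesis
        using split b1(2) b2(2) b3(2) unfolding a_def e_def[symmetric] D_def by linarith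
    qed
    have "(\<lambda>q. a n + K * (\<Sum>k<n. expectation (\<lambda>\<omega>. min 1 \<bar>gap q (Suc k) \<omega>\<bar>) + expectation (\<lambda>\<omega>. min 1 \<bar>gap q k \<omega>\<bar>)))
        \<longlonglongrightarrow> a n + K * (\<Sum>k<n. 0 + 0)"
      by (intro tendsto_intros gap0)
    from LIMSEQ_le_const[OF this, of E] main show "E \<le> a n" by auto
  qed
  have drift0: "(\<lambda>n. expectation (\<lambda>\<omega>. min 1 (\<Sum>k<n. \<bar>drift n k \<omega>\<bar>))) \<longlonglongrightarrow> 0"
  proof -
    have JX': "AE \<omega> in P. \<forall>n k. X (grid T n k) \<omega> = x + integral {0..grid T n k} (\<lambda>s. \<mu> * X s \<omega>) + J (grid T n k) \<omega>"
      using JX grid_nonneg T by (simp add: AE_all_countable)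
    have "AE \<omega> in P. (\<lambda>n. min 1 (\<Sum>k<n. \<bar>drift n k \<omega>\<bar>)) \<longlonglongrightarrow> min 1 0"
      using JX' AE_space
    proof eventually_elim
      fix \<omega> assume h: "\<forall>n k. X (grid T n k) \<omega> = x + integral {0..grid T n k} (\<lambda>s. \<mu> * X s \<omega>) + J (grid T n k) \<omega>"
        and \<omega>: "\<omega> \<in> space P"
      let ?f = "\<lambda>s. \<mu> * X s \<omega>"
      have f: "continuous_on {0..t} ?f" for t
        using continuous_on_subset[OF continuous_X[OF \<omega>]] by (intro continuous_intros) auto
      have d: "drift n k \<omega> = integral {T * real k / real n..T * real (Suc k) / real n} ?f - ?f (T * real k / real n) * (T / real n)" for n k
      proof -
        have "integral {0..grid T n k} ?f + integral {grid T n k..grid T n (Suc k)} ?f = integral {0..grid T n (Suc k)} ?f"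
          using T f by (intro Henstock_Kurzweil_Integration.integral_combine grid_nonneg grid_mono integrable_continuous_interval) auto
        then show ?thesis
          using h[rule_format, of n k] h[rule_format, of n "Suc k"] unfolding drift_def grid_def by (simp add: mult.assoc)
      qed
      have "(\<lambda>n. \<Sum>k<n. \<bar>drift n k \<omega>\<bar>) \<longlonglongrightarrow> 0"
        unfolding d by (rule riemann_block_error_tendsto[OF f T])
      then show "(\<lambda>n. min 1 (\<Sum>k<n. \<bar>drift n k \<omega>\<bar>)) \<longlonglongrightarrow> min 1 0" by (intro tendsto_intros)
    qed
    then have "(\<lambda>n. expectation (\<lambda>\<omega>. min 1 (\<Sum>k<n. \<bar>drift n k \<omega>\<bar>))) \<longlonglongrightarrow> expectation (\<lambda>\<omega>. min 1 0)"
      by (intro integral_dominated_convergence[where w="\<lambda>_. 1"]) (auto simp: sum_nonneg)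
    then show ?thesis by simp
  qed
  have e: "e \<longlonglongrightarrow> 0" unfolding e_def by (rule osc_square(2)[OF K0 T])
  have se: "(\<lambda>n. sqrt (e n)) \<longlonglongrightarrow> 0" using tendsto_real_sqrt[OF e] by simp
  have c: "c \<longlonglongrightarrow> 0" unfolding c_def using tendsto_add[OF se lim_1_over_n] by simp
  note s = scaled_mean_step_errors_tendsto[OF T, of \<mu> \<sigma>]
  have "a \<longlonglongrightarrow> sqrt ((K * K)\<^sup>2 * 0) + K * K * \<bar>0\<bar> + sqrt (T * (K\<^sup>2 * \<sigma>\<^sup>2 * 0)) + K * (0 * (T * \<sigma>\<^sup>2) + T * \<sigma>\<^sup>2 * 0) + K * 0"
    unfolding a_def by (intro tendsto_intros s e se c drift0)
  then have "a \<longlonglongrightarrow> 0" by simp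
  then have "E \<le> 0" by (rule LIMSEQ_le_const) (use bound in \<open>auto intro!: exI[of _ 1]\<close>)
  moreover have "E \<ge> 0" unfolding E_def by (intro integral_nonneg_AE) auto
  ultimately have "E = 0" by simp
  then have "AE \<omega> in P. indicator (bounded_paths K T) \<omega> * min 1 \<bar>W \<omega>\<bar> = 0"
    unfolding E_def using integral_nonneg_eq_0_iff_AE[OF Wi] by auto
  then show ?thesis
    by eventually_elim (auto simp: W_def indicator_def min_def split: if_splits)
qed

text \<open>
  A continuous path on a compact interval belongs to \<open>bounded_paths\<close> for some integer bound, and
  equality at rational times extends to all times.
\<close>

theorem explicit_solution:
  "AE \<omega> in P. \<forall>t\<ge>0. X t \<omega> = x * exp (\<sigma> * B t \<omega> + (\<mu> - \<sigma>\<^sup>2 / 2) * t)"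
proof -
  have X0: "AE \<omega> in P. X 0 \<omega> = x" using sde unfolding solves_gbm_sde_def by blast
  have B0: "AE \<omega> in P. B 0 \<omega> = 0" and Bc: "AE \<omega> in P. continuous_on {0..} (\<lambda>t. B t \<omega>)"
    using brownian unfolding brownian_motion_def by blast+
  have "AE \<omega> in P. X t \<omega> = x * exp (\<sigma> * B t \<omega> + (\<mu> - \<sigma>\<^sup>2 / 2) * t)" if "t > 0" for t
  proof -
    have "AE \<omega> in P. \<forall>K. \<omega> \<in> bounded_paths (real (Suc K)) t \<longrightarrow> X t \<omega> * Z t \<omega> = X 0 \<omega> * Z 0 \<omega>"
      unfolding AE_all_countable using product_constant_on_bounded_paths[OF that] by simp
    then show ?thesis using X0 B0 Bc AE_space
    proof eventually_elim
      fix \<omega> assume h: "\<forall>K. \<omega> \<in> bounded_paths (real (Suc K)) t \<longrightarrow> X t \<omega> * Z t \<omega> = X 0 \<omega> * Z 0 \<omega>"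
        and X0: "X 0 \<omega> = x" and B0: "B 0 \<omega> = 0" and Bc: "continuous_on {0..} (\<lambda>t. B t \<omega>)" and \<omega>: "\<omega> \<in> space P"
      have cX: "continuous_on {0..t} (\<lambda>t. X t \<omega>)" and cZ: "continuous_on {0..t} (\<lambda>t. Z t \<omega>)"
        unfolding Z_def using continuous_on_subset[OF continuous_X[OF \<omega>]] continuous_on_subset[OF Bc]
        by (auto intro!: continuous_intros)
      have "bounded ((\<lambda>t. X t \<omega>) ` {0..t})" "bounded ((\<lambda>t. Z t \<omega>) ` {0..t})"
        using cX cZ by (auto intro!: compact_imp_bounded compact_continuous_image)
      then obtain k1 k2 where k: "\<And>s. s \<in> {0..t} \<Longrightarrow> \<bar>X s \<omega>\<bar> \<le> k1" "\<And>s. s \<in> {0..t} \<Longrightarrow> \<bar>Z s \<omega>\<bar> \<le> k2"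
        unfolding bounded_iff by (metis image_eqI real_norm_def)
      obtain K where K: "max k1 k2 \<le> real K" using real_arch_simple by blast
      have "\<omega> \<in> bounded_paths (real (Suc K)) t"
        unfolding bounded_paths_def
      proof (intro CollectI conjI ballI \<omega>)
        fix a :: real assume "a \<in> \<rat> \<inter> {0..1}"
        then have "t * a \<in> {0..t}" using that by (auto simp: mult_le_cancel_left1)
        with k[of "t * a"] K show "\<bar>X (t * a) \<omega>\<bar> \<le> real (Suc K)" "Z (t * a) \<omega> \<le> real (Suc K)" by auto
      qed
      with h have "X t \<omega> * Z t \<omega> = X 0 \<omega> * Z 0 \<omega>" by blast
      then have "X t \<omega> * Z t \<omega> = x" using X0 B0 by (simp add: Z_def[of 0])
      then have "X t \<omega> = x * (1 / Z t \<omega>)" using Z_pos[of t \<omega>] by (simp add: field_simps)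
      also have "1 / Z t \<omega> = exp (\<sigma> * B t \<omega> + (\<mu> - \<sigma>\<^sup>2 / 2) * t)"
        unfolding Z_def inverse_eq_divide[symmetric] exp_minus[symmetric] by simp
      finally show "X t \<omega> = x * exp (\<sigma> * B t \<omega> + (\<mu> - \<sigma>\<^sup>2 / 2) * t)" .
    qed
  qed
  then have "AE \<omega> in P. \<forall>t\<in>\<rat> \<inter> {0<..}. X t \<omega> = x * exp (\<sigma> * B t \<omega> + (\<mu> - \<sigma>\<^sup>2 / 2) * t)"
    by (subst AE_ball_countable) (auto intro: countable_Int1 countable_rat)
  then show ?thesis using Bc AE_space
  proof eventually_elim
    fix \<omega> assume h: "\<forall>t\<in>\<rat> \<inter> {0<..}. X t \<omega> = x * exp (\<sigma> * B t \<omega> + (\<mu> - \<sigma>\<^sup>2 / 2) * t)"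
      and Bc: "continuous_on {0..} (\<lambda>t. B t \<omega>)" and \<omega>: "\<omega> \<in> space P"
    show "\<forall>t\<ge>0. X t \<omega> = x * exp (\<sigma> * B t \<omega> + (\<mu> - \<sigma>\<^sup>2 / 2) * t)"
    proof (intro allI impI)
      fix t :: real assume t: "t \<ge> 0"
      define d where "d t = X t \<omega> - x * exp (\<sigma> * B t \<omega> + (\<mu> - \<sigma>\<^sup>2 / 2) * t)" for t
      have d: "continuous_on {0..} d" unfolding d_def
        using continuous_X[OF \<omega>] Bc by (intro continuous_intros)
      have "\<exists>q. q \<in> \<rat> \<inter> {0<..} \<and> t < q \<and> q < t + 1 / real (Suc n)" for n
      proof -
        obtain q where "q \<in> \<rat>" "t < q" "q < t + 1 / real (Suc n)" using Rats_dense_in_real[of t "t + 1 / real (Suc n)"] by auto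
        then show ?thesis using t by auto
      qed
      then obtain q where q: "\<And>n. q n \<in> \<rat> \<inter> {0<..}" "\<And>n. t < q n" "\<And>n. q n < t + 1 / real (Suc n)" by metis
      have "q \<longlonglongrightarrow> t"
      proof (rule tendsto_sandwich[of "\<lambda>_. t" q _ "\<lambda>n. t + 1 / real (Suc n)"])
        show "(\<lambda>n. t + 1 / real (Suc n)) \<longlonglongrightarrow> t" using tendsto_add[OF tendsto_const LIMSEQ_Suc[OF lim_1_over_n], of t] by simp
      qed (use q(2,3) in \<open>auto intro!: always_eventually less_imp_le\<close>)
      then have "(\<lambda>n. d (q n)) \<longlonglongrightarrow> d t"
        using q(1) t by (intro continuous_on_tendsto_compose[OF d]) (auto intro!: always_eventually less_imp_le)
      moreover have "d (q n) = 0" for n using h q(1) by (simp add: d_def)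
      ultimately have "d t = 0" by (simp add: LIMSEQ_const_iff)
      then show "X t \<omega> = x * exp (\<sigma> * B t \<omega> + (\<mu> - \<sigma>\<^sup>2 / 2) * t)" by (simp add: d_def)
    qed
  qed
qed

end

section \<open>Optional sampling of an exponential martingale\<close>

context brownian_filtration begin

definition exp_mart :: "real \<Rightarrow> real \<Rightarrow> 'a \<Rightarrow> real"
  where "exp_mart a t \<omega> = exp (a * B t \<omega> - a\<^sup>2 * t / 2)"

lemma exp_mart_pos: "0 < exp_mart a t \<omega>" by (simp add: exp_mart_def)

lemma measurable_exp_mart: "0 \<le> s \<Longrightarrow> s \<le> t \<Longrightarrow> exp_mart a s \<in> borel_measurable (\<F>r t)"
  unfolding exp_mart_def using measurable_B[of s t] by simp

lemma measurable_exp_mart_P: "0 \<le> s \<Longrightarrow> exp_mart a s \<in> borel_measurable P"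
  using measurable_exp_mart[of s s] measurable_from_filtration by blast

lemma exp_mart_step:
  "exp_mart a t \<omega> = exp_mart a s \<omega> * (exp (- a\<^sup>2 * (t - s) / 2) * exp (a * (B t \<omega> - B s \<omega>)))"
  unfolding exp_mart_def exp_add[symmetric] by (simp add: algebra_simps diff_divide_distrib)

text \<open>
  The \<open>p\<close>-th power grows over \<open>[s,t]\<close> by an independent factor with mean
  \<open>exp (p (p - 1) a\<^sup>2 (t - s) / 2)\<close>.  For \<open>p = 1\<close> this is the martingale property; for \<open>p = 2\<close> the mean is at
  least 1, which bounds second moments by those at the final time.
\<close>

lemma exp_mart_increment:
  assumes "0 \<le> s" "s < t" and U: "U \<in> borel_measurable (\<F>r s)"
    and i: "integrable P (\<lambda>\<omega>. U \<omega> * exp_mart a s \<omega> ^ p)"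
  shows "integrable P (\<lambda>\<omega>. U \<omega> * exp_mart a t \<omega> ^ p)"
    "expectation (\<lambda>\<omega>. U \<omega> * exp_mart a t \<omega> ^ p) =
      expectation (\<lambda>\<omega>. U \<omega> * exp_mart a s \<omega> ^ p) * exp ((real p * (real p - 1)) * a\<^sup>2 * (t - s) / 2)"
proof -
  define k where "k = exp (- (real p * a\<^sup>2 * (t - s) / 2))"
  define g where "g b = k * exp (real p * a * b)" for b
  have gm: "g \<in> borel_measurable borel" unfolding g_def by measurable
  note m = increment_exponential_moments[OF assms(1,2), where ?c0.0=k and ?c1.0=0 and ?c2.0=0 and a="real p * a"]
  have gi: "integrable P (\<lambda>\<omega>. g (B t \<omega> - B s \<omega>))" using m(1) by (simp add: g_def)
  have ge: "expectation (\<lambda>\<omega>. g (B t \<omega> - B s \<omega>)) = exp ((real p * (real p - 1)) * a\<^sup>2 * (t - s) / 2)"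
  proof -
    have "expectation (\<lambda>\<omega>. g (B t \<omega> - B s \<omega>)) = k * exp ((real p * a)\<^sup>2 * (t - s) / 2)"
      using m(2) by (simp add: g_def)
    also have "\<dots> = exp ((real p * (real p - 1)) * a\<^sup>2 * (t - s) / 2)"
      unfolding k_def exp_add[symmetric] by (simp add: power2_eq_square field_simps)
    finally show ?thesis .
  qed
  have eq: "U \<omega> * exp_mart a t \<omega> ^ p = (U \<omega> * exp_mart a s \<omega> ^ p) * g (B t \<omega> - B s \<omega>)" for \<omega>
    unfolding exp_mart_step[of a t \<omega> s] g_def k_def power_mult_distrib exp_of_nat_mult[symmetric]
    by (simp add: algebra_simps diff_divide_distrib)
  have Um: "(\<lambda>\<omega>. U \<omega> * exp_mart a s \<omega> ^ p) \<in> borel_measurable (\<F>r s)"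
    using U measurable_exp_mart[OF assms(1) order_refl] by simp
  show "integrable P (\<lambda>\<omega>. U \<omega> * exp_mart a t \<omega> ^ p)"
    "expectation (\<lambda>\<omega>. U \<omega> * exp_mart a t \<omega> ^ p) =
      expectation (\<lambda>\<omega>. U \<omega> * exp_mart a s \<omega> ^ p) * exp ((real p * (real p - 1)) * a\<^sup>2 * (t - s) / 2)"
    unfolding eq using increment_product[OF assms(1,2) Um gm i gi] ge by auto
qed

lemma integrable_exp_mart_power:
  assumes "0 \<le> t" shows "integrable P (\<lambda>\<omega>. exp_mart a t \<omega> ^ p)"
proof -
  have "AE \<omega> in P. exp_mart a 0 \<omega> ^ p = 1"
    using brownian unfolding brownian_motion_def exp_mart_def by auto
  then have i: "integrable P (\<lambda>\<omega>. exp_mart a 0 \<omega> ^ p)"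
    using measurable_exp_mart_P[of 0 a] by (subst integrable_cong_AE[where g="\<lambda>_. 1"]) auto
  show ?thesis
  proof (cases "t = 0")
    case False
    then show ?thesis using exp_mart_increment(1)[of 0 t "\<lambda>_. 1" a p] i assms by simp
  qed (use i in simp)
qed

lemma integrable_weighted_exp_mart:
  assumes "0 \<le> t" "U \<in> borel_measurable P" "\<And>\<omega>. \<omega> \<in> space P \<Longrightarrow> U \<omega> \<in> {0..1}"
  shows "integrable P (\<lambda>\<omega>. U \<omega> * exp_mart a t \<omega> ^ p)"
  using measurable_exp_mart_P[OF assms(1), of a] assms(2,3) exp_mart_pos
  by (intro Bochner_Integration.integrable_bound[OF integrable_exp_mart_power[OF assms(1), of a p]])
     (auto intro!: AE_I2 mult_left_le_one_le simp: abs_mult less_imp_le)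

lemma exp_mart_mono:
  assumes "0 \<le> s" "s \<le> t" and U: "U \<in> borel_measurable (\<F>r s)" "\<And>\<omega>. \<omega> \<in> space P \<Longrightarrow> U \<omega> \<in> {0..1}"
  shows "expectation (\<lambda>\<omega>. U \<omega> * exp_mart a s \<omega>) = expectation (\<lambda>\<omega>. U \<omega> * exp_mart a t \<omega>)"
    "expectation (\<lambda>\<omega>. U \<omega> * (exp_mart a s \<omega>)\<^sup>2) \<le> expectation (\<lambda>\<omega>. U \<omega> * (exp_mart a t \<omega>)\<^sup>2)"
proof -
  have i: "integrable P (\<lambda>\<omega>. U \<omega> * exp_mart a s \<omega> ^ p)" for p
    using assms measurable_from_filtration by (intro integrable_weighted_exp_mart) auto
  have "expectation (\<lambda>\<omega>. U \<omega> * exp_mart a s \<omega>) = expectation (\<lambda>\<omega>. U \<omega> * exp_mart a t \<omega>) \<and>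
    expectation (\<lambda>\<omega>. U \<omega> * (exp_mart a s \<omega>)\<^sup>2) \<le> expectation (\<lambda>\<omega>. U \<omega> * (exp_mart a t \<omega>)\<^sup>2)"
  proof (cases "s = t")
    case False
    then have st: "s < t" using assms by simp
    have "0 \<le> expectation (\<lambda>\<omega>. U \<omega> * (exp_mart a s \<omega>)\<^sup>2)"
      using U(2) by (intro integral_nonneg_AE) auto
    moreover have "1 \<le> exp ((real 2 * (real 2 - 1)) * a\<^sup>2 * (t - s) / 2)" using st by simp
    ultimately show ?thesis
      using exp_mart_increment(2)[OF assms(1) st U(1) i, of 1] exp_mart_increment(2)[OF assms(1) st U(1) i, of 2]
        mult_left_mono[of 1 "exp ((real 2 * (real 2 - 1)) * a\<^sup>2 * (t - s) / 2)" "expectation (\<lambda>\<omega>. U \<omega> * (exp_mart a s \<omega>)\<^sup>2)"]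
      by simp
  qed simp
  then show "expectation (\<lambda>\<omega>. U \<omega> * exp_mart a s \<omega>) = expectation (\<lambda>\<omega>. U \<omega> * exp_mart a t \<omega>)"
    "expectation (\<lambda>\<omega>. U \<omega> * (exp_mart a s \<omega>)\<^sup>2) \<le> expectation (\<lambda>\<omega>. U \<omega> * (exp_mart a t \<omega>)\<^sup>2)"
    by auto
qed

text \<open>
  The martingale at the first point of the grid \<open>s\<close> that is not before \<open>\<tau>\<close>, or at \<open>s k\<close> if there is none
  yet.  The recursion exhibits each step as a martingale increment on an event known at its start.
\<close>

fun sampled :: "real \<Rightarrow> (nat \<Rightarrow> real) \<Rightarrow> ('a \<Rightarrow> ennreal) \<Rightarrow> nat \<Rightarrow> 'a \<Rightarrow> real"
  where "sampled a s \<tau> 0 \<omega> = exp_mart a (s 0) \<omega>"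
  | "sampled a s \<tau> (Suc k) \<omega> = (if ennreal (s k) < \<tau> \<omega> then exp_mart a (s (Suc k)) \<omega> else sampled a s \<tau> k \<omega>)"

lemma sampled_time:
  assumes s: "0 \<le> s 0" "\<And>k. s (Suc k) = s k + \<delta>" and \<delta>: "\<delta> > 0" and \<tau>: "ennreal (s 0) \<le> \<tau> \<omega>"
  shows "\<exists>\<rho>. s 0 \<le> \<rho> \<and> \<rho> \<le> s k \<and> min (\<tau> \<omega>) (ennreal (s k)) \<le> ennreal \<rho> \<and> ennreal \<rho> \<le> \<tau> \<omega> + ennreal \<delta> \<and>
    sampled a s \<tau> k \<omega> = exp_mart a \<rho> \<omega>"
proof -
  have s0: "0 \<le> s k" for k using s \<delta> by (induction k) auto
  have ss: "s 0 \<le> s k" for k using s \<delta> by (induction k) auto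
  show ?thesis
  proof (induction k)
    case 0
    then show ?case using \<tau> by (intro exI[of _ "s 0"]) (auto simp: add_increasing2)
  next
    case (Suc k)
    show ?case
    proof (cases "ennreal (s k) < \<tau> \<omega>")
      case True
      have "ennreal (s (Suc k)) = ennreal (s k) + ennreal \<delta>" using s(2) s0 \<delta> by (simp add: ennreal_plus)
      then have "ennreal (s (Suc k)) \<le> \<tau> \<omega> + ennreal \<delta>" using True by (simp add: less_imp_le)
      then show ?thesis using True ss[of "Suc k"] by (intro exI[of _ "s (Suc k)"]) auto
    next
      case False
      obtain \<rho> where \<rho>: "s 0 \<le> \<rho>" "\<rho> \<le> s k" "min (\<tau> \<omega>) (ennreal (s k)) \<le> ennreal \<rho>"
        "ennreal \<rho> \<le> \<tau> \<omega> + ennreal \<delta>" "sampled a s \<tau> k \<omega> = exp_mart a \<rho> \<omega>" using Suc by auto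
      have "\<tau> \<omega> \<le> ennreal \<rho>" using \<rho>(3) False by (simp add: min_absorb1)
      then show ?thesis using \<rho> False s(2)[of k] \<delta>
        by (intro exI[of _ \<rho>]) (auto simp: min.coboundedI1)
    qed
  qed
qed

text \<open>
  In step \<open>k\<close> the sampled process, weighted with \<open>w\<close>, changes by \<open>U k\<close> times an increment of the
  martingale, where \<open>U k = w\<close> on \<open>{s k < \<tau>}\<close> and 0 elsewhere is known at time \<open>s k\<close>.
\<close>

lemma sampled_expectation:
  assumes s: "0 \<le> s 0" "\<And>k. s (Suc k) = s k + \<delta>" and \<delta>: "\<delta> > 0" and \<tau>: "stopping_time \<F> \<tau>"
    and w: "w \<in> borel_measurable (\<F>r (s 0))" "\<And>\<omega>. \<omega> \<in> space P \<Longrightarrow> w \<omega> \<in> {0..1}"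
      "\<And>\<omega>. \<omega> \<in> space P \<Longrightarrow> w \<omega> \<noteq> 0 \<Longrightarrow> ennreal (s 0) \<le> \<tau> \<omega>"
  shows "sampled a s \<tau> k \<in> borel_measurable P" "integrable P (\<lambda>\<omega>. w \<omega> * sampled a s \<tau> k \<omega>)"
    "expectation (\<lambda>\<omega>. w \<omega> * sampled a s \<tau> k \<omega>) = expectation (\<lambda>\<omega>. w \<omega> * exp_mart a (s 0) \<omega>)"
    "integrable P (\<lambda>\<omega>. w \<omega> * (sampled a s \<tau> k \<omega>)\<^sup>2)"
    "expectation (\<lambda>\<omega>. w \<omega> * (sampled a s \<tau> k \<omega>)\<^sup>2) \<le> expectation (\<lambda>\<omega>. (exp_mart a (s k) \<omega>)\<^sup>2)"
proof -
  have s0: "0 \<le> s k" for k using s \<delta> by (induction k) auto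
  have ss: "s 0 \<le> s k" for k using s \<delta> by (induction k) auto
  have wP: "w \<in> borel_measurable P" using w(1) measurable_from_filtration by blast
  define H where "H k \<omega> = (if ennreal (s k) < \<tau> \<omega> then 1 else 0 :: real)" for k \<omega>
  have Hm: "H k \<in> borel_measurable (\<F>r (s k))" for k
    unfolding H_def using stopping_timeD2[OF \<tau>, of "ennreal (s k)"] by measurable
  define U where "U k \<omega> = w \<omega> * H k \<omega>" for k \<omega>
  have Um: "U k \<in> borel_measurable (\<F>r (s k))" for k
    unfolding U_def using Hm measurable_filtrationr_mono[OF w(1) ss] by simp
  have Ub: "U k \<omega> \<in> {0..1}" if "\<omega> \<in> space P" for k \<omega>
    using w(2)[OF that] by (auto simp: U_def H_def)
  have UP: "U k \<in> borel_measurable P" for k using Um measurable_from_filtration by blast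
  have step: "w \<omega> * sampled a s \<tau> (Suc k) \<omega> ^ p = w \<omega> * sampled a s \<tau> k \<omega> ^ p +
      (U k \<omega> * exp_mart a (s (Suc k)) \<omega> ^ p - U k \<omega> * exp_mart a (s k) \<omega> ^ p)" if \<omega>: "\<omega> \<in> space P" for \<omega> k p
  proof (cases "w \<omega> = 0 \<or> \<tau> \<omega> \<le> ennreal (s k)")
    case False
    then have t: "ennreal (s k) < \<tau> \<omega>" "ennreal (s 0) \<le> \<tau> \<omega>" using w(3)[OF \<omega>] by auto
    obtain \<rho> where r0: "s 0 \<le> \<rho>" and \<rho>: "\<rho> \<le> s k" "min (\<tau> \<omega>) (ennreal (s k)) \<le> ennreal \<rho>" "sampled a s \<tau> k \<omega> = exp_mart a \<rho> \<omega>"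
      using sampled_time[where s=s and \<tau>=\<tau> and \<omega>=\<omega>, OF s \<delta> t(2), of k a] by auto
    then have "ennreal (s k) \<le> ennreal \<rho>" using t by simp
    then have "s k \<le> \<rho>" using r0 s(1) by simp
    then have "\<rho> = s k" using \<rho>(1) by simp
    then show ?thesis using \<rho> t by (simp add: U_def H_def)
  qed (auto simp: U_def H_def)
  have meas: "sampled a s \<tau> k \<in> borel_measurable P" for k
  proof (induction k)
    case (Suc k)
    have "Measurable.pred P (\<lambda>\<omega>. ennreal (s k) < \<tau> \<omega>)"
      using stopping_timeD2[OF \<tau>, of "ennreal (s k)"] by (rule measurable_from_filtration)
    moreover have "exp_mart a (s (Suc k)) \<in> borel_measurable P" by (rule measurable_exp_mart_P[OF s0])
    ultimately show ?case using Suc by simp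
  qed (simp add: measurable_exp_mart_P[OF s0])
  then show "sampled a s \<tau> k \<in> borel_measurable P" .
  have ii: "integrable P (\<lambda>\<omega>. U k \<omega> * exp_mart a (s j) \<omega> ^ p)" for k j p
    using Ub UP s0 by (intro integrable_weighted_exp_mart) auto
  have wi: "integrable P (\<lambda>\<omega>. w \<omega> * exp_mart a (s j) \<omega> ^ p)" for j p
    using w wP s0 by (intro integrable_weighted_exp_mart) auto
  have int: "integrable P (\<lambda>\<omega>. w \<omega> * sampled a s \<tau> k \<omega> ^ p)" for k p
  proof (induction k)
    case (Suc k)
    have "integrable P (\<lambda>\<omega>. w \<omega> * sampled a s \<tau> k \<omega> ^ p +
      (U k \<omega> * exp_mart a (s (Suc k)) \<omega> ^ p - U k \<omega> * exp_mart a (s k) \<omega> ^ p))"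
      using Suc ii by (intro Bochner_Integration.integrable_add Bochner_Integration.integrable_diff) auto
    then show ?case using step[of _ k p] by (subst Bochner_Integration.integrable_cong[OF refl step]) auto
  qed (simp add: wi)
  show "integrable P (\<lambda>\<omega>. w \<omega> * sampled a s \<tau> k \<omega>)" using int[of k 1] by simp
  show "integrable P (\<lambda>\<omega>. w \<omega> * (sampled a s \<tau> k \<omega>)\<^sup>2)" using int[of k 2] by simp
  have inc: "expectation (\<lambda>\<omega>. w \<omega> * sampled a s \<tau> (Suc k) \<omega> ^ p) = expectation (\<lambda>\<omega>. w \<omega> * sampled a s \<tau> k \<omega> ^ p) +
      (expectation (\<lambda>\<omega>. U k \<omega> * exp_mart a (s (Suc k)) \<omega> ^ p) - expectation (\<lambda>\<omega>. U k \<omega> * exp_mart a (s k) \<omega> ^ p))" for k p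
  proof -
    have "expectation (\<lambda>\<omega>. w \<omega> * sampled a s \<tau> (Suc k) \<omega> ^ p) = expectation (\<lambda>\<omega>. w \<omega> * sampled a s \<tau> k \<omega> ^ p +
      (U k \<omega> * exp_mart a (s (Suc k)) \<omega> ^ p - U k \<omega> * exp_mart a (s k) \<omega> ^ p))"
      using step by (intro Bochner_Integration.integral_cong) auto
    then show ?thesis using int[of k p] ii by simp
  qed
  have le: "s k \<le> s (Suc k)" for k using s(2) \<delta> by simp
  show "expectation (\<lambda>\<omega>. w \<omega> * sampled a s \<tau> k \<omega>) = expectation (\<lambda>\<omega>. w \<omega> * exp_mart a (s 0) \<omega>)"
  proof (induction k)
    case (Suc k)
    then show ?case using inc[of k 1] exp_mart_mono(1)[OF s0 le Um Ub, of k a] by simp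
  qed simp
  show "expectation (\<lambda>\<omega>. w \<omega> * (sampled a s \<tau> k \<omega>)\<^sup>2) \<le> expectation (\<lambda>\<omega>. (exp_mart a (s k) \<omega>)\<^sup>2)"
  proof (induction k)
    case 0
    then show ?case using wi[of 0 2] integrable_exp_mart_power[OF s0, of a 0 2] w(2)
      by (auto intro!: integral_mono mult_left_le_one_le)
  next
    case (Suc k)
    have c: "(\<lambda>\<omega>. 1 - U k \<omega>) \<in> borel_measurable (\<F>r (s k))" "\<And>\<omega>. \<omega> \<in> space P \<Longrightarrow> 1 - U k \<omega> \<in> {0..1}"
      using Um Ub by auto
    note e = integrable_exp_mart_power[OF s0, of a _ 2]
    have "expectation (\<lambda>\<omega>. (1 - U k \<omega>) * (exp_mart a (s j) \<omega>)\<^sup>2) = expectation (\<lambda>\<omega>. (exp_mart a (s j) \<omega>)\<^sup>2) - expectation (\<lambda>\<omega>. U k \<omega> * (exp_mart a (s j) \<omega>)\<^sup>2)" for j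
      using e ii[of k j 2] by (simp add: left_diff_distrib)
    then show ?case
      using exp_mart_mono(2)[OF s0 le c, of a] inc[of k 2] Suc by simp
  qed
qed

text \<open>
  Refining the grid requires an integrable majorant.  It is provided by the truncation at \<open>C\<close>: since
  \<open>S \<le> min C S + S\<^sup>2 / C\<close>, the cost is the second moment at the horizon divided by \<open>C\<close>, uniformly in the
  grid.
\<close>

lemma optional_sampling_truncated:
  assumes t: "0 \<le> t" "t < T" and \<tau>: "stopping_time \<F> \<tau>" and C: "C > 0"
    and w: "w \<in> borel_measurable (\<F>r t)" "\<And>\<omega>. \<omega> \<in> space P \<Longrightarrow> w \<omega> \<in> {0..1}"
      "\<And>\<omega>. \<omega> \<in> space P \<Longrightarrow> w \<omega> \<noteq> 0 \<Longrightarrow> ennreal t \<le> \<tau> \<omega>"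
    and m: "(\<lambda>\<omega>. exp_mart a (enn2real (min (\<tau> \<omega>) (ennreal T))) \<omega>) \<in> borel_measurable P"
  shows "expectation (\<lambda>\<omega>. w \<omega> * exp_mart a t \<omega>) \<le>
    expectation (\<lambda>\<omega>. w \<omega> * min C (exp_mart a (enn2real (min (\<tau> \<omega>) (ennreal T))) \<omega>))
    + expectation (\<lambda>\<omega>. (exp_mart a T \<omega>)\<^sup>2) / C"
proof -
  define s where "s n k = t + (T - t) / real (Suc n) * real k" for n k
  define S where "S n = sampled a (s n) \<tau> (Suc n)" for n
  have s: "0 \<le> s n 0" "\<And>k. s n (Suc k) = s n k + (T - t) / real (Suc n)" "(T - t) / real (Suc n) > 0" "s n 0 = t" "s n (Suc n) = T" for n
    using t by (auto simp: s_def distrib_left simp del: of_nat_Suc) (simp add: distrib_left add_divide_distrib)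
  note se = sampled_expectation[OF s(1-3) \<tau>, unfolded s(4), OF w, of a]
  have wP: "w \<in> borel_measurable P" using w(1) measurable_from_filtration by blast
  have S0: "S n \<omega> \<ge> 0" for n \<omega>
  proof -
    have "sampled a f \<tau> k \<omega> \<ge> 0" for k f by (induction k) (auto simp: exp_mart_pos less_imp_le)
    then show ?thesis unfolding S_def .
  qed
  have Sm: "S n \<in> borel_measurable P" for n unfolding S_def by (rule se(1))
  have b: "expectation (\<lambda>\<omega>. w \<omega> * exp_mart a t \<omega>) \<le> expectation (\<lambda>\<omega>. w \<omega> * min C (S n \<omega>)) + expectation (\<lambda>\<omega>. (exp_mart a T \<omega>)\<^sup>2) / C" for n
  proof -
    have i: "integrable P (\<lambda>\<omega>. w \<omega> * min C (S n \<omega>))"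
      using w(2) wP Sm S0 C
      by (intro integrable_const_bound[of _ C]) (auto simp: abs_mult intro!: AE_I2 mult_le_one order_trans[OF mult_left_le_one_le])
    have i2: "integrable P (\<lambda>\<omega>. w \<omega> * (S n \<omega>)\<^sup>2 / C)" unfolding S_def by (intro integrable_divide se(4))
    have "expectation (\<lambda>\<omega>. w \<omega> * exp_mart a t \<omega>) = expectation (\<lambda>\<omega>. w \<omega> * S n \<omega>)"
      unfolding S_def by (rule se(3)[symmetric])
    also have "\<dots> \<le> expectation (\<lambda>\<omega>. w \<omega> * min C (S n \<omega>) + w \<omega> * (S n \<omega>)\<^sup>2 / C)"
    proof (rule integral_mono)
      show "integrable P (\<lambda>\<omega>. w \<omega> * S n \<omega>)" using se(2) unfolding S_def .
      show "integrable P (\<lambda>\<omega>. w \<omega> * min C (S n \<omega>) + w \<omega> * (S n \<omega>)\<^sup>2 / C)" using i i2 by simp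
      fix \<omega> assume "\<omega> \<in> space P"
      then have w0: "0 \<le> w \<omega>" using w(2) by auto
      have "S n \<omega> \<le> min C (S n \<omega>) + (S n \<omega>)\<^sup>2 / C"
      proof (cases "S n \<omega> \<le> C")
        case False
        then have "S n \<omega> * C \<le> (S n \<omega>)\<^sup>2" using C by (simp add: power2_eq_square)
        then have "S n \<omega> \<le> (S n \<omega>)\<^sup>2 / C" using C by (simp add: pos_le_divide_eq)
        then show ?thesis using False C by linarith
      qed (use C in simp)
      from mult_left_mono[OF this w0] show "w \<omega> * S n \<omega> \<le> w \<omega> * min C (S n \<omega>) + w \<omega> * (S n \<omega>)\<^sup>2 / C"
        by (simp add: distrib_left add_divide_distrib)
    qed
    also have "\<dots> = expectation (\<lambda>\<omega>. w \<omega> * min C (S n \<omega>)) + expectation (\<lambda>\<omega>. w \<omega> * (S n \<omega>)\<^sup>2) / C"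
      using i i2 by simp
    also have "expectation (\<lambda>\<omega>. w \<omega> * (S n \<omega>)\<^sup>2) / C \<le> expectation (\<lambda>\<omega>. (exp_mart a T \<omega>)\<^sup>2) / C"
      using se(5)[of n "Suc n"] C unfolding S_def s(5) by (intro divide_right_mono) auto
    finally show ?thesis by simp
  qed
  have Bc: "AE \<omega> in P. continuous_on {0..} (\<lambda>t. B t \<omega>)"
    using brownian unfolding brownian_motion_def by blast
  have "(\<lambda>n. expectation (\<lambda>\<omega>. w \<omega> * min C (S n \<omega>))) \<longlonglongrightarrow>
      expectation (\<lambda>\<omega>. w \<omega> * min C (exp_mart a (enn2real (min (\<tau> \<omega>) (ennreal T))) \<omega>))"
  proof (rule integral_dominated_convergence[where w="\<lambda>_. C"])
    show "AE \<omega> in P. (\<lambda>n. w \<omega> * min C (S n \<omega>)) \<longlonglongrightarrow> w \<omega> * min C (exp_mart a (enn2real (min (\<tau> \<omega>) (ennreal T))) \<omega>)"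
      using Bc AE_space
    proof eventually_elim
      fix \<omega> assume Bc: "continuous_on {0..} (\<lambda>t. B t \<omega>)" and \<omega>: "\<omega> \<in> space P"
      show "(\<lambda>n. w \<omega> * min C (S n \<omega>)) \<longlonglongrightarrow> w \<omega> * min C (exp_mart a (enn2real (min (\<tau> \<omega>) (ennreal T))) \<omega>)"
      proof (cases "w \<omega> = 0")
        case False
        then have tt: "ennreal (s n 0) \<le> \<tau> \<omega>" for n using w(3)[OF \<omega>] s(4) by simp
        define \<rho>0 where "\<rho>0 = enn2real (min (\<tau> \<omega>) (ennreal T))"
        have e0: "ennreal \<rho>0 = min (\<tau> \<omega>) (ennreal T)"
          unfolding \<rho>0_def by (intro ennreal_enn2real) (simp add: min_less_iff_disj)
        have "\<exists>\<rho>. 0 \<le> \<rho> \<and> \<bar>\<rho> - \<rho>0\<bar> \<le> (T - t) / real (Suc n) \<and> S n \<omega> = exp_mart a \<rho> \<omega>" for n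
        proof -
          obtain \<rho> where \<rho>: "s n 0 \<le> \<rho>" "\<rho> \<le> T" "min (\<tau> \<omega>) (ennreal T) \<le> ennreal \<rho>"
            "ennreal \<rho> \<le> \<tau> \<omega> + ennreal ((T - t) / real (Suc n))" "S n \<omega> = exp_mart a \<rho> \<omega>"
            using sampled_time[where s="s n" and \<tau>=\<tau> and \<omega>=\<omega>, OF s(1-3) tt, of "Suc n" a] unfolding s(5) S_def by auto
          have "0 \<le> \<rho>" using \<rho>(1) s(1)[of n] by simp
          have "\<rho>0 \<le> \<rho>" using \<rho>(3) \<open>0 \<le> \<rho>\<close> unfolding e0[symmetric] by simp
          have "ennreal \<rho> \<le> ennreal T + ennreal ((T - t) / real (Suc n))"
            using \<rho>(2) by (intro add_increasing2) (auto intro: ennreal_leI)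
          then have "ennreal \<rho> \<le> min (\<tau> \<omega>) (ennreal T) + ennreal ((T - t) / real (Suc n))"
            using \<rho>(4) by (auto simp: min_def)
          then have "ennreal \<rho> \<le> ennreal (\<rho>0 + (T - t) / real (Suc n))"
            unfolding e0[symmetric] using s(3)[of n] by (subst ennreal_plus) (auto simp: \<rho>0_def)
          then have "\<rho> \<le> \<rho>0 + (T - t) / real (Suc n)"
            by (rule ennreal_le_iff[THEN iffD1, rotated]) (use s(3)[of n] in \<open>auto simp: \<rho>0_def intro!: add_nonneg_nonneg\<close>)
          then show ?thesis using \<open>0 \<le> \<rho>\<close> \<open>\<rho>0 \<le> \<rho>\<close> \<rho>(5) by auto
        qed
        then obtain \<rho> where \<rho>: "\<And>n. 0 \<le> \<rho> n" "\<And>n. \<bar>\<rho> n - \<rho>0\<bar> \<le> (T - t) / real (Suc n)" "\<And>n. S n \<omega> = exp_mart a (\<rho> n) \<omega>"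
          by metis
        have conv: "\<rho> \<longlonglongrightarrow> \<rho>0"
        proof (rule LIM_zero_cancel, rule Lim_null_comparison)
          show "\<forall>\<^sub>F n in sequentially. norm (\<rho> n - \<rho>0) \<le> (T - t) / real (Suc n)" using \<rho>(2) by simp
          show "(\<lambda>n. (T - t) / real (Suc n)) \<longlonglongrightarrow> 0" using LIMSEQ_Suc[OF lim_const_over_n] .
        qed
        have cont: "continuous_on {0..} (\<lambda>t. exp_mart a t \<omega>)"
          unfolding exp_mart_def using Bc by (intro continuous_intros) auto
        have "(\<lambda>n. exp_mart a (\<rho> n) \<omega>) \<longlonglongrightarrow> exp_mart a \<rho>0 \<omega>"
          by (rule continuous_on_tendsto_compose[OF cont conv]) (use \<rho>(1) in \<open>auto simp: \<rho>0_def\<close>)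
        then show ?thesis unfolding \<rho>(3) \<rho>0_def by (intro tendsto_intros)
      qed simp
    qed
    show "AE \<omega> in P. norm (w \<omega> * min C (S n \<omega>)) \<le> C" for n
      using w(2) S0 C by (auto simp: abs_mult intro!: AE_I2 order_trans[OF mult_left_le_one_le])
  qed (use wP Sm m in auto)
  from tendsto_add[OF this tendsto_const[of "expectation (\<lambda>\<omega>. (exp_mart a T \<omega>)\<^sup>2) / C"]] show ?thesis
    by (rule LIMSEQ_le_const) (use b in auto)
qed

end

section \<open>Left limits and Stieltjes integrals of distribution functions\<close>

lemma at_left_ennreal_nontrivial: "0 < u \<Longrightarrow> at_left (u::ennreal) \<noteq> bot"
proof
  assume u: "0 < u" and "at_left u = bot"
  then have "eventually (\<lambda>_. False) (at_left u)" by simp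
  then show False unfolding eventually_at_left[OF u] by (meson dense less_imp_le not_less)
qed

lemma left_lim_zero [simp]: "left_lim g 0 = 0"
  by (simp add: left_lim_def)

lemma left_lim_eqI: "0 < u \<Longrightarrow> (g \<longlongrightarrow> l) (at_left u) \<Longrightarrow> left_lim g u = l"
  using at_left_ennreal_nontrivial[of u] by (simp add: left_lim_def tendsto_Lim)

lemma left_lim_cong:
  assumes "\<And>s. s < u \<Longrightarrow> g s = h s" shows "left_lim g u = left_lim h u"
proof (cases "u = 0")
  case False
  have "eventually (\<lambda>s. g s = h s) (at_left u)"
    using assms by (auto simp: eventually_at_filter intro!: always_eventually)
  then have "Lim (at_left u) g = Lim (at_left u) h"
    unfolding t2_space_class.Lim_def by (intro arg_cong[where f=The] ext) (rule tendsto_cong)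
  then show ?thesis by (simp add: left_lim_def)
qed simp

lemma left_lim_const: "left_lim (\<lambda>_. c) u = (if u = 0 then 0 else c)"
  by (auto intro!: left_lim_eqI simp: zero_less_iff_neq_zero)

lemma left_lim_step: "left_lim (\<lambda>s. if c \<le> s then 1 else 0) u = (if c < u then 1 else 0)"
proof (cases "c < u")
  case True
  have "eventually (\<lambda>s. c < s) (at_left u)"
    using True by (auto simp: eventually_at_left[OF True])
  then have "eventually (\<lambda>s. (if c \<le> s then 1 else 0 :: real) = 1) (at_left u)"
    by eventually_elim auto
  then have "((\<lambda>s. if c \<le> s then 1 else 0 :: real) \<longlongrightarrow> 1) (at_left u)" by (rule tendsto_eventually)
  then show ?thesis using True by (simp add: left_lim_eqI order_le_less_trans[OF zero_le])
next
  case False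
  then have "left_lim (\<lambda>s. if c \<le> s then 1 else 0 :: real) u = left_lim (\<lambda>_. 0) u"
    by (intro left_lim_cong) auto
  then show ?thesis using False by (simp add: left_lim_const)
qed

lemma left_lim_tendsto:
  assumes g: "mono g" "\<And>s. g s \<le> (1::real)" and u: "0 < u"
  shows "(g \<longlongrightarrow> left_lim g u) (at_left u)"
proof -
  define l where "l = (SUP s\<in>{..<u}. g s)"
  have bdd: "bdd_above (g ` {..<u})" using g(2) by (intro bdd_aboveI2)
  have "(g \<longlongrightarrow> l) (at_left u)"
  proof (rule increasing_tendsto)
    show "eventually (\<lambda>s. g s \<le> l) (at_left u)"
      unfolding l_def using bdd by (auto simp: eventually_at_filter intro!: always_eventually cSUP_upper)
    fix y assume "y < l"
    then obtain s where s: "s < u" "y < g s"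
      unfolding l_def using less_cSUP_iff[OF _ bdd] u by auto
    then show "eventually (\<lambda>s. y < g s) (at_left u)"
      unfolding eventually_at_left[OF u] using monoD[OF g(1)] by (meson less_imp_le order_less_le_trans)
  qed
  then show ?thesis using left_lim_eqI[OF u] by simp
qed

lemma left_lim_bounds:
  assumes g: "mono g" "\<And>s. 0 \<le> g s" "\<And>s. g s \<le> (1::real)"
  shows "0 \<le> left_lim g u" "left_lim g u \<le> g u" "s < u \<Longrightarrow> g s \<le> left_lim g u"
proof -
  have "0 \<le> left_lim g u \<and> left_lim g u \<le> g u \<and> (s < u \<longrightarrow> g s \<le> left_lim g u)"
  proof (cases "u = 0")
    case False
    then have u: "0 < u" by (simp add: zero_less_iff_neq_zero)
    note t = left_lim_tendsto[OF g(1,3) u] and nb = at_left_ennreal_nontrivial[OF u]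
    have "0 \<le> left_lim g u"
      using t by (rule tendsto_lowerbound) (use g nb in auto)
    moreover have "left_lim g u \<le> g u"
      using t by (rule tendsto_upperbound) (use nb monoD[OF g(1)] in \<open>auto simp: eventually_at_filter less_imp_le intro!: always_eventually\<close>)
    moreover have "g s \<le> left_lim g u" if "s < u"
      using t by (rule tendsto_lowerbound)
        (use nb monoD[OF g(1)] that in \<open>auto simp: eventually_at_left[OF that] less_imp_le\<close>)
    ultimately show ?thesis by blast
  qed (use g in auto)
  then show "0 \<le> left_lim g u" "left_lim g u \<le> g u" "s < u \<Longrightarrow> g s \<le> left_lim g u" by auto
qed

text \<open>
  A distribution function is a path of the first component of a strategy.  The Stieltjes measure lives
  on the finite times; what is missing from mass 1 sits at \<open>\<infinity>\<close>.
\<close>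

locale distribution_path =
  fixes g :: "ennreal \<Rightarrow> real"
  assumes nonneg: "0 \<le> g t" and le_one: "g t \<le> 1" and mono_g: "mono g"
    and right_cont: "(g \<longlongrightarrow> g t) (at_right t)"
begin

definition extended :: "real \<Rightarrow> real"
  where "extended s = (if s < 0 then 0 else g (ennreal s))"

definition \<nu> :: "real measure"
  where "\<nu> = interval_measure extended"

lemma extended_mono: "s \<le> t \<Longrightarrow> extended s \<le> extended t"
  using monoD[OF mono_g] nonneg by (auto simp: extended_def ennreal_leI)

lemma extended_right_cont: "continuous (at_right s) extended"
proof (cases "s < 0")
  case True
  have "eventually (\<lambda>u. u < 0) (at_right s)"
    using True by (auto simp: eventually_at_right[OF True])
  then have "eventually (\<lambda>u. extended u = extended s) (at_right s)"
    by eventually_elim (use True in \<open>simp add: extended_def\<close>)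
  then show ?thesis unfolding continuous_within by (rule tendsto_eventually)
next
  case False
  have "filterlim ennreal (at_right (ennreal s)) (at_right s)"
    unfolding filterlim_at
  proof
    show "(ennreal \<longlongrightarrow> ennreal s) (at_right s)" by (intro tendsto_intros)
    show "\<forall>\<^sub>F u in at_right s. ennreal u \<in> {ennreal s<..} \<and> ennreal u \<noteq> ennreal s"
      using False by (auto simp: eventually_at_filter ennreal_less_iff intro!: always_eventually)
  qed
  from filterlim_compose[OF right_cont this]
  have "((\<lambda>u. g (ennreal u)) \<longlongrightarrow> g (ennreal s)) (at_right s)" .
  moreover have "eventually (\<lambda>u. g (ennreal u) = extended u) (at_right s)"
    using False by (auto simp: eventually_at_filter extended_def intro!: always_eventually)
  ultimately have "(extended \<longlongrightarrow> g (ennreal s)) (at_right s)" by (rule Lim_transform_eventually)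
  then show ?thesis using False unfolding continuous_within by (simp add: extended_def)
qed

lemma sets_\<nu> [simp, measurable_cong]: "sets \<nu> = sets borel" and space_\<nu> [simp]: "space \<nu> = UNIV"
  by (simp_all add: \<nu>_def)

lemma emeasure_Ioc: "a \<le> b \<Longrightarrow> emeasure \<nu> {a<..b} = ennreal (extended b - extended a)"
  unfolding \<nu>_def by (rule emeasure_interval_measure_Ioc) (use extended_mono extended_right_cont in auto)

lemma emeasure_initial:
  assumes "0 \<le> t" shows "emeasure \<nu> {0..t} = ennreal (g (ennreal t))"
proof -
  (* The atom of mass g 0 at time 0 is visible only in intervals that start before 0. *)
  have "emeasure \<nu> {-1<..t} = ennreal (g (ennreal t))"
    using emeasure_Ioc[of "-1" t] assms by (simp add: extended_def)
  moreover have "emeasure \<nu> {-1<..t} = emeasure \<nu> {0..t} + emeasure \<nu> {-1<..<0}"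
    using assms by (subst plus_emeasure) (auto intro!: arg_cong[where f="emeasure \<nu>"])
  moreover have "emeasure \<nu> {-1<..<0} = 0"
  proof -
    have "emeasure \<nu> {-1<..<0} \<le> emeasure \<nu> (\<Union>n. {-1<..- (1 / real (Suc n))})"
    proof (intro emeasure_mono subsetI)
      fix y :: real assume y: "y \<in> {-1<..<0}"
      then obtain n where "1 / real (Suc n) < - y" using nat_approx_posE[of "- y"] by auto
      then show "y \<in> (\<Union>n. {-1<..- (1 / real (Suc n))})" using y by (intro UN_I[of n]) auto
    qed auto
    also have "\<dots> = 0"
    proof (intro emeasure_UN_eq_0)
      fix n show "emeasure \<nu> {-1<..- (1 / real (Suc n))} = 0"
        by (subst emeasure_Ioc) (auto simp: extended_def)
    qed auto
    finally show ?thesis by simp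
  qed
  ultimately show ?thesis by simp
qed

definition before :: "ennreal \<Rightarrow> real set"
  where "before \<tau> = {s. 0 \<le> s \<and> ennreal s < \<tau>}"

lemma before_borel [measurable]: "before \<tau> \<in> sets borel"
  unfolding before_def by measurable

lemma emeasure_before: "emeasure \<nu> (before \<tau>) = ennreal (left_lim g \<tau>)"
proof (cases "\<tau> = 0")
  case False
  then have \<tau>: "0 < \<tau>" by (simp add: zero_less_iff_neq_zero)
  obtain u :: "nat \<Rightarrow> real" where u: "incseq u" "\<And>n. 0 \<le> u n" "\<And>n. ennreal (u n) < \<tau>"
      "(\<lambda>n. ennreal (u n)) \<longlonglongrightarrow> \<tau>"
  proof (cases \<tau>)
    case (real t)
    define u where "u n = t - t / real (Suc n)" for n
    have t: "t > 0" using real \<tau> by simp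
    have "u \<longlonglongrightarrow> t - 0" unfolding u_def by (intro tendsto_intros LIMSEQ_Suc[OF lim_const_over_n])
    then have "(\<lambda>n. ennreal (u n)) \<longlonglongrightarrow> \<tau>" using real by (auto intro!: tendsto_intros)
    moreover have "incseq u" unfolding u_def incseq_def using t
      by (intro allI impI diff_left_mono divide_left_mono) auto
    moreover have "0 \<le> u n" "ennreal (u n) < \<tau>" for n
      using t real by (auto simp: u_def field_simps ennreal_less_iff)
    ultimately show ?thesis using that by blast
  next
    case top
    have "(\<lambda>n. ennreal (real n)) \<longlonglongrightarrow> \<tau>"
      using of_nat_tendsto_top_ennreal top by (simp add: ennreal_of_nat_eq_real_of_nat)
    then show ?thesis using top by (intro that[of real]) (auto simp: incseq_def)
  qed
  let ?f = "\<lambda>n. ennreal (u n)"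
  have U: "before \<tau> = (\<Union>n. {0..u n})"
  proof (intro set_eqI iffI)
    fix s assume s: "s \<in> before \<tau>"
    then obtain n where "ennreal s < ennreal (u n)"
      using order_tendstoD(1)[OF u(4), of "ennreal s"] unfolding before_def by (auto dest: eventually_happens)
    then have "s \<le> u n" using s by (auto simp: before_def ennreal_less_iff)
    then show "s \<in> (\<Union>n. {0..u n})" using s by (auto simp: before_def)
  next
    fix s assume "s \<in> (\<Union>n. {0..u n})"
    then obtain n where "0 \<le> s" "s \<le> u n" by auto
    then have "ennreal s \<le> ennreal (u n)" by (intro ennreal_leI)
    then show "s \<in> before \<tau>" using u(3)[of n] \<open>0 \<le> s\<close> by (auto simp: before_def)
  qed
  have inc: "incseq (\<lambda>n. {0..u n})"
    using u(1) by (auto simp: incseq_def intro: order_trans)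
  have "(\<lambda>n. emeasure \<nu> {0..u n}) \<longlonglongrightarrow> emeasure \<nu> (before \<tau>)"
    unfolding U by (rule Lim_emeasure_incseq) (use inc in auto)
  moreover have "(\<lambda>n. emeasure \<nu> {0..u n}) \<longlonglongrightarrow> ennreal (left_lim g \<tau>)"
  proof -
    have "filterlim ?f (at_left \<tau>) sequentially"
      unfolding filterlim_at using u(3,4) by (auto simp: less_imp_neq)
    from filterlim_compose[OF left_lim_tendsto[OF mono_g le_one \<tau>] this]
    have "(\<lambda>n. ennreal (g (?f n))) \<longlonglongrightarrow> ennreal (left_lim g \<tau>)" by (intro tendsto_intros)
    moreover have "emeasure \<nu> {0..u n} = ennreal (g (?f n))" for n
      using emeasure_initial u(2) by simp
    ultimately show ?thesis by simp
  qed
  ultimately show ?thesis by (rule LIMSEQ_unique)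
qed (simp add: before_def)

lemma measure_before: "measure \<nu> (before \<tau>) = left_lim g \<tau>"
  unfolding measure_def emeasure_before using left_lim_bounds(1)[OF mono_g nonneg le_one] by simp

lemma finite_on_before: "emeasure \<nu> (before \<tau>) < \<infinity>"
  by (simp add: emeasure_before)

lemma stieltjes_eq: "stieltjes_integral \<tau> g f = set_lebesgue_integral \<nu> (before \<tau>) (\<lambda>s. f (ennreal s))"
  by (simp add: stieltjes_integral_def \<nu>_def extended_def[abs_def] before_def)

end

section \<open>Sampling continuous processes at random times\<close>

text \<open>
  Rounding the random time up to multiples of \<open>1 / n\<close> leaves countably many cases; continuity of the
  paths recovers the limit.
\<close>

lemma borel_measurable_at_random_time:
  fixes Y :: "real \<Rightarrow> 'b \<Rightarrow> real" and h :: "'b \<Rightarrow> real"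
  assumes Y: "\<And>s. 0 \<le> s \<Longrightarrow> Y s \<in> borel_measurable M"
    and cont: "\<And>\<omega>. \<omega> \<in> space M \<Longrightarrow> continuous_on {0..} (\<lambda>s. Y s \<omega>)"
    and h: "h \<in> borel_measurable M" "\<And>\<omega>. 0 \<le> h \<omega>"
  shows "(\<lambda>\<omega>. Y (h \<omega>) \<omega>) \<in> borel_measurable M"
proof (rule borel_measurable_LIMSEQ_real)
  define d where "d n \<omega> = real (nat \<lceil>h \<omega> * real (Suc n)\<rceil>) / real (Suc n)" for n \<omega>
  show "(\<lambda>\<omega>. Y (d n \<omega>) \<omega>) \<in> borel_measurable M" for n
  proof -
    have "(\<lambda>\<omega>. Y (real k / real (Suc n)) \<omega>) \<in> borel_measurable M" for k using Y by simp
    moreover have "(\<lambda>\<omega>. nat \<lceil>h \<omega> * real (Suc n)\<rceil>) \<in> measurable M (count_space UNIV)"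
      using h(1) by measurable
    ultimately show ?thesis unfolding d_def
      by (rule measurable_compose_countable[where f="\<lambda>k \<omega>. Y (real k / real (Suc n)) \<omega>"])
  qed
  fix \<omega> assume \<omega>: "\<omega> \<in> space M"
  have d: "0 \<le> d n \<omega>" "h \<omega> \<le> d n \<omega>" "d n \<omega> \<le> h \<omega> + 1 / real (Suc n)" for n
  proof -
    have e: "real (nat \<lceil>h \<omega> * real (Suc n)\<rceil>) = of_int \<lceil>h \<omega> * real (Suc n)\<rceil>"
      using h(2)[of \<omega>] by simp
    have "h \<omega> * real (Suc n) \<le> real (nat \<lceil>h \<omega> * real (Suc n)\<rceil>)"
      "real (nat \<lceil>h \<omega> * real (Suc n)\<rceil>) \<le> h \<omega> * real (Suc n) + 1"
      unfolding e by linarith+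
    then show "0 \<le> d n \<omega>" "h \<omega> \<le> d n \<omega>" "d n \<omega> \<le> h \<omega> + 1 / real (Suc n)"
      unfolding d_def by (auto simp: field_simps simp del: of_nat_Suc)
  qed
  have conv: "(\<lambda>n. d n \<omega>) \<longlonglongrightarrow> h \<omega>"
  proof (rule tendsto_sandwich[of "\<lambda>_. h \<omega>" _ _ "\<lambda>n. h \<omega> + 1 / real (Suc n)"])
    show "(\<lambda>n. h \<omega> + 1 / real (Suc n)) \<longlonglongrightarrow> h \<omega>"
      using tendsto_add[OF tendsto_const LIMSEQ_Suc[OF lim_1_over_n], of "h \<omega>"] by simp
  qed (use d in auto)
  show "(\<lambda>n. Y (d n \<omega>) \<omega>) \<longlonglongrightarrow> Y (h \<omega>) \<omega>"
    by (rule continuous_on_tendsto_compose[OF cont[OF \<omega>] conv]) (use h(2) d(1) in auto)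
qed

text \<open>
  Right-continuity of the filtration: \<open>{T \<le> t}\<close> is the intersection of the events \<open>{T < s}\<close>, for \<open>s\<close>
  decreasing to \<open>t\<close>.
\<close>

lemma (in usual_filtration) stopping_timeI_less:
  assumes "\<And>t. t < \<infinity> \<Longrightarrow> {\<omega> \<in> space P. T \<omega> < t} \<in> sets (\<F> t)"
  shows "stopping_time \<F> T"
proof
  fix t
  show "Measurable.pred (\<F> t) (\<lambda>\<omega>. T \<omega> \<le> t)"
  proof (cases "t = \<infinity>")
    case False
    then have t: "t < \<infinity>" by (simp add: less_top)
    have "{\<omega> \<in> space P. T \<omega> \<le> t} \<in> sets (\<F> s)" if s: "t < s" for s
    proof -
      obtain s' where s': "t < s'" "s' < s" using dense[OF s] by blast
      then have s'f: "s' < \<infinity>" using top_greatest order_less_le_trans unfolding infinity_ennreal_def by blast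
      obtain u :: "nat \<Rightarrow> ennreal" where u: "\<And>n. t < u n" "u \<longlonglongrightarrow> t"
        using approx_from_above_dense_linorder[OF s'(1)] by blast
      have "{\<omega> \<in> space P. T \<omega> \<le> t} = (\<Inter>n. {\<omega> \<in> space P. T \<omega> < min s' (u n)})"
      proof (intro set_eqI iffI)
        fix \<omega> assume h: "\<omega> \<in> (\<Inter>n. {\<omega> \<in> space P. T \<omega> < min s' (u n)})"
        have "T \<omega> \<le> t"
          using u(2) by (rule tendsto_lowerbound) (use h in \<open>auto simp: less_imp_le\<close>)
        then show "\<omega> \<in> {\<omega> \<in> space P. T \<omega> \<le> t}" using h by auto
      qed (use u(1) s' in \<open>auto intro: le_less_trans\<close>)
      moreover have "{\<omega> \<in> space P. T \<omega> < min s' (u n)} \<in> sets (\<F> s)" for n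
      proof -
        have "min s' (u n) < \<infinity>" using s'f by (simp add: min_less_iff_disj)
        from assms[OF this] show ?thesis using sets_F_mono[of "min s' (u n)" s] s' by (auto simp: min.coboundedI1)
      qed
      ultimately show ?thesis by auto
    qed
    then have "{\<omega> \<in> space P. T \<omega> \<le> t} \<in> (\<Inter>s\<in>{t<..}. sets (\<F> s))" by auto
    then show ?thesis using right_continuous_filtration[OF t] by (simp add: pred_def space_F)
  qed simp
qed

section \<open>The entry time and the equilibrium strategies\<close>

locale entry_game = gbm_sde P \<F> B \<mu> \<sigma> x X + entry_parameters \<mu> \<sigma> m I r
  for P :: "'a measure" and \<F> :: "ennreal \<Rightarrow> 'a measure" and B :: "real \<Rightarrow> 'a \<Rightarrow> real"
    and \<mu> \<sigma> x :: real and X :: "real \<Rightarrow> 'a \<Rightarrow> real" and m I r :: real +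
  assumes start: "x \<ge> 0"
begin

abbreviation "L \<equiv> discounted_process r lv X"
abbreviation "F \<equiv> discounted_process r fv X"
abbreviation "M \<equiv> discounted_process r sv X"

definition entry_time :: "('a \<Rightarrow> ennreal) \<Rightarrow> 'a \<Rightarrow> ennreal"
  where "entry_time \<theta> \<omega> = min (hitting_time X {xP<..<xF} \<theta> \<omega>) (hitting_time X {xF..} \<theta> \<omega>)"

lemma entry_time_eq: "entry_time \<theta> \<omega> = hitting_time X {xP<..} \<theta> \<omega>"
proof -
  let ?S = "\<lambda>A. {ennreal s | s. 0 \<le> s \<and> \<theta> \<omega> \<le> ennreal s \<and> X s \<omega> \<in> A}"
  have "?S {xP<..} = ?S {xP<..<xF} \<union> ?S {xF..}" using x_P_less by force
  then show ?thesis unfolding entry_time_def hitting_time_def by (simp add: Inf_union_distrib inf_min)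
qed

lemma entry_time_ge: "\<theta> \<omega> \<le> entry_time \<theta> \<omega>"
  unfolding entry_time_eq hitting_time_def by (rule Inf_greatest) auto

lemma entry_time_le: "0 \<le> s \<Longrightarrow> \<theta> \<omega> \<le> ennreal s \<Longrightarrow> xP < X s \<omega> \<Longrightarrow> entry_time \<theta> \<omega> \<le> ennreal s"
  unfolding entry_time_eq hitting_time_def by (rule Inf_lower) auto

lemma before_entry: "0 \<le> s \<Longrightarrow> \<theta> \<omega> \<le> ennreal s \<Longrightarrow> ennreal s < entry_time \<theta> \<omega> \<Longrightarrow> X s \<omega> \<le> xP"
  using entry_time_le[of s \<theta> \<omega>] by force

lemma entry_time_less:
  assumes "entry_time \<theta> \<omega> < t"
  obtains s where "0 \<le> s" "\<theta> \<omega> \<le> ennreal s" "xP < X s \<omega>" "ennreal s < t"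
  using assms unfolding entry_time_eq hitting_time_def Inf_less_iff by auto

lemma visit_persists:
  assumes "\<omega> \<in> space P" "0 \<le> s" "xP < X s \<omega>"
  obtains d where "d > 0" "\<And>u. s \<le> u \<Longrightarrow> u < s + d \<Longrightarrow> xP < X u \<omega>"
proof -
  have "continuous (at s within {0..}) (\<lambda>t. X t \<omega>)"
    using continuous_X[OF assms(1)] assms(2) by (simp add: continuous_on_eq_continuous_within)
  then have "\<forall>\<^sub>F u in at s within {0..}. xP < X u \<omega>"
    unfolding continuous_within using assms(3) by (rule order_tendstoD(1))
  then obtain d where d: "d > 0" "\<And>u. u \<in> {0..} \<Longrightarrow> u \<noteq> s \<Longrightarrow> dist u s < d \<Longrightarrow> xP < X u \<omega>"
    unfolding eventually_at by auto
  show ?thesis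
  proof (rule that[OF d(1)])
    fix u assume "s \<le> u" "u < s + d"
    then show "xP < X u \<omega>" using d(2)[of u] assms by (cases "u = s") (auto simp: dist_real_def)
  qed
qed

text \<open>
  The region \<open>(xP, \<infinity>)\<close> is open, so that every visit contains rational times.  Countably many
  conditions therefore decide whether entry occurs before \<open>t\<close>.
\<close>

lemma entry_time_less_iff:
  assumes \<omega>: "\<omega> \<in> space P"
  shows "entry_time \<theta> \<omega> < t \<longleftrightarrow> (\<exists>q\<in>{q\<in>\<rat>. 0 \<le> q \<and> ennreal q < t}. \<theta> \<omega> \<le> ennreal q \<and> xP < X q \<omega>)"
proof
  assume "entry_time \<theta> \<omega> < t"
  then obtain s where s: "0 \<le> s" "\<theta> \<omega> \<le> ennreal s" "xP < X s \<omega>" "ennreal s < t" by (rule entry_time_less)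
  obtain d where d: "d > 0" "\<And>u. s \<le> u \<Longrightarrow> u < s + d \<Longrightarrow> xP < X u \<omega>"
    using visit_persists[OF \<omega> s(1,3)] by blast
  obtain t' where t': "s < t'" "ennreal t' \<le> t" "t' \<le> s + d"
  proof (cases t)
    case (real v)
    then show ?thesis using that[of "min v (s + d)"] s d(1) by (auto simp: ennreal_less_iff intro!: ennreal_leI)
  next
    case top
    then show ?thesis using that[of "s + d"] d(1) by auto
  qed
  obtain q where q: "q \<in> \<rat>" "s < q" "q < t'" using Rats_dense_in_real[OF t'(1)] by blast
  then have "ennreal q < t" using t' s by (meson ennreal_lessI le_less_trans less_imp_le order_less_le_trans)
  moreover have "\<theta> \<omega> \<le> ennreal q" using s(2) q(2) by (meson ennreal_leI less_imp_le order_trans)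
  moreover have "xP < X q \<omega>" using d(2)[of q] q t' by simp
  ultimately show "\<exists>q\<in>{q\<in>\<rat>. 0 \<le> q \<and> ennreal q < t}. \<theta> \<omega> \<le> ennreal q \<and> xP < X q \<omega>" using q s by auto
qed (auto dest: entry_time_le intro: le_less_trans)

lemma stopping_time_entry:
  assumes \<theta>: "stopping_time \<F> \<theta>" shows "stopping_time \<F> (entry_time \<theta>)"
proof (rule stopping_timeI_less)
  fix t :: ennreal assume "t < \<infinity>"
  have "{\<omega> \<in> space P. entry_time \<theta> \<omega> < t} =
      {\<omega> \<in> space (\<F> t). \<exists>q\<in>{q\<in>\<rat>. 0 \<le> q \<and> ennreal q < t}. \<theta> \<omega> \<le> ennreal q \<and> xP < X q \<omega>}"
    using entry_time_less_iff by (auto simp: space_F)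
  also have "\<dots> \<in> sets (\<F> t)"
  proof (rule sets.sets_Collect_countable_Ex')
    fix q assume "q \<in> {q\<in>\<rat>. 0 \<le> q \<and> ennreal q < t}"
    then have q: "0 \<le> q" "ennreal q \<le> t" by auto
    have [measurable]: "X q \<in> borel_measurable (\<F> t)"
      using measurable_X[OF q(1) order_refl] q(2) by (rule measurable_filtration_mono)
    have [measurable]: "Measurable.pred (\<F> t) (\<lambda>\<omega>. \<theta> \<omega> \<le> ennreal q)"
      using \<theta> q(2) by (rule stopping_time_le_const)
    show "{\<omega> \<in> space (\<F> t). \<theta> \<omega> \<le> ennreal q \<and> xP < X q \<omega>} \<in> sets (\<F> t)" by measurable
  qed (auto intro: countable_subset[OF _ countable_rat])
  finally show "{\<omega> \<in> space P. entry_time \<theta> \<omega> < t} \<in> sets (\<F> t)" .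
qed

lemma measurable_X_random:
  assumes N: "\<And>s. 0 \<le> s \<Longrightarrow> s \<le> t \<Longrightarrow> X s \<in> borel_measurable N" "space N = space P"
    and h: "h \<in> borel_measurable N" "\<And>\<omega>. 0 \<le> h \<omega>" "\<And>\<omega>. h \<omega> \<le> t"
  shows "(\<lambda>\<omega>. X (h \<omega>) \<omega>) \<in> borel_measurable N"
proof -
  have t: "0 \<le> t" using h(2,3) order_trans by blast
  have "(\<lambda>\<omega>. X (min t (h \<omega>)) \<omega>) \<in> borel_measurable N"
  proof (rule borel_measurable_at_random_time[where Y="\<lambda>s. X (min t s)"])
    show "0 \<le> s \<Longrightarrow> X (min t s) \<in> borel_measurable N" for s using N t by simp
    show "continuous_on {0..} (\<lambda>s. X (min t s) \<omega>)" if "\<omega> \<in> space N" for \<omega>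
      using that N(2) t by (intro continuous_on_compose2[OF continuous_X]) (auto intro!: continuous_intros)
  qed (use h in auto)
  then show ?thesis using h(3) by (simp add: min_absorb2)
qed

lemma measurable_process_at:
  assumes T: "T \<in> borel_measurable P" and v: "v \<in> borel_measurable borel"
  shows "(\<lambda>\<omega>. discounted_process r v X (T \<omega>) \<omega>) \<in> borel_measurable P"
proof -
  have [measurable]: "(\<lambda>\<omega>. X (enn2real (T \<omega>)) \<omega>) \<in> borel_measurable P"
    by (rule borel_measurable_at_random_time) (use T continuous_X in \<open>auto intro: measurable_X_P\<close>)
  note [measurable] = T v
  show ?thesis unfolding discounted_process_def infinity_ennreal_def by measurable
qed

text \<open>
  The intensity of the equilibrium strategy as a function of the state.
\<close>

definition preempt :: "real \<Rightarrow> real"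
  where "preempt y = (if y \<le> xP then 0 else if y < xF then (lv y - fv y) / (lv y - sv y) else 1)"

lemma entry_alpha_eq:
  "entry_alpha L F M \<theta> t \<omega> = (if t = \<infinity> then 1 else if t < \<theta> \<omega> then 0 else preempt (X (enn2real t) \<omega>))"
proof (cases "t = \<infinity>")
  case False
  let ?e = "exp (- r * enn2real t)" and ?y = "X (enn2real t) \<omega>"
  have e: "?e > 0" by simp
  have "(?e * lv ?y - ?e * fv ?y) / (?e * lv ?y - ?e * sv ?y) = (lv ?y - fv ?y) / (lv ?y - sv ?y)"
    unfolding right_diff_distrib[symmetric] using e by (simp add: mult_divide_mult_cancel_left)
  then show ?thesis
    using False e fv_less_lv_iff[of ?y] fv_eq_sv_iff[of ?y] x_P_less
    unfolding entry_alpha_def discounted_process_def preempt_def by auto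
qed (simp add: entry_alpha_def)

lemma preempt_interior: "xP < y \<Longrightarrow> y < xF \<Longrightarrow> 0 < preempt y \<and> preempt y < 1"
  using fv_less_lv_iff[of y] sv_less_fv[of y] by (simp add: preempt_def)

lemma preempt_bounds: "0 \<le> preempt y" "preempt y \<le> 1"
  using preempt_interior[of y] by (cases "y \<le> xP"; cases "y < xF"; simp add: preempt_def)+

lemma preempt_pos_iff: "0 < preempt y \<longleftrightarrow> xP < y"
  using preempt_interior[of y] by (cases "y \<le> xP"; cases "y < xF"; simp add: preempt_def)

lemma preempt_eq_one_iff: "preempt y = 1 \<longleftrightarrow> xF \<le> y"
  using preempt_interior[of y] x_P_less by (cases "y \<le> xP"; cases "y < xF") (auto simp: preempt_def)

text \<open>
  The intensity is the solution of this equation: an attempt to become leader is worth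
  as much as following, since it ends in simultaneous entry with probability \<open>preempt y\<close>.
\<close>

lemma preempt_indifference: "xP < y \<Longrightarrow> (1 - preempt y) * lv y + preempt y * sv y = fv y"
proof (cases "y < xF")
  case True
  assume "xP < y"
  then have "lv y - sv y \<noteq> 0" "preempt y = (lv y - fv y) / (lv y - sv y)"
    using True fv_less_lv_iff[of y] sv_less_fv[of y] by (auto simp: preempt_def)
  then have "preempt y * (lv y - sv y) = lv y - fv y" by simp
  then show ?thesis by (simp add: algebra_simps)
qed (use x_P_less fv_eq_sv[of y] in \<open>auto simp: preempt_def\<close>)

lemma continuous_preempt: "continuous_on {xP<..<xF} preempt"
proof -
  have "continuous_on {xP<..<xF} (\<lambda>y. (lv y - fv y) / (lv y - sv y))"
    using x_P_pos fv_less_lv_iff sv_less_fv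
    by (intro continuous_intros continuous_on_subset[OF continuous_lv] continuous_on_subset[OF continuous_fv] continuous_sv)
       (auto, metis less_trans order_less_irrefl)
  then show ?thesis by (rule continuous_on_eq) (auto simp: preempt_def)
qed

lemma measurable_preempt [measurable]: "preempt \<in> borel_measurable borel"
  unfolding preempt_def[abs_def] by measurable

lemma tendsto_X_right:
  assumes "\<omega> \<in> space P" "t < \<infinity>"
  shows "((\<lambda>s. X (enn2real s) \<omega>) \<longlongrightarrow> X (enn2real t) \<omega>) (at_right t)"
proof -
  have "continuous (at (enn2real t) within {0..}) (\<lambda>t. X t \<omega>)"
    using continuous_X[OF assms(1)] by (simp add: continuous_on_eq_continuous_within)
  moreover have "(enn2real \<longlongrightarrow> enn2real t) (at_right t)"
    using assms(2) by (intro tendsto_enn2real tendsto_ident_at) (auto simp: less_top)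
  ultimately show ?thesis
    by (intro continuous_within_tendsto_compose[of "enn2real t" "{0..}" "\<lambda>t. X t \<omega>"]) auto
qed

lemma entry_alpha_right_continuous:
  assumes \<omega>: "\<omega> \<in> space P" and a: "0 < entry_alpha L F M \<theta> t \<omega>" "entry_alpha L F M \<theta> t \<omega> < 1"
  shows "((\<lambda>s. entry_alpha L F M \<theta> s \<omega>) \<longlongrightarrow> entry_alpha L F M \<theta> t \<omega>) (at_right t)"
proof -
  have t: "t < \<infinity>" "\<theta> \<omega> \<le> t" "entry_alpha L F M \<theta> t \<omega> = preempt (X (enn2real t) \<omega>)"
    using a unfolding entry_alpha_eq by (auto split: if_splits simp: less_top)
  then have y: "X (enn2real t) \<omega> \<in> {xP<..<xF}"
    using a preempt_pos_iff preempt_eq_one_iff by (auto simp: not_le) (metis linorder_not_less order_less_irrefl)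
  have "isCont preempt (X (enn2real t) \<omega>)"
    using continuous_preempt y by (simp add: continuous_on_eq_continuous_at)
  from isCont_tendsto_compose[OF this tendsto_X_right[OF \<omega> t(1)]]
  have lim: "((\<lambda>s. preempt (X (enn2real s) \<omega>)) \<longlongrightarrow> preempt (X (enn2real t) \<omega>)) (at_right t)" .
  have "eventually (\<lambda>s. s < \<infinity>) (at_right t)"
    using t(1) by (auto simp: eventually_at_right[OF t(1)])
  moreover have "eventually (\<lambda>s. t < s) (at_right t)" by (auto simp: eventually_at_filter)
  ultimately have "eventually (\<lambda>s. preempt (X (enn2real s) \<omega>) = entry_alpha L F M \<theta> s \<omega>) (at_right t)"
    by eventually_elim (use t(2) in \<open>auto simp: entry_alpha_eq\<close>)
  from Lim_transform_eventually[OF lim this] show ?thesis unfolding t(3) .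
qed

lemma measurable_min_stopping_time:
  assumes \<theta>: "stopping_time \<F> \<theta>" shows "(\<lambda>\<omega>. min (\<theta> \<omega>) t) \<in> borel_measurable (\<F> t)"
proof (rule borel_measurableI_le)
  fix y show "{\<omega> \<in> space (\<F> t). min (\<theta> \<omega>) t \<le> y} \<in> sets (\<F> t)"
  proof (cases "t \<le> y")
    case False
    then have "{\<omega> \<in> space (\<F> t). min (\<theta> \<omega>) t \<le> y} = {\<omega> \<in> space (\<F> t). \<theta> \<omega> \<le> y}"
      by (auto simp: min_le_iff_disj)
    then show ?thesis using stopping_time_le_const[OF \<theta>, of y t] False by (simp add: pred_def)
  qed (simp add: min_le_iff_disj)
qed

lemma progressive_entry_alpha:
  assumes \<theta>: "stopping_time \<F> \<theta>" shows "progressive \<F> (entry_alpha L F M \<theta>)"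
  unfolding progressive_def
proof (intro allI impI)
  fix t :: ennreal assume t: "t < \<infinity>"
  then obtain u where u: "t = ennreal u" "0 \<le> u" by (cases t) auto
  let ?N = "restrict_space borel {0..t} \<Otimes>\<^sub>M \<F> t"
  have fstm: "fst \<in> measurable ?N (borel :: ennreal measure)"
    by (rule measurable_compose[OF measurable_fst]) (rule measurable_restrict_space1, simp)
  have sp: "space ?N = {0..t} \<times> space P" by (simp add: space_pair_measure space_restrict_space space_F)
  have Xm: "(\<lambda>p. X (min u (enn2real (fst p))) (snd p)) \<in> borel_measurable ?N"
  proof (rule borel_measurable_at_random_time[where Y="\<lambda>s p. X (min u s) (snd p)" and h="\<lambda>p. enn2real (fst p)"])
    show "(\<lambda>p. X (min u s) (snd p)) \<in> borel_measurable ?N" if "0 \<le> s" for s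
      by (rule measurable_compose[OF measurable_snd]) (use measurable_X[of "min u s" u] that u in auto)
    show "continuous_on {0..} (\<lambda>s. X (min u s) (snd p))" if "p \<in> space ?N" for p
      using that u unfolding sp by (intro continuous_on_compose2[OF continuous_X]) (auto intro!: continuous_intros)
    show "(\<lambda>p. enn2real (fst p)) \<in> borel_measurable ?N" using fstm by measurable
  qed simp
  have lt: "Measurable.pred (\<F> t) (\<lambda>\<omega>. t < \<theta> \<omega>)" using \<theta> by (rule stopping_timeD2)
  have c1: "Measurable.pred ?N (\<lambda>p. fst p < min (\<theta> (snd p)) t)"
    using fstm measurable_compose[OF measurable_snd measurable_min_stopping_time[OF \<theta>]] by (intro borel_measurable_pred_less) auto
  have c2: "Measurable.pred ?N (\<lambda>p. t < \<theta> (snd p))"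
    using measurable_compose[OF measurable_snd lt] .
  have "(\<lambda>p. if t < \<theta> (snd p) \<or> fst p < min (\<theta> (snd p)) t then 0 else preempt (X (min u (enn2real (fst p))) (snd p)))
      \<in> borel_measurable ?N"
    using c1 c2 measurable_compose[OF Xm measurable_preempt] by measurable
  then show "(\<lambda>(s, \<omega>). entry_alpha L F M \<theta> s \<omega>) \<in> borel_measurable ?N"
  proof (rule measurable_cong[THEN iffD1, rotated])
    fix p assume "p \<in> space ?N"
    then have p: "fst p \<le> t" unfolding sp by auto
    then have "enn2real (fst p) \<le> u" using u enn2real_mono[OF p] t by (simp add: less_top)
    moreover have "fst p \<noteq> \<infinity>" using p t by auto
    moreover have "fst p < \<theta> (snd p) \<longleftrightarrow> t < \<theta> (snd p) \<or> fst p < min (\<theta> (snd p)) t"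
      using p by (auto simp: min_def)
    ultimately show "(if t < \<theta> (snd p) \<or> fst p < min (\<theta> (snd p)) t then 0 else preempt (X (min u (enn2real (fst p))) (snd p)))
        = (case p of (s, \<omega>) \<Rightarrow> entry_alpha L F M \<theta> s \<omega>)"
      unfolding entry_alpha_eq split_beta by (simp add: min_absorb2)
  qed
qed

lemma entry_G_right_continuous:
  "((\<lambda>s. entry_G entry_time \<theta> s \<omega>) \<longlongrightarrow> entry_G entry_time \<theta> t \<omega>) (at_right t)"
proof (cases "entry_time \<theta> \<omega> \<le> t")
  case True
  then have "eventually (\<lambda>s. entry_G entry_time \<theta> s \<omega> = entry_G entry_time \<theta> t \<omega>) (at_right t)"
    by (auto simp: entry_G_def eventually_at_filter intro!: always_eventually)
  then show ?thesis by (rule tendsto_eventually)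
next
  case False
  then have lt: "t < entry_time \<theta> \<omega>" by simp
  then have "eventually (\<lambda>s. s < entry_time \<theta> \<omega>) (at_right t)" by (auto simp: eventually_at_right[OF lt])
  then have "eventually (\<lambda>s. entry_G entry_time \<theta> s \<omega> = entry_G entry_time \<theta> t \<omega>) (at_right t)"
    by eventually_elim (use lt in \<open>auto simp: entry_G_def\<close>)
  then show ?thesis by (rule tendsto_eventually)
qed

lemma subgame_strategy_entry:
  assumes \<theta>: "stopping_time \<F> \<theta>"
  shows "subgame_strategy P \<F> \<theta> (entry_G entry_time \<theta>) (entry_alpha L F M \<theta>)"
proof -
  have G1: "entry_G entry_time \<theta> t \<omega> = 1" if "0 < entry_alpha L F M \<theta> t \<omega>" for t \<omega>
  proof (cases t)
    case (real s)
    then have "\<theta> \<omega> \<le> t" "xP < X s \<omega>"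
      using that preempt_pos_iff unfolding entry_alpha_eq by (auto split: if_splits)
    then show ?thesis using entry_time_le[of s \<theta> \<omega>] real by (simp add: entry_G_def)
  qed (simp add: entry_G_def)
  have ad: "adapted \<F> (entry_G entry_time \<theta>)"
    unfolding adapted_def
  proof (intro allI impI)
    fix t
    have [measurable]: "Measurable.pred (\<F> t) (\<lambda>\<omega>. entry_time \<theta> \<omega> \<le> t)"
      by (rule stopping_timeD[OF stopping_time_entry[OF \<theta>]])
    show "entry_G entry_time \<theta> t \<in> borel_measurable (\<F> t)"
      unfolding entry_G_def[abs_def] by measurable
  qed
  show ?thesis
    unfolding subgame_strategy_def
  proof (intro conjI)
    show "\<forall>t. \<forall>\<omega>\<in>space P. entry_G entry_time \<theta> t \<omega> \<in> {0..1} \<and> entry_alpha L F M \<theta> t \<omega> \<in> {0..1}"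
      using preempt_bounds by (auto simp: entry_G_def entry_alpha_eq)
    show "\<forall>\<omega>\<in>space P. entry_G entry_time \<theta> \<infinity> \<omega> = 1 \<and> entry_alpha L F M \<theta> \<infinity> \<omega> = 1"
      by (auto simp: entry_G_def entry_alpha_eq)
    have "mono (\<lambda>t. entry_G entry_time \<theta> t \<omega>)" "\<forall>s<\<theta> \<omega>. entry_G entry_time \<theta> s \<omega> = 0" for \<omega>
      using entry_time_ge[of \<theta> \<omega>] by (auto simp: entry_G_def mono_def)
    then show "AE \<omega> in P. (\<forall>t. ((\<lambda>s. entry_G entry_time \<theta> s \<omega>) \<longlongrightarrow> entry_G entry_time \<theta> t \<omega>) (at_right t)) \<and>
      mono (\<lambda>t. entry_G entry_time \<theta> t \<omega>) \<and> (\<forall>s<\<theta> \<omega>. entry_G entry_time \<theta> s \<omega> = 0)"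
      using entry_G_right_continuous by simp
    show "AE \<omega> in P. \<forall>t. 0 < entry_alpha L F M \<theta> t \<omega> \<and> entry_alpha L F M \<theta> t \<omega> < 1 \<longrightarrow>
        ((\<lambda>s. entry_alpha L F M \<theta> s \<omega>) \<longlongrightarrow> entry_alpha L F M \<theta> t \<omega>) (at_right t)"
      using entry_alpha_right_continuous by (intro AE_I2) blast
  qed (use ad progressive_entry_alpha[OF \<theta>] G1 in auto)
qed

lemma entry_time_consistent:
  assumes "\<theta> \<omega> \<le> \<theta>' \<omega>" "\<theta>' \<omega> \<le> entry_time \<theta> \<omega>"
  shows "entry_time \<theta>' \<omega> = entry_time \<theta> \<omega>"
proof (rule antisym)
  show "entry_time \<theta>' \<omega> \<le> entry_time \<theta> \<omega>"
    unfolding entry_time_eq[of \<theta>] hitting_time_def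
  proof (rule Inf_greatest)
    fix e assume "e \<in> {ennreal s |s. 0 \<le> s \<and> \<theta> \<omega> \<le> ennreal s \<and> X s \<omega> \<in> {xP<..}}"
    then obtain s where s: "e = ennreal s" "0 \<le> s" "\<theta> \<omega> \<le> ennreal s" "xP < X s \<omega>" by auto
    then have "\<theta>' \<omega> \<le> ennreal s" using entry_time_le[of s \<theta> \<omega>] s(2-4) assms(2) by simp
    then show "entry_time \<theta>' \<omega> \<le> e" using s entry_time_le by simp
  qed
  show "entry_time \<theta> \<omega> \<le> entry_time \<theta>' \<omega>"
    unfolding entry_time_eq hitting_time_def using assms(1) by (intro Inf_superset_mono) (auto intro: order_trans)
qed

lemma extended_mixed_strategy_entry:
  "extended_mixed_strategy P \<F> (entry_G entry_time) (entry_alpha L F M)"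
  unfolding extended_mixed_strategy_def
  using subgame_strategy_entry
  by (auto simp: entry_G_def entry_alpha_def entry_time_def hitting_time_def)

lemma time_consistent_entry: "time_consistent P \<F> (entry_G entry_time) (entry_alpha L F M)"
  unfolding time_consistent_def
proof (intro allI impI conjI; (elim conjE)?)
  fix \<theta> \<theta>' :: "'a \<Rightarrow> ennreal" assume le: "AE \<omega> in P. \<theta> \<omega> \<le> \<theta>' \<omega>"
  show "AE \<omega> in P. \<forall>t<\<infinity>. \<theta>' \<omega> \<le> t \<longrightarrow> entry_G entry_time \<theta> t \<omega> = left_lim (\<lambda>s. entry_G entry_time \<theta> s \<omega>) (\<theta>' \<omega>)
          + (1 - left_lim (\<lambda>s. entry_G entry_time \<theta> s \<omega>) (\<theta>' \<omega>)) * entry_G entry_time \<theta>' t \<omega>"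
    using le
  proof eventually_elim
    fix \<omega> assume le: "\<theta> \<omega> \<le> \<theta>' \<omega>"
    have "left_lim (\<lambda>s. entry_G entry_time \<theta> s \<omega>) (\<theta>' \<omega>) = (if entry_time \<theta> \<omega> < \<theta>' \<omega> then 1 else 0)"
      unfolding entry_G_def by (rule left_lim_step)
    then show "\<forall>t<\<infinity>. \<theta>' \<omega> \<le> t \<longrightarrow> entry_G entry_time \<theta> t \<omega> = left_lim (\<lambda>s. entry_G entry_time \<theta> s \<omega>) (\<theta>' \<omega>)
          + (1 - left_lim (\<lambda>s. entry_G entry_time \<theta> s \<omega>) (\<theta>' \<omega>)) * entry_G entry_time \<theta>' t \<omega>"
      using entry_time_consistent[of \<theta> \<omega> \<theta>', OF le] by (auto simp: entry_G_def not_less)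
  qed
  fix \<tau> assume "AE \<omega> in P. \<theta>' \<omega> \<le> \<tau> \<omega>"
  with le show "AE \<omega> in P. entry_alpha L F M \<theta> (\<tau> \<omega>) \<omega> = entry_alpha L F M \<theta>' (\<tau> \<omega>) \<omega>"
    by eventually_elim (auto simp: entry_alpha_def)
qed

end

section \<open>The mean of limes inferior and limes superior\<close>

text \<open>
  The tie-breaking rule of \<open>mean_lim_mu_L\<close> for an arbitrary function and filter.
\<close>

definition mean_lim :: "'b filter \<Rightarrow> ('b \<Rightarrow> real) \<Rightarrow> real"
  where "mean_lim A f = (real_of_ereal (Liminf A (\<lambda>t. ereal (f t))) + real_of_ereal (Limsup A (\<lambda>t. ereal (f t)))) / 2"

lemma Liminf_Limsup_unit_interval:
  assumes "A \<noteq> bot" "eventually (\<lambda>t. f t \<in> {0..1}) A"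
  obtains l u where "Liminf A (\<lambda>t. ereal (f t)) = ereal l" "Limsup A (\<lambda>t. ereal (f t)) = ereal u"
    "0 \<le> l" "l \<le> u" "u \<le> 1"
proof -
  have 1: "0 \<le> Liminf A (\<lambda>t. ereal (f t))"
    by (rule Liminf_bounded) (use assms(2) in eventually_elim, auto)
  have 2: "Limsup A (\<lambda>t. ereal (f t)) \<le> 1"
    by (rule Limsup_bounded) (use assms(2) in eventually_elim, auto)
  have 3: "Liminf A (\<lambda>t. ereal (f t)) \<le> Limsup A (\<lambda>t. ereal (f t))"
    by (rule Liminf_le_Limsup[OF assms(1)])
  show ?thesis
    using 1 2 3 that
    by (cases "Liminf A (\<lambda>t. ereal (f t))"; cases "Limsup A (\<lambda>t. ereal (f t))") (auto simp: one_ereal_def zero_ereal_def)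
qed

lemma mean_lim_tendsto: "A \<noteq> bot \<Longrightarrow> (f \<longlongrightarrow> l) A \<Longrightarrow> mean_lim A f = l"
  unfolding mean_lim_def using lim_imp_Liminf[of A "\<lambda>t. ereal (f t)" "ereal l"] lim_imp_Limsup[of A "\<lambda>t. ereal (f t)" "ereal l"]
  by simp

lemma Liminf_perturb:
  assumes "A \<noteq> bot" "((\<lambda>t. f t - g t) \<longlongrightarrow> (0::real)) A"
  shows "Liminf A (\<lambda>t. ereal (f t)) \<le> Liminf A (\<lambda>t. ereal (g t))"
proof (rule ccontr)
  assume "\<not> ?thesis"
  then have "Liminf A (\<lambda>t. ereal (g t)) < Liminf A (\<lambda>t. ereal (f t))" by simp
  then obtain z2 where z2: "Liminf A (\<lambda>t. ereal (g t)) < ereal z2" "ereal z2 < Liminf A (\<lambda>t. ereal (f t))"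
    using ereal_dense2 by blast
  then obtain z1 where z1: "Liminf A (\<lambda>t. ereal (g t)) < ereal z1" "ereal z1 < ereal z2"
    using ereal_dense2 by blast
  have "eventually (\<lambda>t. ereal z2 < ereal (f t)) A" using z2(2) by (rule less_LiminfD)
  moreover have "eventually (\<lambda>t. f t - g t < z2 - z1) A"
    using assms(2) by (rule order_tendstoD(2)) (use z1 in simp)
  ultimately have "eventually (\<lambda>t. ereal z1 \<le> ereal (g t)) A"
    by eventually_elim simp
  then have "ereal z1 \<le> Liminf A (\<lambda>t. ereal (g t))" by (rule Liminf_bounded)
  with z1 show False by simp
qed

lemma Limsup_perturb:
  assumes "A \<noteq> bot" "((\<lambda>t. f t - g t) \<longlongrightarrow> (0::real)) A"
  shows "Limsup A (\<lambda>t. ereal (f t)) \<le> Limsup A (\<lambda>t. ereal (g t))"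
proof -
  have "((\<lambda>t. - g t - - f t) \<longlongrightarrow> 0) A" using assms(2) by (simp add: algebra_simps)
  from Liminf_perturb[OF assms(1) this]
  have "Liminf A (\<lambda>t. - ereal (g t)) \<le> Liminf A (\<lambda>t. - ereal (f t))" by simp
  then show ?thesis unfolding ereal_Liminf_uminus by simp
qed

lemma mean_lim_cong_tendsto:
  assumes "A \<noteq> bot" "((\<lambda>t. f t - g t) \<longlongrightarrow> (0::real)) A"
  shows "mean_lim A f = mean_lim A g"
proof -
  have "((\<lambda>t. g t - f t) \<longlongrightarrow> 0) A" using tendsto_minus[OF assms(2)] by simp
  then show ?thesis unfolding mean_lim_def
    using Liminf_perturb[OF assms] Limsup_perturb[OF assms] Liminf_perturb[OF assms(1), of g f] Limsup_perturb[OF assms(1), of g f]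
    by (simp add: antisym)
qed

lemma Liminf_Limsup_reflect:
  assumes "A \<noteq> bot" "c \<ge> 0"
    and lu: "Liminf A (\<lambda>t. ereal (g t)) = ereal l" "Limsup A (\<lambda>t. ereal (g t)) = ereal u"
  shows "Liminf A (\<lambda>t. ereal (c * (1 - g t))) = ereal (c * (1 - u))"
    "Limsup A (\<lambda>t. ereal (c * (1 - g t))) = ereal (c * (1 - l))"
proof -
  have e: "ereal (c * (1 - y)) = ereal c * (1 + - ereal y)" for y
    by (simp add: one_ereal_def)
  have fin: "\<bar>1 :: ereal\<bar> \<noteq> \<infinity>" by simp
  show "Liminf A (\<lambda>t. ereal (c * (1 - g t))) = ereal (c * (1 - u))"
    unfolding e Liminf_ereal_mult_left[OF assms(1,2)] Liminf_add_ereal_left[OF assms(1) fin] ereal_Liminf_uminus lu ..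
  show "Limsup A (\<lambda>t. ereal (c * (1 - g t))) = ereal (c * (1 - l))"
    unfolding e Limsup_ereal_mult_left[OF assms(1,2)] Limsup_add_ereal_left[OF assms(1) fin] ereal_Limsup_uminus lu ..
qed

lemma mean_lim_reflect:
  assumes "A \<noteq> bot" "c \<ge> 0" "eventually (\<lambda>t. g t \<in> {0..1}) A"
  shows "mean_lim A (\<lambda>t. c * (1 - g t)) = c * (1 - mean_lim A g)"
proof -
  obtain l u where lu: "Liminf A (\<lambda>t. ereal (g t)) = ereal l" "Limsup A (\<lambda>t. ereal (g t)) = ereal u"
    using Liminf_Limsup_unit_interval[OF assms(1,3)] by metis
  show ?thesis unfolding mean_lim_def Liminf_Limsup_reflect[OF assms(1,2) lu] lu by (simp add: field_simps)
qed

lemma mean_lim_add_le_one: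
  assumes "eventually (\<lambda>t. f t \<in> {0..1} \<and> g t \<in> {0..1} \<and> f t + g t \<le> 1) A"
  shows "mean_lim A f + mean_lim A g \<le> 1"
proof (cases "A = bot")
  case False
  have f: "eventually (\<lambda>t. f t \<in> {0..1}) A" and g: "eventually (\<lambda>t. g t \<in> {0..1}) A"
    using assms by (auto elim: eventually_mono)
  obtain l u where lu: "Liminf A (\<lambda>t. ereal (f t)) = ereal l" "Limsup A (\<lambda>t. ereal (f t)) = ereal u"
    using Liminf_Limsup_unit_interval[OF False f] by metis
  obtain l' u' where lu': "Liminf A (\<lambda>t. ereal (g t)) = ereal l'" "Limsup A (\<lambda>t. ereal (g t)) = ereal u'"
    using Liminf_Limsup_unit_interval[OF False g] by metis
  note r = Liminf_Limsup_reflect[OF False _ lu', of 1, simplified]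
  have le: "eventually (\<lambda>t. ereal (f t) \<le> ereal (1 - g t)) A"
    using assms by (auto elim!: eventually_mono)
  have "l \<le> 1 - u'" "u \<le> 1 - l'"
    using Liminf_mono[OF le] Limsup_mono[OF le] unfolding lu r by auto
  then show ?thesis unfolding mean_lim_def lu lu' real_of_ereal.simps by argo
qed (simp add: mean_lim_def top_ereal_def bot_ereal_def)

section \<open>Conditional outcome probabilities\<close>

lemma mu_denominator_pos:
  assumes "a \<in> {0..1}" "b \<in> {0..1::real}" "a + b > 0" shows "a + b - a * b > 0"
proof -
  have "a + b - a * b = a + b * (1 - a)" by (simp add: algebra_simps)
  moreover have "a > 0 \<or> (a = 0 \<and> b > 0)" using assms by auto
  moreover have "0 \<le> b * (1 - a)" using assms by simp
  ultimately show ?thesis by auto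
qed

lemma mu_L_bounds:
  assumes "a \<in> {0..1}" "b \<in> {0..1}"
  shows "mu_L a b \<in> {0..1}" "mu_L a b + mu_L b a \<le> 1"
proof -
  have "mu_L a b \<in> {0..1} \<and> mu_L a b + mu_L b a \<le> 1"
  proof (cases "a + b > 0")
    case True
    have d: "a + b - a * b > 0" "b + a - b * a = a + b - a * b" using mu_denominator_pos[OF assms True] by auto
    have "a * (1 - b) \<le> a + b - a * b" using assms by (simp add: right_diff_distrib)
    moreover have "0 \<le> a * (1 - b)" using assms by simp
    moreover have "mu_L a b + mu_L b a = (a * (1 - b) + b * (1 - a)) / (a + b - a * b)"
      unfolding mu_L_def d(2) by (simp add: add_divide_distrib)
    moreover have "0 \<le> a * b" using assms by simp
    then have "a * (1 - b) + b * (1 - a) \<le> a + b - a * b" by (simp add: algebra_simps)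
    ultimately show ?thesis using d(1) unfolding mu_L_def by (auto simp: divide_le_eq_1)
  next
    case False
    then have "a = 0" "b = 0" using assms by auto
    then show ?thesis by (simp add: mu_L_def)
  qed
  then show "mu_L a b \<in> {0..1}" "mu_L a b + mu_L b a \<le> 1" by auto
qed

text \<open>
  Both players stop independently in rounds until somebody does.  In the decisive round the first
  player stops with probability \<open>1 - mu_L b a\<close>, and then the second one does not with probability
  \<open>1 - b\<close>.
\<close>

lemma mu_L_reflect:
  assumes "a \<in> {0..1}" "b \<in> {0..1}" "a + b > 0"
  shows "mu_L a b = (1 - b) * (1 - mu_L b a)"
proof -
  have d: "a + b - a * b > 0" "b + a - b * a = a + b - a * b" using mu_denominator_pos[OF assms] by auto
  have "1 - mu_L b a = a / (a + b - a * b)"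
    unfolding mu_L_def d(2) using d(1) by (simp add: field_simps)
  then show ?thesis by (simp add: mu_L_def)
qed

text \<open>
  If one attempt against the intensity \<open>b\<close> is worth as much as following, so is any number of attempts,
  and therefore every intensity \<open>a\<close>.
\<close>

lemma mu_mixture:
  assumes "a \<in> {0..1}" "b \<in> {0..1}" "a + b > 0" and v: "(1 - b) * l + b * k = f"
  shows "mu_L a b * l + mu_L b a * f + mu_M a b * k = f"
proof -
  have d: "a + b - a * b > 0" "b + a - b * a = a + b - a * b" using mu_denominator_pos[OF assms(1-3)] by auto
  have "mu_L a b * l + mu_L b a * f + mu_M a b * k = (a * ((1 - b) * l + b * k) + b * (1 - a) * f) / (a + b - a * b)"
    unfolding mu_L_def mu_M_def d(2) times_divide_eq_left add_divide_distrib[symmetric]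
    by (simp add: algebra_simps)
  also have "\<dots> = f" unfolding v using d(1) by (simp add: field_simps)
  finally show ?thesis .
qed

lemma mean_lim_mu_L_eq:
  "mean_lim_mu_L \<tau> a b = mean_lim (at \<tau> within {t. \<tau> < t \<and> a t + b t > 0}) (\<lambda>t. mu_L (a t) (b t))"
  by (simp add: mean_lim_mu_L_def mean_lim_def Let_def)

section \<open>Path payoffs against the equilibrium strategy\<close>

text \<open>
  From here on a single path with nonnegative states is considered.  The payoffs along this path are
  primed, and \<open>G', b\<close> is the path of the equilibrium strategy.
\<close>

locale state_path = entry_game P \<F> B \<mu> \<sigma> x X m I r
  for P :: "'a measure" and \<F> :: "ennreal \<Rightarrow> 'a measure" and B :: "real \<Rightarrow> 'a \<Rightarrow> real"
    and \<mu> \<sigma> x :: real and X :: "real \<Rightarrow> 'a \<Rightarrow> real" and m I r :: real +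
  fixes \<theta> :: "'a \<Rightarrow> ennreal" and \<omega> :: 'a
  assumes \<omega>: "\<omega> \<in> space P" and X_nonneg: "\<And>t. 0 \<le> t \<Longrightarrow> 0 \<le> X t \<omega>"
begin

abbreviation "L' t \<equiv> L t \<omega>"
abbreviation "F' t \<equiv> F t \<omega>"
abbreviation "M' t \<equiv> M t \<omega>"
abbreviation "c \<equiv> entry_time \<theta> \<omega>"
abbreviation "G' t \<equiv> entry_G entry_time \<theta> t \<omega>"
abbreviation "b t \<equiv> entry_alpha L F M \<theta> t \<omega>"

lemma discounted_finite: "t < \<infinity> \<Longrightarrow> discounted_process r v X t \<omega> = exp (- r * enn2real t) * v (X (enn2real t) \<omega>)"
  by (auto simp: discounted_process_def)

lemma b_unit: "b t \<in> {0..1}"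
  using preempt_bounds by (simp add: entry_alpha_eq)

lemma b_pos_iff: "\<theta> \<omega> \<le> t \<Longrightarrow> 0 < b t \<longleftrightarrow> t = \<infinity> \<or> xP < X (enn2real t) \<omega>"
  by (auto simp: entry_alpha_eq preempt_pos_iff)

lemma tau_hat1_b: "tau_hat1 (\<theta> \<omega>) b = c"
proof -
  have "{t. \<theta> \<omega> \<le> t \<and> 0 < b t} = insert \<infinity> {ennreal s | s. 0 \<le> s \<and> \<theta> \<omega> \<le> ennreal s \<and> X s \<omega> \<in> {xP<..}}"
  proof (intro set_eqI)
    fix t show "t \<in> {t. \<theta> \<omega> \<le> t \<and> 0 < b t} \<longleftrightarrow> t \<in> insert \<infinity> {ennreal s | s. 0 \<le> s \<and> \<theta> \<omega> \<le> ennreal s \<and> X s \<omega> \<in> {xP<..}}"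
    proof (cases t)
      case (real s)
      then show ?thesis using b_pos_iff[of t] by auto
    qed (auto simp: entry_alpha_eq)
  qed
  then show ?thesis unfolding tau_hat1_def entry_time_eq hitting_time_def by simp
qed

lemma G'_left_lim: "left_lim G' t = (if c < t then 1 else 0)"
  unfolding entry_G_def by (rule left_lim_step)

lemma integral_G'_before:
  assumes "t \<le> c" shows "stieltjes_integral t G' f = 0"
proof -
  interpret G: distribution_path G'
  proof
    show "(G' \<longlongrightarrow> G' t) (at_right t)" for t by (rule entry_G_right_continuous)
  qed (auto simp: entry_G_def mono_def)
  have "emeasure G.\<nu> (G.before t) = 0"
    using assms by (simp add: G.emeasure_before G'_left_lim)
  then have "AE s in G.\<nu>. s \<notin> G.before t" by (intro AE_not_in) (simp add: null_sets_def)
  then have "AE s in G.\<nu>. indicator (G.before t) s *\<^sub>R f (ennreal s) = 0"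
    by eventually_elim simp
  then show ?thesis unfolding G.stieltjes_eq set_lebesgue_integral_def
    by (subst integral_eq_zero_AE) auto
qed

lemma entry_state:
  assumes "c < \<infinity>" shows "xP \<le> X (enn2real c) \<omega>"
proof (rule ccontr)
  assume n: "\<not> ?thesis"
  have "((\<lambda>s. X (enn2real s) \<omega>) \<longlongrightarrow> X (enn2real c) \<omega>) (at_right c)" by (rule tendsto_X_right[OF \<omega> assms])
  then have "eventually (\<lambda>s. X (enn2real s) \<omega> < xP) (at_right c)" by (rule order_tendstoD(2)) (use n in simp)
  then obtain d where d: "c < d" "\<And>s. c < s \<Longrightarrow> s < d \<Longrightarrow> X (enn2real s) \<omega> < xP"
    unfolding eventually_at_right[OF assms] by blast
  obtain s where s: "0 \<le> s" "\<theta> \<omega> \<le> ennreal s" "xP < X s \<omega>" "ennreal s < d" using entry_time_less[OF d(1)] by blast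
  have "c \<le> ennreal s" using s entry_time_le by blast
  moreover have "c \<noteq> ennreal s" using n s by auto
  ultimately have "c < ennreal s" by simp
  from d(2)[OF this s(4)] show False using s(1,3) by simp
qed

lemma b_finite: "\<theta> \<omega> \<le> t \<Longrightarrow> t < \<infinity> \<Longrightarrow> b t = preempt (X (enn2real t) \<omega>)"
  by (auto simp: entry_alpha_eq)

lemma M'_le_F': "M' t \<le> F' t"
  using sv_le_fv by (simp add: discounted_process_def)

text \<open>
  Above \<open>xP\<close> this is the indifference that defines the intensity.  At \<open>xP\<close> the intensity is 0 and
  leader and follower payoff coincide; at infinity all payoffs vanish.
\<close>

lemma indifference_at_entry: "(1 - b c) * L' c + b c * M' c = F' c"
proof (cases "c < \<infinity>")
  case True
  let ?y = "X (enn2real c) \<omega>"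
  have "(1 - preempt ?y) * lv ?y + preempt ?y * sv ?y = fv ?y"
  proof (cases "xP < ?y")
    case False
    then have "?y = xP" using entry_state[OF True] by simp
    then show ?thesis using lv_eq_fv_threshold by (simp add: preempt_def)
  qed (rule preempt_indifference)
  moreover have "(1 - p) * (e * l) + p * (e * k) = e * ((1 - p) * l + p * k)" for p e l k :: real
    by (simp add: algebra_simps)
  ultimately show ?thesis
    unfolding discounted_finite[OF True] b_finite[OF entry_time_ge True] by simp
next
  case False
  then have "c = \<infinity>" by (simp add: less_top[symmetric])
  then show ?thesis by (simp add: discounted_process_def)
qed

lemma preempt_tendsto_0: "(preempt \<longlongrightarrow> 0) (at xP)"
proof -
  let ?q = "\<lambda>y. (lv y - fv y) / (lv y - sv y)"
  have "isCont ?q xP"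
  proof -
    have "continuous_on {0<..<xF} lv" "continuous_on {0<..<xF} fv" "continuous_on {0<..<xF} sv"
      using continuous_lv continuous_sv by (auto intro: continuous_on_subset[OF continuous_fv])
    then have "isCont lv xP" "isCont fv xP" "isCont sv xP"
      using x_P_pos x_P_less by (auto simp: continuous_on_eq_continuous_at)
    then show ?thesis using lv_eq_fv_threshold sv_less_fv[OF x_P_less] by (intro continuous_intros) auto
  qed
  then have "(?q \<longlongrightarrow> 0) (at xP)" unfolding isCont_def using lv_eq_fv_threshold by simp
  then have lim: "((\<lambda>y. norm (?q y)) \<longlongrightarrow> 0) (at xP)" by (rule tendsto_norm_zero)
  have "eventually (\<lambda>y. y < xF) (at xP)"
    using x_P_less by (intro order_tendstoD(2)[OF tendsto_ident_at])
  then have "eventually (\<lambda>y. norm (preempt y) \<le> norm (?q y)) (at xP)"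
    by eventually_elim (auto simp: preempt_def)
  then show ?thesis using lim by (rule Lim_null_comparison)
qed

end

text \<open>
  The path \<open>g, a\<close> of an arbitrary strategy of one player, against the equilibrium strategy of the other.
\<close>

locale deviation_path = state_path P \<F> B \<mu> \<sigma> x X m I r \<theta> \<omega> + distribution_path g
  for P :: "'a measure" and \<F> :: "ennreal \<Rightarrow> 'a measure" and B :: "real \<Rightarrow> 'a \<Rightarrow> real"
    and \<mu> \<sigma> x :: real and X :: "real \<Rightarrow> 'a \<Rightarrow> real" and m I r :: real
    and \<theta> :: "'a \<Rightarrow> ennreal" and \<omega> :: 'a and g +
  fixes a :: "ennreal \<Rightarrow> real"
  assumes a_unit: "\<And>t. a t \<in> {0..1}" and g_one: "\<And>t. 0 < a t \<Longrightarrow> g t = 1"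
    and g_zero: "\<And>s. s < \<theta> \<omega> \<Longrightarrow> g s = 0"
begin

abbreviation "h \<equiv> tau_hat1 (\<theta> \<omega>) a"

lemma tau_hat_eq: "tau_hat (\<theta> \<omega>) a b = min h c" "tau_hat (\<theta> \<omega>) b a = min h c"
proof -
  have p: "0 < a t + b t \<longleftrightarrow> 0 < a t \<or> 0 < b t" for t using a_unit[of t] b_unit[of t] by auto
  have "{t. \<theta> \<omega> \<le> t \<and> 0 < a t + b t} = {t. \<theta> \<omega> \<le> t \<and> 0 < a t} \<union> {t. \<theta> \<omega> \<le> t \<and> 0 < b t}"
    unfolding p by auto
  then show 1: "tau_hat (\<theta> \<omega>) a b = min h c"
    unfolding tau_hat_def tau_hat1_b[symmetric] tau_hat1_def by (simp add: Inf_union_distrib inf_min)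
  then show "tau_hat (\<theta> \<omega>) b a = min h c" unfolding tau_hat_def by (simp add: add.commute)
qed

lemma payoff_terms_before:
  assumes "t \<le> c"
  shows "stieltjes_integral t g (\<lambda>s. (1 - G' s) * L' s) = (LINT s:before t|\<nu>. L' (ennreal s))"
    "stieltjes_integral t G' (\<lambda>s. (1 - g s) * F' s) = 0"
    "(\<Sum>\<^sub>\<infinity>s\<in>{..<t}. jump g s * jump G' s * M' s) = 0"
proof -
  show "stieltjes_integral t g (\<lambda>s. (1 - G' s) * L' s) = (LINT s:before t|\<nu>. L' (ennreal s))"
    unfolding stieltjes_eq set_lebesgue_integral_def
    using assms by (intro Bochner_Integration.integral_cong) (auto simp: before_def entry_G_def indicator_def)
  show "stieltjes_integral t G' (\<lambda>s. (1 - g s) * F' s) = 0" by (rule integral_G'_before[OF assms])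
  have "jump G' s = 0" if "s < t" for s
    using that assms unfolding jump_def G'_left_lim by (auto simp: entry_G_def)
  then show "(\<Sum>\<^sub>\<infinity>s\<in>{..<t}. jump g s * jump G' s * M' s) = 0" by (intro infsum_0) auto
qed

lemma payoff_first_mover:
  assumes "h < c"
  shows "path_payoff (\<theta> \<omega>) L' F' M' g a G' b = (LINT s:before h|\<nu>. L' (ennreal s)) + (1 - left_lim g h) * L' h"
proof -
  have t: "tau_hat (\<theta> \<omega>) a b = h" "tau_hat (\<theta> \<omega>) b a = h" using assms tau_hat_eq by auto
  have "G' h = 0" "jump G' h = 0" unfolding jump_def G'_left_lim using assms by (auto simp: entry_G_def)
  then show ?thesis
    unfolding path_payoff_def lambda_L_def lambda_M_def t tau_hat1_b Let_def
    using assms payoff_terms_before[of h] by simp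
qed

lemma payoff_at_entry_terms:
  assumes "c \<le> h"
  shows "path_payoff (\<theta> \<omega>) L' F' M' g a G' b = (LINT s:before c|\<nu>. L' (ennreal s))
    + lambda_L (\<theta> \<omega>) g a G' b * L' c + lambda_L (\<theta> \<omega>) G' b g a * F' c + lambda_M (\<theta> \<omega>) g a G' b * M' c"
proof -
  have "tau_hat (\<theta> \<omega>) a b = c" using assms tau_hat_eq by auto
  then show ?thesis unfolding path_payoff_def Let_def using payoff_terms_before[of c] by simp
qed

text \<open>
  In the interior of the preemption region \<open>b\<close> is right-continuous, so that the reflection formula
  survives the passage to the limits.  Reflection exchanges limes inferior and limes superior, which
  their mean does not notice.
\<close>

lemma mean_lim_mu_L_b:
  assumes c: "c < \<infinity>" and bc: "0 < b c" "b c < 1"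
  shows "mean_lim_mu_L c a b = (1 - b c) * (1 - mean_lim_mu_L c b a)"
proof -
  let ?S = "{t. c < t \<and> a t + b t > 0}"
  let ?A = "at c within ?S"
  have bt: "(b \<longlongrightarrow> b c) (at_right c)"
    using entry_alpha_right_continuous[OF \<omega> bc] .
  then have "eventually (\<lambda>t. 0 < b t) (at_right c)" using bc(1) by (rule order_tendstoD(1))
  then have "eventually (\<lambda>t. t \<in> ?S \<longleftrightarrow> t \<in> {c<..}) (at_right c)"
    using a_unit by (auto simp: eventually_at_filter elim!: eventually_mono intro: add_nonneg_pos)
  then have "eventually (\<lambda>t. t \<noteq> c \<longrightarrow> (t \<in> ?S \<longleftrightarrow> t \<in> {c<..})) (nhds c)"
    unfolding eventually_at_filter by eventually_elim auto
  then have A: "?A = at_right c"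
    by (intro filter_eq_iff[THEN iffD2] allI) (auto simp: eventually_at_filter elim: eventually_elim2)
  have nb: "?A \<noteq> bot"
  proof
    assume "?A = bot"
    then have "eventually (\<lambda>_. False) (at_right c)" unfolding A by simp
    then obtain d where "c < d" "\<And>s. c < s \<Longrightarrow> s < d \<Longrightarrow> False" unfolding eventually_at_right[OF c] by blast
    then show False using dense by blast
  qed
  have g: "eventually (\<lambda>t. mu_L (b t) (a t) \<in> {0..1}) ?A"
    using mu_L_bounds(1)[OF b_unit a_unit] by simp
  have ev: "eventually (\<lambda>t. mu_L (a t) (b t) = (1 - b t) * (1 - mu_L (b t) (a t))) ?A"
    using mu_L_reflect[OF a_unit b_unit] by (auto simp: eventually_at_filter intro!: always_eventually)
  have S: "{t. c < t \<and> b t + a t > 0} = ?S" by (simp add: add.commute)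
  have "((\<lambda>t. mu_L (a t) (b t) - (1 - b c) * (1 - mu_L (b t) (a t))) \<longlongrightarrow> 0) ?A"
  proof (rule Lim_null_comparison)
    show "eventually (\<lambda>t. norm (mu_L (a t) (b t) - (1 - b c) * (1 - mu_L (b t) (a t))) \<le> \<bar>b t - b c\<bar>) ?A"
      using ev
    proof eventually_elim
      fix t assume e: "mu_L (a t) (b t) = (1 - b t) * (1 - mu_L (b t) (a t))"
      have "mu_L (a t) (b t) - (1 - b c) * (1 - mu_L (b t) (a t)) = (b c - b t) * (1 - mu_L (b t) (a t))"
        unfolding e by (simp add: algebra_simps)
      moreover have "\<bar>1 - mu_L (b t) (a t)\<bar> \<le> 1" using mu_L_bounds(1)[OF b_unit a_unit, of t t] by auto
      ultimately show "norm (mu_L (a t) (b t) - (1 - b c) * (1 - mu_L (b t) (a t))) \<le> \<bar>b t - b c\<bar>"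
        using mult_left_mono[of "\<bar>1 - mu_L (b t) (a t)\<bar>" 1 "\<bar>b c - b t\<bar>"] by (simp add: abs_mult abs_minus_commute)
    qed
    have "((\<lambda>t. b t - b c) \<longlongrightarrow> 0) (at_right c)" using bt by (rule LIM_zero)
    then show "((\<lambda>t. \<bar>b t - b c\<bar>) \<longlongrightarrow> 0) ?A" unfolding A by (rule tendsto_rabs_zero)
  qed
  from mean_lim_cong_tendsto[OF nb this] mean_lim_reflect[OF nb _ g, of "1 - b c"] bc(2)
  show ?thesis unfolding mean_lim_mu_L_eq S by simp
qed

lemma mean_lim_mu_L_add_le_one:
  "mean_lim_mu_L c a b + mean_lim_mu_L c b a \<le> 1"
proof -
  have S: "{t. c < t \<and> b t + a t > 0} = {t. c < t \<and> a t + b t > 0}" by (simp add: add.commute)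
  show ?thesis
    unfolding mean_lim_mu_L_eq S
    using mu_L_bounds[OF a_unit b_unit] mu_L_bounds[OF b_unit a_unit]
    by (auto intro!: mean_lim_add_le_one)
qed

text \<open>
  If entry occurs at the threshold, both intensities vanish as the state returns to it, and
  \<open>mu_L p p = (1 - p) / (2 - p)\<close> tends to one half: simultaneous entry has probability 0 in the limit.
\<close>

lemma mean_lim_mu_L_symmetric:
  assumes c: "c < \<infinity>" and y: "X (enn2real c) \<omega> = xP"
  shows "mean_lim_mu_L c b b = 1 / 2"
proof -
  let ?S = "{t. c < t \<and> b t + b t > 0}"
  let ?A = "at c within ?S"
  have S: "t \<in> ?S \<longleftrightarrow> c < t \<and> (t = \<infinity> \<or> xP < X (enn2real t) \<omega>)" for t
    using b_pos_iff[of t] entry_time_ge[of \<theta> \<omega>] by auto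
  have nb: "?A \<noteq> bot"
  proof
    assume "?A = bot"
    then have "eventually (\<lambda>t. t \<notin> ?S) (at_right c)"
      unfolding trivial_limit_def eventually_at_filter by (auto elim: eventually_mono)
    then obtain d where d: "c < d" "\<And>s. c < s \<Longrightarrow> s < d \<Longrightarrow> s \<notin> ?S" unfolding eventually_at_right[OF c] by blast
    obtain s where s: "0 \<le> s" "\<theta> \<omega> \<le> ennreal s" "xP < X s \<omega>" "ennreal s < d" using entry_time_less[OF d(1)] by blast
    have "c \<le> ennreal s" using s entry_time_le by blast
    moreover have "c \<noteq> ennreal s" using y s by auto
    ultimately have "c < ennreal s" by simp
    then have "ennreal s \<in> ?S" unfolding S using s by simp
    then show False using d(2)[OF \<open>c < ennreal s\<close> s(4)] by blast
  qed
  have le: "?A \<le> at_right c" by (rule at_le) auto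
  have "eventually (\<lambda>t. t < \<infinity>) (at_right c)" using c by (auto simp: eventually_at_right[OF c])
  then have ev: "eventually (\<lambda>t. t \<in> ?S \<and> t < \<infinity>) ?A"
    using filter_leD[OF le] by (auto simp: eventually_at_filter elim: eventually_mono)
  have "((\<lambda>s. X (enn2real s) \<omega>) \<longlongrightarrow> xP) ?A"
    using tendsto_mono[OF le tendsto_X_right[OF \<omega> c]] y by simp
  moreover have "eventually (\<lambda>s. X (enn2real s) \<omega> \<in> UNIV \<and> X (enn2real s) \<omega> \<noteq> xP) ?A"
    using ev unfolding S by eventually_elim auto
  ultimately have "filterlim (\<lambda>s. X (enn2real s) \<omega>) (at xP) ?A"
    unfolding filterlim_at by blast
  from filterlim_compose[OF preempt_tendsto_0 this]
  have p0: "((\<lambda>s. preempt (X (enn2real s) \<omega>)) \<longlongrightarrow> 0) ?A" .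
  have "((\<lambda>s. (1 - preempt (X (enn2real s) \<omega>)) / (2 - preempt (X (enn2real s) \<omega>))) \<longlongrightarrow> (1 - 0) / (2 - 0)) ?A"
    by (intro tendsto_intros p0) simp
  then have "((\<lambda>t. mu_L (b t) (b t)) \<longlongrightarrow> (1 - 0) / (2 - 0)) ?A"
  proof (rule Lim_transform_eventually)
    show "eventually (\<lambda>s. (1 - preempt (X (enn2real s) \<omega>)) / (2 - preempt (X (enn2real s) \<omega>)) = mu_L (b s) (b s)) ?A"
      using ev
    proof eventually_elim
      fix t assume t: "t \<in> ?S \<and> t < \<infinity>"
      then have "\<theta> \<omega> \<le> t" using entry_time_ge[of \<theta> \<omega>] by auto
      then have e: "b t = preempt (X (enn2real t) \<omega>)" using t by (simp add: b_finite)
      define p where "p = preempt (X (enn2real t) \<omega>)"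
      have p: "0 < p" "p \<le> 1" using t e b_unit[of t] unfolding p_def by auto
      have "mu_L p p = (p * (1 - p)) / (p * (2 - p))" unfolding mu_L_def by (simp add: algebra_simps)
      also have "\<dots> = (1 - p) / (2 - p)" using p by simp
      finally show "(1 - preempt (X (enn2real t) \<omega>)) / (2 - preempt (X (enn2real t) \<omega>)) = mu_L (b t) (b t)"
        unfolding e p_def by simp
    qed
  qed
  from mean_lim_tendsto[OF nb this] show ?thesis unfolding mean_lim_mu_L_eq by simp
qed

text \<open>
  Here \<open>v\<close> is the value of the outcome at the entry time, given that the deviating player has not
  stopped before.  By indifference it equals the follower payoff, except at the threshold: there a
  deviation may leave a positive probability of simultaneous entry, which only lowers \<open>v\<close>.
\<close>

lemma payoff_at_entry:
  assumes ch: "c \<le> h"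
  obtains v where
    "path_payoff (\<theta> \<omega>) L' F' M' g a G' b = (LINT s:before c|\<nu>. L' (ennreal s)) + (1 - left_lim g c) * v"
    "v \<le> F' c" "c = \<infinity> \<or> xP < X (enn2real c) \<omega> \<or> a = b \<Longrightarrow> v = F' c"
proof -
  let ?l = "1 - left_lim g c" and ?y = "X (enn2real c) \<omega>"
  define v' where "v' = lambda_L (\<theta> \<omega>) g a G' b * L' c + lambda_L (\<theta> \<omega>) G' b g a * F' c + lambda_M (\<theta> \<omega>) g a G' b * M' c"
  have pay: "path_payoff (\<theta> \<omega>) L' F' M' g a G' b = (LINT s:before c|\<nu>. L' (ennreal s)) + v'"
    unfolding payoff_at_entry_terms[OF ch] v'_def by simp
  have G: "left_lim G' c = 0" "jump G' c = 1" "G' c = 1" unfolding jump_def G'_left_lim by (auto simp: entry_G_def)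
  have tau: "tau_hat (\<theta> \<omega>) a b = c" "tau_hat (\<theta> \<omega>) b a = c" using ch tau_hat_eq by auto
  have ind: "(1 - b c) * L' c + b c * M' c = F' c" by (rule indifference_at_entry)
  note lambdas = lambda_L_def lambda_M_def Let_def tau tau_hat1_b G
  show ?thesis
  proof (cases "c < h")
    case True
    have "v' = jump g c * ((1 - b c) * L' c + b c * M' c) + (1 - g c) * F' c"
      unfolding v'_def lambdas using True by (simp add: algebra_simps)
    also have "\<dots> = ?l * F' c" unfolding ind by (simp add: jump_def algebra_simps)
    finally show ?thesis using that[of "F' c"] pay by simp
  next
    case False
    with ch have hc: "h = c" by simp
    consider (inf) "c = \<infinity>" | (sure) "c < \<infinity>" "max (a c) (b c) = 1 \<or> min (a c) (b c) > 0"
      | (interior) "c < \<infinity>" "\<not> (max (a c) (b c) = 1 \<or> min (a c) (b c) > 0)" "xP < ?y"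
      | (boundary) "c < \<infinity>" "\<not> (max (a c) (b c) = 1 \<or> min (a c) (b c) > 0)" "?y = xP"
      using entry_state by (cases "c = \<infinity>") (force simp: less_top[symmetric])+
    then show ?thesis
    proof cases
      case inf
      then have "L' c = 0" "F' c = 0" "M' c = 0" by (auto simp: discounted_process_def)
      then show ?thesis using that[of 0] pay by (simp add: v'_def)
    next
      case sure
      have p: "a c + b c > 0" using sure(2) a_unit[of c] b_unit[of c] by (auto simp: max_def min_def split: if_splits)
      have "v' = ?l * (mu_L (a c) (b c) * L' c + mu_L (b c) (a c) * F' c + mu_M (a c) (b c) * M' c)"
        unfolding v'_def lambdas hc using sure by (simp add: max.commute min.commute algebra_simps)
      also have "\<dots> = ?l * F' c" unfolding mu_mixture[OF a_unit b_unit p ind] ..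
      finally show ?thesis using that[of "F' c"] pay by simp
    next
      case interior
      have bpos: "0 < b c" using interior b_pos_iff[of c] entry_time_ge[of \<theta> \<omega>] by simp
      have ac: "a c = 0" and b1: "b c < 1" using interior(2) bpos a_unit[of c] b_unit[of c] by (auto simp: max_def min_def split: if_splits)
      define p q where "p = mean_lim_mu_L c a b" and "q = mean_lim_mu_L c b a"
      have pq: "p = (1 - b c) * (1 - q)" unfolding p_def q_def by (rule mean_lim_mu_L_b[OF interior(1) bpos b1])
      have cond: "\<not> (max (b c) (a c) = 1 \<or> min (b c) (a c) > 0)" using interior(2) by (simp add: max.commute min.commute)
      have "v' = ?l * (1 - b c) * p * L' c + ?l * (b c + (1 - b c) * q) * F' c
          + (?l - ?l * (1 - b c) * p - ?l * (b c + (1 - b c) * q)) * M' c"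
        unfolding v'_def lambdas hc p_def q_def using interior(2) cond ac by simp
      also have "\<dots> = ?l * (M' c + (1 - b c) * p * (L' c - M' c) + (b c + (1 - b c) * q) * (F' c - M' c))"
        by (simp add: algebra_simps)
      also have "F' c - M' c = (1 - b c) * (L' c - M' c)" unfolding ind[symmetric] by (simp add: algebra_simps)
      also have "M' c + (1 - b c) * p * (L' c - M' c) + (b c + (1 - b c) * q) * ((1 - b c) * (L' c - M' c))
          = (1 - b c) * L' c + b c * M' c"
        unfolding pq by (simp add: algebra_simps)
      finally have "v' = ?l * F' c" unfolding ind .
      then show ?thesis using that[of "F' c"] pay by simp
    next
      case boundary
      have b0: "b c = 0" using boundary b_finite[of c] entry_time_ge[of \<theta> \<omega>] by (simp add: preempt_def)
      then have LF: "L' c = F' c" using ind by simp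
      have a1: "a c < 1" using boundary(2) a_unit[of c] b0 by (auto simp: max_def split: if_splits)
      define p q where "p = mean_lim_mu_L c a b" and "q = mean_lim_mu_L c b a"
      have cond: "\<not> (max (b c) (a c) = 1 \<or> min (b c) (a c) > 0)" using boundary(2) by (simp add: max.commute min.commute)
      (* The conditional probability of simultaneous entry: since b c = 0, the deviating player leads at once
         with probability a c; otherwise the players lead with probabilities p and q. *)
      define w where "w = (1 - a c) * (1 - (p + q))"
      have "v' = ?l * (a c + (1 - a c) * p) * F' c + ?l * (1 - a c) * q * F' c
          + (?l - ?l * (a c + (1 - a c) * p) - ?l * (1 - a c) * q) * M' c"
        unfolding v'_def lambdas hc p_def q_def using boundary(2) cond b0 LF by simp
      also have "\<dots> = ?l * (F' c - w * (F' c - M' c))" unfolding w_def by (simp add: algebra_simps)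
      finally have v': "v' = ?l * (F' c - w * (F' c - M' c))" .
      have "0 \<le> 1 - (p + q)" using mean_lim_mu_L_add_le_one unfolding p_def q_def by simp
      then have "0 \<le> w" unfolding w_def using a1 by simp
      then have le: "0 \<le> w * (F' c - M' c)" using M'_le_F'[of c] by simp
      have eq: "w = 0" if "a = b"
        using that mean_lim_mu_L_symmetric[OF boundary(1,3)] unfolding w_def p_def q_def by simp
      show ?thesis
      proof (rule that)
        show "path_payoff (\<theta> \<omega>) L' F' M' g a G' b = (LINT s:before c|\<nu>. L' (ennreal s)) + ?l * (F' c - w * (F' c - M' c))"
          unfolding pay v' ..
        show "F' c - w * (F' c - M' c) \<le> F' c" using le by simp
        show "F' c - w * (F' c - M' c) = F' c" if "c = \<infinity> \<or> xP < ?y \<or> a = b"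
          using that boundary eq by auto
      qed
    qed
  qed
qed

end

section \<open>Comparison with the follower payoff\<close>

context entry_game begin

text \<open>
  A Riemann sum of mesh \<open>1 / (n + 1)\<close> up to time \<open>n + 1\<close> for the follower payoff stopped at
  entry, integrated against \<open>g\<close>; the remaining mass is put at the entry time.  With the integrand
  taken at the right end point, the weight of each interval is known when the payoff is observed, so
  that the martingale property at deterministic times is enough to compare expectations.
\<close>

definition right_sum :: "(ennreal \<Rightarrow> real) \<Rightarrow> ('a \<Rightarrow> ennreal) \<Rightarrow> 'a \<Rightarrow> nat \<Rightarrow> real"
  where "right_sum g \<theta> \<omega> n = g 0 * F (min 0 (entry_time \<theta> \<omega>)) \<omega>
    + (\<Sum>k<Suc n * Suc n. (g (ennreal (real (Suc k) / real (Suc n))) - g (ennreal (real k / real (Suc n)))) *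
        F (min (ennreal (real (Suc k) / real (Suc n))) (entry_time \<theta> \<omega>)) \<omega>)
    + (1 - g (ennreal (real (Suc n)))) * F (entry_time \<theta> \<omega>) \<omega>"

end

context state_path begin

text \<open>
  The subgame does not start inside the region where both players stop at once.
\<close>

definition calm :: bool
  where "calm \<longleftrightarrow> \<theta> \<omega> = \<infinity> \<or> X (enn2real (\<theta> \<omega>)) \<omega> \<le> xP"

lemma state_until_entry:
  assumes calm and t: "\<theta> \<omega> \<le> t" "t \<le> c" "t < \<infinity>"
  shows "X (enn2real t) \<omega> \<le> xP"
proof (cases "t < c")
  case True
  have "ennreal (enn2real t) = t" using t by simp
  then show ?thesis using before_entry[of "enn2real t" \<theta> \<omega>] t True by simp
next
  case False
  then have tc: "t = c" using t by simp
  show ?thesis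
  proof (cases "\<theta> \<omega> = c")
    case True
    then show ?thesis using assms(1) t(3) unfolding calm_def tc by auto
  next
    case False
    then have lt: "\<theta> \<omega> < c" using entry_time_ge[of \<theta> \<omega>] by simp
    let ?u = "enn2real c"
    have u: "ennreal ?u = c" "0 \<le> ?u" using t tc by auto
    show ?thesis
    proof (rule ccontr)
      assume "\<not> ?thesis"
      then have gt: "xP < X ?u \<omega>" unfolding tc by simp
      have "continuous (at ?u within {0..}) (\<lambda>t. X t \<omega>)"
        using continuous_X[OF \<omega>] u by (simp add: continuous_on_eq_continuous_within)
      then have "\<forall>\<^sub>F s in at ?u within {0..}. xP < X s \<omega>"
        unfolding continuous_within using gt by (rule order_tendstoD(1))
      then obtain d where d: "d > 0" "\<And>s. s \<in> {0..} \<Longrightarrow> s \<noteq> ?u \<Longrightarrow> dist s ?u < d \<Longrightarrow> xP < X s \<omega>"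
        unfolding eventually_at by auto
      have "\<theta> \<omega> < \<infinity>" using order_less_le_trans[OF lt top_greatest] by simp
      then have th: "ennreal (enn2real (\<theta> \<omega>)) = \<theta> \<omega>" by simp
      have "enn2real (\<theta> \<omega>) < ?u" using lt u th by (metis ennreal_less_iff enn2real_nonneg)
      define s where "s = max (enn2real (\<theta> \<omega>)) (?u - d / 2)"
      have "0 \<le> s" unfolding s_def by (simp add: max.coboundedI1)
      have s: "0 \<le> s" "enn2real (\<theta> \<omega>) \<le> s" "s < ?u" "dist s ?u < d"
        using \<open>enn2real (\<theta> \<omega>) < ?u\<close> d(1) \<open>0 \<le> s\<close> unfolding s_def by (auto simp: dist_real_def max_def)
      have "\<theta> \<omega> \<le> ennreal s" using s(2) th ennreal_leI by metis
      moreover have "ennreal s < c" using s u by (metis ennreal_less_iff)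
      ultimately have "X s \<omega> \<le> xP" using before_entry s(1) by blast
      then show False using d(2)[of s] s by simp
    qed
  qed
qed

lemma F'_nonneg: "0 \<le> F' t"
  using fv_nonneg by (simp add: discounted_process_def)

lemma follower_bound_pos: "0 \<le> I / (\<beta> - 1)"
  using beta1_root(1) cost by simp

lemma F'_bound:
  assumes calm "\<theta> \<omega> \<le> t" "t \<le> c"
  shows "F' t \<le> I / (\<beta> - 1)"
proof (cases "t < \<infinity>")
  case True
  have "exp (- r * enn2real t) \<le> 1" using r_pos by simp
  then have "exp (- r * enn2real t) * fv (X (enn2real t) \<omega>) \<le> 1 * (I / (\<beta> - 1))"
    using fv_le[OF X_nonneg state_until_entry[OF assms True], OF enn2real_nonneg] fv_nonneg follower_bound_pos by (intro mult_mono) auto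
  then show ?thesis by (simp add: discounted_finite[OF True])
qed (use follower_bound_pos in \<open>simp add: discounted_process_def less_top[symmetric]\<close>)

lemma L'_le_F':
  assumes calm "\<theta> \<omega> \<le> t" "t \<le> c"
  shows "L' t \<le> F' t"
  using lv_le_fv[OF state_until_entry[OF assms]] by (auto simp: discounted_process_def less_top)

lemma L'_bound:
  assumes calm "\<theta> \<omega> \<le> t" "t \<le> c"
  shows "\<bar>L' t\<bar> \<le> I + xF * (m - 1) / (r - \<mu>) + I / (\<beta> - 1)"
proof -
  let ?k = "I + xF * (m - 1) / (r - \<mu>)"
  have k: "0 \<le> ?k" using cost x_F_pos markup r_gt by simp
  have "- ?k \<le> L' t"
  proof (cases "t < \<infinity>")
    case True
    let ?e = "exp (- r * enn2real t)"
    have "?e \<le> 1" using r_pos by simp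
    then have "?e * ?k \<le> 1 * ?k" using k by (intro mult_right_mono) auto
    moreover have "?e * (- ?k) \<le> ?e * lv (X (enn2real t) \<omega>)"
      using lv_ge[OF X_nonneg, of "enn2real t"] state_until_entry[OF assms True] x_P_less
      by (intro mult_left_mono) auto
    ultimately have "- ?k \<le> ?e * lv (X (enn2real t) \<omega>)" unfolding mult_minus_right mult_1 by linarith
    then show ?thesis by (simp add: discounted_finite[OF True])
  qed (use k in \<open>simp add: discounted_process_def less_top[symmetric]\<close>)
  then show ?thesis using L'_le_F'[OF assms] F'_bound[OF assms] k follower_bound_pos by linarith
qed

lemma borel_measurable_path:
  assumes v: "v \<in> borel_measurable borel"
  shows "(\<lambda>s. indicator {0..} s * discounted_process r v X (ennreal s) \<omega>) \<in> borel_measurable borel"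
proof -
  have [measurable]: "(\<lambda>s. indicator {0..} s *\<^sub>R X s \<omega>) \<in> borel_measurable borel"
    by (rule borel_measurable_continuous_on_indicator) (use continuous_X[OF \<omega>] in auto)
  note [measurable] = v
  have "(\<lambda>s. indicator {0..} s * (exp (- r * s) * v (indicator {0..} s *\<^sub>R X s \<omega>))) \<in> borel_measurable borel" by measurable
  then show ?thesis
    by (rule measurable_cong[THEN iffD1, rotated]) (auto simp: discounted_process_def indicator_def)
qed

lemma continuous_F':
  "continuous_on {0..} (\<lambda>s. F' (ennreal s))"
proof -
  have "continuous_on {0..} (\<lambda>s. exp (- r * s) * fv (X s \<omega>))"
    using continuous_X[OF \<omega>] X_nonneg
    by (intro continuous_intros continuous_on_compose2[OF continuous_fv]) auto
  then show ?thesis by (rule continuous_on_eq) (auto simp: discounted_process_def)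
qed

end

context deviation_path begin

text \<open>
  The payoff if stopping were always rewarded with the follower payoff and were forced at entry.
\<close>

definition \<Phi> :: real
  where "\<Phi> = (LINT s:before c|\<nu>. F' (ennreal s)) + (1 - left_lim g c) * F' c"

lemma no_mass_before_start: "AE s in \<nu>. s \<in> before t \<longrightarrow> \<theta> \<omega> \<le> ennreal s"
proof -
  have "left_lim g (\<theta> \<omega>) = left_lim (\<lambda>_. 0) (\<theta> \<omega>)" by (rule left_lim_cong) (rule g_zero)
  then have "left_lim g (\<theta> \<omega>) = 0" by (simp add: left_lim_const)
  then have "before (\<theta> \<omega>) \<in> null_sets \<nu>" by (simp add: null_sets_def emeasure_before)
  then have "AE s in \<nu>. s \<notin> before (\<theta> \<omega>)" by (rule AE_not_in)
  then show ?thesis by eventually_elim (auto simp: before_def not_less)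
qed

lemma integrable_path_before:
  assumes v: "v \<in> borel_measurable borel" and "t \<le> c"
    and b: "\<And>u. \<theta> \<omega> \<le> u \<Longrightarrow> u \<le> c \<Longrightarrow> \<bar>discounted_process r v X u \<omega>\<bar> \<le> C"
  shows "set_integrable \<nu> (before t) (\<lambda>s. discounted_process r v X (ennreal s) \<omega>)"
  unfolding set_integrable_def
proof (rule Bochner_Integration.integrable_bound)
  show "integrable \<nu> (\<lambda>s. C * indicator (before t) s)"
    using finite_on_before by (intro integrable_mult_right integrable_real_indicator) auto
  have "(\<lambda>s. indicator (before t) s * (indicator {0..} s * discounted_process r v X (ennreal s) \<omega>)) \<in> borel_measurable borel"
    using borel_measurable_path[OF v] by measurable
  also have "(\<lambda>s. indicator (before t) s * (indicator {0..} s * discounted_process r v X (ennreal s) \<omega>)) =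
      (\<lambda>s. indicator (before t) s *\<^sub>R discounted_process r v X (ennreal s) \<omega>)"
    by (auto simp: fun_eq_iff before_def indicator_def)
  finally show "(\<lambda>s. indicator (before t) s *\<^sub>R discounted_process r v X (ennreal s) \<omega>) \<in> borel_measurable \<nu>" by simp
  show "AE s in \<nu>. norm (indicator (before t) s *\<^sub>R discounted_process r v X (ennreal s) \<omega>) \<le> norm (C * indicator (before t) s)"
    using no_mass_before_start[of t]
  proof eventually_elim
    fix s assume "s \<in> before t \<longrightarrow> \<theta> \<omega> \<le> ennreal s"
    then have "\<bar>discounted_process r v X (ennreal s) \<omega>\<bar> \<le> \<bar>C\<bar>" if "s \<in> before t"
      using b[of "ennreal s"] assms(2) that by (force simp: before_def)
    then show "norm (indicator (before t) s *\<^sub>R discounted_process r v X (ennreal s) \<omega>) \<le> norm (C * indicator (before t) s)"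
      by (simp add: indicator_def)
  qed
qed

lemma LINT_L'_le_F':
  assumes calm "t \<le> c"
  shows "set_integrable \<nu> (before t) (\<lambda>s. F' (ennreal s))"
    "(LINT s:before t|\<nu>. L' (ennreal s)) \<le> (LINT s:before t|\<nu>. F' (ennreal s))"
proof -
  show F: "set_integrable \<nu> (before t) (\<lambda>s. F' (ennreal s))"
    using integrable_path_before[OF measurable_values(1) assms(2)] F'_bound[OF assms(1)] F'_nonneg by auto
  have L: "set_integrable \<nu> (before t) (\<lambda>s. L' (ennreal s))"
    using integrable_path_before[OF measurable_values(2) assms(2)] L'_bound[OF assms(1)] by auto
  show "(LINT s:before t|\<nu>. L' (ennreal s)) \<le> (LINT s:before t|\<nu>. F' (ennreal s))"
    unfolding set_lebesgue_integral_def
  proof (rule integral_mono_AE[OF L[unfolded set_integrable_def] F[unfolded set_integrable_def]])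
    show "AE s in \<nu>. indicator (before t) s *\<^sub>R L' (ennreal s) \<le> indicator (before t) s *\<^sub>R F' (ennreal s)"
      using no_mass_before_start[of t]
    proof eventually_elim
      fix s assume "s \<in> before t \<longrightarrow> \<theta> \<omega> \<le> ennreal s"
      then show "indicator (before t) s *\<^sub>R L' (ennreal s) \<le> indicator (before t) s *\<^sub>R F' (ennreal s)"
        using L'_le_F'[OF assms(1), of "ennreal s"] assms(2) by (cases "s \<in> before t") (auto simp: before_def)
    qed
  qed
qed

lemma h_ge: "\<theta> \<omega> \<le> h"
  unfolding tau_hat1_def by (rule Inf_greatest) auto

lemma g_at_h:
  assumes "h < \<infinity>" shows "g h = 1"
proof -
  have one: "g t = 1" if ht: "h < t" for t
  proof -
    obtain t' where "0 < a t'" "t' < t" using ht unfolding tau_hat1_def Inf_less_iff by auto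
    then have "1 \<le> g t" using g_one[of t'] monoD[OF mono_g, of t' t] by simp
    then show ?thesis using le_one[of t] by simp
  qed
  have "eventually (\<lambda>t. g t = 1) (at_right h)" using one by (auto simp: eventually_at_filter)
  then have "(g \<longlongrightarrow> 1) (at_right h)" by (rule tendsto_eventually)
  moreover have "at_right h \<noteq> bot"
  proof
    assume "at_right h = bot"
    then have "eventually (\<lambda>_. False) (at_right h)" by simp
    then show False unfolding eventually_at_right[OF assms] by (meson dense)
  qed
  ultimately show ?thesis using right_cont tendsto_unique by blast
qed

text \<open>
  Leading is worth at most as much as following until entry, and the outcome at entry is worth at most the
  follower payoff.  If the intensity of the deviation becomes positive before entry, then \<open>g\<close> reaches 1
  at that time \<open>h\<close>, and the payoff of the first mover is at most the contribution to \<open>\<Phi>\<close> of the atom of \<open>g\<close>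
  at \<open>h\<close>.
\<close>

lemma payoff_le_\<Phi>:
  assumes calm shows "path_payoff (\<theta> \<omega>) L' F' M' g a G' b \<le> \<Phi>"
proof (cases "h < c")
  case True
  then have hfin: "h < \<infinity>" using order_less_le_trans[OF True top_greatest] by simp
  let ?h = "enn2real h"
  have hr: "ennreal ?h = h" "0 \<le> ?h" using hfin by auto
  note g1 = g_at_h[OF hfin]
  have "left_lim g c = 1"
    using left_lim_bounds(2)[OF mono_g nonneg le_one, of c] left_lim_bounds(3)[OF mono_g nonneg le_one True] g1 le_one[of c]
    by linarith
  then have \<Phi>: "\<Phi> = (LINT s:before c|\<nu>. F' (ennreal s))" by (simp add: \<Phi>_def)
  have hn: "?h \<notin> before h" using hr by (simp add: before_def)
  have split: "{0..?h} = before h \<union> {?h}"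
  proof (intro set_eqI)
    fix s show "s \<in> {0..?h} \<longleftrightarrow> s \<in> before h \<union> {?h}"
      using hr ennreal_less_iff[of s ?h] by (cases "0 \<le> s") (auto simp: before_def)
  qed
  have "emeasure \<nu> {0..?h} = emeasure \<nu> (before h) + emeasure \<nu> {?h}"
    unfolding split using hn by (intro plus_emeasure[symmetric]) auto
  then have "1 = ennreal (left_lim g h) + emeasure \<nu> {?h}"
    unfolding emeasure_initial[OF hr(2)] emeasure_before hr(1) g1 by simp
  then have fin: "emeasure \<nu> {?h} < \<infinity>" and mass: "measure \<nu> {?h} = 1 - left_lim g h"
  proof -
    assume e: "1 = ennreal (left_lim g h) + emeasure \<nu> {?h}"
    have "emeasure \<nu> {?h} \<le> 1" unfolding e by (rule add_increasing) auto
    also have "(1::ennreal) < \<infinity>" by simp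
    finally show fin: "emeasure \<nu> {?h} < \<infinity>" .
    have "emeasure \<nu> {?h} = ennreal (measure \<nu> {?h})" using fin by (intro emeasure_eq_ennreal_measure) auto
    then have "ennreal 1 = ennreal (left_lim g h + measure \<nu> {?h})"
      using e left_lim_bounds(1)[OF mono_g nonneg le_one] by (subst ennreal_plus) auto
    then have "1 = left_lim g h + measure \<nu> {?h}"
      by (rule ennreal_inj[THEN iffD1, rotated 2]) (use left_lim_bounds(1)[OF mono_g nonneg le_one, of h] in auto)
    then show "measure \<nu> {?h} = 1 - left_lim g h" by simp
  qed
  have sub: "before h \<union> {?h} \<subseteq> before c" using True hr by (auto simp: before_def)
  note Fc = LINT_L'_le_F'(1)[OF assms order_refl] and Fh = LINT_L'_le_F'[OF assms less_imp_le[OF True]]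
  have "(LINT s:before h|\<nu>. F' (ennreal s)) + (1 - left_lim g h) * F' h = (LINT s:before h \<union> {?h}|\<nu>. F' (ennreal s))"
  proof -
    have "set_integrable \<nu> {?h} (\<lambda>s. F' (ennreal s))"
      by (rule set_integrable_subset[OF Fc]) (use sub in auto)
    then have "(LINT s:before h \<union> {?h}|\<nu>. F' (ennreal s)) = (LINT s:before h|\<nu>. F' (ennreal s)) + (LINT s:{?h}|\<nu>. F' (ennreal s))"
      using hn by (intro set_integral_Un[OF _ Fh(1)]) auto
    also have "(LINT s:{?h}|\<nu>. F' (ennreal s)) = (LINT s:{?h}|\<nu>. F' h)"
      using hr by (intro set_lebesgue_integral_cong) auto
    also have "\<dots> = (1 - left_lim g h) * F' h"
      unfolding set_lebesgue_integral_def using fin mass by simp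
    finally show ?thesis by simp
  qed
  also have "\<dots> \<le> (LINT s:before c|\<nu>. F' (ennreal s))"
    unfolding set_lebesgue_integral_def
  proof (rule integral_mono')
    show "integrable \<nu> (\<lambda>s. indicator (before c) s *\<^sub>R F' (ennreal s))" using Fc unfolding set_integrable_def .
    show "indicator (before h \<union> {?h}) s *\<^sub>R F' (ennreal s) \<le> indicator (before c) s *\<^sub>R F' (ennreal s)" for s
      using sub F'_nonneg by (auto simp: indicator_def)
    show "0 \<le> indicator (before c) s *\<^sub>R F' (ennreal s)" for s using F'_nonneg by simp
  qed
  finally have "(LINT s:before h|\<nu>. F' (ennreal s)) + (1 - left_lim g h) * F' h \<le> \<Phi>" unfolding \<Phi> .
  moreover have "(1 - left_lim g h) * L' h \<le> (1 - left_lim g h) * F' h"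
    using L'_le_F'[OF assms h_ge less_imp_le[OF True]] left_lim_bounds(2)[OF mono_g nonneg le_one, of h] le_one[of h]
    by (intro mult_left_mono) auto
  ultimately show ?thesis unfolding payoff_first_mover[OF True] using Fh(2) by linarith
next
  case False
  then have "c \<le> h" by simp
  then obtain v where v: "path_payoff (\<theta> \<omega>) L' F' M' g a G' b = (LINT s:before c|\<nu>. L' (ennreal s)) + (1 - left_lim g c) * v"
    "v \<le> F' c" by (rule payoff_at_entry) blast
  have "(1 - left_lim g c) * v \<le> (1 - left_lim g c) * F' c"
    using v(2) left_lim_bounds(2)[OF mono_g nonneg le_one, of c] le_one[of c] by (intro mult_left_mono) auto
  then show ?thesis unfolding v(1) \<Phi>_def using LINT_L'_le_F'(2)[OF assms order_refl] by linarith
qed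

text \<open>
  Entry is immediate, and indifference at an entry state above \<open>xP\<close> is exact.
\<close>

lemma payoff_not_calm:
  assumes "\<not> calm" shows "path_payoff (\<theta> \<omega>) L' F' M' g a G' b = F' c"
proof -
  have c: "c = \<theta> \<omega>"
  proof (rule antisym[OF _ entry_time_ge])
    have "ennreal (enn2real (\<theta> \<omega>)) = \<theta> \<omega>" using assms by (auto simp: calm_def less_top[symmetric])
    then show "c \<le> \<theta> \<omega>" using entry_time_le[of "enn2real (\<theta> \<omega>)" \<theta> \<omega>] assms by (auto simp: calm_def)
  qed
  have "left_lim g c = left_lim (\<lambda>_. 0) c" unfolding c by (rule left_lim_cong) (rule g_zero)
  then have l: "left_lim g c = 0" by (simp add: left_lim_const)
  have "AE s in \<nu>. indicator (before c) s *\<^sub>R L' (ennreal s) = 0"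
    using no_mass_before_start[of c] by eventually_elim (auto simp: before_def c indicator_def)
  then have 0: "(LINT s:before c|\<nu>. L' (ennreal s)) = 0"
    unfolding set_lebesgue_integral_def by (rule integral_eq_zero_AE)
  have "c \<le> h" using h_ge c by simp
  then obtain v where v: "path_payoff (\<theta> \<omega>) L' F' M' g a G' b = (LINT s:before c|\<nu>. L' (ennreal s)) + (1 - left_lim g c) * v"
    "c = \<infinity> \<or> xP < X (enn2real c) \<omega> \<or> a = b \<Longrightarrow> v = F' c" by (rule payoff_at_entry) blast
  have "c = \<infinity> \<or> xP < X (enn2real c) \<omega> \<or> a = b" using assms c by (auto simp: calm_def)
  from v(2)[OF this] show ?thesis using v(1) l 0 by simp
qed

lemma payoff_equilibrium:
  assumes "g = G'" "a = b" shows "path_payoff (\<theta> \<omega>) L' F' M' g a G' b = F' c"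
proof -
  have l: "left_lim g c = 0" unfolding assms(1) G'_left_lim by simp
  have "(LINT s:before c|\<nu>. L' (ennreal s)) = stieltjes_integral c g L'" unfolding stieltjes_eq ..
  then have 0: "(LINT s:before c|\<nu>. L' (ennreal s)) = 0"
    using integral_G'_before[of c L'] unfolding assms(1) by simp
  have "c \<le> h" unfolding assms(2) tau_hat1_b by simp
  then obtain v where "path_payoff (\<theta> \<omega>) L' F' M' g a G' b = (LINT s:before c|\<nu>. L' (ennreal s)) + (1 - left_lim g c) * v"
    "c = \<infinity> \<or> xP < X (enn2real c) \<omega> \<or> a = b \<Longrightarrow> v = F' c" by (rule payoff_at_entry) blast
  then show ?thesis using l 0 assms(2) by simp
qed

lemma \<Phi>_bounds:
  assumes calm shows "0 \<le> \<Phi>" "\<Phi> \<le> I / (\<beta> - 1)"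
proof -
  let ?C = "I / (\<beta> - 1)"
  note l = left_lim_bounds(1,2)[OF mono_g nonneg le_one, of c] le_one[of c]
  have "0 \<le> (LINT s:before c|\<nu>. F' (ennreal s))"
    unfolding set_lebesgue_integral_def using F'_nonneg by (intro integral_nonneg_AE) auto
  moreover have "(LINT s:before c|\<nu>. F' (ennreal s)) \<le> (\<integral>s. ?C * indicator (before c) s \<partial>\<nu>)"
    unfolding set_lebesgue_integral_def
  proof (rule integral_mono_AE[OF LINT_L'_le_F'(1)[OF assms order_refl, unfolded set_integrable_def]])
    show "integrable \<nu> (\<lambda>s. ?C * indicator (before c) s)"
      using finite_on_before by (intro integrable_mult_right integrable_real_indicator) auto
    show "AE s in \<nu>. indicator (before c) s *\<^sub>R F' (ennreal s) \<le> ?C * indicator (before c) s"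
      using no_mass_before_start[of c]
    proof eventually_elim
      fix s assume "s \<in> before c \<longrightarrow> \<theta> \<omega> \<le> ennreal s"
      then show "indicator (before c) s *\<^sub>R F' (ennreal s) \<le> ?C * indicator (before c) s"
        using F'_bound[OF assms, of "ennreal s"] by (cases "s \<in> before c") (auto simp: before_def)
    qed
  qed
  then have "(LINT s:before c|\<nu>. F' (ennreal s)) \<le> ?C * left_lim g c" using measure_before[of c] by simp
  moreover have "(1 - left_lim g c) * F' c \<le> (1 - left_lim g c) * ?C"
    using F'_bound[OF assms entry_time_ge order_refl] l by (intro mult_left_mono) auto
  moreover have "0 \<le> (1 - left_lim g c) * F' c" using F'_nonneg l by simp
  ultimately show "0 \<le> \<Phi>" "\<Phi> \<le> ?C" unfolding \<Phi>_def by (auto simp: algebra_simps)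
qed

text \<open>
  Up to the mass at infinity, the Riemann sum is the integral of the step function \<open>f n\<close>, whose value
  at \<open>s\<close> is the stopped follower payoff at a time at most \<open>1 / (n + 1)\<close> after \<open>s\<close>.  Continuity of the
  path gives pointwise convergence, and the bound on the follower payoff until entry a majorant.
\<close>

lemma right_sum_tendsto:
  assumes calm shows "right_sum g \<theta> \<omega> \<longlonglongrightarrow> \<Phi>"
proof -
  define t where "t n k = real k / real (Suc n)" for n k
  define K where "K n = Suc n * Suc n" for n
  let ?F = "\<lambda>u. F' (min u c)"
  define f where "f n s = indicator {0} s * ?F 0 + (\<Sum>k<K n. indicator {t n k<..t n (Suc k)} s * ?F (ennreal (t n (Suc k))))
     + indicator {real (Suc n)<..} s * F' c" for n s
  have tK: "t n (K n) = real (Suc n)" for n unfolding t_def K_def of_nat_mult by simp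
  have t0: "0 \<le> t n k" "t n k \<le> t n (Suc k)" for n k by (auto simp: t_def divide_right_mono)
  have all: "before \<infinity> = {0..}" by (auto simp: before_def)
  have massive: "emeasure \<nu> A < \<infinity>" if "A \<subseteq> {0..}" "A \<in> sets borel" for A
    using emeasure_mono[of A "before \<infinity>" \<nu>] that finite_on_before[of \<infinity>] unfolding all by (auto intro: le_less_trans)
  have m0: "measure \<nu> {0} = g 0" using emeasure_initial[of 0] nonneg by (simp add: measure_def)
  have mk: "measure \<nu> {t n k<..t n (Suc k)} = g (ennreal (t n (Suc k))) - g (ennreal (t n k))" for n k
  proof -
    have "extended (t n k) = g (ennreal (t n k))" "extended (t n (Suc k)) = g (ennreal (t n (Suc k)))"
      using t0(1)[of n k] t0(1)[of n "Suc k"] by (auto simp: extended_def)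
    then show ?thesis
      using emeasure_Ioc[OF t0(2), of n k] extended_mono[OF t0(2), of n k] by (simp add: measure_def)
  qed
  have ml: "measure \<nu> {real (Suc n)<..} = left_lim g \<infinity> - g (ennreal (real (Suc n)))" for n
  proof -
    have "{0..} = {0..real (Suc n)} \<union> {real (Suc n)<..}" by auto
    then have "measure \<nu> {0..} = measure \<nu> {0..real (Suc n)} + measure \<nu> {real (Suc n)<..}"
      using massive[of "{0..real (Suc n)}"] massive[of "{real (Suc n)<..}"]
      by (subst measure_Union[symmetric]) auto
    moreover have "measure \<nu> {0..real (Suc n)} = g (ennreal (real (Suc n)))"
      using emeasure_initial[of "real (Suc n)"] nonneg by (simp add: measure_def)
    ultimately show ?thesis using measure_before[of \<infinity>] unfolding all by simp
  qed
  have ind: "integrable \<nu> (\<lambda>s. indicator A s * y)" "(\<integral>s. indicator A s * y \<partial>\<nu>) = measure \<nu> A * y"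
    if "A \<subseteq> {0..}" "A \<in> sets borel" for A and y :: real
    using massive[OF that] that by auto
  have sub: "{t n k<..t n (Suc k)} \<subseteq> {0..}" for n k using t0(1)[of n k] by auto
  have fi: "(\<integral>s. f n s \<partial>\<nu>) = g 0 * ?F 0 + (\<Sum>k<K n. (g (ennreal (t n (Suc k))) - g (ennreal (t n k))) * ?F (ennreal (t n (Suc k))))
     + (left_lim g \<infinity> - g (ennreal (real (Suc n)))) * F' c" for n
  proof -
    have 1: "integrable \<nu> (\<lambda>s. indicator {0} s * ?F 0)" "(\<integral>s. indicator {0} s * ?F 0 \<partial>\<nu>) = g 0 * ?F 0"
      unfolding m0[symmetric] by (rule ind; simp)+
    have 2: "integrable \<nu> (\<lambda>s. indicator {t n k<..t n (Suc k)} s * ?F (ennreal (t n (Suc k))))"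
      "(\<integral>s. indicator {t n k<..t n (Suc k)} s * ?F (ennreal (t n (Suc k))) \<partial>\<nu>) =
        (g (ennreal (t n (Suc k))) - g (ennreal (t n k))) * ?F (ennreal (t n (Suc k)))" for k
      unfolding mk[symmetric] by (rule ind[OF sub]; simp)+
    have 3: "integrable \<nu> (\<lambda>s. indicator {real (Suc n)<..} s * F' c)"
      "(\<integral>s. indicator {real (Suc n)<..} s * F' c \<partial>\<nu>) = (left_lim g \<infinity> - g (ennreal (real (Suc n)))) * F' c"
      unfolding ml[symmetric] by (rule ind; auto)+
    have 4: "integrable \<nu> (\<lambda>s. \<Sum>k<K n. indicator {t n k<..t n (Suc k)} s * ?F (ennreal (t n (Suc k))))"
      by (rule Bochner_Integration.integrable_sum) (rule 2(1))
    have 5: "(\<integral>s. (\<Sum>k<K n. indicator {t n k<..t n (Suc k)} s * ?F (ennreal (t n (Suc k)))) \<partial>\<nu>) =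
        (\<Sum>k<K n. (g (ennreal (t n (Suc k))) - g (ennreal (t n k))) * ?F (ennreal (t n (Suc k))))"
      unfolding 2(2)[symmetric] by (rule Bochner_Integration.integral_sum) (rule 2(1))
    show ?thesis unfolding f_def
      by (subst Bochner_Integration.integral_add[OF Bochner_Integration.integrable_add[OF 1(1) 4] 3(1)],
          subst Bochner_Integration.integral_add[OF 1(1) 4]) (simp only: 1(2) 3(2) 5)
  qed
  have sum: "right_sum g \<theta> \<omega> n = (\<integral>s. f n s \<partial>\<nu>) + (1 - left_lim g \<infinity>) * F' c" for n
    unfolding fi right_sum_def K_def t_def by (simp add: algebra_simps)
  have late: "f n s = F' c" if "real (Suc n) < s" for n s
  proof -
    have "t n (Suc k) \<le> real (Suc n)" if "k < K n" for k
      unfolding tK[of n, symmetric] using that by (auto simp: t_def intro!: divide_right_mono)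
    then have "(\<Sum>k<K n. indicator {t n k<..t n (Suc k)} s * ?F (ennreal (t n (Suc k)))) = 0"
      using that by (intro sum.neutral) (force simp: indicator_def)
    then show ?thesis using that by (simp add: f_def)
  qed
  have early: "\<exists>d. s \<le> d \<and> d \<le> s + 1 / real (Suc n) \<and> f n s = ?F (ennreal d)" if s: "0 \<le> s" "s \<le> real (Suc n)" for n s
  proof (cases "s = 0")
    case True
    have "(\<Sum>k<K n. indicator {t n k<..t n (Suc k)} (0::real) * ?F (ennreal (t n (Suc k)))) = 0"
      using t0(1) by (intro sum.neutral) (auto simp: indicator_def not_less)
    then have "f n 0 = ?F (ennreal 0)" unfolding f_def by simp
    then show ?thesis using True by (intro exI[of _ 0]) simp
  next
    case False
    define N where "N = real (Suc n)"
    have N: "N > 0" by (simp add: N_def)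
    (* The interval of the grid that contains s. *)
    define k0 where "k0 = nat \<lceil>s * N\<rceil> - 1"
    have sN: "0 < s * N" using s False N by simp
    then have "1 \<le> \<lceil>s * N\<rceil>" by (simp add: le_ceiling_iff)
    then have k0: "of_int \<lceil>s * N\<rceil> = real (Suc k0)" by (simp add: k0_def)
    then have c1: "s * N \<le> real (Suc k0)" "real k0 < s * N"
      using le_of_int_ceiling[of "s * N"] ceiling_correct[of "s * N"] by auto
    have in0: "t n k0 < s" "s \<le> t n (Suc k0)" "t n (Suc k0) \<le> s + 1 / N"
      using c1 N unfolding t_def N_def[symmetric] by (auto simp: field_simps)
    have "s * N \<le> N * N" using s(2) N unfolding N_def[symmetric] by (intro mult_right_mono) auto
    then have "real k0 < N * N" using c1(2) by linarith
    then have "real k0 < real (K n)" unfolding K_def N_def of_nat_mult .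
    then have kK: "k0 < K n" by simp
    have "indicator {t n k<..t n (Suc k)} s = (if k = k0 then 1 else 0 :: real)" for k
    proof (cases "k = k0")
      case False
      have "\<not> (t n k < s \<and> s \<le> t n (Suc k))"
      proof
        assume h: "t n k < s \<and> s \<le> t n (Suc k)"
        then have "real k < s * N" "s * N \<le> real (Suc k)" using N unfolding t_def N_def[symmetric] by (auto simp: field_simps)
        then have "real k < real (Suc k0)" "real k0 < real (Suc k)" using c1 by linarith+
        then show False using False by simp
      qed
      then show ?thesis using False by (simp add: indicator_def)
    qed (use in0 in auto)
    then have "f n s = ?F (ennreal (t n (Suc k0)))"
      using False s kK by (simp add: f_def sum.delta indicator_def if_distrib[of "\<lambda>y. y * _"] cong: if_cong)
    then show ?thesis using in0 unfolding N_def by blast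
  qed
  have cont: "continuous_on {0..} (\<lambda>u. ?F (ennreal u))"
  proof (cases c)
    case (real q)
    then have "?F (ennreal u) = F' (ennreal (min u q))" if "0 \<le> u" for u
      using that by (auto simp: min_def ennreal_le_iff)
    moreover have "continuous_on {0..} (\<lambda>u. F' (ennreal (min u q)))"
      using real by (intro continuous_on_compose2[OF continuous_F']) (auto intro!: continuous_intros)
    ultimately show ?thesis by (subst continuous_on_cong[OF refl]) auto
  next
    case top
    then show ?thesis using continuous_F' by (simp add: min_absorb1)
  qed
  define CF where "CF = I / (\<beta> - 1)"
  have bound: "\<bar>?F u\<bar> \<le> CF" if "\<theta> \<omega> \<le> u" for u
    using F'_bound[OF assms, of "min u c"] F'_nonneg that entry_time_ge[of \<theta> \<omega>] by (simp add: CF_def)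
  have lim: "(\<lambda>n. \<integral>s. f n s \<partial>\<nu>) \<longlonglongrightarrow> (\<integral>s. indicator {0..} s * ?F (ennreal s) \<partial>\<nu>)"
  proof (rule integral_dominated_convergence[where w="\<lambda>s. indicator {0..} s * CF"])
    show "integrable \<nu> (\<lambda>s. indicator {0..} s * CF)" by (rule ind(1)) auto
    show "f n \<in> borel_measurable \<nu>" for n unfolding f_def by measurable
    have "(\<lambda>s. indicator {0..} s *\<^sub>R ?F (ennreal s)) \<in> borel_measurable borel"
      by (rule borel_measurable_continuous_on_indicator[OF _ cont]) simp
    then show "(\<lambda>s. indicator {0..} s * ?F (ennreal s)) \<in> borel_measurable \<nu>" by simp
    have neg: "f n s = 0" if "s < 0" for n s
    proof -
      have "(\<Sum>k<K n. indicator {t n k<..t n (Suc k)} s * ?F (ennreal (t n (Suc k)))) = 0"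
        using that t0(1) by (intro sum.neutral) (auto simp: indicator_def not_less intro: less_imp_le order_trans)
      then show ?thesis using that by (simp add: f_def)
    qed
    show "AE s in \<nu>. (\<lambda>n. f n s) \<longlonglongrightarrow> indicator {0..} s * ?F (ennreal s)"
    proof (intro AE_I2)
      fix s
      show "(\<lambda>n. f n s) \<longlonglongrightarrow> indicator {0..} s * ?F (ennreal s)"
      proof (cases "0 \<le> s")
        case True
        obtain n0 :: nat where n0: "s \<le> real n0" using real_arch_simple by blast
        have "\<exists>d. s \<le> d \<and> d \<le> s + 1 / real (Suc n) \<and> (n \<ge> n0 \<longrightarrow> f n s = ?F (ennreal d))" for n
        proof (cases "n \<ge> n0")
          case h: True
          then have "s \<le> real (Suc n)" using n0 by linarith
          then show ?thesis using early[OF True] by blast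
        qed (intro exI[of _ s], simp)
        then obtain d where d: "\<And>n. s \<le> d n" "\<And>n. d n \<le> s + 1 / real (Suc n)" "\<And>n. n \<ge> n0 \<Longrightarrow> f n s = ?F (ennreal (d n))"
          by metis
        have "d \<longlonglongrightarrow> s"
        proof (rule tendsto_sandwich[of "\<lambda>_. s" _ _ "\<lambda>n. s + 1 / real (Suc n)"])
          show "(\<lambda>n. s + 1 / real (Suc n)) \<longlonglongrightarrow> s"
            using tendsto_add[OF tendsto_const LIMSEQ_Suc[OF lim_1_over_n], of s] by simp
        qed (use d in auto)
        then have "(\<lambda>n. ?F (ennreal (d n))) \<longlonglongrightarrow> ?F (ennreal s)"
          by (rule continuous_on_tendsto_compose[OF cont]) (use True order_trans[OF True d(1)] in auto)
        then have "(\<lambda>n. f n s) \<longlonglongrightarrow> ?F (ennreal s)"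
          by (rule Lim_transform_eventually) (use d(3) in \<open>auto simp: eventually_sequentially intro!: exI[of _ n0]\<close>)
        then show ?thesis using True by simp
      qed (simp add: neg)
    qed
    show "AE s in \<nu>. norm (f n s) \<le> indicator {0..} s * CF" for n
      using no_mass_before_start[of \<infinity>]
    proof eventually_elim
      fix s assume h: "s \<in> before \<infinity> \<longrightarrow> \<theta> \<omega> \<le> ennreal s"
      show "norm (f n s) \<le> indicator {0..} s * CF"
      proof (cases "0 \<le> s")
        case True
        then have th: "\<theta> \<omega> \<le> ennreal s" using h unfolding all by simp
        show ?thesis
        proof (cases "s \<le> real (Suc n)")
          case le: True
          obtain d where d: "s \<le> d" "f n s = ?F (ennreal d)" using early[OF True le] by blast
          then have "\<theta> \<omega> \<le> ennreal d" using th by (meson ennreal_leI order_trans)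
          then show ?thesis using bound[of "ennreal d"] d True by simp
        next
          case False
          then show ?thesis using late[of n s] bound[of c] entry_time_ge[of \<theta> \<omega>] True by simp
        qed
      qed (simp add: neg)
    qed
  qed
  have "(\<integral>s. indicator {0..} s * ?F (ennreal s) \<partial>\<nu>) + (1 - left_lim g \<infinity>) * F' c = \<Phi>"
  proof -
    let ?R = "{0..} - before c"
    have "(\<integral>s. indicator {0..} s * ?F (ennreal s) \<partial>\<nu>) = (\<integral>s. indicator (before c) s *\<^sub>R F' (ennreal s) + indicator ?R s * F' c \<partial>\<nu>)"
      by (intro Bochner_Integration.integral_cong) (auto simp: indicator_def before_def min_def)
    also have "\<dots> = (LINT s:before c|\<nu>. F' (ennreal s)) + measure \<nu> ?R * F' c"
      using LINT_L'_le_F'(1)[OF assms order_refl] ind[of ?R "F' c"] unfolding set_integrable_def set_lebesgue_integral_def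
      by (subst Bochner_Integration.integral_add) auto
    also have "measure \<nu> ?R = left_lim g \<infinity> - left_lim g c"
    proof -
      have "{0..} = before c \<union> ?R" by (auto simp: before_def)
      then have "measure \<nu> (before c \<union> ?R) = left_lim g \<infinity>" using measure_before[of \<infinity>] unfolding all by simp
      moreover have "measure \<nu> (before c \<union> ?R) = measure \<nu> (before c) + measure \<nu> ?R"
        using massive[of ?R] finite_on_before[of c] by (intro measure_Union) auto
      ultimately show ?thesis using measure_before[of c] by simp
    qed
    finally show ?thesis unfolding \<Phi>_def by (simp add: algebra_simps)
  qed
  then show ?thesis unfolding sum[abs_def] using tendsto_add[OF lim tendsto_const, of "(1 - left_lim g \<infinity>) * F' c"] by simp
qed

end

section \<open>Conditional expectations\<close>

lemma (in prob_space) real_cond_exp_mono_sets: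
  assumes sub: "subalgebra M S" and f: "integrable M f" and g: "integrable M g"
    and le: "\<And>A. A \<in> sets S \<Longrightarrow> expectation (\<lambda>x. indicator A x * f x) \<le> expectation (\<lambda>x. indicator A x * g x)"
  shows "AE x in M. real_cond_exp M S f x \<le> real_cond_exp M S g x"
proof -
  interpret finite_measure_subalgebra M S by unfold_locales (rule sub)
  define d where "d x = real_cond_exp M S f x - real_cond_exp M S g x" for x
  have di: "integrable M d" unfolding d_def using real_cond_exp_int(1)[OF f] real_cond_exp_int(1)[OF g] by simp
  define A where "A = {x \<in> space S. 0 < d x}"
  have A: "A \<in> sets S" unfolding A_def d_def by measurable
  then have AM: "A \<in> sets M" using sub by (auto simp: subalgebra_def)
  have i: "integrable M (\<lambda>x. indicator A x * d x)"
    using integrable_real_mult_indicator[OF AM di] by (simp add: mult.commute)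
  have "expectation (\<lambda>x. indicator A x * d x) = expectation (\<lambda>x. indicator A x * real_cond_exp M S f x) - expectation (\<lambda>x. indicator A x * real_cond_exp M S g x)"
    unfolding d_def right_diff_distrib
    using integrable_real_mult_indicator[OF AM real_cond_exp_int(1)[OF f]] integrable_real_mult_indicator[OF AM real_cond_exp_int(1)[OF g]]
    by (intro Bochner_Integration.integral_diff) (simp_all add: mult.commute)
  also have "\<dots> = expectation (\<lambda>x. indicator A x * f x) - expectation (\<lambda>x. indicator A x * g x)"
    using real_cond_exp_intA[OF f A] real_cond_exp_intA[OF g A] by (simp add: set_lebesgue_integral_def)
  also have "\<dots> \<le> 0" using le[OF A] by simp
  finally have "expectation (\<lambda>x. indicator A x * d x) \<le> 0" .
  moreover have nn: "AE x in M. 0 \<le> indicator A x * d x" by (rule AE_I2) (simp add: A_def indicator_def)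
  ultimately have "expectation (\<lambda>x. indicator A x * d x) = 0" using integral_nonneg_AE[OF nn] by simp
  then have "AE x in M. indicator A x * d x = 0" using integral_nonneg_eq_0_iff_AE[OF i nn] by simp
  then show ?thesis using AE_space
  proof eventually_elim
    fix x assume "indicator A x * d x = 0" "x \<in> space M"
    moreover have "space S = space M" using sub by (simp add: subalgebra_def)
    ultimately have "\<not> 0 < d x" by (auto simp: A_def indicator_def split: if_splits)
    then show "real_cond_exp M S f x \<le> real_cond_exp M S g x" by (simp add: d_def)
  qed
qed

lemma (in prob_space) real_cond_exp_nonneg_eq:
  assumes sub: "subalgebra M S" and f: "\<And>x. 0 \<le> f x"
  shows "AE x in M. real_cond_exp M S f x = enn2real (nn_cond_exp M S (\<lambda>x. ennreal (f x)) x)"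
proof -
  interpret finite_measure_subalgebra M S by unfold_locales (rule sub)
  have z: "(\<lambda>x. ennreal (- f x)) = (\<lambda>_. 0)" using f by (simp add: ennreal_neg)
  have "AE x in M. (0::ennreal) = nn_cond_exp M S (\<lambda>_. 0) x" by (rule nn_cond_exp_F_meas) simp
  then show ?thesis by eventually_elim (simp add: real_cond_exp_def z)
qed

text \<open>
  Since \<open>C\<close> belongs to the sub-\<open>\<sigma>\<close>-algebra, the claim can be checked separately on \<open>C\<close> and off \<open>C\<close>, where
  \<open>f\<close> and \<open>g\<close> agree.  Measurability of \<open>f\<close> enters as a premise of the comparison on \<open>C\<close> only: the
  conditional expectation of a positive part that is not measurable is 0 by convention, which is
  at most that of \<open>g \<ge> 0\<close>.
\<close>

lemma (in prob_space) real_cond_exp_le_local: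
  assumes sub: "subalgebra M S" and C: "C \<in> sets S"
    and g: "g \<in> borel_measurable M" "\<And>x. 0 \<le> g x" "integrable M (\<lambda>x. indicator C x * g x)"
    and off: "AE x in M. x \<notin> C \<longrightarrow> f x = g x"
    and main: "(\<lambda>x. ennreal (f x)) \<in> borel_measurable M \<Longrightarrow> integrable M (\<lambda>x. indicator C x * max 0 (f x)) \<and>
      (\<forall>A\<in>sets S. expectation (\<lambda>x. indicator A x * (indicator C x * max 0 (f x))) \<le> expectation (\<lambda>x. indicator A x * (indicator C x * g x)))"
  shows "AE x in M. real_cond_exp M S f x \<le> real_cond_exp M S g x"
proof -
  interpret finite_measure_subalgebra M S by unfold_locales (rule sub)
  define u v where "u x = ennreal (f x)" and "v x = ennreal (g x)" for x
  have le: "real_cond_exp M S f x \<le> enn2real (nn_cond_exp M S u x)" for x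
    unfolding real_cond_exp_def u_def[abs_def] by simp
  have rg: "AE x in M. real_cond_exp M S g x = enn2real (nn_cond_exp M S v x)"
    unfolding v_def[abs_def] by (rule real_cond_exp_nonneg_eq[OF sub g(2)])
  have vm: "v \<in> borel_measurable M" unfolding v_def[abs_def] using g(1) by measurable
  have CM: "C \<in> sets M" using C sub by (auto simp: subalgebra_def)
  show ?thesis
  proof (cases "u \<in> borel_measurable M")
    case False
    then have "nn_cond_exp M S u = (\<lambda>_. 0)" by (simp add: nn_cond_exp_def)
    then have f0: "real_cond_exp M S f x \<le> 0" for x using le[of x] by simp
    show ?thesis using rg by eventually_elim (simp add: order_trans[OF f0])
  next
    case True
    then have um: "u \<in> borel_measurable M" .
    have fi: "integrable M (\<lambda>x. indicator C x * max 0 (f x))"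
      and fle: "\<And>A. A \<in> sets S \<Longrightarrow> expectation (\<lambda>x. indicator A x * (indicator C x * max 0 (f x))) \<le> expectation (\<lambda>x. indicator A x * (indicator C x * g x))"
      using main True unfolding u_def[abs_def] by auto
    have e: "(\<lambda>x. ennreal (indicator C x * max 0 (f x))) = (\<lambda>x. indicator C x * u x)"
        "(\<lambda>x. ennreal (indicator C x * g x)) = (\<lambda>x. indicator C x * v x)"
      by (auto simp: fun_eq_iff u_def v_def indicator_def max_def ennreal_neg)
    have C1: "(indicator C :: _ \<Rightarrow> ennreal) \<in> borel_measurable S" using C by measurable
    have C2: "(indicator (- C) :: _ \<Rightarrow> ennreal) \<in> borel_measurable S"
    proof -
      have "(\<lambda>x. 1 - indicator C x :: ennreal) \<in> borel_measurable S" using C1 by measurable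
      then show ?thesis by (rule measurable_cong[THEN iffD1, rotated]) (auto simp: indicator_def)
    qed
    have r1: "AE x in M. real_cond_exp M S (\<lambda>x. indicator C x * max 0 (f x)) x = enn2real (nn_cond_exp M S (\<lambda>x. indicator C x * u x) x)"
      using real_cond_exp_nonneg_eq[OF sub, of "\<lambda>x. indicator C x * max 0 (f x)"] unfolding e by simp
    have r2: "AE x in M. real_cond_exp M S (\<lambda>x. indicator C x * g x) x = enn2real (nn_cond_exp M S (\<lambda>x. indicator C x * v x) x)"
      using real_cond_exp_nonneg_eq[OF sub, of "\<lambda>x. indicator C x * g x"] g(2) unfolding e by simp
    have "AE x in M. indicator (- C) x * u x = indicator (- C) x * v x"
      using off by eventually_elim (auto simp: indicator_def u_def v_def)
    then have r3: "AE x in M. nn_cond_exp M S (\<lambda>x. indicator (- C) x * u x) x = nn_cond_exp M S (\<lambda>x. indicator (- C) x * v x) x"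
      using um vm measurable_from_subalg[OF sub C2] by (intro nn_cond_exp_cong) auto
    have r4: "AE x in M. real_cond_exp M S (\<lambda>x. indicator C x * max 0 (f x)) x \<le> real_cond_exp M S (\<lambda>x. indicator C x * g x) x"
      by (rule real_cond_exp_mono_sets[OF sub fi g(3)]) (rule fle)
    show ?thesis
      using rg r1 r2 r3 r4
        nn_cond_exp_prod[OF C1 um] nn_cond_exp_prod[OF C1 vm] nn_cond_exp_prod[OF C2 um] nn_cond_exp_prod[OF C2 vm]
    proof eventually_elim
      fix x
      assume h: "real_cond_exp M S g x = enn2real (nn_cond_exp M S v x)"
        "real_cond_exp M S (\<lambda>x. indicator C x * max 0 (f x)) x = enn2real (nn_cond_exp M S (\<lambda>x. indicator C x * u x) x)"
        "real_cond_exp M S (\<lambda>x. indicator C x * g x) x = enn2real (nn_cond_exp M S (\<lambda>x. indicator C x * v x) x)"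
        "nn_cond_exp M S (\<lambda>x. indicator (- C) x * u x) x = nn_cond_exp M S (\<lambda>x. indicator (- C) x * v x) x"
        "real_cond_exp M S (\<lambda>x. indicator C x * max 0 (f x)) x \<le> real_cond_exp M S (\<lambda>x. indicator C x * g x) x"
        "indicator C x * nn_cond_exp M S u x = nn_cond_exp M S (\<lambda>x. indicator C x * u x) x"
        "indicator C x * nn_cond_exp M S v x = nn_cond_exp M S (\<lambda>x. indicator C x * v x) x"
        "indicator (- C) x * nn_cond_exp M S u x = nn_cond_exp M S (\<lambda>x. indicator (- C) x * u x) x"
        "indicator (- C) x * nn_cond_exp M S v x = nn_cond_exp M S (\<lambda>x. indicator (- C) x * v x) x"
      have "enn2real (nn_cond_exp M S u x) \<le> enn2real (nn_cond_exp M S v x)"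
      proof (cases "x \<in> C")
        case True
        then show ?thesis using h(2,3,5) unfolding h(6,7)[symmetric] by simp
      next
        case False
        then show ?thesis using h(4) unfolding h(8,9)[symmetric] by simp
      qed
      then show "real_cond_exp M S f x \<le> real_cond_exp M S g x" using le[of x] h(1) by simp
    qed
  qed
qed

lemma (in usual_filtration) borel_measurable_AE_cong:
  fixes f g :: "'a \<Rightarrow> 'b :: topological_space"
  assumes g: "g \<in> borel_measurable P" and eq: "AE \<omega> in P. f \<omega> = g \<omega>"
  shows "f \<in> borel_measurable P"
proof (rule measurableI)
  obtain N where N: "N \<in> null_sets P" "{\<omega> \<in> space P. f \<omega> \<noteq> g \<omega>} \<subseteq> N"
    using eq unfolding eventually_ae_filter by auto
  fix A :: "'b set" assume "A \<in> sets borel"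
  then have 1: "g -` A \<inter> space P - N \<in> sets P" using N(1) g by (intro sets.Diff measurable_sets) auto
  have 2: "f -` A \<inter> space P \<inter> N \<in> sets P"
    using complete_filtration[OF N(1), of "f -` A \<inter> space P \<inter> N"] sets_filtration[of 0] by auto
  have eq: "f -` A \<inter> space P = (g -` A \<inter> space P - N) \<union> (f -` A \<inter> space P \<inter> N)" using N(2) by auto
  show "f -` A \<inter> space P \<in> sets P" by (subst eq) (rule sets.Un[OF 1 2])
qed auto

lemma (in usual_filtration) sigma_at_subalgebra:
  assumes "stopping_time \<F> \<theta>" shows "subalgebra P (sigma_at P \<F> \<theta>)"
  unfolding subalgebra_def
proof
  show "space (sigma_at P \<F> \<theta>) = space P" by (rule space_pre_sigma)
  show "sets (sigma_at P \<F> \<theta>) \<subseteq> sets P"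
  proof
    fix A assume "A \<in> sets (sigma_at P \<F> \<theta>)"
    from sets_pre_sigmaD[OF assms this, of \<infinity>] show "A \<in> sets P" using sets_filtration[of \<infinity>] by auto
  qed
qed

section \<open>The follower payoff as a stopped martingale\<close>

context entry_game begin

lemma measurable_stopping: "stopping_time \<F> T \<Longrightarrow> T \<in> borel_measurable P"
  by (rule measurable_stopping_time[where F=\<F>]) (use sets_filtration space_F in auto)

lemma paths_nonneg: "AE \<omega> in P. \<forall>t\<ge>0. 0 \<le> X t \<omega>"
  using explicit_solution by eventually_elim (use start in simp)

text \<open>
  The quadratic equation for \<open>\<beta>\<close> says that \<open>exp (- r t) X\<^sub>t\<^sup>\<beta>\<close> has no drift: inserting the explicit
  solution leaves exactly the exponent of \<open>exp_mart (\<beta> * \<sigma>)\<close>.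
\<close>

lemma follower_exp_mart:
  "AE \<omega> in P. \<forall>t\<ge>0. X t \<omega> < xF \<longrightarrow> F (ennreal t) \<omega> = (x / xF) powr \<beta> * (I / (\<beta> - 1)) * exp_mart (\<beta> * \<sigma>) t \<omega>"
  using explicit_solution
proof eventually_elim
  fix \<omega> assume h: "\<forall>t\<ge>0. X t \<omega> = x * exp (\<sigma> * B t \<omega> + (\<mu> - \<sigma>\<^sup>2 / 2) * t)"
  show "\<forall>t\<ge>0. X t \<omega> < xF \<longrightarrow> F (ennreal t) \<omega> = (x / xF) powr \<beta> * (I / (\<beta> - 1)) * exp_mart (\<beta> * \<sigma>) t \<omega>"
  proof (intro allI impI)
    fix t :: real assume t: "t \<ge> 0" "X t \<omega> < xF"
    let ?w = "\<sigma> * B t \<omega> + (\<mu> - \<sigma>\<^sup>2 / 2) * t"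
    have "(X t \<omega> / xF) powr \<beta> = ((x / xF) * exp ?w) powr \<beta>" using h t by simp
    also have "\<dots> = (x / xF) powr \<beta> * exp (\<beta> * ?w)"
      using start x_F_pos by (subst powr_mult) (auto simp: powr_def)
    finally have "F (ennreal t) \<omega> = exp (- r * t) * ((x / xF) powr \<beta> * exp (\<beta> * ?w) * (I / (\<beta> - 1)))"
      using t by (simp add: discounted_process_def fv_lt_threshold)
    also have "\<dots> = (x / xF) powr \<beta> * (I / (\<beta> - 1)) * (exp (- r * t) * exp (\<beta> * ?w))" by (simp only: ac_simps)
    also have "exp (- r * t) * exp (\<beta> * ?w) = exp_mart (\<beta> * \<sigma>) t \<omega>"
    proof -
      have "- r * t + \<beta> * ?w = \<beta> * \<sigma> * B t \<omega> - (\<beta> * \<sigma>)\<^sup>2 * t / 2"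
      proof -
        have "- r * t = - (1/2 * \<sigma>\<^sup>2 * \<beta> * (\<beta> - 1) + \<mu> * \<beta>) * t" using beta1_root(2) by simp
        then show ?thesis by (simp add: power2_eq_square algebra_simps add_divide_distrib diff_divide_distrib)
      qed
      then show ?thesis unfolding exp_mart_def exp_add[symmetric] by simp
    qed
    finally show "F (ennreal t) \<omega> = (x / xF) powr \<beta> * (I / (\<beta> - 1)) * exp_mart (\<beta> * \<sigma>) t \<omega>" .
  qed
qed

lemma measurable_exp_mart_random:
  assumes h: "h \<in> borel_measurable P" "\<And>\<omega>. 0 \<le> h \<omega>"
  shows "(\<lambda>\<omega>. exp_mart a (h \<omega>) \<omega>) \<in> borel_measurable P"
proof -
  have "AE \<omega> in P. continuous_on {0..} (\<lambda>t. B t \<omega>)" using brownian unfolding brownian_motion_def by blast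
  then obtain N where N: "N \<in> null_sets P" "{\<omega> \<in> space P. \<not> continuous_on {0..} (\<lambda>t. B t \<omega>)} \<subseteq> N"
    unfolding eventually_ae_filter by auto
  (* B set to 0 on a null set outside of which it is continuous. *)
  define B' where "B' t \<omega> = indicator (space P - N) \<omega> * B t \<omega>" for t \<omega>
  have "(\<lambda>\<omega>. B' (h \<omega>) \<omega>) \<in> borel_measurable P"
  proof (rule borel_measurable_at_random_time[OF _ _ h])
    have [measurable]: "space P - N \<in> sets P" using N(1) by auto
    show "B' s \<in> borel_measurable P" if "0 \<le> s" for s unfolding B'_def using measurable_B_P[OF that] by measurable
    show "continuous_on {0..} (\<lambda>s. B' s \<omega>)" if "\<omega> \<in> space P" for \<omega>
    proof (cases "\<omega> \<in> N")
      case False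
      then have "continuous_on {0..} (\<lambda>t. B t \<omega>)" using that N(2) by auto
      then show ?thesis unfolding B'_def by (intro continuous_intros)
    qed (simp add: B'_def)
  qed
  then have m: "(\<lambda>\<omega>. exp (a * B' (h \<omega>) \<omega> - a\<^sup>2 * h \<omega> / 2)) \<in> borel_measurable P" using h(1) by measurable
  have "AE \<omega> in P. exp_mart a (h \<omega>) \<omega> = exp (a * B' (h \<omega>) \<omega> - a\<^sup>2 * h \<omega> / 2)"
    using AE_not_in[OF N(1)] AE_space by eventually_elim (simp add: exp_mart_def B'_def)
  then show ?thesis by (rule borel_measurable_AE_cong[OF m])
qed

definition calm_at :: "('a \<Rightarrow> ennreal) \<Rightarrow> 'a set"
  where "calm_at \<theta> = {\<omega> \<in> space P. \<theta> \<omega> = \<infinity> \<or> X (enn2real (\<theta> \<omega>)) \<omega> \<le> xP}"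

lemma calm_at_sigma:
  assumes \<theta>: "stopping_time \<F> \<theta>" shows "calm_at \<theta> \<in> sets (sigma_at P \<F> \<theta>)"
proof (rule sets_pre_sigmaI[OF \<theta>])
  have fin: "{\<omega> \<in> calm_at \<theta>. \<theta> \<omega> \<le> ennreal u} \<in> sets (\<F> (ennreal u))" if u: "0 \<le> u" for u
  proof -
    have hm: "(\<lambda>\<omega>. enn2real (min (\<theta> \<omega>) (ennreal u))) \<in> borel_measurable (\<F> (ennreal u))"
    proof -
      have "(\<lambda>\<omega>. min (\<theta> \<omega>) (ennreal u)) \<in> borel_measurable (\<F> (ennreal u))"
        by (rule measurable_min_stopping_time[OF \<theta>])
      then show ?thesis by measurable
    qed
    have le: "enn2real (min (\<theta> \<omega>) (ennreal u)) \<le> u" for \<omega>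
      using enn2real_mono[of "min (\<theta> \<omega>) (ennreal u)" "ennreal u"] u by simp
    have [measurable]: "(\<lambda>\<omega>. X (enn2real (min (\<theta> \<omega>) (ennreal u))) \<omega>) \<in> borel_measurable (\<F> (ennreal u))"
      by (rule measurable_X_random[where t=u]) (use hm le measurable_X space_F in auto)
    have [measurable]: "Measurable.pred (\<F> (ennreal u)) (\<lambda>\<omega>. \<theta> \<omega> \<le> ennreal u)" by (rule stopping_timeD[OF \<theta>])
    have "{\<omega> \<in> calm_at \<theta>. \<theta> \<omega> \<le> ennreal u} = {\<omega> \<in> space (\<F> (ennreal u)). X (enn2real (min (\<theta> \<omega>) (ennreal u))) \<omega> \<le> xP \<and> \<theta> \<omega> \<le> ennreal u}"
      by (auto simp: calm_at_def space_F min_absorb1 top_unique)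
    also have "\<dots> \<in> sets (\<F> (ennreal u))" by measurable
    finally show ?thesis .
  qed
  fix t show "{\<omega> \<in> calm_at \<theta>. \<theta> \<omega> \<le> t} \<in> sets (\<F> t)"
  proof (cases t)
    case (real u)
    then show ?thesis using fin by simp
  next
    case top
    have "{\<omega> \<in> calm_at \<theta>. \<theta> \<omega> \<le> t} = (\<Union>n. {\<omega> \<in> calm_at \<theta>. \<theta> \<omega> \<le> ennreal (real n)}) \<union> {\<omega> \<in> space (\<F> t). \<theta> \<omega> = \<infinity>}"
    proof (intro set_eqI iffI)
      fix \<omega> assume h: "\<omega> \<in> {\<omega> \<in> calm_at \<theta>. \<theta> \<omega> \<le> t}"
      show "\<omega> \<in> (\<Union>n. {\<omega> \<in> calm_at \<theta>. \<theta> \<omega> \<le> ennreal (real n)}) \<union> {\<omega> \<in> space (\<F> t). \<theta> \<omega> = \<infinity>}"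
      proof (cases "\<theta> \<omega>")
        case (real v)
        obtain n where "v \<le> real n" using real_arch_simple by blast
        then show ?thesis using h real by (auto intro!: exI[of _ n] ennreal_leI)
      qed (use h in \<open>auto simp: calm_at_def space_F\<close>)
    qed (auto simp: calm_at_def space_F top)
    moreover have "{\<omega> \<in> calm_at \<theta>. \<theta> \<omega> \<le> ennreal (real n)} \<in> sets (\<F> t)" for n
      using fin[of "real n"] sets_F_mono[of "ennreal (real n)" t] top by auto
    moreover have "{\<omega> \<in> space (\<F> t). \<theta> \<omega> = \<infinity>} \<in> sets (\<F> t)"
      using stopping_time_eq_const[OF \<theta>, of \<infinity>] top by (simp add: pred_def)
    ultimately show ?thesis by auto
  qed
qed

end

section \<open>Optimality of the equilibrium strategy\<close>

context entry_game begin

lemma state_path_AE: "AE \<omega> in P. state_path P \<F> B \<mu> \<sigma> x X m I r \<omega>"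
  using paths_nonneg AE_space
  by eventually_elim (intro state_path.intro entry_game_axioms state_path_axioms.intro; blast)

lemma follower_until_entry:
  "AE \<omega> in P. \<omega> \<in> calm_at \<theta> \<longrightarrow> (\<forall>u. \<theta> \<omega> \<le> u \<and> u \<le> entry_time \<theta> \<omega> \<longrightarrow>
    F u \<omega> \<in> {0..I / (\<beta> - 1)} \<and> (u < \<infinity> \<longrightarrow> 0 \<le> X (enn2real u) \<omega> \<and> X (enn2real u) \<omega> \<le> xP))"
  using state_path_AE
proof eventually_elim
  fix \<omega> assume "state_path P \<F> B \<mu> \<sigma> x X m I r \<omega>"
  then interpret state_path P \<F> B \<mu> \<sigma> x X m I r \<theta> \<omega> .
  show "\<omega> \<in> calm_at \<theta> \<longrightarrow> (\<forall>u. \<theta> \<omega> \<le> u \<and> u \<le> entry_time \<theta> \<omega> \<longrightarrow>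
    F u \<omega> \<in> {0..I / (\<beta> - 1)} \<and> (u < \<infinity> \<longrightarrow> 0 \<le> X (enn2real u) \<omega> \<and> X (enn2real u) \<omega> \<le> xP))"
  proof (intro impI allI)
    fix u assume "\<omega> \<in> calm_at \<theta>" and u: "\<theta> \<omega> \<le> u \<and> u \<le> entry_time \<theta> \<omega>"
    then have calm by (auto simp: calm_at_def calm_def)
    then show "F u \<omega> \<in> {0..I / (\<beta> - 1)} \<and> (u < \<infinity> \<longrightarrow> 0 \<le> X (enn2real u) \<omega> \<and> X (enn2real u) \<omega> \<le> xP)"
      using F'_bound F'_nonneg state_until_entry X_nonneg u by auto
  qed
qed

lemma F_nonneg: "0 \<le> F u \<omega>"
  using fv_nonneg by (simp add: discounted_process_def)

lemma measurable_F_at: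
  assumes "T \<in> borel_measurable P" shows "(\<lambda>\<omega>. F (T \<omega>) \<omega>) \<in> borel_measurable P"
  using measurable_process_at[OF assms measurable_values(1)] .

lemma weighted_F_bounded:
  assumes \<theta>: "stopping_time \<F> \<theta>" and w: "w \<in> borel_measurable P" "\<And>\<omega>. \<omega> \<in> space P \<Longrightarrow> w \<omega> \<in> {0..1}"
    and T: "T \<in> borel_measurable P"
    and s: "\<And>\<omega>. \<omega> \<in> space P \<Longrightarrow> w \<omega> \<noteq> 0 \<Longrightarrow> \<omega> \<in> calm_at \<theta> \<and> \<theta> \<omega> \<le> T \<omega> \<and> T \<omega> \<le> entry_time \<theta> \<omega>"
  shows "AE \<omega> in P. norm (w \<omega> * F (T \<omega>) \<omega>) \<le> I / (\<beta> - 1)" "integrable P (\<lambda>\<omega>. w \<omega> * F (T \<omega>) \<omega>)"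
proof -
  have CF: "0 \<le> I / (\<beta> - 1)" using beta1_root(1) cost by simp
  show b: "AE \<omega> in P. norm (w \<omega> * F (T \<omega>) \<omega>) \<le> I / (\<beta> - 1)"
    using follower_until_entry[of \<theta>] AE_space
  proof eventually_elim
    fix \<omega> assume h: "\<omega> \<in> calm_at \<theta> \<longrightarrow> (\<forall>u. \<theta> \<omega> \<le> u \<and> u \<le> entry_time \<theta> \<omega> \<longrightarrow>
      F u \<omega> \<in> {0..I / (\<beta> - 1)} \<and> (u < \<infinity> \<longrightarrow> 0 \<le> X (enn2real u) \<omega> \<and> X (enn2real u) \<omega> \<le> xP))" and \<omega>: "\<omega> \<in> space P"
    show "norm (w \<omega> * F (T \<omega>) \<omega>) \<le> I / (\<beta> - 1)"
    proof (cases "w \<omega> = 0")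
      case False
      then have "F (T \<omega>) \<omega> \<in> {0..I / (\<beta> - 1)}" using h s[OF \<omega>] by blast
      then have "w \<omega> * F (T \<omega>) \<omega> \<le> 1 * (I / (\<beta> - 1))" "0 \<le> w \<omega> * F (T \<omega>) \<omega>"
        using w(2)[OF \<omega>] CF by (intro mult_mono mult_nonneg_nonneg; simp)+
      then show ?thesis by simp
    qed (use CF in simp)
  qed
  show "integrable P (\<lambda>\<omega>. w \<omega> * F (T \<omega>) \<omega>)"
    using w(1) measurable_F_at[OF T] by (intro integrable_const_bound[OF b]) auto
qed

text \<open>
  Until entry the discounted follower value is a multiple of an exponential martingale and lies between
  0 and \<open>I / (\<beta> - 1)\<close>.  Optional sampling up to a horizon \<open>T\<close> becomes exact as the truncation \<open>C\<close> tends to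
  infinity; the bound justifies \<open>T \<rightarrow> \<infinity>\<close>, where discounting makes the payoff of never entering 0.
\<close>

lemma follower_le_at_entry:
  assumes \<theta>: "stopping_time \<F> \<theta>" and t: "0 \<le> t"
    and w: "w \<in> borel_measurable (\<F>r t)" "\<And>\<omega>. \<omega> \<in> space P \<Longrightarrow> w \<omega> \<in> {0..1}"
    and s: "\<And>\<omega>. \<omega> \<in> space P \<Longrightarrow> w \<omega> \<noteq> 0 \<Longrightarrow> \<omega> \<in> calm_at \<theta> \<and> \<theta> \<omega> \<le> ennreal t \<and> ennreal t \<le> entry_time \<theta> \<omega>"
  shows "expectation (\<lambda>\<omega>. w \<omega> * F (ennreal t) \<omega>) \<le> expectation (\<lambda>\<omega>. w \<omega> * F (entry_time \<theta> \<omega>) \<omega>)"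
proof -
  define \<tau> where "\<tau> = entry_time \<theta>"
  define a where "a = \<beta> * \<sigma>"
  define \<kappa> where "\<kappa> = (x / xF) powr \<beta> * (I / (\<beta> - 1))"
  have \<kappa>: "\<kappa> \<ge> 0" using beta1_root(1) cost by (simp add: \<kappa>_def)
  have \<tau>: "stopping_time \<F> \<tau>" unfolding \<tau>_def by (rule stopping_time_entry[OF \<theta>])
  have \<tau>m[measurable]: "\<tau> \<in> borel_measurable P" by (rule measurable_stopping[OF \<tau>])
  have wP[measurable]: "w \<in> borel_measurable P" using w(1) measurable_from_filtration by blast
  have s': "\<omega> \<in> calm_at \<theta> \<and> \<theta> \<omega> \<le> ennreal t \<and> ennreal t \<le> \<tau> \<omega>" if "\<omega> \<in> space P" "w \<omega> \<noteq> 0" for \<omega>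
    using s[OF that] unfolding \<tau>_def .
  have E: "AE \<omega> in P. w \<omega> \<noteq> 0 \<longrightarrow> (\<forall>u. \<theta> \<omega> \<le> u \<and> u \<le> \<tau> \<omega> \<longrightarrow> F u \<omega> \<in> {0..I / (\<beta> - 1)} \<and>
      (u < \<infinity> \<longrightarrow> F u \<omega> = \<kappa> * exp_mart a (enn2real u) \<omega>))"
    using follower_until_entry[of \<theta>] follower_exp_mart AE_space
  proof eventually_elim
    fix \<omega> assume h: "\<omega> \<in> calm_at \<theta> \<longrightarrow> (\<forall>u. \<theta> \<omega> \<le> u \<and> u \<le> entry_time \<theta> \<omega> \<longrightarrow>
        F u \<omega> \<in> {0..I / (\<beta> - 1)} \<and> (u < \<infinity> \<longrightarrow> 0 \<le> X (enn2real u) \<omega> \<and> X (enn2real u) \<omega> \<le> xP))"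
      "\<forall>t\<ge>0. X t \<omega> < xF \<longrightarrow> F (ennreal t) \<omega> = (x / xF) powr \<beta> * (I / (\<beta> - 1)) * exp_mart (\<beta> * \<sigma>) t \<omega>"
      and \<omega>: "\<omega> \<in> space P"
    show "w \<omega> \<noteq> 0 \<longrightarrow> (\<forall>u. \<theta> \<omega> \<le> u \<and> u \<le> \<tau> \<omega> \<longrightarrow> F u \<omega> \<in> {0..I / (\<beta> - 1)} \<and>
      (u < \<infinity> \<longrightarrow> F u \<omega> = \<kappa> * exp_mart a (enn2real u) \<omega>))"
    proof (intro impI allI conjI)
      fix u assume wu: "w \<omega> \<noteq> 0" "\<theta> \<omega> \<le> u \<and> u \<le> \<tau> \<omega>"
      then have k: "F u \<omega> \<in> {0..I / (\<beta> - 1)} \<and> (u < \<infinity> \<longrightarrow> 0 \<le> X (enn2real u) \<omega> \<and> X (enn2real u) \<omega> \<le> xP)"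
        using h(1) s'[OF \<omega>] unfolding \<tau>_def by blast
      then show "F u \<omega> \<in> {0..I / (\<beta> - 1)}" by blast
      assume "u < \<infinity>"
      then have "ennreal (enn2real u) = u" "X (enn2real u) \<omega> < xF" using k x_P_less by auto
      then show "F u \<omega> = \<kappa> * exp_mart a (enn2real u) \<omega>"
        using h(2)[rule_format, of "enn2real u"] unfolding \<kappa>_def a_def by simp
    qed
  qed
  have minm: "(\<lambda>\<omega>. min (\<tau> \<omega>) (ennreal T)) \<in> borel_measurable P" for T by measurable
  have capped: "\<omega> \<in> calm_at \<theta> \<and> \<theta> \<omega> \<le> min (\<tau> \<omega>) (ennreal T) \<and> min (\<tau> \<omega>) (ennreal T) \<le> entry_time \<theta> \<omega>"
    if "t < T" "\<omega> \<in> space P" "w \<omega> \<noteq> 0" for T \<omega>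
  proof -
    have "ennreal t \<le> ennreal T" using that(1) by (simp add: ennreal_leI)
    then show ?thesis using s'[OF that(2,3)] unfolding \<tau>_def by (auto intro: order_trans)
  qed
  have stopped: "expectation (\<lambda>\<omega>. w \<omega> * F (ennreal t) \<omega>) \<le> expectation (\<lambda>\<omega>. w \<omega> * F (min (\<tau> \<omega>) (ennreal T)) \<omega>)" if T: "t < T" for T
  proof -
    let ?M = "\<lambda>\<omega>. exp_mart a (enn2real (min (\<tau> \<omega>) (ennreal T))) \<omega>"
    have Mm: "?M \<in> borel_measurable P" by (rule measurable_exp_mart_random) auto
    have mfin: "min (\<tau> \<omega>) (ennreal T) < \<infinity>" for \<omega> by (simp add: min_less_iff_disj)
    have wFi: "integrable P (\<lambda>\<omega>. w \<omega> * F (min (\<tau> \<omega>) (ennreal T)) \<omega>)"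
      by (rule weighted_F_bounded(2)[OF \<theta> wP w(2) minm capped[OF T]])
    have "expectation (\<lambda>\<omega>. w \<omega> * F (ennreal t) \<omega>) = expectation (\<lambda>\<omega>. \<kappa> * (w \<omega> * exp_mart a t \<omega>))"
    proof (rule integral_cong_AE)
      show "AE \<omega> in P. w \<omega> * F (ennreal t) \<omega> = \<kappa> * (w \<omega> * exp_mart a t \<omega>)"
        using E AE_space
      proof eventually_elim
        fix \<omega> assume e: "w \<omega> \<noteq> 0 \<longrightarrow> (\<forall>u. \<theta> \<omega> \<le> u \<and> u \<le> \<tau> \<omega> \<longrightarrow> F u \<omega> \<in> {0..I / (\<beta> - 1)} \<and>
          (u < \<infinity> \<longrightarrow> F u \<omega> = \<kappa> * exp_mart a (enn2real u) \<omega>))" and \<omega>: "\<omega> \<in> space P"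
        show "w \<omega> * F (ennreal t) \<omega> = \<kappa> * (w \<omega> * exp_mart a t \<omega>)"
        proof (cases "w \<omega> = 0")
          case False
          then have "F (ennreal t) \<omega> = \<kappa> * exp_mart a (enn2real (ennreal t)) \<omega>" using e s'[OF \<omega>] by auto
          then show ?thesis using t by simp
        qed simp
      qed
    qed (use measurable_F_at[of "\<lambda>_. ennreal t"] measurable_exp_mart_P[OF t] in auto)
    then have eq: "expectation (\<lambda>\<omega>. w \<omega> * F (ennreal t) \<omega>) = \<kappa> * expectation (\<lambda>\<omega>. w \<omega> * exp_mart a t \<omega>)" by simp
    define e where "e = expectation (\<lambda>\<omega>. (exp_mart a T \<omega>)\<^sup>2)"
    have "expectation (\<lambda>\<omega>. w \<omega> * F (ennreal t) \<omega>) \<le> expectation (\<lambda>\<omega>. w \<omega> * F (min (\<tau> \<omega>) (ennreal T)) \<omega>) + \<kappa> * (e / C)" if C: "C > 0" for C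
    proof -
      have "expectation (\<lambda>\<omega>. w \<omega> * exp_mart a t \<omega>) \<le> expectation (\<lambda>\<omega>. w \<omega> * min C (?M \<omega>)) + e / C"
        unfolding e_def using s' by (intro optional_sampling_truncated[OF t T \<tau> C w _ Mm]) auto
      from mult_left_mono[OF this \<kappa>]
      have "expectation (\<lambda>\<omega>. w \<omega> * F (ennreal t) \<omega>) \<le> expectation (\<lambda>\<omega>. \<kappa> * (w \<omega> * min C (?M \<omega>))) + \<kappa> * (e / C)"
        unfolding eq by (simp add: distrib_left)
      also have "expectation (\<lambda>\<omega>. \<kappa> * (w \<omega> * min C (?M \<omega>))) \<le> expectation (\<lambda>\<omega>. w \<omega> * F (min (\<tau> \<omega>) (ennreal T)) \<omega>)"
      proof (rule integral_mono_AE[OF _ wFi])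
        show "integrable P (\<lambda>\<omega>. \<kappa> * (w \<omega> * min C (?M \<omega>)))"
        proof (intro integrable_mult_right integrable_const_bound[of _ C] AE_I2)
          fix \<omega> assume "\<omega> \<in> space P"
          then have "0 \<le> w \<omega>" "w \<omega> \<le> 1" using w(2) by auto
          moreover have "0 \<le> min C (?M \<omega>)" using C exp_mart_pos[of a _ \<omega>] by (simp add: less_imp_le)
          ultimately have "w \<omega> * min C (?M \<omega>) \<le> 1 * C" "0 \<le> w \<omega> * min C (?M \<omega>)"
            using C by (intro mult_mono mult_nonneg_nonneg; simp)+
          then show "norm (w \<omega> * min C (?M \<omega>)) \<le> C" by simp
        qed (use Mm in measurable)
        show "AE \<omega> in P. \<kappa> * (w \<omega> * min C (?M \<omega>)) \<le> w \<omega> * F (min (\<tau> \<omega>) (ennreal T)) \<omega>"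
          using E AE_space
        proof eventually_elim
          fix \<omega> assume e: "w \<omega> \<noteq> 0 \<longrightarrow> (\<forall>u. \<theta> \<omega> \<le> u \<and> u \<le> \<tau> \<omega> \<longrightarrow> F u \<omega> \<in> {0..I / (\<beta> - 1)} \<and>
            (u < \<infinity> \<longrightarrow> F u \<omega> = \<kappa> * exp_mart a (enn2real u) \<omega>))" and \<omega>: "\<omega> \<in> space P"
          show "\<kappa> * (w \<omega> * min C (?M \<omega>)) \<le> w \<omega> * F (min (\<tau> \<omega>) (ennreal T)) \<omega>"
          proof (cases "w \<omega> = 0")
            case False
            have "\<theta> \<omega> \<le> min (\<tau> \<omega>) (ennreal T)" using capped[OF T \<omega> False] by blast
            then have "F (min (\<tau> \<omega>) (ennreal T)) \<omega> = \<kappa> * ?M \<omega>" using e False mfin by auto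
            moreover have "w \<omega> * (\<kappa> * min C (?M \<omega>)) \<le> w \<omega> * (\<kappa> * ?M \<omega>)"
              using \<kappa> w(2)[OF \<omega>] by (intro mult_left_mono) auto
            ultimately show ?thesis by (simp add: ac_simps)
          qed simp
        qed
      qed
      finally show ?thesis by simp
    qed
    then have b: "expectation (\<lambda>\<omega>. w \<omega> * F (ennreal t) \<omega>) \<le> expectation (\<lambda>\<omega>. w \<omega> * F (min (\<tau> \<omega>) (ennreal T)) \<omega>) + \<kappa> * (e / real (Suc n))" for n
      by simp
    have "(\<lambda>n. expectation (\<lambda>\<omega>. w \<omega> * F (min (\<tau> \<omega>) (ennreal T)) \<omega>) + \<kappa> * (e / real (Suc n))) \<longlonglongrightarrow>
        expectation (\<lambda>\<omega>. w \<omega> * F (min (\<tau> \<omega>) (ennreal T)) \<omega>) + \<kappa> * 0"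
      by (intro tendsto_intros LIMSEQ_Suc[OF lim_const_over_n])
    from LIMSEQ_le_const[OF this] b show ?thesis by simp
  qed
  define T where "T n = t + 1 + real n" for n
  have Tt: "t < T n" for n by (simp add: T_def)
  have "(\<lambda>n. expectation (\<lambda>\<omega>. w \<omega> * F (min (\<tau> \<omega>) (ennreal (T n))) \<omega>)) \<longlonglongrightarrow> expectation (\<lambda>\<omega>. w \<omega> * F (\<tau> \<omega>) \<omega>)"
  proof (rule integral_dominated_convergence[where w="\<lambda>_. I / (\<beta> - 1)"])
    show "AE \<omega> in P. norm (w \<omega> * F (min (\<tau> \<omega>) (ennreal (T n))) \<omega>) \<le> I / (\<beta> - 1)" for n
      by (rule weighted_F_bounded(1)[OF \<theta> wP w(2) minm capped[OF Tt]])
    show "AE \<omega> in P. (\<lambda>n. w \<omega> * F (min (\<tau> \<omega>) (ennreal (T n))) \<omega>) \<longlonglongrightarrow> w \<omega> * F (\<tau> \<omega>) \<omega>"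
      using follower_until_entry[of \<theta>] AE_space
    proof eventually_elim
      fix \<omega> assume h: "\<omega> \<in> calm_at \<theta> \<longrightarrow> (\<forall>u. \<theta> \<omega> \<le> u \<and> u \<le> entry_time \<theta> \<omega> \<longrightarrow>
        F u \<omega> \<in> {0..I / (\<beta> - 1)} \<and> (u < \<infinity> \<longrightarrow> 0 \<le> X (enn2real u) \<omega> \<and> X (enn2real u) \<omega> \<le> xP))" and \<omega>: "\<omega> \<in> space P"
      show "(\<lambda>n. w \<omega> * F (min (\<tau> \<omega>) (ennreal (T n))) \<omega>) \<longlonglongrightarrow> w \<omega> * F (\<tau> \<omega>) \<omega>"
      proof (cases "w \<omega> = 0")
        case False
        note c = s'[OF \<omega> False]
        show ?thesis
        proof (cases "\<tau> \<omega>")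
          case (real v)
          obtain n0 :: nat where n0: "v \<le> real n0" using real_arch_simple by blast
          have "eventually (\<lambda>n. w \<omega> * F (min (\<tau> \<omega>) (ennreal (T n))) \<omega> = w \<omega> * F (\<tau> \<omega>) \<omega>) sequentially"
            using eventually_ge_at_top[of n0]
          proof eventually_elim
            fix n assume "n0 \<le> n"
            then have "v \<le> T n" using n0 t unfolding T_def by linarith
            then show "w \<omega> * F (min (\<tau> \<omega>) (ennreal (T n))) \<omega> = w \<omega> * F (\<tau> \<omega>) \<omega>"
              using real by (simp add: min_absorb1 ennreal_leI)
          qed
          then show ?thesis by (rule tendsto_eventually)
        next
          case top
          have b: "F (ennreal (T n)) \<omega> \<le> exp (- r * T n) * (I / (\<beta> - 1))" for n
          proof -
            have Tn: "0 \<le> T n" using t by (simp add: T_def)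
            have "\<theta> \<omega> \<le> ennreal (T n)" using c Tt[of n] by (meson ennreal_leI less_imp_le order_trans)
            then have "0 \<le> X (T n) \<omega>" "X (T n) \<omega> \<le> xP"
              using h c top Tn unfolding \<tau>_def by (auto dest!: spec[of _ "ennreal (T n)"])
            then have "fv (X (T n) \<omega>) \<le> I / (\<beta> - 1)" by (rule fv_le)
            from mult_left_mono[OF this, of "exp (- r * T n)"] show ?thesis
              using Tn by (simp add: discounted_process_def)
          qed
          have "(\<lambda>n. exp (- r * T n) * (I / (\<beta> - 1))) \<longlonglongrightarrow> 0 * (I / (\<beta> - 1))"
          proof (intro tendsto_intros)
            have "filterlim T at_top sequentially"
              unfolding T_def using filterlim_real_sequentially by (rule filterlim_tendsto_add_at_top[OF tendsto_const])
            then have "filterlim (\<lambda>n. - r * T n) at_bot sequentially"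
              using r_pos by (intro filterlim_tendsto_neg_mult_at_bot[OF tendsto_const]) auto
            then show "(\<lambda>n. exp (- r * T n)) \<longlonglongrightarrow> 0" by (rule filterlim_compose[OF exp_at_bot])
          qed
          then have "(\<lambda>n. exp (- r * T n) * (I / (\<beta> - 1))) \<longlonglongrightarrow> 0" by simp
          then have "(\<lambda>n. F (ennreal (T n)) \<omega>) \<longlonglongrightarrow> 0"
            by (rule tendsto_sandwich[OF _ _ tendsto_const, rotated 2]) (use b F_nonneg in auto)
          from tendsto_mult[OF tendsto_const this, of "w \<omega>"]
          show ?thesis using top by (simp add: discounted_process_def)
        qed
      qed simp
    qed
  qed (use measurable_F_at[OF \<tau>m] measurable_F_at[OF minm] in auto)
  from LIMSEQ_le_const[OF this] stopped[OF Tt] show ?thesis unfolding \<tau>_def by auto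
qed

text \<open>
  If entry has occurred by time \<open>t\<close>, both sides agree; this event is known at time \<open>t\<close> and can be
  removed from the weight.
\<close>

lemma follower_capped_le:
  assumes \<theta>: "stopping_time \<F> \<theta>" and t: "0 \<le> t"
    and w: "w \<in> borel_measurable (\<F>r t)" "\<And>\<omega>. \<omega> \<in> space P \<Longrightarrow> w \<omega> \<in> {0..1}"
    and s: "\<And>\<omega>. \<omega> \<in> space P \<Longrightarrow> w \<omega> \<noteq> 0 \<Longrightarrow> \<omega> \<in> calm_at \<theta> \<and> \<theta> \<omega> \<le> ennreal t"
  shows "integrable P (\<lambda>\<omega>. w \<omega> * F (min (ennreal t) (entry_time \<theta> \<omega>)) \<omega>)"
    "integrable P (\<lambda>\<omega>. w \<omega> * F (entry_time \<theta> \<omega>) \<omega>)"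
    "expectation (\<lambda>\<omega>. w \<omega> * F (min (ennreal t) (entry_time \<theta> \<omega>)) \<omega>) \<le> expectation (\<lambda>\<omega>. w \<omega> * F (entry_time \<theta> \<omega>) \<omega>)"
proof -
  have \<tau>: "stopping_time \<F> (entry_time \<theta>)" by (rule stopping_time_entry[OF \<theta>])
  have \<tau>m[measurable]: "entry_time \<theta> \<in> borel_measurable P" by (rule measurable_stopping[OF \<tau>])
  have wP[measurable]: "w \<in> borel_measurable P" using w(1) measurable_from_filtration by blast
  have ge: "\<theta> \<omega> \<le> entry_time \<theta> \<omega>" for \<omega> by (rule entry_time_ge)
  show i1: "integrable P (\<lambda>\<omega>. w \<omega> * F (min (ennreal t) (entry_time \<theta> \<omega>)) \<omega>)"
    by (intro weighted_F_bounded(2)[OF \<theta> wP w(2)]) (use s ge in auto)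
  show i2: "integrable P (\<lambda>\<omega>. w \<omega> * F (entry_time \<theta> \<omega>) \<omega>)"
    by (intro weighted_F_bounded(2)[OF \<theta> wP w(2)]) (use s ge in auto)
  define v where "v \<omega> = (if entry_time \<theta> \<omega> < ennreal t then 0 else w \<omega>)" for \<omega>
  have vm: "v \<in> borel_measurable (\<F>r t)"
    unfolding v_def using stopping_time_less_const[OF \<tau>, of "ennreal t"] w(1) by measurable
  have le: "expectation (\<lambda>\<omega>. v \<omega> * F (ennreal t) \<omega>) \<le> expectation (\<lambda>\<omega>. v \<omega> * F (entry_time \<theta> \<omega>) \<omega>)"
    by (intro follower_le_at_entry[OF \<theta> t vm]) (use w(2) s in \<open>auto simp: v_def split: if_splits\<close>)
  have vP[measurable]: "v \<in> borel_measurable P" using vm measurable_from_filtration by blast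
  have v1: "v \<omega> \<in> {0..1}" if "\<omega> \<in> space P" for \<omega> using w(2)[OF that] by (auto simp: v_def)
  have j1: "integrable P (\<lambda>\<omega>. v \<omega> * F (ennreal t) \<omega>)"
    by (intro weighted_F_bounded(2)[OF \<theta> vP v1]) (use s in \<open>auto simp: v_def split: if_splits\<close>)
  have j2: "integrable P (\<lambda>\<omega>. v \<omega> * F (entry_time \<theta> \<omega>) \<omega>)"
    by (intro weighted_F_bounded(2)[OF \<theta> vP v1]) (use s ge in \<open>auto simp: v_def split: if_splits\<close>)
  have "expectation (\<lambda>\<omega>. w \<omega> * F (min (ennreal t) (entry_time \<theta> \<omega>)) \<omega>)
      = expectation (\<lambda>\<omega>. v \<omega> * F (ennreal t) \<omega> + (w \<omega> * F (entry_time \<theta> \<omega>) \<omega> - v \<omega> * F (entry_time \<theta> \<omega>) \<omega>))"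
    by (intro Bochner_Integration.integral_cong) (auto simp: v_def min_def)
  also have "\<dots> = expectation (\<lambda>\<omega>. v \<omega> * F (ennreal t) \<omega>) + (expectation (\<lambda>\<omega>. w \<omega> * F (entry_time \<theta> \<omega>) \<omega>) - expectation (\<lambda>\<omega>. v \<omega> * F (entry_time \<theta> \<omega>) \<omega>))"
    using j1 j2 i2 by simp
  finally show "expectation (\<lambda>\<omega>. w \<omega> * F (min (ennreal t) (entry_time \<theta> \<omega>)) \<omega>) \<le> expectation (\<lambda>\<omega>. w \<omega> * F (entry_time \<theta> \<omega>) \<omega>)"
    using le by simp
qed

lemma deviation_path_AE:
  assumes "subgame_strategy P \<F> \<theta> Ga \<alpha>a"
  shows "AE \<omega> in P. deviation_path P \<F> B \<mu> \<sigma> x X m I r \<theta> \<omega> (\<lambda>t. Ga t \<omega>) (\<lambda>t. \<alpha>a t \<omega>)"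
proof -
  have u: "\<forall>t. \<forall>\<omega>\<in>space P. Ga t \<omega> \<in> {0..1} \<and> \<alpha>a t \<omega> \<in> {0..1}"
    and 1: "AE \<omega> in P. (\<forall>t. ((\<lambda>s. Ga s \<omega>) \<longlongrightarrow> Ga t \<omega>) (at_right t)) \<and> mono (\<lambda>t. Ga t \<omega>) \<and> (\<forall>s<\<theta> \<omega>. Ga s \<omega> = 0)"
    and 2: "AE \<omega> in P. \<forall>t. \<alpha>a t \<omega> > 0 \<longrightarrow> Ga t \<omega> = 1"
    using assms unfolding subgame_strategy_def by blast+
  show ?thesis
    using state_path_AE 1 2 AE_space
  proof eventually_elim
    fix \<omega>
    assume "state_path P \<F> B \<mu> \<sigma> x X m I r \<omega>"
      "(\<forall>t. ((\<lambda>s. Ga s \<omega>) \<longlongrightarrow> Ga t \<omega>) (at_right t)) \<and> mono (\<lambda>t. Ga t \<omega>) \<and> (\<forall>s<\<theta> \<omega>. Ga s \<omega> = 0)"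
      "\<forall>t. \<alpha>a t \<omega> > 0 \<longrightarrow> Ga t \<omega> = 1" "\<omega> \<in> space P"
    then show "deviation_path P \<F> B \<mu> \<sigma> x X m I r \<theta> \<omega> (\<lambda>t. Ga t \<omega>) (\<lambda>t. \<alpha>a t \<omega>)"
      using u by (intro deviation_path.intro distribution_path.intro deviation_path_axioms.intro) auto
  qed
qed

text \<open>
  Each summand is a payoff at a deterministic time capped by entry, with a weight known at that time.
  Replacing all payoffs by the one at entry makes the weights add up to 1.
\<close>

lemma right_sum_le_follower:
  fixes n :: nat
  assumes \<theta>: "stopping_time \<F> \<theta>" and G: "subgame_strategy P \<F> \<theta> Ga \<alpha>a"
    and A: "A \<in> sets (sigma_at P \<F> \<theta>)" "A \<subseteq> calm_at \<theta>"
  defines "S \<equiv> \<lambda>\<omega>. indicator A \<omega> * right_sum (\<lambda>t. Ga t \<omega>) \<theta> \<omega> n"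
  shows "S \<in> borel_measurable P" "integrable P S" "AE \<omega> in P. 0 \<le> S \<omega>"
    "expectation S \<le> expectation (\<lambda>\<omega>. indicator A \<omega> * F (entry_time \<theta> \<omega>) \<omega>)"
proof -
  define t where "t k = real k / real (Suc n)" for k
  define K where "K = Suc n * Suc n"
  have t0: "0 \<le> t k" "t k \<le> t (Suc k)" for k by (auto simp: t_def divide_right_mono)
  have tK: "t K = real (Suc n)" unfolding t_def K_def of_nat_mult by simp
  let ?F = "\<lambda>u \<omega>. F (min (ennreal u) (entry_time \<theta> \<omega>)) \<omega>" and ?E = "\<lambda>\<omega>. F (entry_time \<theta> \<omega>) \<omega>"
  have \<tau>m: "entry_time \<theta> \<in> borel_measurable P" by (rule measurable_stopping[OF stopping_time_entry[OF \<theta>]])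
  have Em[measurable]: "?E \<in> borel_measurable P" by (rule measurable_F_at[OF \<tau>m])
  have Fm[measurable]: "?F u \<in> borel_measurable P" for u
    by (rule measurable_F_at) (use \<tau>m in measurable)
  have AP[measurable]: "A \<in> sets P" using A(1) sigma_at_subalgebra[OF \<theta>] by (auto simp: subalgebra_def)
  have u: "\<And>s \<omega>. \<omega> \<in> space P \<Longrightarrow> Ga s \<omega> \<in> {0..1}"
    and Gm: "\<And>s. 0 \<le> s \<Longrightarrow> Ga (ennreal s) \<in> borel_measurable (\<F>r s)"
    and path: "AE \<omega> in P. (\<forall>t. ((\<lambda>s. Ga s \<omega>) \<longlongrightarrow> Ga t \<omega>) (at_right t)) \<and> mono (\<lambda>t. Ga t \<omega>) \<and> (\<forall>s<\<theta> \<omega>. Ga s \<omega> = 0)"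
    using G unfolding subgame_strategy_def adapted_def by auto
  have GP[measurable]: "Ga (ennreal s) \<in> borel_measurable P" if "0 \<le> s" for s
    using Gm[OF that] measurable_from_filtration by blast
  have started: "Measurable.pred (\<F>r s) (\<lambda>\<omega>. \<omega> \<in> A \<and> \<theta> \<omega> \<le> ennreal s)" for s
  proof -
    have "{\<omega> \<in> space (\<F>r s). \<omega> \<in> A \<and> \<theta> \<omega> \<le> ennreal s} = {\<omega> \<in> A. \<theta> \<omega> \<le> ennreal s}"
      using A(2) by (auto simp: calm_at_def space_F)
    then show ?thesis using sets_pre_sigmaD[OF \<theta> A(1), of "ennreal s"] by (simp add: pred_def)
  qed
  define w :: "real \<Rightarrow> ('a \<Rightarrow> real) \<Rightarrow> 'a \<Rightarrow> real"
    where "w s v \<omega> = (if \<omega> \<in> A \<and> \<theta> \<omega> \<le> ennreal s then v \<omega> else 0)" for s v \<omega>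
  have wm: "w s v \<in> borel_measurable (\<F>r s)" if "v \<in> borel_measurable (\<F>r s)" for s and v :: "'a \<Rightarrow> real"
    unfolding w_def using started that by measurable
  (* Paths of Ga are monotone only almost surely; the maximum makes all weights nonnegative. *)
  define v where "v k \<omega> = max 0 (Ga (ennreal (t (Suc k))) \<omega> - Ga (ennreal (t k)) \<omega>)" for k \<omega>
  have vm: "v k \<in> borel_measurable (\<F>r (t (Suc k)))" for k
    unfolding v_def using Gm[OF t0(1)] measurable_filtrationr_mono[OF Gm[OF t0(1)] t0(2)] by measurable
  have vb: "v k \<omega> \<in> {0..1}" if "\<omega> \<in> space P" for k \<omega>
    using u[OF that, of "ennreal (t k)"] u[OF that, of "ennreal (t (Suc k))"] by (auto simp: v_def)
  have cap: "integrable P (\<lambda>\<omega>. w s v \<omega> * ?F s \<omega>)" "integrable P (\<lambda>\<omega>. w s v \<omega> * ?E \<omega>)"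
      "expectation (\<lambda>\<omega>. w s v \<omega> * ?F s \<omega>) \<le> expectation (\<lambda>\<omega>. w s v \<omega> * ?E \<omega>)"
    if "0 \<le> s" "v \<in> borel_measurable (\<F>r s)" "\<And>\<omega>. \<omega> \<in> space P \<Longrightarrow> v \<omega> \<in> {0..1}" for s v
  proof -
    have 1: "w s v \<omega> \<in> {0..1}" if "\<omega> \<in> space P" for \<omega>
      using \<open>\<And>\<omega>. \<omega> \<in> space P \<Longrightarrow> v \<omega> \<in> {0..1}\<close>[OF that] by (simp add: w_def)
    have 2: "\<omega> \<in> calm_at \<theta> \<and> \<theta> \<omega> \<le> ennreal s" if "w s v \<omega> \<noteq> 0" for \<omega>
      using that A(2) by (auto simp: w_def split: if_splits)
    show "integrable P (\<lambda>\<omega>. w s v \<omega> * ?F s \<omega>)" "integrable P (\<lambda>\<omega>. w s v \<omega> * ?E \<omega>)"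
      "expectation (\<lambda>\<omega>. w s v \<omega> * ?F s \<omega>) \<le> expectation (\<lambda>\<omega>. w s v \<omega> * ?E \<omega>)"
      by (rule follower_capped_le[OF \<theta> that(1) wm[OF that(2)] 1 2]; assumption)+
  qed
  let ?wi = "w 0 (Ga 0)" and ?w = "\<lambda>k. w (t (Suc k)) (v k)" and ?l = "\<lambda>\<omega>. indicator A \<omega> * (1 - Ga (ennreal (real (Suc n))) \<omega>)"
  have G0: "Ga 0 \<in> borel_measurable (\<F>r 0)" using Gm[of 0] by simp
  note c0 = cap[OF order_refl G0 u]
  note ck = cap[OF t0(1) vm vb]
  have li: "integrable P (\<lambda>\<omega>. ?l \<omega> * ?E \<omega>)"
  proof (rule weighted_F_bounded(2)[OF \<theta> _ _ \<tau>m])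
    show "?l \<in> borel_measurable P" using GP[of "real (Suc n)"] by measurable
    show "?l \<omega> \<in> {0..1}" if "\<omega> \<in> space P" for \<omega> using u[OF that] by (auto simp: indicator_def)
    show "\<omega> \<in> calm_at \<theta> \<and> \<theta> \<omega> \<le> entry_time \<theta> \<omega> \<and> entry_time \<theta> \<omega> \<le> entry_time \<theta> \<omega>" if "?l \<omega> \<noteq> 0" for \<omega>
      using that A(2) entry_time_ge by (auto simp: indicator_def split: if_splits)
  qed
  define R where "R \<omega> = ?wi \<omega> * ?F 0 \<omega> + (\<Sum>k<K. ?w k \<omega> * ?F (t (Suc k)) \<omega>) + ?l \<omega> * ?E \<omega>" for \<omega>
  have eq: "AE \<omega> in P. S \<omega> = R \<omega> \<and> ?wi \<omega> + (\<Sum>k<K. ?w k \<omega>) + ?l \<omega> = indicator A \<omega>"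
    using path AE_space
  proof eventually_elim
    fix \<omega> assume p: "(\<forall>t. ((\<lambda>s. Ga s \<omega>) \<longlongrightarrow> Ga t \<omega>) (at_right t)) \<and> mono (\<lambda>t. Ga t \<omega>) \<and> (\<forall>s<\<theta> \<omega>. Ga s \<omega> = 0)"
      and \<omega>: "\<omega> \<in> space P"
    show "S \<omega> = R \<omega> \<and> ?wi \<omega> + (\<Sum>k<K. ?w k \<omega>) + ?l \<omega> = indicator A \<omega>"
    proof (cases "\<omega> \<in> A")
      case True
      have zero: "Ga s \<omega> = 0" if "\<not> \<theta> \<omega> \<le> s" for s using p that by auto
      have w0: "?wi \<omega> = Ga 0 \<omega>" using True zero[of 0] by (auto simp: w_def)
      have wk: "?w k \<omega> = Ga (ennreal (t (Suc k))) \<omega> - Ga (ennreal (t k)) \<omega>" for k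
      proof -
        have "Ga (ennreal (t k)) \<omega> \<le> Ga (ennreal (t (Suc k))) \<omega>"
          using p t0(2)[of k] by (auto intro!: monoD[of "\<lambda>t. Ga t \<omega>"] ennreal_leI)
        moreover have "0 \<le> Ga (ennreal (t k)) \<omega>" using u[OF \<omega>] by simp
        ultimately show ?thesis using True zero[of "ennreal (t (Suc k))"] by (auto simp: w_def v_def)
      qed
      have "S \<omega> = R \<omega>"
        unfolding R_def w0 wk unfolding S_def right_sum_def K_def[symmetric] t_def using True by simp
      moreover have "(\<Sum>k<K. ?w k \<omega>) = Ga (ennreal (t K)) \<omega> - Ga (ennreal (t 0)) \<omega>"
        unfolding wk by (rule sum_lessThan_telescope)
      then have "?wi \<omega> + (\<Sum>k<K. ?w k \<omega>) + ?l \<omega> = indicator A \<omega>"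
        unfolding w0 tK using True by (simp add: t_def)
      ultimately show ?thesis by blast
    qed (simp add: S_def R_def w_def)
  qed
  have Sm: "S \<in> borel_measurable P"
    unfolding S_def right_sum_def
    by (intro borel_measurable_add borel_measurable_times borel_measurable_sum borel_measurable_diff
        borel_measurable_const borel_measurable_indicator AP Em Fm Fm[of 0, unfolded ennreal_0]
        GP GP[of 0, unfolded ennreal_0]) auto
  then show "S \<in> borel_measurable P" .
  have Ri: "integrable P R" unfolding R_def
    using c0(1) ck(1) li by (intro Bochner_Integration.integrable_add Bochner_Integration.integrable_sum) auto
  have Rm: "R \<in> borel_measurable P" using Ri by (rule borel_measurable_integrable)
  have SR: "AE \<omega> in P. S \<omega> = R \<omega>" using eq by eventually_elim simp
  show "integrable P S" using integrable_cong_AE_imp[OF Ri Sm] SR by (auto simp: eq_commute)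
  show "AE \<omega> in P. 0 \<le> S \<omega>"
    using SR AE_space
  proof eventually_elim
    fix \<omega> assume e: "S \<omega> = R \<omega>" and \<omega>: "\<omega> \<in> space P"
    have "0 \<le> ?wi \<omega>" "\<And>k. 0 \<le> ?w k \<omega>" "0 \<le> ?l \<omega>" using u[OF \<omega>] vb[OF \<omega>] by (auto simp: w_def indicator_def)
    then have "0 \<le> ?wi \<omega> * ?F 0 \<omega>" "0 \<le> (\<Sum>k<K. ?w k \<omega> * ?F (t (Suc k)) \<omega>)" "0 \<le> ?l \<omega> * ?E \<omega>"
      by (auto intro!: sum_nonneg mult_nonneg_nonneg[OF _ F_nonneg] simp del: of_nat_Suc)
    then show "0 \<le> S \<omega>" unfolding e R_def by linarith
  qed
  have "expectation S = expectation R" by (rule integral_cong_AE[OF Sm Rm SR])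
  also have "\<dots> = expectation (\<lambda>\<omega>. ?wi \<omega> * ?F 0 \<omega>) + (\<Sum>k<K. expectation (\<lambda>\<omega>. ?w k \<omega> * ?F (t (Suc k)) \<omega>)) + expectation (\<lambda>\<omega>. ?l \<omega> * ?E \<omega>)"
    unfolding R_def using c0(1) ck(1) li by (simp del: min.bounded_iff)
  also have "\<dots> \<le> expectation (\<lambda>\<omega>. ?wi \<omega> * ?E \<omega>) + (\<Sum>k<K. expectation (\<lambda>\<omega>. ?w k \<omega> * ?E \<omega>)) + expectation (\<lambda>\<omega>. ?l \<omega> * ?E \<omega>)"
    using c0(3) ck(3) by (intro add_mono sum_mono order_refl) auto
  also have "\<dots> = expectation (\<lambda>\<omega>. ?wi \<omega> * ?E \<omega> + (\<Sum>k<K. ?w k \<omega> * ?E \<omega>) + ?l \<omega> * ?E \<omega>)"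
    using c0(2) ck(2) li by simp
  also have "\<dots> = expectation (\<lambda>\<omega>. indicator A \<omega> * ?E \<omega>)"
  proof (rule integral_cong_AE)
    have "integrable P (\<lambda>\<omega>. ?wi \<omega> * ?E \<omega> + (\<Sum>k<K. ?w k \<omega> * ?E \<omega>) + ?l \<omega> * ?E \<omega>)"
      using c0(2) ck(2) li by (intro Bochner_Integration.integrable_add Bochner_Integration.integrable_sum) auto
    then show "(\<lambda>\<omega>. ?wi \<omega> * ?E \<omega> + (\<Sum>k<K. ?w k \<omega> * ?E \<omega>) + ?l \<omega> * ?E \<omega>) \<in> borel_measurable P"
      by (rule borel_measurable_integrable)
    show "AE \<omega> in P. ?wi \<omega> * ?E \<omega> + (\<Sum>k<K. ?w k \<omega> * ?E \<omega>) + ?l \<omega> * ?E \<omega> = indicator A \<omega> * ?E \<omega>"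
      using eq
    proof eventually_elim
      fix \<omega> assume "S \<omega> = R \<omega> \<and> ?wi \<omega> + (\<Sum>k<K. ?w k \<omega>) + ?l \<omega> = indicator A \<omega>"
      then have "indicator A \<omega> * ?E \<omega> = (?wi \<omega> + (\<Sum>k<K. ?w k \<omega>) + ?l \<omega>) * ?E \<omega>" by simp
      then show "?wi \<omega> * ?E \<omega> + (\<Sum>k<K. ?w k \<omega> * ?E \<omega>) + ?l \<omega> * ?E \<omega> = indicator A \<omega> * ?E \<omega>"
        unfolding distrib_right sum_distrib_right by simp
    qed
  qed simp
  finally show "expectation S \<le> expectation (\<lambda>\<omega>. indicator A \<omega> * ?E \<omega>)" .
qed

text \<open>
  Off \<open>calm_at \<theta>\<close> every deviation yields the follower payoff at entry.  On \<open>calm_at \<theta>\<close> its payoff is at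
  most the limit of the Riemann sums, whose expectations over events known at \<open>\<theta>\<close> do not exceed that of the
  follower payoff at entry.
\<close>

lemma deviation_payoff_le:
  assumes \<theta>: "stopping_time \<F> \<theta>" and G: "subgame_strategy P \<F> \<theta> Ga \<alpha>a"
  shows "AE \<omega> in P. payoff P \<F> L F M \<theta> Ga \<alpha>a (entry_G entry_time \<theta>) (entry_alpha L F M \<theta>) \<omega>
    \<le> real_cond_exp P (sigma_at P \<F> \<theta>) (\<lambda>\<omega>. F (entry_time \<theta> \<omega>) \<omega>) \<omega>"
proof -
  define f where "f \<omega> = path_payoff (\<theta> \<omega>) (\<lambda>t. L t \<omega>) (\<lambda>t. F t \<omega>) (\<lambda>t. M t \<omega>) (\<lambda>t. Ga t \<omega>) (\<lambda>t. \<alpha>a t \<omega>)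
    (\<lambda>t. entry_G entry_time \<theta> t \<omega>) (\<lambda>t. entry_alpha L F M \<theta> t \<omega>)" for \<omega>
  let ?E = "\<lambda>\<omega>. F (entry_time \<theta> \<omega>) \<omega>" and ?C = "calm_at \<theta>" and ?k = "I / (\<beta> - 1)"
  have k: "0 \<le> ?k" using beta1_root(1) cost by simp
  have \<tau>m: "entry_time \<theta> \<in> borel_measurable P" by (rule measurable_stopping[OF stopping_time_entry[OF \<theta>]])
  have Em: "?E \<in> borel_measurable P" by (rule measurable_F_at[OF \<tau>m])
  note sub = sigma_at_subalgebra[OF \<theta>]
  note C = calm_at_sigma[OF \<theta>]
  have CP[measurable]: "?C \<in> sets P" using C sub by (auto simp: subalgebra_def)
  have Ei: "integrable P (\<lambda>\<omega>. indicator ?C \<omega> * ?E \<omega>)"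
    by (rule weighted_F_bounded(2)[OF \<theta> _ _ \<tau>m]) (use entry_time_ge in \<open>auto simp: indicator_def split: if_splits\<close>)
  have off: "AE \<omega> in P. \<omega> \<notin> ?C \<longrightarrow> f \<omega> = ?E \<omega>"
    using deviation_path_AE[OF G] AE_space
  proof eventually_elim
    fix \<omega> assume "deviation_path P \<F> B \<mu> \<sigma> x X m I r \<theta> \<omega> (\<lambda>t. Ga t \<omega>) (\<lambda>t. \<alpha>a t \<omega>)" and \<omega>': "\<omega> \<in> space P"
    then interpret deviation_path P \<F> B \<mu> \<sigma> x X m I r \<theta> \<omega> "\<lambda>t. Ga t \<omega>" "\<lambda>t. \<alpha>a t \<omega>" by blast
    show "\<omega> \<notin> ?C \<longrightarrow> f \<omega> = ?E \<omega>"
      using payoff_not_calm \<omega>' unfolding f_def calm_at_def calm_def by blast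
  qed
  have on: "AE \<omega> in P. \<omega> \<in> ?C \<longrightarrow> (\<exists>\<phi>. f \<omega> \<le> \<phi> \<and> 0 \<le> \<phi> \<and> \<phi> \<le> ?k \<and> right_sum (\<lambda>t. Ga t \<omega>) \<theta> \<omega> \<longlonglongrightarrow> \<phi>)"
    using deviation_path_AE[OF G]
  proof eventually_elim
    fix \<omega> assume "deviation_path P \<F> B \<mu> \<sigma> x X m I r \<theta> \<omega> (\<lambda>t. Ga t \<omega>) (\<lambda>t. \<alpha>a t \<omega>)"
    then interpret deviation_path P \<F> B \<mu> \<sigma> x X m I r \<theta> \<omega> "\<lambda>t. Ga t \<omega>" "\<lambda>t. \<alpha>a t \<omega>" .
    show "\<omega> \<in> ?C \<longrightarrow> (\<exists>\<phi>. f \<omega> \<le> \<phi> \<and> 0 \<le> \<phi> \<and> \<phi> \<le> ?k \<and> right_sum (\<lambda>t. Ga t \<omega>) \<theta> \<omega> \<longlonglongrightarrow> \<phi>)"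
    proof
      assume "\<omega> \<in> ?C"
      then have calm unfolding calm_at_def calm_def by blast
      from payoff_le_\<Phi>[OF this] \<Phi>_bounds[OF this] right_sum_tendsto[OF this]
      show "\<exists>\<phi>. f \<omega> \<le> \<phi> \<and> 0 \<le> \<phi> \<and> \<phi> \<le> ?k \<and> right_sum (\<lambda>t. Ga t \<omega>) \<theta> \<omega> \<longlonglongrightarrow> \<phi>"
        unfolding f_def by blast
    qed
  qed
  have "AE \<omega> in P. real_cond_exp P (sigma_at P \<F> \<theta>) f \<omega> \<le> real_cond_exp P (sigma_at P \<F> \<theta>) ?E \<omega>"
  proof (rule real_cond_exp_le_local[OF sub C Em F_nonneg Ei off])
    assume um: "(\<lambda>\<omega>. ennreal (f \<omega>)) \<in> borel_measurable P"
    have "(\<lambda>\<omega>. enn2real (ennreal (f \<omega>))) \<in> borel_measurable P" using um by measurable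
    moreover have "(\<lambda>\<omega>. enn2real (ennreal (f \<omega>))) = (\<lambda>\<omega>. max 0 (f \<omega>))"
      by (auto simp: fun_eq_iff max_def ennreal_neg)
    ultimately have fm[measurable]: "(\<lambda>\<omega>. max 0 (f \<omega>)) \<in> borel_measurable P" by simp
    have bound: "AE \<omega> in P. norm (indicator ?C \<omega> * max 0 (f \<omega>)) \<le> ?k"
      using on by eventually_elim (use k in \<open>auto simp: indicator_def\<close>)
    have fi: "integrable P (\<lambda>\<omega>. indicator ?C \<omega> * max 0 (f \<omega>))"
      by (rule integrable_const_bound[OF bound]) measurable
    have "expectation (\<lambda>\<omega>. indicator A \<omega> * (indicator ?C \<omega> * max 0 (f \<omega>))) \<le> expectation (\<lambda>\<omega>. indicator A \<omega> * (indicator ?C \<omega> * ?E \<omega>))"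
      if A: "A \<in> sets (sigma_at P \<F> \<theta>)" for A
    proof -
      have AP[measurable]: "A \<in> sets P" using A sub by (auto simp: subalgebra_def)
      define h where "h \<omega> = indicator (A \<inter> ?C) \<omega> * max 0 (f \<omega>)" for \<omega>
      define S where "S n \<omega> = indicator (A \<inter> ?C) \<omega> * right_sum (\<lambda>t. Ga t \<omega>) \<theta> \<omega> n" for n \<omega>
      have AC: "A \<inter> ?C \<in> sets (sigma_at P \<F> \<theta>)" using A C by blast
      note r = right_sum_le_follower[OF \<theta> G AC Int_lower2]
      have S: "S n \<in> borel_measurable P" "integrable P (S n)" "AE \<omega> in P. 0 \<le> S n \<omega>"
        "expectation (S n) \<le> expectation (\<lambda>\<omega>. indicator (A \<inter> ?C) \<omega> * ?E \<omega>)" for n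
        unfolding S_def by (rule r)+
      have hm[measurable]: "h \<in> borel_measurable P" unfolding h_def by measurable
      have hb: "AE \<omega> in P. 0 \<le> h \<omega> \<and> h \<omega> \<le> ?k"
        using on by eventually_elim (use k in \<open>auto simp: indicator_def h_def\<close>)
      (* The minimum with h makes the sequence bounded, and its limit is h since h is at most the limit of S n. *)
      have "(\<lambda>n. expectation (\<lambda>\<omega>. min (h \<omega>) (S n \<omega>))) \<longlonglongrightarrow> expectation h"
      proof (rule integral_dominated_convergence[where w="\<lambda>_. ?k"])
        show "AE \<omega> in P. (\<lambda>n. min (h \<omega>) (S n \<omega>)) \<longlonglongrightarrow> h \<omega>"
          using on
        proof eventually_elim
          fix \<omega> assume on: "\<omega> \<in> ?C \<longrightarrow> (\<exists>\<phi>. f \<omega> \<le> \<phi> \<and> 0 \<le> \<phi> \<and> \<phi> \<le> ?k \<and> right_sum (\<lambda>t. Ga t \<omega>) \<theta> \<omega> \<longlonglongrightarrow> \<phi>)"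
          show "(\<lambda>n. min (h \<omega>) (S n \<omega>)) \<longlonglongrightarrow> h \<omega>"
          proof (cases "\<omega> \<in> A \<inter> ?C")
            case True
            then obtain \<phi> where \<phi>: "f \<omega> \<le> \<phi>" "0 \<le> \<phi>" "right_sum (\<lambda>t. Ga t \<omega>) \<theta> \<omega> \<longlonglongrightarrow> \<phi>" using on by blast
            have "(\<lambda>n. min (h \<omega>) (S n \<omega>)) \<longlonglongrightarrow> min (h \<omega>) \<phi>"
              using \<phi>(3) True unfolding S_def by (intro tendsto_min) auto
            moreover have "min (h \<omega>) \<phi> = h \<omega>" using \<phi> True by (simp add: h_def min_def)
            ultimately show ?thesis by simp
          qed (simp add: h_def S_def)
        qed
        show "AE \<omega> in P. norm (min (h \<omega>) (S n \<omega>)) \<le> ?k" for n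
          using hb S(3)[of n] by eventually_elim (auto simp: min_def)
      qed (use S(1) in auto)
      moreover have "expectation (\<lambda>\<omega>. min (h \<omega>) (S n \<omega>)) \<le> expectation (\<lambda>\<omega>. indicator (A \<inter> ?C) \<omega> * ?E \<omega>)" for n
      proof -
        have "expectation (\<lambda>\<omega>. min (h \<omega>) (S n \<omega>)) \<le> expectation (S n)"
        proof (rule integral_mono_AE)
          show "integrable P (\<lambda>\<omega>. min (h \<omega>) (S n \<omega>))"
          proof (rule integrable_const_bound)
            show "AE \<omega> in P. norm (min (h \<omega>) (S n \<omega>)) \<le> ?k"
              using hb S(3)[of n] by eventually_elim (auto simp: min_def)
          qed (use S(1) in measurable)
        qed (use S(2) in auto)
        then show ?thesis using S(4)[of n] by simp
      qed
      ultimately have "expectation h \<le> expectation (\<lambda>\<omega>. indicator (A \<inter> ?C) \<omega> * ?E \<omega>)"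
        by (intro LIMSEQ_le_const2) auto
      then show ?thesis unfolding h_def by (simp add: indicator_inter_arith mult.assoc)
    qed
    with fi show "integrable P (\<lambda>\<omega>. indicator ?C \<omega> * max 0 (f \<omega>)) \<and>
      (\<forall>A\<in>sets (sigma_at P \<F> \<theta>). expectation (\<lambda>\<omega>. indicator A \<omega> * (indicator ?C \<omega> * max 0 (f \<omega>))) \<le> expectation (\<lambda>\<omega>. indicator A \<omega> * (indicator ?C \<omega> * ?E \<omega>)))"
      by blast
  qed
  then show ?thesis unfolding payoff_def f_def[abs_def] .
qed

lemma equilibrium_payoff:
  assumes \<theta>: "stopping_time \<F> \<theta>"
  shows "AE \<omega> in P. payoff P \<F> L F M \<theta> (entry_G entry_time \<theta>) (entry_alpha L F M \<theta>) (entry_G entry_time \<theta>) (entry_alpha L F M \<theta>) \<omega>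
    = real_cond_exp P (sigma_at P \<F> \<theta>) (\<lambda>\<omega>. F (entry_time \<theta> \<omega>) \<omega>) \<omega>"
proof -
  define f where "f \<omega> = path_payoff (\<theta> \<omega>) (\<lambda>t. L t \<omega>) (\<lambda>t. F t \<omega>) (\<lambda>t. M t \<omega>)
    (\<lambda>t. entry_G entry_time \<theta> t \<omega>) (\<lambda>t. entry_alpha L F M \<theta> t \<omega>)
    (\<lambda>t. entry_G entry_time \<theta> t \<omega>) (\<lambda>t. entry_alpha L F M \<theta> t \<omega>)" for \<omega>
  interpret S: finite_measure_subalgebra P "sigma_at P \<F> \<theta>" by unfold_locales (rule sigma_at_subalgebra[OF \<theta>])
  have Em: "(\<lambda>\<omega>. F (entry_time \<theta> \<omega>) \<omega>) \<in> borel_measurable P"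
    by (rule measurable_F_at[OF measurable_stopping[OF stopping_time_entry[OF \<theta>]]])
  have eq: "AE \<omega> in P. f \<omega> = F (entry_time \<theta> \<omega>) \<omega>"
    using deviation_path_AE[OF subgame_strategy_entry[OF \<theta>]]
  proof eventually_elim
    fix \<omega> assume "deviation_path P \<F> B \<mu> \<sigma> x X m I r \<theta> \<omega> (\<lambda>t. entry_G entry_time \<theta> t \<omega>) (\<lambda>t. entry_alpha L F M \<theta> t \<omega>)"
    then interpret deviation_path P \<F> B \<mu> \<sigma> x X m I r \<theta> \<omega> "\<lambda>t. entry_G entry_time \<theta> t \<omega>" "\<lambda>t. entry_alpha L F M \<theta> t \<omega>" .
    show "f \<omega> = F (entry_time \<theta> \<omega>) \<omega>" unfolding f_def by (rule payoff_equilibrium) auto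
  qed
  have "AE \<omega> in P. real_cond_exp P (sigma_at P \<F> \<theta>) f \<omega> = real_cond_exp P (sigma_at P \<F> \<theta>) (\<lambda>\<omega>. F (entry_time \<theta> \<omega>) \<omega>) \<omega>"
    by (rule S.real_cond_exp_cong[OF eq borel_measurable_AE_cong[OF Em eq] Em])
  then show ?thesis unfolding payoff_def f_def[abs_def] .
qed

lemma subgame_perfect_equilibrium_entry:
  "subgame_perfect_equilibrium P \<F> (\<lambda>i. L) (\<lambda>i. F) (\<lambda>i. M) (\<lambda>i. entry_G entry_time) (\<lambda>i. entry_alpha L F M)"
  unfolding subgame_perfect_equilibrium_def
proof (intro conjI ballI allI impI extended_mixed_strategy_entry time_consistent_entry)
  fix \<theta> Ga \<alpha>a assume \<theta>: "stopping_time \<F> \<theta>" and G: "subgame_strategy P \<F> \<theta> Ga \<alpha>a"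
  show "AE \<omega> in P. payoff P \<F> L F M \<theta> Ga \<alpha>a (entry_G entry_time \<theta>) (entry_alpha L F M \<theta>) \<omega> \<le>
    payoff P \<F> L F M \<theta> (entry_G entry_time \<theta>) (entry_alpha L F M \<theta>) (entry_G entry_time \<theta>) (entry_alpha L F M \<theta>) \<omega>"
    using deviation_payoff_le[OF \<theta> G] equilibrium_payoff[OF \<theta>] by eventually_elim simp
qed

end

theorem proposition4p2:
  fixes P :: "'a measure" and \<F> :: "ennreal \<Rightarrow> 'a measure"
    and B X :: "real \<Rightarrow> 'a \<Rightarrow> real"
    and \<mu> \<sigma> m I r x :: real
  assumes "usual_filtration P \<F>"
    and "brownian_motion P \<F> B"
    and "\<sigma> \<noteq> 0" and "m > 1" and "I > 0" and "r > max \<mu> 0" and "x \<ge> 0"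
    and "solves_gbm_sde P \<F> B \<mu> \<sigma> x X"
  shows "let
      L = discounted_process r (leader_value \<mu> \<sigma> r I m) X;
      F = discounted_process r (follower_value \<mu> \<sigma> r I) X;
      M = discounted_process r (simultaneous_value \<mu> r I) X;
      \<tau>\<P> = hitting_time X {x_P \<mu> \<sigma> r I m<..<x_F \<mu> \<sigma> r I};
      \<tau>\<M> = hitting_time X {x_F \<mu> \<sigma> r I..};
      \<tau> = (\<lambda>\<theta> \<omega>. min (\<tau>\<P> \<theta> \<omega>) (\<tau>\<M> \<theta> \<omega>));
      G = (\<lambda>i::nat. entry_G \<tau>);
      \<alpha> = (\<lambda>i::nat. entry_alpha L F M)
    in
      subgame_perfect_equilibrium P \<F> (\<lambda>i. L) (\<lambda>i. F) (\<lambda>i. M) G \<alpha> \<and>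
      (\<forall>\<theta>. stopping_time \<F> \<theta> \<longrightarrow>
        (\<forall>i\<in>{1,2}. \<forall>j\<in>{1,2}. i \<noteq> j \<longrightarrow>
          (AE \<omega> in P. payoff P \<F> L F M \<theta> (G i \<theta>) (\<alpha> i \<theta>) (G j \<theta>) (\<alpha> j \<theta>) \<omega>
            = real_cond_exp P (sigma_at P \<F> \<theta>) (\<lambda>\<omega>. F (\<tau> \<theta> \<omega>) \<omega>) \<omega>)))"
proof -
  interpret usual_filtration P \<F> by fact
  interpret entry_game P \<F> B \<mu> \<sigma> x X m I r
    by unfold_locales (use assms in auto)
  have \<tau>: "(\<lambda>\<theta> \<omega>. min (hitting_time X {x_P \<mu> \<sigma> r I m<..<x_F \<mu> \<sigma> r I} \<theta> \<omega>) (hitting_time X {x_F \<mu> \<sigma> r I..} \<theta> \<omega>)) = entry_time"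
    by (simp add: fun_eq_iff entry_time_def)
  show ?thesis
    unfolding Let_def \<tau> entry_time_def[symmetric]
    using subgame_perfect_equilibrium_entry equilibrium_payoff by blast
qed

end
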